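(* Let $u^*=(u^{1*},u^{2*})\in U^1_{\mathrm{ad}}\times U^2_{\mathrm{ad}}$ be an admissible control, $X^*$ the corresponding state process, and let $(p,k^1,\dots,k^d)\in L^2_{\mathcal F}(0,T;\mathbb R^n)\times (L^2_{\mathcal F}(0,T;\mathbb R^n))^d$ be the unique solution of the backward SDE $$dp(s)=-\Big[A_s'p(s)+\sum_{j=1}^d (C_s^j)'k^j(s)+Q_sX^*_s\Big]ds+\sum_{j=1}^d k^j(s)\,dW^j_s,\quad s\in[0,T];\qquad p(T)=GX^*_T.$$ If $u^*$ is optimal, then the following optimality conditions hold: $$\mathbb E\Big[(B_s^1)'p(s)+\sum_{j=1}^d (D_s^{1j})'k^j(s)+R_s^1u_s^{1*}\Big]=0\quad\text{for a.e. } s\in[0,T],$$ $$(B_s^2)'p(s)+\sum_{j=1}^d (D_s^{2j})'k^j(s)+R_s^2u_s^{2*}=0\quad ds\otimes d\mathbb P\text{-a.e.}$$ Conversely, these two conditions are sufficient for $u^*$ to be optimal.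
   Context: Fix $T>0$ and integers $n,l_1,l_2,d\ge1$. Let $W=(W^1,\dots,W^d)$ be a $d$-dimensional standard Brownian motion on a probability space $(\Omega,\mathcal F,\mathbb P)$ and $(\mathcal F_t)$ the augmented natural filtration of $W$. The deterministic coefficients $A,C^1,\dots,C^d:[0,T]\to\mathbb R^{n\times n}$, $B^1:[0,T]\to\mathbb R^{n\times l_1}$, $B^2:[0,T]\to\mathbb R^{n\times l_2}$, $D^{1j}:[0,T]\to\mathbb R^{n\times l_1}$, $D^{2j}:[0,T]\to\mathbb R^{n\times l_2}$ ($j=1,\dots,d$) are bounded Borel measurable; $Q,R^1,R^2$ are deterministic essentially bounded measurable functions on $[0,T]$ with values in the symmetric $n\times n$, $l_1\times l_1$, $l_2\times l_2$ matrices, $Q$ nonnegative definite and $R^1(t),R^2(t)$ positive definite; $G$ is a symmetric positive semidefinite $n\times n$ matrix; $x_0\in\mathbb R^n$. The admissible controls are $u^1\in U^1_{\mathrm{ad}}:=L^2(0,T;\mathbb R^{l_1})$ (deterministic square-integrable functions; "deterministic controller") and $u^2\in U^2_{\mathrm{ad}}:=L^2_{\mathcal F}(0,T;\mathbb R^{l_2})$ ($(\mathcal F_t)$-adapted processes with $\mathbb E\int_0^T|u^2_s|^2ds<\infty$; "random controller"). The state $X$ solves $$dX_s=[A_sX_s+B^1_su^1_s+B^2_su^2_s]ds+\sum_{j=1}^d[C^j_sX_s+D^{1j}_su^1_s+D^{2j}_su^2_s]dW^j_s,\quad X_0=x_0,$$ and the cost is $J(u)=\frac12\mathbb E\int_0^T[\langle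 Q_sX_s,X_s\rangle+\langle R^1_su^1_s,u^1_s\rangle+\langle R^2_su^2_s,u^2_s\rangle]ds+\frac12\mathbb E\langle GX_T,X_T\rangle$. A control $u^*$ is optimal if it minimizes $J$ over $U^1_{\mathrm{ad}}\times U^2_{\mathrm{ad}}$. *)

theory Defs
  imports "HOL-Probability.Probability"
begin

definition brownian :: "'w measure \<Rightarrow> ('d::finite \<Rightarrow> real \<Rightarrow> 'w \<Rightarrow> real) \<Rightarrow> bool" where
  "brownian M W \<longleftrightarrow>
     (\<forall>j \<omega>. W j 0 \<omega> = 0) \<and>
     (\<forall>j \<omega>. continuous_on {0..} (\<lambda>t. W j t \<omega>)) \<and>
     (\<forall>j t. W j t \<in> borel_measurable M) \<and>
     (\<forall>(ts::nat \<Rightarrow> real) k. 0 \<le> ts 0 \<and> (\<forall>i<k. ts i < ts (Suc i)) \<longrightarrow>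
        prob_space.indep_vars M (\<lambda>_. borel)
          (\<lambda>(j, i) \<omega>. W j (ts (Suc i)) \<omega> - W j (ts i) \<omega>) (UNIV \<times> {..<k})) \<and>
     (\<forall>j s t. 0 \<le> s \<and> s < t \<longrightarrow>
        distributed M lborel (\<lambda>\<omega>. W j t \<omega> - W j s \<omega>) (normal_density 0 (sqrt (t - s))))"

definition aug_filtration :: "'w measure \<Rightarrow> ('d \<Rightarrow> real \<Rightarrow> 'w \<Rightarrow> real) \<Rightarrow> real \<Rightarrow> 'w set set" where
  "aug_filtration M W t = sigma_sets (space M)
     ({(W j s) -` B \<inter> space M | j s B. 0 \<le> s \<and> s \<le> t \<and> B \<in> sets borel} \<union> null_sets M)"

definition progressive :: "'w measure \<Rightarrow> (real \<Rightarrow> 'w set set) \<Rightarrow> real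
    \<Rightarrow> (real \<Rightarrow> 'w \<Rightarrow> 'a::topological_space) \<Rightarrow> bool" where
  "progressive M F T X \<longleftrightarrow>
     (\<forall>t\<in>{0..T}. (\<lambda>(s, \<omega>). X s \<omega>) \<in>
        borel_measurable (restrict_space borel {0..t} \<Otimes>\<^sub>M sigma (space M) (F t)))"

definition L2F :: "'w measure \<Rightarrow> (real \<Rightarrow> 'w set set) \<Rightarrow> real
    \<Rightarrow> (real \<Rightarrow> 'w \<Rightarrow> 'a::real_normed_vector) \<Rightarrow> bool" where
  "L2F M F T X \<longleftrightarrow> progressive M F T X \<and>
     (\<integral>\<^sup>+\<omega>. (\<integral>\<^sup>+s. indicator {0..T} s * ennreal ((norm (X s \<omega>))\<^sup>2) \<partial>lborel) \<partial>M) < \<infinity>"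

definition L2det :: "real \<Rightarrow> (real \<Rightarrow> 'a::{real_normed_vector, second_countable_topology}) \<Rightarrow> bool" where
  "L2det T u \<longleftrightarrow> u \<in> borel_measurable lborel \<and>
     (\<integral>\<^sup>+s. indicator {0..T} s * ennreal ((norm (u s))\<^sup>2) \<partial>lborel) < \<infinity>"

definition simple_proc :: "(nat \<Rightarrow> real) \<Rightarrow> nat \<Rightarrow> (nat \<Rightarrow> 'w \<Rightarrow> 'a::real_vector) \<Rightarrow> real \<Rightarrow> 'w \<Rightarrow> 'a" where
  "simple_proc ts m \<xi> s \<omega> = (\<Sum>i<m. indicator {ts i..<ts (Suc i)} s *\<^sub>R \<xi> i \<omega>)"

definition simple_ito :: "('d \<Rightarrow> real \<Rightarrow> 'w \<Rightarrow> real) \<Rightarrow> 'd \<Rightarrow> (nat \<Rightarrow> real) \<Rightarrow> nat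
    \<Rightarrow> (nat \<Rightarrow> 'w \<Rightarrow> 'a::real_vector) \<Rightarrow> real \<Rightarrow> 'w \<Rightarrow> 'a" where
  "simple_ito W j ts m \<xi> t \<omega> =
     (\<Sum>i<m. (W j (min (ts (Suc i)) t) \<omega> - W j (min (ts i) t) \<omega>) *\<^sub>R \<xi> i \<omega>)"

definition adm_simple :: "'w measure \<Rightarrow> (real \<Rightarrow> 'w set set) \<Rightarrow> real \<Rightarrow> (nat \<Rightarrow> real) \<Rightarrow> nat
    \<Rightarrow> (nat \<Rightarrow> 'w \<Rightarrow> 'a::{real_normed_vector, second_countable_topology}) \<Rightarrow> bool" where
  "adm_simple M F T ts m \<xi> \<longleftrightarrow> ts 0 = 0 \<and> ts m = T \<and> (\<forall>i<m. ts i < ts (Suc i)) \<and>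
     (\<forall>i<m. \<xi> i \<in> borel_measurable (sigma (space M) (F (ts i))) \<and>
            (\<integral>\<^sup>+\<omega>. ennreal ((norm (\<xi> i \<omega>))\<^sup>2) \<partial>M) < \<infinity>)"

text \<open>I is (a version of) the Ito integral t \<mapsto> \<integral>_0^t H dW^j on [0,T]: H is approximated in
  L^2(ds \<otimes> dP) by simple adapted processes whose elementary Ito integrals converge
  in L^2(P) to I t for every t \<in> [0,T].\<close>

definition is_ito :: "'w measure \<Rightarrow> (real \<Rightarrow> 'w set set) \<Rightarrow> ('d \<Rightarrow> real \<Rightarrow> 'w \<Rightarrow> real) \<Rightarrow> 'd \<Rightarrow> real
    \<Rightarrow> (real \<Rightarrow> 'w \<Rightarrow> 'a::{real_normed_vector, second_countable_topology})
    \<Rightarrow> (real \<Rightarrow> 'w \<Rightarrow> 'a) \<Rightarrow> bool" where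
  "is_ito M F W j T H I \<longleftrightarrow>
     (\<forall>t\<in>{0..T}. I t \<in> borel_measurable M) \<and>
     (\<exists>(ts::nat \<Rightarrow> nat \<Rightarrow> real) (m::nat \<Rightarrow> nat) (\<xi>::nat \<Rightarrow> nat \<Rightarrow> 'w \<Rightarrow> 'a).
        (\<forall>k. adm_simple M F T (ts k) (m k) (\<xi> k)) \<and>
        (\<lambda>k. \<integral>\<^sup>+\<omega>. (\<integral>\<^sup>+s. indicator {0..T} s *
              ennreal ((norm (H s \<omega> - simple_proc (ts k) (m k) (\<xi> k) s \<omega>))\<^sup>2) \<partial>lborel) \<partial>M)
          \<longlonglongrightarrow> 0 \<and>
        (\<forall>t\<in>{0..T}. (\<lambda>k. \<integral>\<^sup>+\<omega>. ennreal ((norm (I t \<omega> - simple_ito W j (ts k) (m k) (\<xi> k) t \<omega>))\<^sup>2) \<partial>M)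
          \<longlonglongrightarrow> 0))"

definition is_state :: "'w measure \<Rightarrow> ('d::finite \<Rightarrow> real \<Rightarrow> 'w \<Rightarrow> real) \<Rightarrow> real
    \<Rightarrow> (real \<Rightarrow> real^'n::finite^'n) \<Rightarrow> (real \<Rightarrow> real^'l1::finite^'n) \<Rightarrow> (real \<Rightarrow> real^'l2::finite^'n)
    \<Rightarrow> ('d \<Rightarrow> real \<Rightarrow> real^'n^'n) \<Rightarrow> ('d \<Rightarrow> real \<Rightarrow> real^'l1^'n) \<Rightarrow> ('d \<Rightarrow> real \<Rightarrow> real^'l2^'n)
    \<Rightarrow> real^'n \<Rightarrow> (real \<Rightarrow> real^'l1) \<Rightarrow> (real \<Rightarrow> 'w \<Rightarrow> real^'l2) \<Rightarrow> (real \<Rightarrow> 'w \<Rightarrow> real^'n) \<Rightarrow> bool" where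
  "is_state M W T A B1 B2 C D1 D2 x0 u1 u2 X \<longleftrightarrow>
     L2F M (aug_filtration M W) T X \<and>
     (\<exists>I::'d \<Rightarrow> real \<Rightarrow> 'w \<Rightarrow> real^'n.
        (\<forall>j. is_ito M (aug_filtration M W) W j T
               (\<lambda>s \<omega>. C j s *v X s \<omega> + D1 j s *v u1 s + D2 j s *v u2 s \<omega>) (I j)) \<and>
        (\<forall>t\<in>{0..T}. AE \<omega> in M.
           X t \<omega> = x0 + set_lebesgue_integral lborel {0..t}
                         (\<lambda>s. A s *v X s \<omega> + B1 s *v u1 s + B2 s *v u2 s \<omega>)
                    + (\<Sum>j\<in>UNIV. I j t \<omega>)))"

definition is_adjoint :: "'w measure \<Rightarrow> ('d::finite \<Rightarrow> real \<Rightarrow> 'w \<Rightarrow> real) \<Rightarrow> real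
    \<Rightarrow> (real \<Rightarrow> real^'n::finite^'n) \<Rightarrow> ('d \<Rightarrow> real \<Rightarrow> real^'n^'n) \<Rightarrow> (real \<Rightarrow> real^'n^'n)
    \<Rightarrow> real^'n^'n \<Rightarrow> (real \<Rightarrow> 'w \<Rightarrow> real^'n)
    \<Rightarrow> (real \<Rightarrow> 'w \<Rightarrow> real^'n) \<Rightarrow> ('d \<Rightarrow> real \<Rightarrow> 'w \<Rightarrow> real^'n) \<Rightarrow> bool" where
  "is_adjoint M W T A C Q G X p k \<longleftrightarrow>
     L2F M (aug_filtration M W) T p \<and> (\<forall>j. L2F M (aug_filtration M W) T (k j)) \<and>
     (\<exists>I::'d \<Rightarrow> real \<Rightarrow> 'w \<Rightarrow> real^'n.
        (\<forall>j. is_ito M (aug_filtration M W) W j T (k j) (I j)) \<and>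
        (\<forall>t\<in>{0..T}. AE \<omega> in M.
           p t \<omega> = G *v X T \<omega>
                   + set_lebesgue_integral lborel {t..T}
                       (\<lambda>s. transpose (A s) *v p s \<omega> + (\<Sum>j\<in>UNIV. transpose (C j s) *v k j s \<omega>)
                            + Q s *v X s \<omega>)
                   - (\<Sum>j\<in>UNIV. I j T \<omega> - I j t \<omega>)))"

definition cost :: "'w measure \<Rightarrow> real \<Rightarrow> (real \<Rightarrow> real^'n::finite^'n)
    \<Rightarrow> (real \<Rightarrow> real^'l1::finite^'l1) \<Rightarrow> (real \<Rightarrow> real^'l2::finite^'l2) \<Rightarrow> real^'n^'n
    \<Rightarrow> (real \<Rightarrow> real^'l1) \<Rightarrow> (real \<Rightarrow> 'w \<Rightarrow> real^'l2) \<Rightarrow> (real \<Rightarrow> 'w \<Rightarrow> real^'n) \<Rightarrow> real" where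
  "cost M T Q R1 R2 G u1 u2 X =
     1/2 * integral\<^sup>L M (\<lambda>\<omega>. set_lebesgue_integral lborel {0..T}
        (\<lambda>s. X s \<omega> \<bullet> (Q s *v X s \<omega>) + u1 s \<bullet> (R1 s *v u1 s) + u2 s \<omega> \<bullet> (R2 s *v u2 s \<omega>)))
     + 1/2 * integral\<^sup>L M (\<lambda>\<omega>. X T \<omega> \<bullet> (G *v X T \<omega>))"

definition optimal :: "'w measure \<Rightarrow> ('d::finite \<Rightarrow> real \<Rightarrow> 'w \<Rightarrow> real) \<Rightarrow> real
    \<Rightarrow> (real \<Rightarrow> real^'n::finite^'n) \<Rightarrow> (real \<Rightarrow> real^'l1::finite^'n) \<Rightarrow> (real \<Rightarrow> real^'l2::finite^'n)
    \<Rightarrow> ('d \<Rightarrow> real \<Rightarrow> real^'n^'n) \<Rightarrow> ('d \<Rightarrow> real \<Rightarrow> real^'l1^'n) \<Rightarrow> ('d \<Rightarrow> real \<Rightarrow> real^'l2^'n)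
    \<Rightarrow> (real \<Rightarrow> real^'n^'n) \<Rightarrow> (real \<Rightarrow> real^'l1^'l1) \<Rightarrow> (real \<Rightarrow> real^'l2^'l2) \<Rightarrow> real^'n^'n
    \<Rightarrow> real^'n \<Rightarrow> (real \<Rightarrow> real^'l1) \<Rightarrow> (real \<Rightarrow> 'w \<Rightarrow> real^'l2) \<Rightarrow> (real \<Rightarrow> 'w \<Rightarrow> real^'n) \<Rightarrow> bool" where
  "optimal M W T A B1 B2 C D1 D2 Q R1 R2 G x0 u1 u2 X \<longleftrightarrow>
     (\<forall>v1 v2 Y. L2det T v1 \<and> L2F M (aug_filtration M W) T v2 \<and>
        is_state M W T A B1 B2 C D1 D2 x0 v1 v2 Y \<longrightarrow>
        cost M T Q R1 R2 G u1 u2 X \<le> cost M T Q R1 R2 G v1 v2 Y)"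

end

theory Submission
  imports Defs
begin

text \<open>
  The cost is a convex quadratic functional and the state depends affinely on the control. Hence a
  control is optimal iff the first variation of the cost vanishes in every admissible direction
  \<open>(w1, w2)\<close>. Pairing the adjoint process with the state of the linearised equation turns the first
  variation into the expected time integral of \<open>\<Gamma>1 . w1 + \<Gamma>2 . w2\<close>, where \<open>\<Gamma>1\<close> and \<open>\<Gamma>2\<close> are the expressions in
  the two optimality conditions; since \<open>w1\<close> is deterministic, only the mean of \<open>\<Gamma>1\<close> is seen. For
  necessity one takes \<open>w1\<close> to be that mean, respectively \<open>w2 = \<Gamma>2\<close>, which requires the state
  equation to be solvable for every admissible control: the Ito integral is constructed on all
  square-integrable progressive processes and the equation is solved by Picard iteration.
\<close>

section \<open>Square-integrable functions\<close>

text \<open>An Ito integral is available here only as a mean square limit of elementary integrals,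
  separately at each time and up to null sets. Every fact about it is therefore first an identity
  between expectations of inner products of elementary integrals, which the Cauchy-Schwarz
  inequality carries to the limit; linearity and the value at time 0 are deduced from these
  identities. The obstacle is measurability: states have to be progressive, whereas a mean square
  limit has no preferred version. Approximating sequences are chosen with squared errors of order
  \<open>(1/4)^k\<close>. Their successive differences then have L1 norms of order
  \<open>(1/2)^k\<close>, which is summable, so they converge almost surely and the pointwise
  \<open>lim\<close> is a progressive version. A Picard step yields the same rate, so one
  completeness argument serves both the stochastic integral and the state equation. All stochastic
  equations hold almost surely at each fixed time, and conditional expectations are replaced by
  tests against square-integrable variables known at the earlier time.\<close>

definition sqi :: "'a measure \<Rightarrow> ('a \<Rightarrow> 'b::euclidean_space) \<Rightarrow> bool" where
  "sqi N f \<longleftrightarrow> f \<in> borel_measurable N \<and> integrable N (\<lambda>x. (norm (f x))\<^sup>2)"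

lemma sqi_measurable: "sqi N f \<Longrightarrow> f \<in> borel_measurable N"
  by (simp add: sqi_def)

lemma sqi_norm2: "sqi N f \<Longrightarrow> integrable N (\<lambda>x. (norm (f x))\<^sup>2)"
  by (simp add: sqi_def)

lemma sqi_iff_nn_integral:
  assumes "f \<in> borel_measurable N"
  shows "sqi N f \<longleftrightarrow> (\<integral>\<^sup>+x. ennreal ((norm (f x))\<^sup>2) \<partial>N) < \<infinity>"
  using assms unfolding sqi_def integrable_iff_bounded by auto

lemma sqi_cong_AE:
  assumes "sqi N f" "g \<in> borel_measurable N" "AE x in N. f x = g x"
  shows "sqi N g"
proof -
  have "integrable N (\<lambda>x. (norm (g x))\<^sup>2) \<longleftrightarrow> integrable N (\<lambda>x. (norm (f x))\<^sup>2)"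
    using assms by (intro integrable_cong_AE) (auto simp: sqi_def)
  then show ?thesis using assms by (simp add: sqi_def)
qed

lemma norm_add_power2_le: "(norm (x + y :: 'a::real_normed_vector))\<^sup>2 \<le> 2 * (norm x)\<^sup>2 + 2 * (norm y)\<^sup>2"
proof -
  have "(norm (x + y))\<^sup>2 \<le> (norm x + norm y)\<^sup>2"
    by (intro power_mono norm_triangle_ineq) auto
  also have "\<dots> \<le> 2 * (norm x)\<^sup>2 + 2 * (norm y)\<^sup>2"
    using sum_squares_bound[of "norm x" "norm y"] by (simp add: power2_sum)
  finally show ?thesis .
qed

lemma norm_diff_power2_le: "(norm (x - y :: 'a::real_normed_vector))\<^sup>2 \<le> 2 * (norm x)\<^sup>2 + 2 * (norm y)\<^sup>2"
  using norm_add_power2_le[of x "- y"] by simp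

lemma norm_sum_power2_le:
  fixes f :: "'i \<Rightarrow> 'a::real_normed_vector"
  assumes "finite I"
  shows "(norm (\<Sum>i\<in>I. f i))\<^sup>2 \<le> real (card I) * (\<Sum>i\<in>I. (norm (f i))\<^sup>2)"
proof -
  have "(norm (\<Sum>i\<in>I. f i))\<^sup>2 \<le> (\<Sum>i\<in>I. 1 * norm (f i))\<^sup>2"
    by (intro power_mono) (auto intro: norm_sum)
  also have "\<dots> \<le> (\<Sum>i\<in>I. 1\<^sup>2) * (\<Sum>i\<in>I. (norm (f i))\<^sup>2)"
    by (rule Cauchy_Schwarz_ineq_sum)
  finally show ?thesis by simp
qed

lemma abs_inner_le_power2: "\<bar>x \<bullet> y\<bar> \<le> (norm x)\<^sup>2 + (norm (y::'a::real_inner))\<^sup>2"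
proof -
  have "\<bar>x \<bullet> y\<bar> \<le> norm x * norm y" by (rule Cauchy_Schwarz_ineq2)
  also have "\<dots> \<le> (norm x)\<^sup>2 + (norm y)\<^sup>2"
    using sum_squares_bound[of "norm x" "norm y"] mult_nonneg_nonneg[OF norm_ge_zero[of x] norm_ge_zero[of y]] by linarith
  finally show ?thesis .
qed

lemma sqi_add:
  assumes "sqi N f" "sqi N g"
  shows "sqi N (\<lambda>x. f x + g x)"
proof -
  have [measurable]: "f \<in> borel_measurable N" "g \<in> borel_measurable N"
    using assms by (auto simp: sqi_def)
  have "integrable N (\<lambda>x. (norm (f x + g x))\<^sup>2)"
    by (rule Bochner_Integration.integrable_bound[of N "\<lambda>x. 2 * (norm (f x))\<^sup>2 + 2 * (norm (g x))\<^sup>2"])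
       (use assms norm_add_power2_le in \<open>auto simp: sqi_def\<close>)
  then show ?thesis by (simp add: sqi_def)
qed

lemma sqi_scaleR: "sqi N f \<Longrightarrow> sqi N (\<lambda>x. c *\<^sub>R f x)"
  unfolding sqi_def by (auto simp: power_mult_distrib)

lemma sqi_diff: "sqi N f \<Longrightarrow> sqi N g \<Longrightarrow> sqi N (\<lambda>x. f x - g x)"
  using sqi_add[of N f "\<lambda>x. (-1) *\<^sub>R g x"] sqi_scaleR[of N g "-1"] by simp

lemma sqi_zero [simp]: "sqi N (\<lambda>x. 0)"
  by (simp add: sqi_def)

lemma sqi_sum: "(\<And>i. i \<in> I \<Longrightarrow> sqi N (f i)) \<Longrightarrow> sqi N (\<lambda>x. \<Sum>i\<in>I. f i x)"
  by (induction I rule: infinite_finite_induct) (auto intro: sqi_add)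

lemma sqi_bound:
  assumes "sqi N f" "g \<in> borel_measurable N" "AE x in N. norm (g x) \<le> c * norm (f x)"
  shows "sqi N g"
proof -
  have "integrable N (\<lambda>x. (norm (g x))\<^sup>2)"
  proof (rule Bochner_Integration.integrable_bound[of N "\<lambda>x. c\<^sup>2 * (norm (f x))\<^sup>2"])
    show "AE x in N. norm ((norm (g x))\<^sup>2) \<le> norm (c\<^sup>2 * (norm (f x))\<^sup>2)"
      using assms(3)
    proof eventually_elim
      case (elim x)
      then have "(norm (g x))\<^sup>2 \<le> (c * norm (f x))\<^sup>2" by (intro power_mono) auto
      then show ?case by (simp add: power_mult_distrib)
    qed
  qed (use assms in \<open>auto simp: sqi_def\<close>)
  then show ?thesis using assms by (simp add: sqi_def)
qed

lemma sqi_const: "finite_measure N \<Longrightarrow> sqi N (\<lambda>x. c)"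
  by (simp add: sqi_def finite_measure.integrable_const)

lemma sqi_inner:
  assumes "sqi N f" "sqi N g"
  shows "integrable N (\<lambda>x. f x \<bullet> g x)"
proof -
  have [measurable]: "f \<in> borel_measurable N" "g \<in> borel_measurable N"
    using assms by (auto simp: sqi_def)
  show ?thesis
    by (rule Bochner_Integration.integrable_bound[of N "\<lambda>x. (norm (f x))\<^sup>2 + (norm (g x))\<^sup>2"])
       (use assms abs_inner_le_power2 in \<open>auto simp: sqi_def\<close>)
qed

lemma sqi_integrable:
  assumes "finite_measure N" "sqi N f"
  shows "integrable N f"
proof (rule Bochner_Integration.integrable_bound[of N "\<lambda>x. 1 + (norm (f x))\<^sup>2"])
  have "t \<le> 1 + t\<^sup>2" for t :: real
    using sum_squares_bound[of t 1] by (smt (verit) mult_nonneg_nonneg mult_cancel_left2 one_power2 zero_le_power2)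
  then show "AE x in N. norm (f x) \<le> norm (1 + (norm (f x))\<^sup>2)"
    by (intro AE_I2) (smt (verit) real_norm_def)
qed (use assms in \<open>auto simp: sqi_def finite_measure.integrable_const\<close>)

text \<open>The integral of the squared norm of \<open>s *\<^sub>R f x + g x\<close> is a
  nonnegative quadratic in \<open>s\<close>, so its discriminant cannot be positive. For
  \<open>a = 0\<close> the quadratic degenerates to an affine function and is treated
  separately.\<close>

lemma sqi_Cauchy_Schwarz:
  assumes f: "sqi N f" and g: "sqi N g"
  shows "(\<integral>x. f x \<bullet> g x \<partial>N)\<^sup>2 \<le> (\<integral>x. (norm (f x))\<^sup>2 \<partial>N) * (\<integral>x. (norm (g x))\<^sup>2 \<partial>N)"
proof -
  define a b c where "a = (\<integral>x. (norm (f x))\<^sup>2 \<partial>N)" and "b = (\<integral>x. (norm (g x))\<^sup>2 \<partial>N)"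
    and "c = (\<integral>x. f x \<bullet> g x \<partial>N)"
  have q: "0 \<le> s\<^sup>2 * a + 2 * s * c + b" for s
  proof -
    have "0 \<le> (\<integral>x. (norm (s *\<^sub>R f x + g x))\<^sup>2 \<partial>N)" by simp
    also have "\<dots> = (\<integral>x. s\<^sup>2 * (norm (f x))\<^sup>2 + 2 * s * (f x \<bullet> g x) + (norm (g x))\<^sup>2 \<partial>N)"
      unfolding power2_norm_eq_inner
      by (intro Bochner_Integration.integral_cong)
        (auto simp: inner_add_left inner_add_right inner_commute power2_eq_square)
    also have "\<dots> = s\<^sup>2 * a + 2 * s * c + b"
      using f g sqi_inner[OF f g] by (simp add: a_def b_def c_def sqi_def)
    finally show ?thesis .
  qed
  have a0: "a \<ge> 0" "b \<ge> 0" by (auto simp: a_def b_def)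
  have "c\<^sup>2 \<le> a * b"
  proof (cases "a = 0")
    case True
    have "c = 0"
    proof (rule ccontr)
      assume "c \<noteq> 0"
      \<comment> \<open>At this \<open>s\<close> the affine function \<open>2 * s * c + b\<close>
        takes the value -1.\<close>
      then show False using q[of "- (b + 1) / (2 * c)"] True a0 by (simp add: field_simps)
    qed
    then show ?thesis using a0 by simp
  next
    case False
    then have "a > 0" using a0 by simp
    \<comment> \<open>The minimiser \<open>- c / a\<close> of the quadratic is inserted, and
      multiplication by \<open>a\<close> clears the denominator.\<close>
    have "0 \<le> a * ((- c / a)\<^sup>2 * a + 2 * (- c / a) * c + b)"
      using q[of "- c / a"] a0 by (intro mult_nonneg_nonneg)
    also have "\<dots> = a * b - c\<^sup>2" using \<open>a > 0\<close> by (simp add: field_simps power2_eq_square)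
    finally show ?thesis by simp
  qed
  then show ?thesis by (simp add: a_def b_def c_def)
qed

lemma sqi_abs_inner_le:
  assumes f: "sqi N f" and g: "sqi N g"
  shows "\<bar>\<integral>x. f x \<bullet> g x \<partial>N\<bar> \<le> sqrt (\<integral>x. (norm (f x))\<^sup>2 \<partial>N) * sqrt (\<integral>x. (norm (g x))\<^sup>2 \<partial>N)"
  unfolding real_sqrt_mult[symmetric] by (rule real_le_rsqrt) (use sqi_Cauchy_Schwarz[OF assms] in simp)

text \<open>The error splits as \<open>(f - fk) \<bullet> (g - gk) - (f - fk) \<bullet> g - f
  \<bullet> (g - gk)\<close>, and Cauchy-Schwarz makes each part small. This continuity of the inner
  product is the device by which identities for elementary integrals pass to Ito integrals.\<close>

lemma sqi_inner_limit:
  assumes f: "sqi N f" and g: "sqi N g" and fk: "\<And>k. sqi N (fk k)" and gk: "\<And>k. sqi N (gk k)"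
    and lf: "(\<lambda>k. \<integral>x. (norm (f x - fk k x))\<^sup>2 \<partial>N) \<longlonglongrightarrow> 0"
    and lg: "(\<lambda>k. \<integral>x. (norm (g x - gk k x))\<^sup>2 \<partial>N) \<longlonglongrightarrow> 0"
  shows "(\<lambda>k. \<integral>x. fk k x \<bullet> gk k x \<partial>N) \<longlonglongrightarrow> (\<integral>x. f x \<bullet> g x \<partial>N)"
proof -
  define F where "F k = sqrt (\<integral>x. (norm (f x - fk k x))\<^sup>2 \<partial>N)" for k
  define G where "G k = sqrt (\<integral>x. (norm (g x - gk k x))\<^sup>2 \<partial>N)" for k
  have F: "F \<longlonglongrightarrow> 0" and G: "G \<longlonglongrightarrow> 0"
    using tendsto_real_sqrt[OF lf] tendsto_real_sqrt[OF lg] unfolding F_def G_def by simp_all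
  define a b where "a = sqrt (\<integral>x. (norm (f x))\<^sup>2 \<partial>N)" and "b = sqrt (\<integral>x. (norm (g x))\<^sup>2 \<partial>N)"
  have *: "norm ((\<integral>x. fk k x \<bullet> gk k x \<partial>N) - (\<integral>x. f x \<bullet> g x \<partial>N)) \<le> F k * G k + F k * b + a * G k" for k
  proof -
    note df = sqi_diff[OF f fk[of k]] and dg = sqi_diff[OF g gk[of k]]
    have "(\<integral>x. fk k x \<bullet> gk k x \<partial>N) - (\<integral>x. f x \<bullet> g x \<partial>N)
       = (\<integral>x. (f x - fk k x) \<bullet> (g x - gk k x) - (f x - fk k x) \<bullet> g x - f x \<bullet> (g x - gk k x) \<partial>N)"
      using sqi_inner[OF fk gk] sqi_inner[OF f g]
      by (subst Bochner_Integration.integral_diff[symmetric])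
         (auto simp: inner_diff_left inner_diff_right algebra_simps intro!: Bochner_Integration.integral_cong)
    also have "\<dots> = (\<integral>x. (f x - fk k x) \<bullet> (g x - gk k x) \<partial>N) - (\<integral>x. (f x - fk k x) \<bullet> g x \<partial>N)
          - (\<integral>x. f x \<bullet> (g x - gk k x) \<partial>N)"
      using sqi_inner[OF df dg] sqi_inner[OF df g] sqi_inner[OF f dg] by simp
    finally show ?thesis
      using sqi_abs_inner_le[OF df dg] sqi_abs_inner_le[OF df g] sqi_abs_inner_le[OF f dg]
      unfolding real_norm_def F_def G_def a_def b_def by linarith
  qed
  have lim: "(\<lambda>k. F k * G k + F k * b + a * G k) \<longlonglongrightarrow> 0"
    using tendsto_add[OF tendsto_add[OF tendsto_mult[OF F G] tendsto_mult_right[OF F, of b]] tendsto_mult_left[OF G, of a]]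
    by (simp add: mult.commute)
  have "(\<lambda>k. (\<integral>x. fk k x \<bullet> gk k x \<partial>N) - (\<integral>x. f x \<bullet> g x \<partial>N)) \<longlonglongrightarrow> 0"
    by (rule Lim_null_comparison[OF always_eventually[OF allI[OF *]] lim])
  then show ?thesis by (simp add: LIM_zero_iff)
qed

text \<open>The definition of the Ito integral speaks of extended integrals, whereas the pairings
  use real ones. The two agree even where infinite, because \<open>enn2real\<close> sends infinity
  to 0 and a non-integrable function has Bochner integral 0.\<close>

lemma sqi_limit_real:
  fixes f :: "'a \<Rightarrow> 'b::euclidean_space"
  assumes lim: "(\<lambda>k. \<integral>\<^sup>+x. ennreal ((norm (f x - fk k x))\<^sup>2) \<partial>N) \<longlonglongrightarrow> 0"
    and [measurable]: "f \<in> borel_measurable N" "\<And>k. fk k \<in> borel_measurable N"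
  shows "(\<lambda>k. \<integral>x. (norm (f x - fk k x))\<^sup>2 \<partial>N) \<longlonglongrightarrow> 0"
proof -
  have "(\<lambda>k. enn2real (\<integral>\<^sup>+x. ennreal ((norm (f x - fk k x))\<^sup>2) \<partial>N)) \<longlonglongrightarrow> enn2real 0"
    using lim by (intro tendsto_enn2real) auto
  moreover have "(\<integral>x. (norm (f x - fk k x))\<^sup>2 \<partial>N) = enn2real (\<integral>\<^sup>+x. ennreal ((norm (f x - fk k x))\<^sup>2) \<partial>N)" for k
    by (intro integral_eq_nn_integral) auto
  ultimately show ?thesis by simp
qed

text \<open>A single approximant at finite distance suffices, since \<open>f\<close> is the sum of
  \<open>f - fk\<close> and \<open>fk\<close>.\<close>

lemma sqi_of_limit:
  assumes lim: "(\<lambda>k. \<integral>\<^sup>+x. ennreal ((norm (f x - fk k x))\<^sup>2) \<partial>N) \<longlonglongrightarrow> 0"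
    and f: "f \<in> borel_measurable N" and fk: "\<And>k. sqi N (fk k)"
  shows "sqi N f"
proof -
  have "eventually (\<lambda>k. (\<integral>\<^sup>+x. ennreal ((norm (f x - fk k x))\<^sup>2) \<partial>N) < 1) sequentially"
    using lim by (rule order_tendstoD) auto
  then obtain k where k: "(\<integral>\<^sup>+x. ennreal ((norm (f x - fk k x))\<^sup>2) \<partial>N) < 1"
    by (auto simp: eventually_sequentially)
  have "sqi N (\<lambda>x. f x - fk k x)"
    using k f fk[THEN sqi_measurable] by (subst sqi_iff_nn_integral) (auto intro: less_trans)
  from sqi_add[OF this fk[of k]] show ?thesis by simp
qed

lemma sqi_AE_zero:
  assumes "sqi N f" "(\<integral>x. (norm (f x))\<^sup>2 \<partial>N) = 0"
  shows "AE x in N. f x = 0"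
proof -
  have "AE x in N. (norm (f x))\<^sup>2 = 0"
    using assms(2) by (rule iffD1[OF integral_nonneg_eq_0_iff_AE, rotated 2]) (use assms in \<open>auto simp: sqi_def\<close>)
  then show ?thesis by eventually_elim simp
qed

text \<open>The rate \<open>(1/4)^k\<close> for squared distances bounds the L1 norm of the
  successive differences by a multiple of \<open>(1/2)^k\<close>. The series of their norms thus has
  a finite integral, is finite almost everywhere, and makes the telescoping series converge
  absolutely.\<close>

lemma rapidly_Cauchy_convergent_AE:
  fixes f :: "nat \<Rightarrow> 'a \<Rightarrow> 'b::euclidean_space"
  assumes N: "finite_measure N" and meas[measurable]: "\<And>k. f k \<in> borel_measurable N"
    and cau: "\<And>k m. k \<le> m \<Longrightarrow> (\<integral>\<^sup>+x. ennreal ((norm (f m x - f k x))\<^sup>2) \<partial>N) \<le> ennreal (c * (1/4)^k)"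
  shows "AE x in N. convergent (\<lambda>k. f k x)"
proof -
  interpret finite_measure N by fact
  have c4: "ennreal (c * (1/4)^k) = ennreal c * ennreal ((1/4)^k)" for k
    by (rule ennreal_mult'') simp
  have *: "(\<integral>\<^sup>+x. ennreal (norm (f (Suc k) x - f k x)) \<partial>N) \<le> ennreal ((1/2)^k) * (emeasure N (space N) + ennreal c)" for k
  proof -
    \<comment> \<open>The arithmetic-geometric mean inequality with weight \<open>2^k\<close> trades
      a first power for a square: the constant costs \<open>(1/2)^k\<close>, and
      \<open>2^k * (1/4)^k\<close> is again \<open>(1/2)^k\<close>.\<close>
    have pt: "t \<le> (1/2)^k + 2^k * t\<^sup>2" for t :: real
    proof -
      have "2 * 1 * (2^k * t) \<le> 1\<^sup>2 + (2^k*t)\<^sup>2" by (rule sum_squares_bound)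
      then have "(1/2)^k * (2 * (2^k * t)) \<le> (1/2)^k * (1 + (2^k*t)\<^sup>2)" by (intro mult_left_mono) auto
      moreover have "(1/2)^k * (2 * (2^k * t)) = 2 * t"
        by (simp add: power_one_over)
      moreover have "(1/2)^k * (1 + (2^k*t)\<^sup>2) = (1/2)^k + 2^k * t\<^sup>2"
        by (simp add: power_one_over field_simps power2_eq_square)
      moreover have "(1/2)^k + 2^k * t\<^sup>2 \<ge> 0" by simp
      ultimately show ?thesis by linarith
    qed
    have "(\<integral>\<^sup>+x. ennreal (norm (f (Suc k) x - f k x)) \<partial>N)
       \<le> (\<integral>\<^sup>+x. ennreal ((1/2)^k) + ennreal (2^k) * ennreal ((norm (f (Suc k) x - f k x))\<^sup>2) \<partial>N)"
      using pt by (intro nn_integral_mono) (auto simp flip: ennreal_plus ennreal_mult intro!: ennreal_leI)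
    also have "\<dots> = ennreal ((1/2)^k) * emeasure N (space N) + ennreal (2^k) * (\<integral>\<^sup>+x. ennreal ((norm (f (Suc k) x - f k x))\<^sup>2) \<partial>N)"
      using meas by (subst nn_integral_add) (auto simp: nn_integral_cmult)
    also have "\<dots> \<le> ennreal ((1/2)^k) * emeasure N (space N) + ennreal (2^k) * ennreal (c * (1/4)^k)"
      by (intro add_left_mono mult_left_mono cau) auto
    also have "ennreal (2^k) * ennreal (c * (1/4)^k) = ennreal ((1/2)^k) * ennreal c"
    proof -
      have "2^k * (1/4)^k = (1/2::real)^k" by (simp flip: power_mult_distrib)
      then show ?thesis unfolding c4 by (metis (no_types, opaque_lifting) ennreal_mult' mult.assoc mult.commute zero_le_power zero_le_numeral)
    qed
    finally show ?thesis by (simp add: distrib_left)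
  qed
  have "(\<integral>\<^sup>+x. (\<Sum>k. ennreal (norm (f (Suc k) x - f k x))) \<partial>N) = (\<Sum>k. \<integral>\<^sup>+x. ennreal (norm (f (Suc k) x - f k x)) \<partial>N)"
    using meas by (intro nn_integral_suminf) auto
  also have "\<dots> \<le> (\<Sum>k. ennreal ((1/2)^k) * (emeasure N (space N) + ennreal c))"
    by (intro suminf_le) (use * in auto)
  also have "\<dots> = (\<Sum>k. ennreal ((1/2)^k)) * (emeasure N (space N) + ennreal c)"
    by simp
  also have "(\<Sum>k. ennreal ((1/2)^k)) = ennreal (\<Sum>k. (1/2)^k)"
    by (intro suminf_ennreal2) (auto intro: summable_geometric)
  also have "\<dots> * (emeasure N (space N) + ennreal c) < \<infinity>"
  proof -
    have "ennreal (\<Sum>k. (1/2)^k) * (emeasure N (space N) + ennreal c) \<noteq> top"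
      using emeasure_finite[of "space N"] by (simp add: ennreal_mult_eq_top_iff)
    then show ?thesis by (metis infinity_ennreal_def less_top)
  qed
  finally have fin: "(\<integral>\<^sup>+x. (\<Sum>k. ennreal (norm (f (Suc k) x - f k x))) \<partial>N) < \<infinity>" .
  have "AE x in N. (\<Sum>k. ennreal (norm (f (Suc k) x - f k x))) \<noteq> \<infinity>"
    by (rule nn_integral_noteq_infinite) (measurable, use fin in simp)
  then show ?thesis
  proof eventually_elim
    case (elim x)
    have "summable (\<lambda>k. norm (f (Suc k) x - f k x))"
      using elim by (intro summable_suminf_not_top) auto
    then have "summable (\<lambda>k. f (Suc k) x - f k x)" by (rule summable_norm_cancel)
    then have "convergent (\<lambda>n. \<Sum>k<n. f (Suc k) x - f k x)" by (simp add: summable_iff_convergent)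
    then have "convergent (\<lambda>n. f n x - f 0 x)" by (subst (asm) sum_lessThan_telescope)
    then show ?case using convergent_add_const_iff[of "- f 0 x" "\<lambda>n. f n x"] by simp
  qed
qed

text \<open>Fatou's lemma in \<open>m\<close> for fixed \<open>k\<close>. The limit is the literal
  pointwise \<open>lim\<close>, whose arbitrary value at points of divergence matters only on a null
  set; being defined pointwise, it inherits progressive measurability later.\<close>

lemma rapidly_Cauchy_limit:
  fixes f :: "nat \<Rightarrow> 'a \<Rightarrow> 'b::euclidean_space"
  assumes N: "finite_measure N" and meas[measurable]: "\<And>k. f k \<in> borel_measurable N"
    and cau: "\<And>k m. k \<le> m \<Longrightarrow> (\<integral>\<^sup>+x. ennreal ((norm (f m x - f k x))\<^sup>2) \<partial>N) \<le> ennreal (c * (1/4)^k)"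
  shows "(\<integral>\<^sup>+x. ennreal ((norm (lim (\<lambda>m. f m x) - f k x))\<^sup>2) \<partial>N) \<le> ennreal (c * (1/4)^k)"
proof -
  have "(\<integral>\<^sup>+x. ennreal ((norm (lim (\<lambda>m. f m x) - f k x))\<^sup>2) \<partial>N)
      = (\<integral>\<^sup>+x. liminf (\<lambda>m. ennreal ((norm (f m x - f k x))\<^sup>2)) \<partial>N)"
  proof (rule nn_integral_cong_AE, rule AE_mp[OF rapidly_Cauchy_convergent_AE[OF N meas cau]], assumption, intro AE_I2 impI)
    fix x assume elim: "convergent (\<lambda>k. f k x)" 
    from elim have "(\<lambda>m. f m x) \<longlonglongrightarrow> lim (\<lambda>m. f m x)" by (simp add: convergent_LIMSEQ_iff)
    then have "(\<lambda>m. ennreal ((norm (f m x - f k x))\<^sup>2)) \<longlonglongrightarrow> ennreal ((norm (lim (\<lambda>m. f m x) - f k x))\<^sup>2)"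
      by (intro tendsto_intros tendsto_ennrealI)
    from lim_imp_Liminf[OF _ this]
    show "ennreal ((norm (lim (\<lambda>m. f m x) - f k x))\<^sup>2) = liminf (\<lambda>m. ennreal ((norm (f m x - f k x))\<^sup>2))"
      by simp
  qed
  also have "\<dots> \<le> liminf (\<lambda>m. \<integral>\<^sup>+x. ennreal ((norm (f m x - f k x))\<^sup>2) \<partial>N)"
    using meas by (intro nn_integral_liminf) auto
  also have "\<dots> \<le> ennreal (c * (1/4)^k)"
    by (intro Liminf_le) (auto simp: eventually_sequentially intro!: exI[of _ k] cau)
  finally show ?thesis .
qed

section \<open>Brownian increments and the augmented filtration\<close>

locale brownian_motion = prob_space M for M :: "'w measure" +
  fixes W :: "'d::finite \<Rightarrow> real \<Rightarrow> 'w \<Rightarrow> real" and T :: real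
  assumes W: "brownian M W" and T: "0 < T"
begin

abbreviation Fs :: "real \<Rightarrow> 'w measure" where
  "Fs t \<equiv> sigma (space M) (aug_filtration M W t)"

lemma W_zero: "W j 0 \<omega> = 0"
  and W_continuous: "continuous_on {0..} (\<lambda>t. W j t \<omega>)"
  and W_measurable [measurable]: "W j t \<in> borel_measurable M"
  and W_normal: "0 \<le> s \<Longrightarrow> s < t \<Longrightarrow> distributed M lborel (\<lambda>\<omega>. W j t \<omega> - W j s \<omega>) (normal_density 0 (sqrt (t - s)))"
  using W unfolding brownian_def by blast+

lemma W_indep:
  fixes ts :: "nat \<Rightarrow> real"
  assumes "0 \<le> ts 0" "\<And>i. i < k \<Longrightarrow> ts i < ts (Suc i)"
  shows "indep_vars (\<lambda>_. borel) (\<lambda>(j, i) \<omega>. W j (ts (Suc i)) \<omega> - W j (ts i) \<omega>) (UNIV \<times> {..<k})"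
  using W assms unfolding brownian_def by blast

section \<open>The augmented filtration as a family of sigma-algebras\<close>

lemma aug_filtration_subset: "aug_filtration M W t \<subseteq> events"
  unfolding aug_filtration_def
  by (rule sets.sigma_sets_subset) (auto intro: measurable_sets)

lemma aug_filtration_Pow: "aug_filtration M W t \<subseteq> Pow (space M)"
  using aug_filtration_subset sets.sets_into_space by blast

lemma sets_Fs: "sets (Fs t) = aug_filtration M W t"
proof -
  have "sigma_sets (space M) (aug_filtration M W t) = aug_filtration M W t"
    unfolding aug_filtration_def by (rule sigma_sets_sigma_sets_eq) (use sets.sets_into_space in \<open>auto simp: null_sets_def\<close>)
  then show ?thesis using aug_filtration_Pow by (simp add: sets_measure_of)
qed

lemma space_Fs [simp]: "space (Fs t) = space M"
  using aug_filtration_Pow by (simp add: space_measure_of)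

lemma measurable_Fs_M: "f \<in> measurable (Fs t) N \<Longrightarrow> f \<in> measurable M N"
  using aug_filtration_subset[of t] unfolding measurable_def by (auto simp: sets_Fs)

lemma aug_filtration_mono: "s \<le> t \<Longrightarrow> aug_filtration M W s \<subseteq> aug_filtration M W t"
  unfolding aug_filtration_def
  by (rule sigma_sets_mono', rule Un_mono[OF Collect_mono subset_refl]) (blast intro: order_trans)

lemma measurable_Fs_mono: "f \<in> measurable (Fs s) N \<Longrightarrow> s \<le> t \<Longrightarrow> f \<in> measurable (Fs t) N"
  using aug_filtration_mono[of s t] unfolding measurable_def by (auto simp: sets_Fs)

lemma W_measurable_Fs:
  assumes "0 \<le> s" "s \<le> t"
  shows "W j s \<in> borel_measurable (Fs t)"
proof (rule measurableI)
  fix A :: "real set" assume "A \<in> sets borel"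
  then have "W j s -` A \<inter> space M \<in> aug_filtration M W t"
    unfolding aug_filtration_def using assms by (intro sigma_sets.Basic) blast
  then show "W j s -` A \<inter> space (Fs t) \<in> sets (Fs t)"
    by (simp add: sets_Fs)
qed auto

lemma W_increment_measurable:
  "(\<lambda>\<omega> j. W j u \<omega> - W j c \<omega>) \<in> measurable M (PiM UNIV (\<lambda>_. borel))"
  by (rule measurable_PiM_single') (auto simp: PiE_def)

text \<open>The finite cylinders in the values of W up to time c, together with the null sets, form a
  \<open>\<pi>\<close>-system generating the augmented filtration.\<close>

lemma indep_increment:
  assumes c: "0 \<le> c" "c < u" and \<zeta>: "\<zeta> \<in> borel_measurable (Fs c)"
    and g: "g \<in> borel_measurable (PiM UNIV (\<lambda>_::'d. borel))"
  shows "indep_var borel (\<zeta> :: 'w \<Rightarrow> real) borel (\<lambda>\<omega>. g (\<lambda>j. W j u \<omega> - W j c \<omega>) :: real)"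
proof -
  \<comment> \<open>The increments of all components form one random vector, so that
    \<open>g\<close> may also be a product of two components, which the pairing of integrals with
    respect to different components requires.\<close>
  define V where "V = (\<lambda>\<omega> j. W j u \<omega> - W j c \<omega>)"
  define cyl where "cyl = {S. \<exists>(K :: ('d \<times> real) set) B. finite K \<and> snd ` K \<subseteq> {0..c} \<and> (\<forall>k. B k \<in> sets borel) \<and>
     S = {\<omega>\<in>space M. \<forall>k\<in>K. W (fst k) (snd k) \<omega> \<in> B k}}"
  define VS where "VS = {V -` A \<inter> space M | A. A \<in> sets (PiM UNIV (\<lambda>_::'d. borel :: real measure))}"
  have Vm: "V \<in> measurable M (PiM UNIV (\<lambda>_. borel))"
    unfolding V_def by (rule W_increment_measurable)
  have VS_events: "VS \<subseteq> events"
    unfolding VS_def using measurable_sets[OF Vm] by blast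
  have cyl_events: "cyl \<subseteq> events"
  proof
    fix S assume "S \<in> cyl"
    then obtain K B where K: "finite (K :: ('d \<times> real) set)" "\<forall>k. B k \<in> sets borel"
      and S: "S = {\<omega>\<in>space M. \<forall>k\<in>K. W (fst k) (snd k) \<omega> \<in> B k}" unfolding cyl_def by blast
    have "{\<omega>\<in>space M. W (fst k) (snd k) \<omega> \<in> B k} \<in> events" for k
      using measurable_sets[OF W_measurable[of "fst k" "snd k"] spec[OF K(2), of k]]
      by (simp add: vimage_def Int_def conj_commute)
    then show "S \<in> events" unfolding S using K(1) by (intro sets.sets_Collect_finite_All) auto
  qed
  have VS_stable: "Int_stable VS"
  proof (rule Int_stableI)
    fix a b assume "a \<in> VS" "b \<in> VS"
    then obtain A B where AB: "A \<in> sets (PiM UNIV (\<lambda>_::'d. borel :: real measure))" "B \<in> sets (PiM UNIV (\<lambda>_::'d. borel :: real measure))"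
       and a: "a = V -` A \<inter> space M" and b: "b = V -` B \<inter> space M" unfolding VS_def by blast
    have "a \<inter> b = V -` (A \<inter> B) \<inter> space M" unfolding a b by blast
    then show "a \<inter> b \<in> VS" unfolding VS_def using sets.Int[OF AB] by blast
  qed
  have cyl_Int: "a \<inter> b \<in> cyl" if ab: "a \<in> cyl" "b \<in> cyl" for a b
  proof -
    obtain K B where K: "finite (K :: ('d \<times> real) set)" "snd ` K \<subseteq> {0..c}" "\<forall>k. B k \<in> sets borel"
      and a: "a = {\<omega>\<in>space M. \<forall>k\<in>K. W (fst k) (snd k) \<omega> \<in> B k}"
      using ab(1) unfolding cyl_def by blast
    obtain K' B' where K': "finite (K' :: ('d \<times> real) set)" "snd ` K' \<subseteq> {0..c}" "\<forall>k. B' k \<in> sets borel"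
      and b: "b = {\<omega>\<in>space M. \<forall>k\<in>K'. W (fst k) (snd k) \<omega> \<in> B' k}"
      using ab(2) unfolding cyl_def by blast
    \<comment> \<open>A pair outside one of the index sets puts no constraint there, hence the
      default \<open>UNIV\<close>.\<close>
    define B'' where "B'' k = (if k \<in> K then B k else UNIV) \<inter> (if k \<in> K' then B' k else UNIV)" for k
    have "a \<inter> b = {\<omega>\<in>space M. \<forall>k\<in>K\<union>K'. W (fst k) (snd k) \<omega> \<in> B'' k}"
      unfolding a b B''_def by auto
    moreover have "\<forall>k. B'' k \<in> sets borel" using K(3) K'(3) by (auto simp: B''_def)
    moreover have "finite (K \<union> K')" "snd ` (K \<union> K') \<subseteq> {0..c}" using K K' by auto
    ultimately show ?thesis unfolding cyl_def by blast
  qed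
  have P_stable: "Int_stable (cyl \<union> null_sets M)"
  proof (rule Int_stableI)
    fix a b assume ab: "a \<in> cyl \<union> null_sets M" "b \<in> cyl \<union> null_sets M"
    then have ev: "a \<in> events" "b \<in> events" using cyl_events by auto
    show "a \<inter> b \<in> cyl \<union> null_sets M"
    proof (cases "a \<in> null_sets M \<or> b \<in> null_sets M")
      case True
      then show ?thesis using null_set_Int1[OF _ ev(1)] null_set_Int2[OF _ ev(2)] by blast
    next
      case False
      then show ?thesis using cyl_Int ab by blast
    qed
  qed
  \<comment> \<open>Independence is checked on the two Int-stable generators only. A null set
    satisfies the product rule trivially, so the real case is a cylinder \<open>a\<close>.\<close>
  have "indep_set (cyl \<union> null_sets M) VS"
  proof (rule indep_setI)
    show "cyl \<union> null_sets M \<subseteq> events" using cyl_events by auto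
    show "VS \<subseteq> events" by fact
    fix a b assume a: "a \<in> cyl \<union> null_sets M" and b: "b \<in> VS"
    show "prob (a \<inter> b) = prob a * prob b"
    proof (cases "a \<in> null_sets M")
      case True
      then have "a \<inter> b \<in> null_sets M" using b VS_events by (auto intro: null_set_Int2)
      then show ?thesis using True by (simp add: null_sets_def measure_def)
    next
      case False
      then obtain K B where K: "finite (K :: ('d \<times> real) set)" "snd ` K \<subseteq> {0..c}" "\<forall>k. B k \<in> sets borel"
        and a_eq: "a = {\<omega>\<in>space M. \<forall>k\<in>K. W (fst k) (snd k) \<omega> \<in> B k}"
        using a unfolding cyl_def by blast
      obtain A0 where A0: "A0 \<in> sets (PiM UNIV (\<lambda>_::'d. borel :: real measure))" and b_eq: "b = V -` A0 \<inter> space M"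
        using b unfolding VS_def by blast
      \<comment> \<open>All times occurring in the cylinder, together with 0, from which values of W
        are sums of increments, and \<open>c\<close>, at which the future increment starts.\<close>
      define R where "R = insert 0 (insert c (snd ` K))"
      define l where "l = sorted_list_of_set R"
      define n where "n = length l"
      have R: "finite R" "R \<subseteq> {0..c}" using K c by (auto simp: R_def)
      have l: "set l = R" "sorted_wrt (<) l" using R by (auto simp: l_def)
      have n: "n > 0" using l(1) by (auto simp: n_def R_def)
      \<comment> \<open>The sorted times are extended by \<open>u\<close> at index \<open>n\<close>.
        As \<open>ts (n - 1) = c\<close>, the increments with index below \<open>n - 1\<close> lie
        in the past and the one with index \<open>n - 1\<close> is exactly the increment from
        \<open>c\<close> to \<open>u\<close>.\<close>
      define ts where "ts i = (if i < n then l ! i else u)" for i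
      have l_mono: "l ! i \<le> l ! i'" if "i \<le> i'" "i' < n" for i i'
        using that sorted_nth_mono[of l i i'] unfolding n_def by (simp add: l_def)
      have l_in: "i < n \<Longrightarrow> l ! i \<in> {0..c}" for i using l(1) R n_def by (metis nth_mem subsetD)
      have "\<forall>r\<in>R. \<exists>i<n. l ! i = r" using l(1) by (metis in_set_conv_nth n_def)
      then obtain idx where idx: "\<And>r. r \<in> R \<Longrightarrow> idx r < n \<and> l ! (idx r) = r" by metis
      have ts0: "ts 0 = 0"
      proof -
        have "l ! 0 \<le> 0" using idx[of 0] l_mono[of 0 "idx 0"] by (auto simp: R_def)
        then show ?thesis using l_in[of 0] n by (auto simp: ts_def)
      qed
      have tsn: "ts (n - 1) = c"
      proof -
        have "c \<le> l ! (n - 1)" using idx[of c] l_mono[of "idx c" "n - 1"] n by (auto simp: R_def)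
        then show ?thesis using l_in[of "n - 1"] n by (auto simp: ts_def)
      qed
      have incr: "ts i < ts (Suc i)" if "i < n" for i
        using that l(2) l_in[of i] c unfolding ts_def n_def by (auto simp: sorted_wrt_iff_nth_less)
      define X where "X = (\<lambda>(j, i) \<omega>. W j (ts (Suc i)) \<omega> - W j (ts i) \<omega>)"
      define Ia where "Ia = (UNIV :: 'd set) \<times> {..<n - 1}"
      define Ib where "Ib = (UNIV :: 'd set) \<times> {n - 1}"
      have ind: "indep_vars (\<lambda>_. borel) X (UNIV \<times> {..<n})"
        unfolding X_def by (rule W_indep) (use ts0 incr in auto)
      have ind2: "indep_var (PiM Ia (\<lambda>_. borel)) (\<lambda>\<omega>. restrict (\<lambda>i. X i \<omega>) Ia) (PiM Ib (\<lambda>_. borel)) (\<lambda>\<omega>. restrict (\<lambda>i. X i \<omega>) Ib)"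
        by (rule indep_var_restrict[OF ind]) (use n in \<open>auto simp: Ia_def Ib_def\<close>)
      \<comment> \<open>Because W starts at 0, its value at a partition time is a sum of increments.
        The cylinder thus becomes an event \<open>S0\<close> about the increments before
        \<open>c\<close>, and \<open>b\<close> becomes an event \<open>S1\<close> about the last
        one.\<close>
      have tel: "(\<Sum>i<m. X (j, i) \<omega>) = W j (ts m) \<omega>" for m j \<omega>
        using sum_lessThan_telescope[of "\<lambda>i. W j (ts i) \<omega>" m] by (simp add: X_def ts0 W_zero)
      define S0 where "S0 = {x\<in>space (PiM Ia (\<lambda>_. borel :: real measure)). \<forall>k\<in>K. (\<Sum>i<idx (snd k). x (fst k, i)) \<in> B k}"
      define S1 where "S1 = (\<lambda>x j. x (j, n - 1)) -` A0 \<inter> space (PiM Ib (\<lambda>_. borel :: real measure))"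
      have idxK: "idx (snd k) < n" "ts (idx (snd k)) = snd k" if "k \<in> K" for k
        using idx[of "snd k"] that by (auto simp: R_def ts_def)
      have S0: "S0 \<in> sets (PiM Ia (\<lambda>_. borel))"
        unfolding S0_def
      proof (rule sets.sets_Collect_finite_All[OF _ K(1)])
        fix k assume k: "k \<in> K"
        have "(\<lambda>x. \<Sum>i<idx (snd k). x (fst k, i)) \<in> borel_measurable (PiM Ia (\<lambda>_. borel :: real measure))"
          using idxK[OF k] by (intro borel_measurable_sum measurable_component_singleton) (auto simp: Ia_def)
        from measurable_sets[OF this spec[OF K(3), of k]]
        show "{x \<in> space (PiM Ia (\<lambda>_. borel)). (\<Sum>i<idx (snd k). x (fst k, i)) \<in> B k} \<in> sets (PiM Ia (\<lambda>_. borel))"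
          by (simp add: vimage_def Int_def conj_commute)
      qed
      have S1: "S1 \<in> sets (PiM Ib (\<lambda>_. borel))"
        unfolding S1_def
        by (rule measurable_sets[OF _ A0], rule measurable_PiM_single')
           (auto simp: Ib_def PiE_def intro!: measurable_component_singleton)
      have pa: "(\<lambda>\<omega>. restrict (\<lambda>i. X i \<omega>) Ia) -` S0 \<inter> space M = a"
      proof -
        have "(\<Sum>i<idx (snd k). restrict (\<lambda>i. X i \<omega>) Ia (fst k, i)) = W (fst k) (snd k) \<omega>" if "k \<in> K" for k \<omega>
        proof -
          have "(\<Sum>i<idx (snd k). restrict (\<lambda>i. X i \<omega>) Ia (fst k, i)) = (\<Sum>i<idx (snd k). X (fst k, i) \<omega>)"
            using idxK[OF that] by (intro sum.cong) (auto simp: Ia_def)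
          then show ?thesis using tel idxK[OF that] by simp
        qed
        then show ?thesis unfolding S0_def a_eq by (auto simp: space_PiM PiE_def)
      qed
      have pb: "(\<lambda>\<omega>. restrict (\<lambda>i. X i \<omega>) Ib) -` S1 \<inter> space M = b"
      proof -
        have "(\<lambda>j. restrict (\<lambda>i. X i \<omega>) Ib (j, n - 1)) = V \<omega>" for \<omega>
          using tsn n by (auto simp: Ib_def X_def V_def ts_def)
        then show ?thesis unfolding S1_def b_eq by (auto simp: space_PiM PiE_def)
      qed
      from indep_varD[OF ind2 S0 S1, unfolded pa pb]
      have "prob ((\<lambda>\<omega>. (restrict (\<lambda>i. X i \<omega>) Ia, restrict (\<lambda>i. X i \<omega>) Ib)) -` (S0 \<times> S1) \<inter> space M) = prob a * prob b" .
      moreover have "(\<lambda>\<omega>. (restrict (\<lambda>i. X i \<omega>) Ia, restrict (\<lambda>i. X i \<omega>) Ib)) -` (S0 \<times> S1) \<inter> space M = a \<inter> b"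
        using pa pb by blast
      ultimately show ?thesis by simp
    qed
  qed
  from indep_set_sigma_sets[OF this P_stable VS_stable]
  have ind: "indep_set (sigma_sets (space M) (cyl \<union> null_sets M)) (sigma_sets (space M) VS)" .
  have sub: "aug_filtration M W c \<subseteq> sigma_sets (space M) (cyl \<union> null_sets M)"
    unfolding aug_filtration_def
  proof (rule sigma_sets_mono, safe)
    fix j s and B :: "real set" assume s: "0 \<le> s" "s \<le> c" and B: "B \<in> sets borel"
    have "W j s -` B \<inter> space M \<in> cyl"
      unfolding cyl_def
      by (rule CollectI, rule exI[of _ "{(j, s)}"], rule exI[of _ "\<lambda>_. B"]) (use s B in auto)
    then show "W j s -` B \<inter> space M \<in> sigma_sets (space M) (cyl \<union> null_sets M)" by (intro sigma_sets.Basic) auto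
  next
    fix A assume "A \<in> null_sets M" then show "A \<in> sigma_sets (space M) (cyl \<union> null_sets M)"
      by (intro sigma_sets.Basic) auto
  qed
  have \<zeta>': "{\<zeta> -` A \<inter> space M |A. A \<in> sets borel} \<subseteq> aug_filtration M W c"
    using measurable_sets[OF \<zeta>] sets_Fs by auto
  have g': "{(\<lambda>\<omega>. g (V \<omega>)) -` A \<inter> space M |A. A \<in> sets borel} \<subseteq> VS"
  proof safe
    fix A :: "real set" assume "A \<in> sets borel"
    then have "g -` A \<inter> space (PiM UNIV (\<lambda>_. borel)) \<in> sets (PiM UNIV (\<lambda>_. borel))"
      by (rule measurable_sets[OF g])
    moreover have "(\<lambda>\<omega>. g (V \<omega>)) -` A \<inter> space M = V -` (g -` A \<inter> space (PiM UNIV (\<lambda>_. borel))) \<inter> space M"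
      by (auto simp: space_PiM)
    ultimately show "(\<lambda>\<omega>. g (V \<omega>)) -` A \<inter> space M \<in> VS" unfolding VS_def by blast
  qed
  show ?thesis
    unfolding indep_var_eq
  proof (intro conjI)
    show "\<zeta> \<in> borel_measurable M" using \<zeta> by (rule measurable_Fs_M)
    show "(\<lambda>\<omega>. g (\<lambda>j. W j u \<omega> - W j c \<omega>)) \<in> borel_measurable M"
      using measurable_compose[OF Vm g] by (simp add: V_def)
    have "sigma_sets (space M) {\<zeta> -` A \<inter> space M |A. A \<in> sets borel} \<subseteq> sigma_sets (space M) (cyl \<union> null_sets M)"
      using \<zeta>' sub by (intro sigma_sets_mono) blast
    moreover have "sigma_sets (space M) {(\<lambda>\<omega>. g (V \<omega>)) -` A \<inter> space M |A. A \<in> sets borel} \<subseteq> sigma_sets (space M) VS"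
      using g' by (rule sigma_sets_mono')
    ultimately have "indep_set (sigma_sets (space M) {\<zeta> -` A \<inter> space M |A. A \<in> sets borel})
      (sigma_sets (space M) {(\<lambda>\<omega>. g (V \<omega>)) -` A \<inter> space M |A. A \<in> sets borel})"
      using ind unfolding indep_sets2_eq V_def[symmetric] by (meson subset_iff)
    then show "indep_set (sigma_sets (space M) {\<zeta> -` A \<inter> space M |A. A \<in> sets borel})
      (sigma_sets (space M) {(\<lambda>\<omega>. g (\<lambda>j. W j u \<omega> - W j c \<omega>)) -` A \<inter> space M |A. A \<in> sets borel})"
      by (simp add: V_def)
  qed
qed

section \<open>Moments of Brownian increments with adapted weights\<close>

lemma W_increment_moments:
  assumes c: "0 \<le> c" "c < u"
  shows "integrable M (\<lambda>\<omega>. W j u \<omega> - W j c \<omega>)"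
    and "(\<integral>\<omega>. W j u \<omega> - W j c \<omega> \<partial>M) = 0"
    and "integrable M (\<lambda>\<omega>. (W j u \<omega> - W j c \<omega>)\<^sup>2)"
    and "(\<integral>\<omega>. (W j u \<omega> - W j c \<omega>)\<^sup>2 \<partial>M) = u - c"
proof -
  have \<sigma>: "0 < sqrt (u - c)" using c by simp
  note D = W_normal[OF c, of j]
  show "integrable M (\<lambda>\<omega>. W j u \<omega> - W j c \<omega>)"
    using distributed_integrable[OF D, of "\<lambda>x. x"] integrable_normal_moment[OF \<sigma>, of 0 1] by simp
  show "(\<integral>\<omega>. W j u \<omega> - W j c \<omega> \<partial>M) = 0"
    using distributed_integral[OF D, of "\<lambda>x. x"] integral_normal_moment_odd[OF \<sigma>, of 0 0] by simp
  show "integrable M (\<lambda>\<omega>. (W j u \<omega> - W j c \<omega>)\<^sup>2)"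
    using distributed_integrable[OF D, of "\<lambda>x. x\<^sup>2"] integrable_normal_moment[OF \<sigma>, of 0 2] by simp
  show "(\<integral>\<omega>. (W j u \<omega> - W j c \<omega>)\<^sup>2 \<partial>M) = u - c"
    using distributed_integral[OF D, of "\<lambda>x. x\<^sup>2"] integral_normal_moment_even[OF \<sigma>, of 0 1] c
    by (simp add: fact_numeral)
qed

lemma W_increment_cross:
  assumes c: "0 \<le> c" "c < u" and ij: "i \<noteq> j"
  shows "integrable M (\<lambda>\<omega>. (W i u \<omega> - W i c \<omega>) * (W j u \<omega> - W j c \<omega>))"
    and "(\<integral>\<omega>. (W i u \<omega> - W i c \<omega>) * (W j u \<omega> - W j c \<omega>) \<partial>M) = 0"
proof -
  \<comment> \<open>A partition with the single step from \<open>c\<close> to \<open>u\<close>: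
    independence of the increments over it is independence of the components.\<close>
  define ts where "ts n = (if n = 0 then c else u)" for n :: nat
  have "indep_vars (\<lambda>_. borel) (\<lambda>(j, i) \<omega>. W j (ts (Suc i)) \<omega> - W j (ts i) \<omega>) (UNIV \<times> {..<1})"
    by (rule W_indep) (use c in \<open>auto simp: ts_def\<close>)
  from indep_var_restrict[OF this, of "{(i, 0)}" "{(j, 0)}"] ij
  have "indep_var borel ((\<lambda>x. x (i, 0)) \<circ> (\<lambda>\<omega>. restrict (\<lambda>k. (\<lambda>(j, i) \<omega>. W j (ts (Suc i)) \<omega> - W j (ts i) \<omega>) k \<omega>) {(i, 0)}))
     borel ((\<lambda>x. x (j, 0)) \<circ> (\<lambda>\<omega>. restrict (\<lambda>k. (\<lambda>(j, i) \<omega>. W j (ts (Suc i)) \<omega> - W j (ts i) \<omega>) k \<omega>) {(j, 0)}))"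
    by (intro indep_var_compose[where ?M1.0 = "PiM {(i, 0)} (\<lambda>_. borel)" and ?M2.0 = "PiM {(j, 0)} (\<lambda>_. borel)"])
       (auto intro!: measurable_component_singleton)
  then have ind: "indep_var borel (\<lambda>\<omega>. W i u \<omega> - W i c \<omega>) borel (\<lambda>\<omega>. W j u \<omega> - W j c \<omega>)"
    by (simp add: comp_def ts_def)
  show "integrable M (\<lambda>\<omega>. (W i u \<omega> - W i c \<omega>) * (W j u \<omega> - W j c \<omega>))"
    by (rule indep_var_integrable[OF ind W_increment_moments(1)[OF c] W_increment_moments(1)[OF c]])
  show "(\<integral>\<omega>. (W i u \<omega> - W i c \<omega>) * (W j u \<omega> - W j c \<omega>) \<partial>M) = 0"
    using indep_var_lebesgue_integral[OF ind W_increment_moments(1)[OF c] W_increment_moments(1)[OF c]]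
      W_increment_moments(2)[OF c] by simp
qed

text \<open>A weight known at time \<open>c\<close> is independent of the later increment, so the
  expectation factorises and the mean of the increment is 0. The degenerate case
  \<open>c = u\<close> is included because truncating a partition at a time produces empty
  increments.\<close>

lemma weighted_increment:
  assumes c: "0 \<le> c" "c \<le> u" and \<zeta>: "\<zeta> \<in> borel_measurable (Fs c)" "integrable M \<zeta>"
  shows "integrable M (\<lambda>\<omega>. \<zeta> \<omega> * (W j u \<omega> - W j c \<omega>))"
    and "(\<integral>\<omega>. \<zeta> \<omega> * (W j u \<omega> - W j c \<omega>) \<partial>M) = 0"
proof -
  consider "c = u" | "c < u" using c by linarith
  then have "integrable M (\<lambda>\<omega>. \<zeta> \<omega> * (W j u \<omega> - W j c \<omega>)) \<and> (\<integral>\<omega>. \<zeta> \<omega> * (W j u \<omega> - W j c \<omega>) \<partial>M) = 0"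
  proof cases
    case 2
    have ind: "indep_var borel \<zeta> borel (\<lambda>\<omega>. W j u \<omega> - W j c \<omega>)"
      using indep_increment[OF c(1) 2 \<zeta>(1), of "\<lambda>x. x j"] by (simp add: measurable_component_singleton)
    note m = W_increment_moments[OF c(1) 2, of j]
    show ?thesis
      using indep_var_integrable[OF ind \<zeta>(2) m(1)] indep_var_lebesgue_integral[OF ind \<zeta>(2) m(1)] m(2) by simp
  qed simp
  then show "integrable M (\<lambda>\<omega>. \<zeta> \<omega> * (W j u \<omega> - W j c \<omega>))"
    and "(\<integral>\<omega>. \<zeta> \<omega> * (W j u \<omega> - W j c \<omega>) \<partial>M) = 0" by auto
qed

text \<open>Here \<open>indep_increment\<close> is used with the product of two coordinates; the
  factor is the variance for equal components and vanishes for different ones.\<close>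

lemma weighted_increment_product:
  assumes c: "0 \<le> c" "c \<le> u" and \<zeta>: "\<zeta> \<in> borel_measurable (Fs c)" "integrable M \<zeta>"
  shows "integrable M (\<lambda>\<omega>. \<zeta> \<omega> * ((W i u \<omega> - W i c \<omega>) * (W j u \<omega> - W j c \<omega>)))"
    and "(\<integral>\<omega>. \<zeta> \<omega> * ((W i u \<omega> - W i c \<omega>) * (W j u \<omega> - W j c \<omega>)) \<partial>M) = (if i = j then (u - c) * (\<integral>\<omega>. \<zeta> \<omega> \<partial>M) else 0)"
proof -
  consider "c = u" | "c < u" using c by linarith
  then have "integrable M (\<lambda>\<omega>. \<zeta> \<omega> * ((W i u \<omega> - W i c \<omega>) * (W j u \<omega> - W j c \<omega>))) \<and>
    (\<integral>\<omega>. \<zeta> \<omega> * ((W i u \<omega> - W i c \<omega>) * (W j u \<omega> - W j c \<omega>)) \<partial>M) = (if i = j then (u - c) * (\<integral>\<omega>. \<zeta> \<omega> \<partial>M) else 0)"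
  proof cases
    case 2
    have "(\<lambda>x. x i * x j) \<in> borel_measurable (PiM UNIV (\<lambda>_::'d. borel :: real measure))"
      by (intro borel_measurable_times measurable_component_singleton) auto
    from indep_increment[OF c(1) 2 \<zeta>(1) this]
    have ind: "indep_var borel \<zeta> borel (\<lambda>\<omega>. (W i u \<omega> - W i c \<omega>) * (W j u \<omega> - W j c \<omega>))" .
    have m: "integrable M (\<lambda>\<omega>. (W i u \<omega> - W i c \<omega>) * (W j u \<omega> - W j c \<omega>))"
      "(\<integral>\<omega>. (W i u \<omega> - W i c \<omega>) * (W j u \<omega> - W j c \<omega>) \<partial>M) = (if i = j then u - c else 0)"
      using W_increment_cross[OF c(1) 2, of i j] W_increment_moments[OF c(1) 2, of j]
      by (auto simp: power2_eq_square)
    show ?thesis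
      using indep_var_integrable[OF ind \<zeta>(2) m(1)] indep_var_lebesgue_integral[OF ind \<zeta>(2) m(1)] m(2) by simp
  qed simp
  then show "integrable M (\<lambda>\<omega>. \<zeta> \<omega> * ((W i u \<omega> - W i c \<omega>) * (W j u \<omega> - W j c \<omega>)))"
    and "(\<integral>\<omega>. \<zeta> \<omega> * ((W i u \<omega> - W i c \<omega>) * (W j u \<omega> - W j c \<omega>)) \<partial>M) = (if i = j then (u - c) * (\<integral>\<omega>. \<zeta> \<omega> \<partial>M) else 0)"
    by auto
qed

end

section \<open>Elementary integrals and the Ito isometry\<close>

lemma integral_double_sum:
  fixes f :: "nat \<Rightarrow> nat \<Rightarrow> 'a \<Rightarrow> real"
  assumes "\<And>k l. k < m \<Longrightarrow> l < n \<Longrightarrow> integrable N (f k l)"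
  shows "(\<integral>x. (\<Sum>k<m. \<Sum>l<n. f k l x) \<partial>N) = (\<Sum>k<m. \<Sum>l<n. \<integral>x. f k l x \<partial>N)"
proof -
  have "(\<integral>x. (\<Sum>k<m. \<Sum>l<n. f k l x) \<partial>N) = (\<Sum>k<m. \<integral>x. (\<Sum>l<n. f k l x) \<partial>N)"
    by (rule Bochner_Integration.integral_sum, rule Bochner_Integration.integrable_sum) (use assms in simp)
  moreover have "k < m \<Longrightarrow> (\<integral>x. (\<Sum>l<n. f k l x) \<partial>N) = (\<Sum>l<n. \<integral>x. f k l x \<partial>N)" for k
    by (rule Bochner_Integration.integral_sum) (use assms in simp)
  ultimately show ?thesis by simp
qed

context brownian_motion
begin

text \<open>With \<open>u\<close> before \<open>v\<close>, the longer increment is split at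
  \<open>u\<close>. The piece after \<open>u\<close> is multiplied by something known at
  \<open>u\<close> and contributes nothing, so two increments over the same interval remain.\<close>

lemma increments_same_start:
  assumes c: "0 \<le> c" "c \<le> u" "c \<le> v" and \<zeta>: "\<zeta> \<in> borel_measurable (Fs c)" "integrable M \<zeta>"
  shows "integrable M (\<lambda>\<omega>. \<zeta> \<omega> * ((W i u \<omega> - W i c \<omega>) * (W j v \<omega> - W j c \<omega>))) \<and>
    (\<integral>\<omega>. \<zeta> \<omega> * ((W i u \<omega> - W i c \<omega>) * (W j v \<omega> - W j c \<omega>)) \<partial>M) = (if i = j then (min u v - c) * (\<integral>\<omega>. \<zeta> \<omega> \<partial>M) else 0)"
proof -
  have *: "integrable M (\<lambda>\<omega>. \<zeta> \<omega> * ((W i u \<omega> - W i c \<omega>) * (W j v \<omega> - W j c \<omega>))) \<and>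
    (\<integral>\<omega>. \<zeta> \<omega> * ((W i u \<omega> - W i c \<omega>) * (W j v \<omega> - W j c \<omega>)) \<partial>M) = (if i = j then (u - c) * (\<integral>\<omega>. \<zeta> \<omega> \<partial>M) else 0)"
    if uv: "c \<le> u" "u \<le> v" for u v i j
  proof -
    have "(\<lambda>\<omega>. \<zeta> \<omega> * (W i u \<omega> - W i c \<omega>)) \<in> borel_measurable (Fs u)"
      using c uv by (intro borel_measurable_times borel_measurable_diff W_measurable_Fs measurable_Fs_mono[OF \<zeta>(1)]) auto
    note w = weighted_increment[OF _ uv(2) this weighted_increment(1)[OF c(1) uv(1) \<zeta>], of j]
    note q = weighted_increment_product[OF c(1) uv(1) \<zeta>, of i j]
    have eq: "\<zeta> \<omega> * ((W i u \<omega> - W i c \<omega>) * (W j v \<omega> - W j c \<omega>)) =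
       \<zeta> \<omega> * (W i u \<omega> - W i c \<omega>) * (W j v \<omega> - W j u \<omega>) + \<zeta> \<omega> * ((W i u \<omega> - W i c \<omega>) * (W j u \<omega> - W j c \<omega>))" for \<omega>
      by (simp add: algebra_simps)
    show ?thesis unfolding eq using w q c uv by simp
  qed
  show ?thesis
  proof (cases "u \<le> v")
    case True then show ?thesis using *[OF c(2) True, of i j] by simp
  next
    case False
    have "(\<lambda>\<omega>. \<zeta> \<omega> * ((W i u \<omega> - W i c \<omega>) * (W j v \<omega> - W j c \<omega>)))
       = (\<lambda>\<omega>. \<zeta> \<omega> * ((W j v \<omega> - W j c \<omega>) * (W i u \<omega> - W i c \<omega>)))"
      by (simp add: mult.commute)
    moreover have "min u v = v" "v \<le> u" using False by auto
    ultimately show ?thesis using *[of v u j i] c(3) by (cases "i = j") simp_all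
  qed
qed

lemma elementary_sqi:
  fixes \<xi> :: "'w \<Rightarrow> 'a::euclidean_space"
  assumes a: "0 \<le> a" "a \<le> b" and \<xi>: "\<xi> \<in> borel_measurable (Fs a)" "sqi M \<xi>"
  shows "sqi M (\<lambda>\<omega>. (W i b \<omega> - W i a \<omega>) *\<^sub>R \<xi> \<omega>)"
proof -
  have "(\<lambda>\<omega>. (norm (\<xi> \<omega>))\<^sup>2) \<in> borel_measurable (Fs a)" using \<xi>(1) by measurable
  from weighted_increment_product(1)[OF a this sqi_norm2[OF \<xi>(2)], of i i]
  moreover have "(norm ((W i b \<omega> - W i a \<omega>) *\<^sub>R \<xi> \<omega>))\<^sup>2
      = (norm (\<xi> \<omega>))\<^sup>2 * ((W i b \<omega> - W i a \<omega>) * (W i b \<omega> - W i a \<omega>))" for \<omega>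
    by (simp add: power_mult_distrib power2_eq_square)
  ultimately have "integrable M (\<lambda>\<omega>. (norm ((W i b \<omega> - W i a \<omega>) *\<^sub>R \<xi> \<omega>))\<^sup>2)"
    by simp
  then show ?thesis using sqi_measurable[OF \<xi>(2)] by (simp add: sqi_def)
qed

text \<open>The factor is the length of the intersection of the two intervals. By symmetry the first
  interval may be taken to start first; its part before \<open>c\<close> is then known at
  \<open>c\<close> and acts as a weight of the second increment, which gives 0, and its part after
  \<open>c\<close> shares the starting point \<open>c\<close>.\<close>

lemma elementary_pairing:
  fixes \<xi> \<eta> :: "'w \<Rightarrow> 'a::euclidean_space"
  assumes a: "0 \<le> a" "a \<le> b" and c: "0 \<le> c" "c \<le> d"
    and \<xi>: "\<xi> \<in> borel_measurable (Fs a)" "sqi M \<xi>" and \<eta>: "\<eta> \<in> borel_measurable (Fs c)" "sqi M \<eta>"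
  shows "(\<integral>\<omega>. ((W i b \<omega> - W i a \<omega>) *\<^sub>R \<xi> \<omega>) \<bullet> ((W j d \<omega> - W j c \<omega>) *\<^sub>R \<eta> \<omega>) \<partial>M)
     = (if i = j then max 0 (min b d - max a c) * (\<integral>\<omega>. \<xi> \<omega> \<bullet> \<eta> \<omega> \<partial>M) else 0)"
proof -
  have *: "(\<integral>\<omega>. ((W i b \<omega> - W i a \<omega>) *\<^sub>R \<xi> \<omega>) \<bullet> ((W j d \<omega> - W j c \<omega>) *\<^sub>R \<eta> \<omega>) \<partial>M)
     = (if i = j then max 0 (min b d - c) * (\<integral>\<omega>. \<xi> \<omega> \<bullet> \<eta> \<omega> \<partial>M) else 0)"
    if a: "0 \<le> a" "a \<le> b" and c: "a \<le> c" "c \<le> d"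
    and \<xi>: "\<xi> \<in> borel_measurable (Fs a)" "sqi M \<xi>" and \<eta>: "\<eta> \<in> borel_measurable (Fs c)" "sqi M \<eta>"
    for a b c d i j and \<xi> \<eta> :: "'w \<Rightarrow> 'a"
  proof -
    \<comment> \<open>The splitting point of the first increment: \<open>e = b\<close> if the
      intervals do not overlap, in which case the remainder is empty, and \<open>e = c\<close>
      otherwise.\<close>
    define e where "e = min b c"
    have e: "a \<le> e" "e \<le> c" "e \<le> b" using a c by (auto simp: e_def)
    have c0: "0 \<le> c" using a c by simp
    define z1 where "z1 \<omega> = ((W i e \<omega> - W i a \<omega>) *\<^sub>R \<xi> \<omega>) \<bullet> \<eta> \<omega>" for \<omega>
    have z1m: "z1 \<in> borel_measurable (Fs c)"
      unfolding z1_def using a c e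
      by (intro borel_measurable_inner borel_measurable_scaleR borel_measurable_diff W_measurable_Fs \<eta> measurable_Fs_mono[OF \<xi>(1)]) auto
    have z1i: "integrable M z1"
      unfolding z1_def by (rule sqi_inner[OF elementary_sqi[OF a(1) e(1) \<xi>] \<eta>(2)])
    note w1 = weighted_increment[OF c0 c(2) z1m z1i, of j]
    define z2 where "z2 \<omega> = \<xi> \<omega> \<bullet> \<eta> \<omega>" for \<omega>
    have z2m: "z2 \<in> borel_measurable (Fs c)"
      unfolding z2_def using c by (intro borel_measurable_inner \<eta> measurable_Fs_mono[OF \<xi>(1)]) auto
    have z2i: "integrable M z2" unfolding z2_def by (rule sqi_inner[OF \<xi>(2) \<eta>(2)])
    have eq: "((W i b \<omega> - W i a \<omega>) *\<^sub>R \<xi> \<omega>) \<bullet> ((W j d \<omega> - W j c \<omega>) *\<^sub>R \<eta> \<omega>)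
       = z1 \<omega> * (W j d \<omega> - W j c \<omega>) + z2 \<omega> * ((W i b \<omega> - W i e \<omega>) * (W j d \<omega> - W j c \<omega>))" for \<omega>
      unfolding z1_def z2_def by (simp add: algebra_simps)
    show ?thesis
    proof (cases "b \<le> c")
      case True
      then have "e = b" by (simp add: e_def)
      then show ?thesis unfolding eq using w1 True by (simp add: max_def)
    next
      case False
      then have "e = c" by (simp add: e_def)
      with increments_same_start[OF c0 _ c(2) z2m z2i, of b i j] False
      show ?thesis unfolding eq using w1 c by (auto simp: z2_def[abs_def] max_def)
    qed
  qed
  show ?thesis
  proof (cases "a \<le> c")
    case True
    then show ?thesis using *[OF a True c(2) \<xi> \<eta>] by (simp add: max_def)
  next
    case False
    then have ca: "c \<le> a" "max a c = a" by auto
    show ?thesis unfolding ca(2) using *[OF c ca(1) a(2) \<eta> \<xi>, of j i]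
      unfolding inner_commute[of "\<eta> _"] inner_commute[of "_ *\<^sub>R \<eta> _"] min.commute[of d b] by (cases "i = j") simp_all
  qed
qed

section \<open>Time measure and its product with the probability measure\<close>

definition lam :: "real measure" where "lam = restrict_space lborel {0..T}"

text \<open>A process is viewed as one function on this product, so that the norm of
  \<open>L2F\<close> is an ordinary L2 norm and the isometry compares L2 over \<open>M\<close> with
  L2 over \<open>N\<close>.\<close>

definition N :: "(real \<times> 'w) measure" where "N = lam \<Otimes>\<^sub>M M"

lemma space_lam [simp]: "space lam = {0..T}"
  by (simp add: lam_def space_restrict_space)

lemma sets_lam: "sets lam = sets (restrict_space borel {0..T})"
  by (simp add: lam_def sets_restrict_space)

lemma measurable_lam: "f \<in> measurable borel S \<Longrightarrow> f \<in> measurable lam S"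
  unfolding lam_def by (rule measurable_restrict_space1) simp

lemma lam_finite: "finite_measure lam"
  by (rule finite_measureI) (use T in \<open>simp add: lam_def emeasure_restrict_space space_restrict_space\<close>)

sublocale lamM: pair_sigma_finite lam M
proof -
  interpret l: finite_measure lam by (rule lam_finite)
  show "pair_sigma_finite lam M" ..
qed

lemma N_finite: "finite_measure N"
proof -
  interpret l: finite_measure lam by (rule lam_finite)
  have "emeasure N (space N) = emeasure lam (space lam) * emeasure M (space M)"
    unfolding N_def space_pair_measure by (rule emeasure_pair_measure_Times[OF sets.top sets.top])
  then show ?thesis
    using l.emeasure_finite[of "space lam"] by (intro finite_measureI) (simp add: ennreal_mult_eq_top_iff)
qed

lemma nn_integral_N:
  "f \<in> borel_measurable N \<Longrightarrow> (\<integral>\<^sup>+z. f z \<partial>N) = (\<integral>\<^sup>+s. \<integral>\<^sup>+\<omega>. f (s, \<omega>) \<partial>M \<partial>lam)"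
  unfolding N_def by (rule nn_integral_fst[symmetric])

lemma nn_integral_N':
  "f \<in> borel_measurable N \<Longrightarrow> (\<integral>\<^sup>+z. f z \<partial>N) = (\<integral>\<^sup>+\<omega>. \<integral>\<^sup>+s. f (s, \<omega>) \<partial>lam \<partial>M)"
  unfolding N_def by (rule lamM.nn_integral_snd[symmetric])

lemma nn_integral_lam:
  "(\<integral>\<^sup>+s. f s \<partial>lam) = (\<integral>\<^sup>+s. indicator {0..T} s * f s \<partial>lborel)"
  unfolding lam_def by (subst nn_integral_restrict_space) (auto simp: mult.commute)

lemma integral_lam:
  fixes f :: "real \<Rightarrow> 'a::euclidean_space"
  shows "(\<integral>s. f s \<partial>lam) = (\<integral>s. indicator {0..T} s *\<^sub>R f s \<partial>lborel)"
  unfolding lam_def by (subst integral_restrict_space) auto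

lemma set_integral_lam:
  fixes f :: "real \<Rightarrow> 'a::euclidean_space"
  assumes "A \<subseteq> {0..T}"
  shows "set_lebesgue_integral lborel A f = (\<integral>s. indicator A s *\<^sub>R f s \<partial>lam)"
  unfolding integral_lam set_lebesgue_integral_def
  by (intro Bochner_Integration.integral_cong) (use assms in \<open>auto simp: indicator_def\<close>)

lemma measurable_fst_N [measurable]: "fst \<in> measurable N lam"
  and measurable_snd_N [measurable]: "snd \<in> measurable N M"
  unfolding N_def by simp_all

lemma measurable_fst_N_borel: "f \<in> measurable borel S \<Longrightarrow> (\<lambda>z. f (fst z)) \<in> measurable N S"
  by (rule measurable_compose[OF measurable_fst_N measurable_lam])

lemma sqi_snd:
  assumes "sqi M \<xi>"
  shows "sqi N (\<lambda>z. \<xi> (snd z))"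
proof -
  interpret l: finite_measure lam by (rule lam_finite)
  have m[measurable]: "\<xi> \<in> borel_measurable M" using assms by (simp add: sqi_def)
  have "(\<integral>\<^sup>+z. ennreal ((norm (\<xi> (snd z)))\<^sup>2) \<partial>N) = (\<integral>\<^sup>+s. \<integral>\<^sup>+\<omega>. ennreal ((norm (\<xi> \<omega>))\<^sup>2) \<partial>M \<partial>lam)"
    by (subst nn_integral_N) auto
  also have "\<dots> < \<infinity>"
  proof -
    have "(\<integral>\<^sup>+\<omega>. ennreal ((norm (\<xi> \<omega>))\<^sup>2) \<partial>M) * emeasure lam (space lam) \<noteq> top"
      using sqi_iff_nn_integral[OF m] assms l.emeasure_finite[of "space lam"]
      by (simp add: ennreal_mult_eq_top_iff)
    then show ?thesis by (simp add: less_top)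
  qed
  finally show ?thesis by (subst sqi_iff_nn_integral) auto
qed

lemma sqi_indicator:
  assumes "sqi N f" "A \<in> sets borel"
  shows "sqi N (\<lambda>z. indicator A (fst z) *\<^sub>R f z)"
proof (rule sqi_bound[OF assms(1), of _ 1])
  have "(\<lambda>z. indicator A (fst z) :: real) \<in> borel_measurable N"
    using assms(2) by (intro measurable_fst_N_borel) auto
  then show "(\<lambda>z. indicator A (fst z) *\<^sub>R f z) \<in> borel_measurable N"
    using assms(1) by (auto simp: sqi_def)
qed (auto simp: indicator_def)

lemma sqi_simple_proc:
  assumes "\<And>i. i < m \<Longrightarrow> sqi M (\<xi> i)"
  shows "sqi N (\<lambda>(s, \<omega>). simple_proc ts m \<xi> s \<omega>)"
  unfolding simple_proc_def case_prod_beta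
  by (intro sqi_sum sqi_indicator sqi_snd assms) auto

lemma adm_simpleD:
  assumes "adm_simple M (aug_filtration M W) T ts m \<xi>"
  shows "i \<le> m \<Longrightarrow> 0 \<le> ts i \<and> ts i \<le> T" and "i < m \<Longrightarrow> ts i < ts (Suc i)"
    and "i < m \<Longrightarrow> \<xi> i \<in> borel_measurable (Fs (ts i))" and "i < m \<Longrightarrow> sqi M (\<xi> i)"
proof -
  note ad = assms[unfolded adm_simple_def]
  have mono: "i \<le> k \<Longrightarrow> k \<le> m \<Longrightarrow> ts i \<le> ts k" for i k
  proof (induction k rule: dec_induct)
    case (step n)
    then show ?case using ad by (smt (verit) Suc_le_eq less_imp_le)
  qed simp
  show "i \<le> m \<Longrightarrow> 0 \<le> ts i \<and> ts i \<le> T" using mono[of 0 i] mono[of i m] ad by simp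
  show "i < m \<Longrightarrow> ts i < ts (Suc i)" using ad by simp
  show m: "i < m \<Longrightarrow> \<xi> i \<in> borel_measurable (Fs (ts i))" using ad by simp
  show "i < m \<Longrightarrow> sqi M (\<xi> i)"
    using ad measurable_Fs_M[OF m] by (simp add: sqi_iff_nn_integral)
qed

lemma simple_ito_term_sqi:
  assumes ad: "adm_simple M (aug_filtration M W) T ts m \<xi>" and i: "i < m" and t: "0 \<le> t"
  shows "sqi M (\<lambda>\<omega>. (W j (min (ts (Suc i)) t) \<omega> - W j (min (ts i) t) \<omega>) *\<^sub>R \<xi> i \<omega>)"
proof (cases "ts i \<le> t")
  case True
  show ?thesis
    using adm_simpleD[OF ad, of i] i True by (intro elementary_sqi) auto
next
  case False
  then have "min (ts (Suc i)) t = min (ts i) t" using adm_simpleD(2)[OF ad i] by simp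
  then show ?thesis by simp
qed

lemma simple_ito_sqi:
  assumes "adm_simple M (aug_filtration M W) T ts m \<xi>" "0 \<le> t"
  shows "sqi M (simple_ito W j ts m \<xi> t)"
  unfolding simple_ito_def using assms by (intro sqi_sum simple_ito_term_sqi) auto

lemma measure_lam_interval:
  "(\<integral>s. indicator {..r} s * (indicator {a..<b} s * indicator {c..<d} s) \<partial>lam) = max 0 (min (min b d) r - max a c)"
  if "0 \<le> a" "b \<le> T" "0 \<le> c" "d \<le> T" "r \<le> T" "0 \<le> r"
proof -
  have "(\<integral>s. indicat_real {..r} s * (indicator {a..<b} s * indicator {c..<d} s) \<partial>lam)
      = (\<integral>s. indicator ({max a c..min (min b d) r}) s \<partial>lborel)"
  proof (subst integral_lam, rule integral_cong_AE)
    \<comment> \<open>The product of indicators and the indicator of the closed interval can differ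
      at the right endpoint only.\<close>
    have "AE x in lborel. x \<noteq> min (min b d) r" by (rule AE_lborel_singleton)
    then show "AE s in lborel. indicator {0..T} s *\<^sub>R (indicator {..r} s * (indicator {a..<b} s * indicator {c..<d} s))
      = (indicator {max a c..min (min b d) r} s :: real)"
      by eventually_elim (use that in \<open>auto simp: indicator_def\<close>)
  qed auto
  also have "\<dots> = max 0 (min (min b d) r - max a c)"
    by (simp add: measure_def max_def)
  finally show ?thesis .
qed

lemma integral_N:
  fixes f :: "real \<times> 'w \<Rightarrow> 'a::euclidean_space"
  assumes "integrable N f"
  shows "(\<integral>z. f z \<partial>N) = (\<integral>s. \<integral>\<omega>. f (s, \<omega>) \<partial>M \<partial>lam)"
  using lamM.integral_fst'[OF assms[unfolded N_def]] by (simp add: N_def)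

text \<open>The pairing is computed term by term, so the two partitions need no common refinement.\<close>

lemma simple_pairing:
  fixes \<xi> \<xi>' :: "nat \<Rightarrow> 'w \<Rightarrow> 'a::euclidean_space"
  assumes ad: "adm_simple M (aug_filtration M W) T ts m \<xi>" and ad': "adm_simple M (aug_filtration M W) T ts' m' \<xi>'"
    and t: "t \<in> {0..T}" "t' \<in> {0..T}"
  shows "(\<integral>\<omega>. simple_ito W i ts m \<xi> t \<omega> \<bullet> simple_ito W j ts' m' \<xi>' t' \<omega> \<partial>M) =
    (if i = j then (\<integral>z. (indicator {..min t t'} (fst z) *\<^sub>R simple_proc ts m \<xi> (fst z) (snd z)) \<bullet> simple_proc ts' m' \<xi>' (fst z) (snd z) \<partial>N) else 0)"
proof -
  note D = adm_simpleD[OF ad] and D' = adm_simpleD[OF ad']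
  define e where "e k l = (\<integral>\<omega>. \<xi> k \<omega> \<bullet> \<xi>' l \<omega> \<partial>M)" for k l
  \<comment> \<open>The length of the overlap of cell \<open>k\<close> of the first partition with
    cell \<open>l\<close> of the second, both cut at the earlier of the two times.\<close>
  define L where "L k l = max 0 (min (min (ts (Suc k)) (ts' (Suc l))) (min t t') - max (ts k) (ts' l))" for k l
  define A where "A k \<omega> = (W i (min (ts (Suc k)) t) \<omega> - W i (min (ts k) t) \<omega>) *\<^sub>R \<xi> k \<omega>" for k \<omega>
  define A' where "A' l \<omega> = (W j (min (ts' (Suc l)) t') \<omega> - W j (min (ts' l) t') \<omega>) *\<^sub>R \<xi>' l \<omega>" for l \<omega>
  have sA: "k < m \<Longrightarrow> sqi M (A k)" "l < m' \<Longrightarrow> sqi M (A' l)" for k l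
    unfolding A_def A'_def using simple_ito_term_sqi[OF ad] simple_ito_term_sqi[OF ad'] t by auto
  have term1: "(\<integral>\<omega>. A k \<omega> \<bullet> A' l \<omega> \<partial>M) = (if i = j then L k l * e k l else 0)" if k: "k < m" and l: "l < m'" for k l
  proof (cases "ts k \<le> t \<and> ts' l \<le> t'")
    case True
    have tk: "0 \<le> ts k" "ts k \<le> min (ts (Suc k)) t" and tl: "0 \<le> ts' l" "ts' l \<le> min (ts' (Suc l)) t'"
      using True D(1)[of k] D(2)[OF k] D'(1)[of l] D'(2)[OF l] k l by auto
    have "min (ts k) t = ts k" "min (ts' l) t' = ts' l" using True by auto
    then have "(\<integral>\<omega>. A k \<omega> \<bullet> A' l \<omega> \<partial>M) = (if i = j then
        max 0 (min (min (ts (Suc k)) t) (min (ts' (Suc l)) t') - max (ts k) (ts' l)) * e k l else 0)"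
      using elementary_pairing[OF tk tl D(3-4)[OF k] D'(3-4)[OF l], of i j] unfolding A_def A'_def e_def by simp
    then show ?thesis by (simp add: L_def min.assoc min.left_commute)
  next
    case False
    \<comment> \<open>A cell that starts after its own cut-off time contributes an empty increment;
      it also starts after \<open>min t t'\<close>, so the overlap \<open>L k l\<close> vanishes as
      well.\<close>
    then have "A k = (\<lambda>_. 0) \<or> A' l = (\<lambda>_. 0)"
      using D(2)[OF k] D'(2)[OF l] unfolding A_def A'_def by (auto simp: fun_eq_iff min_def)
    moreover have "L k l = 0" using False by (auto simp: L_def)
    ultimately show ?thesis by auto
  qed
  have lhs: "(\<integral>\<omega>. simple_ito W i ts m \<xi> t \<omega> \<bullet> simple_ito W j ts' m' \<xi>' t' \<omega> \<partial>M) = (\<Sum>k<m. \<Sum>l<m'. if i = j then L k l * e k l else 0)"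
  proof -
    have "(\<integral>\<omega>. simple_ito W i ts m \<xi> t \<omega> \<bullet> simple_ito W j ts' m' \<xi>' t' \<omega> \<partial>M) = (\<integral>\<omega>. (\<Sum>k<m. \<Sum>l<m'. A k \<omega> \<bullet> A' l \<omega>) \<partial>M)"
    proof -
      have "simple_ito W i ts m \<xi> t \<omega> = (\<Sum>k<m. A k \<omega>)" "simple_ito W j ts' m' \<xi>' t' \<omega> = (\<Sum>l<m'. A' l \<omega>)" for \<omega>
        by (simp_all add: simple_ito_def A_def A'_def)
      then show ?thesis by (simp only: inner_sum_left) (simp only: inner_sum_right)
    qed
    also have "\<dots> = (\<Sum>k<m. \<Sum>l<m'. \<integral>\<omega>. A k \<omega> \<bullet> A' l \<omega> \<partial>M)"
      by (rule integral_double_sum, rule sqi_inner[OF sA])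
    finally show ?thesis using term1 by simp
  qed
  define P where "P k z = indicator {..min t t'} (fst z) *\<^sub>R indicator {ts k..<ts (Suc k)} (fst z) *\<^sub>R \<xi> k (snd z)" for k and z :: "real \<times> 'w"
  define P' where "P' l z = indicator {ts' l..<ts' (Suc l)} (fst z) *\<^sub>R \<xi>' l (snd z)" for l and z :: "real \<times> 'w"
  have sP: "k < m \<Longrightarrow> sqi N (P k)" "l < m' \<Longrightarrow> sqi N (P' l)" for k l
    unfolding P_def P'_def by (intro sqi_indicator sqi_snd D(4) D'(4); simp)+
  have term2: "(\<integral>z. P k z \<bullet> P' l z \<partial>N) = L k l * e k l" if k: "k < m" and l: "l < m'" for k l
  proof -
    have "(\<integral>z. P k z \<bullet> P' l z \<partial>N) = (\<integral>s. \<integral>\<omega>. P k (s, \<omega>) \<bullet> P' l (s, \<omega>) \<partial>M \<partial>lam)"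
      by (rule integral_N[OF sqi_inner[OF sP(1)[OF k] sP(2)[OF l]]])
    also have "\<dots> = (\<integral>s. indicator {..min t t'} s * (indicator {ts k..<ts (Suc k)} s * indicator {ts' l..<ts' (Suc l)} s) * e k l \<partial>lam)"
      unfolding P_def P'_def e_def by (simp add: mult_ac)
    also have "\<dots> = L k l * e k l"
      using D(1)[of k] D(1)[of "Suc k"] D'(1)[of l] D'(1)[of "Suc l"] k l t
      by (subst integral_mult_left_zero, subst measure_lam_interval) (auto simp: L_def)
    finally show ?thesis .
  qed
  have rhs: "(\<integral>z. (indicator {..min t t'} (fst z) *\<^sub>R simple_proc ts m \<xi> (fst z) (snd z)) \<bullet> simple_proc ts' m' \<xi>' (fst z) (snd z) \<partial>N)
     = (\<Sum>k<m. \<Sum>l<m'. L k l * e k l)"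
  proof -
    have 1: "(\<integral>z. (indicator {..min t t'} (fst z) *\<^sub>R simple_proc ts m \<xi> (fst z) (snd z)) \<bullet> simple_proc ts' m' \<xi>' (fst z) (snd z) \<partial>N)
       = (\<integral>z. (\<Sum>k<m. \<Sum>l<m'. P k z \<bullet> P' l z) \<partial>N)"
    proof -
      have "indicator {..min t t'} (fst z) *\<^sub>R simple_proc ts m \<xi> (fst z) (snd z) = (\<Sum>k<m. P k z)"
         "simple_proc ts' m' \<xi>' (fst z) (snd z) = (\<Sum>l<m'. P' l z)" for z
        unfolding simple_proc_def P_def P'_def scaleR_sum_right by (rule refl)+
      then show ?thesis by (simp only: inner_sum_left) (simp only: inner_sum_right)
    qed
    have 2: "(\<integral>z. (\<Sum>k<m. \<Sum>l<m'. P k z \<bullet> P' l z) \<partial>N) = (\<Sum>k<m. \<Sum>l<m'. \<integral>z. P k z \<bullet> P' l z \<partial>N)"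
      by (rule integral_double_sum, rule sqi_inner[OF sP])
    have 3: "(\<Sum>k<m. \<Sum>l<m'. \<integral>z. P k z \<bullet> P' l z \<partial>N) = (\<Sum>k<m. \<Sum>l<m'. L k l * e k l)"
      by (intro sum.cong refl term2) auto
    show ?thesis by (rule trans[OF 1 trans[OF 2 3]])
  qed
  show ?thesis
  proof (cases "i = j")
    case True
    have "(\<Sum>k<m. \<Sum>l<m'. if i = j then L k l * e k l else 0) = (\<Sum>k<m. \<Sum>l<m'. L k l * e k l)"
      using True by simp
    from trans[OF lhs trans[OF this rhs[symmetric]]] show ?thesis unfolding if_P[OF True] .
  next
    case False
    have "(\<Sum>k<m. \<Sum>l<m'. if i = j then L k l * e k l else 0) = 0"
      using False by simp
    from trans[OF lhs this] show ?thesis unfolding if_not_P[OF False] .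
  qed
qed

lemma nn_integral_process:
  assumes "(\<lambda>(s, \<omega>). f s \<omega>) \<in> borel_measurable N"
  shows "(\<integral>\<^sup>+\<omega>. (\<integral>\<^sup>+s. indicator {0..T} s * ennreal ((norm (f s \<omega>))\<^sup>2) \<partial>lborel) \<partial>M)
     = (\<integral>\<^sup>+z. ennreal ((norm (f (fst z) (snd z) :: 'a::euclidean_space))\<^sup>2) \<partial>N)"
proof -
  have "(\<lambda>z. f (fst z) (snd z)) \<in> borel_measurable N" using assms by (simp add: case_prod_beta')
  then have "(\<lambda>z. ennreal ((norm (f (fst z) (snd z)))\<^sup>2)) \<in> borel_measurable N" by measurable
  from nn_integral_N'[OF this] show ?thesis by (simp add: nn_integral_lam)
qed

text \<open>Unpacks the definition once into the form that \<open>sqi_inner_limit\<close> consumes.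
  The same sequence of simple processes approximates the integrand over \<open>N\<close> and the
  integral at every time over \<open>M\<close>, which is what lets both sides of a pairing identity
  converge together.\<close>

lemma is_itoE:
  fixes H :: "real \<Rightarrow> 'w \<Rightarrow> 'a::euclidean_space"
  assumes ito: "is_ito M (aug_filtration M W) W j T H I"
    and H: "sqi N (\<lambda>z. H (fst z) (snd z))"
  obtains ts m \<xi> where "\<And>k. adm_simple M (aug_filtration M W) T (ts k) (m k) (\<xi> k)"
    and "\<And>k. sqi N (\<lambda>z. simple_proc (ts k) (m k) (\<xi> k) (fst z) (snd z))"
    and "(\<lambda>k. \<integral>z. (norm (H (fst z) (snd z) - simple_proc (ts k) (m k) (\<xi> k) (fst z) (snd z)))\<^sup>2 \<partial>N) \<longlonglongrightarrow> 0"
    and "\<And>t. t \<in> {0..T} \<Longrightarrow> sqi M (I t)"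
    and "\<And>t. t \<in> {0..T} \<Longrightarrow> (\<lambda>k. \<integral>\<omega>. (norm (I t \<omega> - simple_ito W j (ts k) (m k) (\<xi> k) t \<omega>))\<^sup>2 \<partial>M) \<longlonglongrightarrow> 0"
proof -
  obtain ts m \<xi> where ad: "\<And>k. adm_simple M (aug_filtration M W) T (ts k) (m k) (\<xi> k)"
    and l1: "(\<lambda>k. \<integral>\<^sup>+\<omega>. (\<integral>\<^sup>+s. indicator {0..T} s *
              ennreal ((norm (H s \<omega> - simple_proc (ts k) (m k) (\<xi> k) s \<omega>))\<^sup>2) \<partial>lborel) \<partial>M) \<longlonglongrightarrow> 0"
    and l2: "\<And>t. t \<in> {0..T} \<Longrightarrow> (\<lambda>k. \<integral>\<^sup>+\<omega>. ennreal ((norm (I t \<omega> - simple_ito W j (ts k) (m k) (\<xi> k) t \<omega>))\<^sup>2) \<partial>M) \<longlonglongrightarrow> 0"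
    and Im: "\<And>t. t \<in> {0..T} \<Longrightarrow> I t \<in> borel_measurable M"
    using ito unfolding is_ito_def by blast
  have sp: "sqi N (\<lambda>z. simple_proc (ts k) (m k) (\<xi> k) (fst z) (snd z))" for k
    using sqi_simple_proc[OF adm_simpleD(4)[OF ad[of k]]] by (simp add: case_prod_beta')
  note spm = sqi_measurable[OF sp] and Hm = sqi_measurable[OF H]
  have "(\<lambda>(s, \<omega>). H s \<omega> - simple_proc (ts k) (m k) (\<xi> k) s \<omega>) \<in> borel_measurable N" for k
    using spm[of k] Hm by (simp add: case_prod_beta')
  from l1[unfolded nn_integral_process[OF this]]
  have 1: "(\<lambda>k. \<integral>z. (norm (H (fst z) (snd z) - simple_proc (ts k) (m k) (\<xi> k) (fst z) (snd z)))\<^sup>2 \<partial>N) \<longlonglongrightarrow> 0"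
    by (rule sqi_limit_real[OF _ Hm spm])
  have si: "t \<in> {0..T} \<Longrightarrow> sqi M (simple_ito W j (ts k) (m k) (\<xi> k) t)" for k t
    using simple_ito_sqi[OF ad] by simp
  have 2: "t \<in> {0..T} \<Longrightarrow> sqi M (I t)" for t
    by (rule sqi_of_limit[OF l2 Im si])
  have 3: "t \<in> {0..T} \<Longrightarrow> (\<lambda>k. \<integral>\<omega>. (norm (I t \<omega> - simple_ito W j (ts k) (m k) (\<xi> k) t \<omega>))\<^sup>2 \<partial>M) \<longlonglongrightarrow> 0" for t
    by (rule sqi_limit_real[OF l2 Im sqi_measurable[OF si]])
  show thesis by (rule that[OF ad sp 1 2 3])
qed

lemma ito_sqi:
  fixes H :: "real \<Rightarrow> 'w \<Rightarrow> 'a::euclidean_space"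
  assumes "is_ito M (aug_filtration M W) W j T H I" "sqi N (\<lambda>z. H (fst z) (snd z))" "t \<in> {0..T}"
  shows "sqi M (I t)"
  by (rule is_itoE[OF assms(1,2)]) (use assms(3) in blast)

lemma indicator_sq_limit:
  fixes f :: "real \<times> 'w \<Rightarrow> 'a::euclidean_space"
  assumes f: "sqi N f" and fk: "\<And>k. sqi N (fk k)" and lim: "(\<lambda>k. \<integral>z. (norm (f z - fk k z))\<^sup>2 \<partial>N) \<longlonglongrightarrow> 0"
    and A: "A \<in> sets borel"
  shows "(\<lambda>k. \<integral>z. (norm (indicator A (fst z) *\<^sub>R f z - indicator A (fst z) *\<^sub>R fk k z))\<^sup>2 \<partial>N) \<longlonglongrightarrow> 0"
proof (rule tendsto_sandwich[OF _ _ tendsto_const lim])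
  show "\<forall>\<^sub>F k in sequentially. (\<integral>z. (norm (indicator A (fst z) *\<^sub>R f z - indicator A (fst z) *\<^sub>R fk k z))\<^sup>2 \<partial>N)
     \<le> (\<integral>z. (norm (f z - fk k z))\<^sup>2 \<partial>N)"
  proof (intro always_eventually allI integral_mono)
    fix k
    show "integrable N (\<lambda>z. (norm (indicator A (fst z) *\<^sub>R f z - indicator A (fst z) *\<^sub>R fk k z))\<^sup>2)"
      by (rule sqi_norm2[OF sqi_diff[OF sqi_indicator[OF f A] sqi_indicator[OF fk A]]])
    show "integrable N (\<lambda>z. (norm (f z - fk k z))\<^sup>2)"
      by (rule sqi_norm2[OF sqi_diff[OF f fk]])
  qed (auto simp: indicator_def)
qed auto

text \<open>The polarised Ito isometry, for two times and two components at once. Both sides of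
  \<open>simple_pairing\<close> converge: expectations to the left side, integrals over
  \<open>N\<close> to the right side, since cutting at a time does not increase the L2
  distance.\<close>

lemma ito_pairing:
  fixes H H' :: "real \<Rightarrow> 'w \<Rightarrow> 'a::euclidean_space"
  assumes ito: "is_ito M (aug_filtration M W) W i T H I" and H: "sqi N (\<lambda>z. H (fst z) (snd z))"
    and ito': "is_ito M (aug_filtration M W) W j T H' I'" and H': "sqi N (\<lambda>z. H' (fst z) (snd z))"
    and t: "t \<in> {0..T}" "t' \<in> {0..T}"
  shows "(\<integral>\<omega>. I t \<omega> \<bullet> I' t' \<omega> \<partial>M) =
    (if i = j then (\<integral>z. (indicator {..min t t'} (fst z) *\<^sub>R H (fst z) (snd z)) \<bullet> H' (fst z) (snd z) \<partial>N) else 0)"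
proof -
  obtain ts m \<xi> where ad: "\<And>k. adm_simple M (aug_filtration M W) T (ts k) (m k) (\<xi> k)"
    and sp: "\<And>k. sqi N (\<lambda>z. simple_proc (ts k) (m k) (\<xi> k) (fst z) (snd z))"
    and l1: "(\<lambda>k. \<integral>z. (norm (H (fst z) (snd z) - simple_proc (ts k) (m k) (\<xi> k) (fst z) (snd z)))\<^sup>2 \<partial>N) \<longlonglongrightarrow> 0"
    and sI: "\<And>t. t \<in> {0..T} \<Longrightarrow> sqi M (I t)"
    and l2: "\<And>t. t \<in> {0..T} \<Longrightarrow> (\<lambda>k. \<integral>\<omega>. (norm (I t \<omega> - simple_ito W i (ts k) (m k) (\<xi> k) t \<omega>))\<^sup>2 \<partial>M) \<longlonglongrightarrow> 0"
    by (rule is_itoE[OF ito H]) blast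
  obtain ts' m' \<xi>' where ad': "\<And>k. adm_simple M (aug_filtration M W) T (ts' k) (m' k) (\<xi>' k)"
    and sp': "\<And>k. sqi N (\<lambda>z. simple_proc (ts' k) (m' k) (\<xi>' k) (fst z) (snd z))"
    and l1': "(\<lambda>k. \<integral>z. (norm (H' (fst z) (snd z) - simple_proc (ts' k) (m' k) (\<xi>' k) (fst z) (snd z)))\<^sup>2 \<partial>N) \<longlonglongrightarrow> 0"
    and sI': "\<And>t. t \<in> {0..T} \<Longrightarrow> sqi M (I' t)"
    and l2': "\<And>t. t \<in> {0..T} \<Longrightarrow> (\<lambda>k. \<integral>\<omega>. (norm (I' t \<omega> - simple_ito W j (ts' k) (m' k) (\<xi>' k) t \<omega>))\<^sup>2 \<partial>M) \<longlonglongrightarrow> 0"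
    by (rule is_itoE[OF ito' H']) blast
  have si: "sqi M (simple_ito W i (ts k) (m k) (\<xi> k) t)" "sqi M (simple_ito W j (ts' k) (m' k) (\<xi>' k) t')" for k
    using simple_ito_sqi[OF ad] simple_ito_sqi[OF ad'] t by auto
  have L: "(\<lambda>k. \<integral>\<omega>. simple_ito W i (ts k) (m k) (\<xi> k) t \<omega> \<bullet> simple_ito W j (ts' k) (m' k) (\<xi>' k) t' \<omega> \<partial>M)
     \<longlonglongrightarrow> (\<integral>\<omega>. I t \<omega> \<bullet> I' t' \<omega> \<partial>M)"
    by (rule sqi_inner_limit[OF sI[OF t(1)] sI'[OF t(2)] si l2[OF t(1)] l2'[OF t(2)]])
  have A: "{..min t t'} \<in> sets borel" by simp
  have R: "(\<lambda>k. \<integral>z. (indicator {..min t t'} (fst z) *\<^sub>R simple_proc (ts k) (m k) (\<xi> k) (fst z) (snd z))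
        \<bullet> simple_proc (ts' k) (m' k) (\<xi>' k) (fst z) (snd z) \<partial>N)
     \<longlonglongrightarrow> (\<integral>z. (indicator {..min t t'} (fst z) *\<^sub>R H (fst z) (snd z)) \<bullet> H' (fst z) (snd z) \<partial>N)"
    by (rule sqi_inner_limit[OF sqi_indicator[OF H A] H' sqi_indicator[OF sp A] sp' indicator_sq_limit[OF H sp l1 A] l1'])
  show ?thesis
  proof (cases "i = j")
    case True
    from L[unfolded simple_pairing[OF ad ad' t] if_P[OF True]] R
    show ?thesis unfolding if_P[OF True] by (rule LIMSEQ_unique)
  next
    case False
    from L[unfolded simple_pairing[OF ad ad' t] if_not_P[OF False]] tendsto_const
    show ?thesis unfolding if_not_P[OF False] by (rule LIMSEQ_unique)
  qed
qed

text \<open>The martingale property in weak form. Cell by cell, the change between \<open>s\<close>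
  and \<open>t\<close> is a later Brownian increment weighted by the inner product of
  \<open>\<xi> k\<close> and \<open>\<eta>\<close>, which is known when that increment
  begins.\<close>

lemma simple_martingale:
  fixes \<xi> :: "nat \<Rightarrow> 'w \<Rightarrow> 'a::euclidean_space"
  assumes ad: "adm_simple M (aug_filtration M W) T ts m \<xi>" and st: "0 \<le> s" "s \<le> t"
    and \<eta>: "\<eta> \<in> borel_measurable (Fs s)" "sqi M \<eta>"
  shows "(\<integral>\<omega>. simple_ito W j ts m \<xi> t \<omega> \<bullet> \<eta> \<omega> \<partial>M) = (\<integral>\<omega>. simple_ito W j ts m \<xi> s \<omega> \<bullet> \<eta> \<omega> \<partial>M)"
proof -
  note D = adm_simpleD[OF ad]
  define A where "A r k \<omega> = (W j (min (ts (Suc k)) r) \<omega> - W j (min (ts k) r) \<omega>) *\<^sub>R \<xi> k \<omega>" for r k \<omega>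
  have sA: "k < m \<Longrightarrow> 0 \<le> r \<Longrightarrow> sqi M (A r k)" for k r
    unfolding A_def by (rule simple_ito_term_sqi[OF ad])
  have iA: "k < m \<Longrightarrow> 0 \<le> r \<Longrightarrow> integrable M (\<lambda>\<omega>. A r k \<omega> \<bullet> \<eta> \<omega>)" for k r
    by (rule sqi_inner[OF sA \<eta>(2)])
  have eq: "(\<integral>\<omega>. simple_ito W j ts m \<xi> r \<omega> \<bullet> \<eta> \<omega> \<partial>M) = (\<Sum>k<m. \<integral>\<omega>. A r k \<omega> \<bullet> \<eta> \<omega> \<partial>M)" if "0 \<le> r" for r
  proof -
    have "simple_ito W j ts m \<xi> r \<omega> \<bullet> \<eta> \<omega> = (\<Sum>k<m. A r k \<omega> \<bullet> \<eta> \<omega>)" for \<omega>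
      unfolding simple_ito_def A_def inner_sum_left ..
    then show ?thesis by (simp only:) (rule Bochner_Integration.integral_sum, rule iA, use that in auto)
  qed
  have "(\<integral>\<omega>. A t k \<omega> \<bullet> \<eta> \<omega> \<partial>M) = (\<integral>\<omega>. A s k \<omega> \<bullet> \<eta> \<omega> \<partial>M)" if k: "k < m" for k
  proof -
    define \<zeta> where "\<zeta> \<omega> = \<xi> k \<omega> \<bullet> \<eta> \<omega>" for \<omega>
    have \<zeta>i: "integrable M \<zeta>" unfolding \<zeta>_def by (rule sqi_inner[OF D(4)[OF k] \<eta>(2)])
    have \<zeta>m: "\<zeta> \<in> borel_measurable (Fs r)" if "s \<le> r" "ts k \<le> r" for r
      unfolding \<zeta>_def by (intro borel_measurable_inner measurable_Fs_mono[OF \<eta>(1)] measurable_Fs_mono[OF D(3)[OF k]] that)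
    \<comment> \<open>The part of cell \<open>k\<close> that lies between \<open>s\<close> and
      \<open>t\<close>; the two ends coincide when there is no such part.\<close>
    define c d where "c = max s (min (ts k) t)" and "d = max s (min (ts (Suc k)) t)"
    have cd: "0 \<le> c" "c \<le> d" using st D(2)[OF k] by (auto simp: c_def d_def)
    have diff: "A t k \<omega> \<bullet> \<eta> \<omega> - A s k \<omega> \<bullet> \<eta> \<omega> = \<zeta> \<omega> * (W j d \<omega> - W j c \<omega>)" for \<omega>
    proof -
      have "W j (min r t) \<omega> - W j (min r s) \<omega> = W j (max s (min r t)) \<omega> - W j s \<omega>" for r
        using st by (cases "r \<le> s") (auto simp: min_def max_def)
      from this[of "ts k"] this[of "ts (Suc k)"]
      have e: "(W j (min (ts (Suc k)) t) \<omega> - W j (min (ts k) t) \<omega>) - (W j (min (ts (Suc k)) s) \<omega> - W j (min (ts k) s) \<omega>)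
         = W j d \<omega> - W j c \<omega>"
        unfolding c_def d_def by linarith
      show ?thesis
        unfolding A_def \<zeta>_def inner_scaleR_left left_diff_distrib[symmetric] e by (rule mult.commute)
    qed
    have "(\<integral>\<omega>. \<zeta> \<omega> * (W j d \<omega> - W j c \<omega>) \<partial>M) = 0"
    \<comment> \<open>If the cell has not started by \<open>c\<close>, it starts after
      \<open>t\<close>; both ends are then clamped to \<open>t\<close> and the increment is
      empty.\<close>
    proof (cases "ts k \<le> c")
      case True
      have "\<zeta> \<in> borel_measurable (Fs c)" by (rule \<zeta>m) (use True in \<open>auto simp: c_def\<close>)
      from weighted_increment(2)[OF cd this \<zeta>i] show ?thesis .
    next
      case False
      then have "c = d" using D(2)[OF k] by (auto simp: c_def d_def)
      then show ?thesis by simp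
    qed
    then have "(\<integral>\<omega>. A t k \<omega> \<bullet> \<eta> \<omega> - A s k \<omega> \<bullet> \<eta> \<omega> \<partial>M) = 0" unfolding diff .
    then show ?thesis using iA[OF k, of t] iA[OF k, of s] st by simp
  qed
  then show ?thesis using eq[of t] eq[of s] st by simp
qed

lemma ito_martingale:
  fixes H :: "real \<Rightarrow> 'w \<Rightarrow> 'a::euclidean_space"
  assumes ito: "is_ito M (aug_filtration M W) W j T H I" and H: "sqi N (\<lambda>z. H (fst z) (snd z))"
    and st: "0 \<le> s" "s \<le> t" "t \<le> T"
    and \<eta>: "\<eta> \<in> borel_measurable (Fs s)" "sqi M \<eta>"
  shows "(\<integral>\<omega>. I t \<omega> \<bullet> \<eta> \<omega> \<partial>M) = (\<integral>\<omega>. I s \<omega> \<bullet> \<eta> \<omega> \<partial>M)"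
proof -
  obtain ts m \<xi> where ad: "\<And>k. adm_simple M (aug_filtration M W) T (ts k) (m k) (\<xi> k)"
    and sI: "\<And>t. t \<in> {0..T} \<Longrightarrow> sqi M (I t)"
    and l2: "\<And>t. t \<in> {0..T} \<Longrightarrow> (\<lambda>k. \<integral>\<omega>. (norm (I t \<omega> - simple_ito W j (ts k) (m k) (\<xi> k) t \<omega>))\<^sup>2 \<partial>M) \<longlonglongrightarrow> 0"
    by (rule is_itoE[OF ito H]) blast
  have L: "(\<lambda>k. \<integral>\<omega>. simple_ito W j (ts k) (m k) (\<xi> k) r \<omega> \<bullet> \<eta> \<omega> \<partial>M) \<longlonglongrightarrow> (\<integral>\<omega>. I r \<omega> \<bullet> \<eta> \<omega> \<partial>M)" if r: "r \<in> {0..T}" for r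
    by (rule sqi_inner_limit[OF sI[OF r] \<eta>(2) simple_ito_sqi[OF ad] \<eta>(2) l2[OF r]]) (use r in auto)
  have "t \<in> {0..T}" "s \<in> {0..T}" using st by auto
  from L[OF this(1), unfolded simple_martingale[OF ad st(1,2) \<eta>]] L[OF this(2)] show ?thesis by (rule LIMSEQ_unique)
qed

end

section \<open>Block averages\<close>

text \<open>Cauchy-Schwarz of the integrand against the indicator of \<open>P\<close>. It is used
  with a sliding window in time, with an initial piece of the time interval, and with
  \<open>P\<close> always true as Jensen's inequality.\<close>

lemma norm_integral_power2_le:
  fixes h :: "'a \<Rightarrow> 'b::euclidean_space"
  assumes [measurable]: "h \<in> borel_measurable L" "Measurable.pred L P"
  shows "ennreal ((norm (\<integral>x. (if P x then h x else 0) \<partial>L))\<^sup>2)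
     \<le> emeasure L {x\<in>space L. P x} * (\<integral>\<^sup>+x. (if P x then ennreal ((norm (h x))\<^sup>2) else 0) \<partial>L)"
proof -
  define i where "i x = (if P x then 1 else 0 :: ennreal)" for x
  have [measurable]: "i \<in> borel_measurable L" unfolding i_def by measurable
  have "ennreal (norm (\<integral>x. (if P x then h x else 0) \<partial>L)) \<le> (\<integral>\<^sup>+x. i x * (i x * ennreal (norm (h x))) \<partial>L)"
  proof (cases "integrable L (\<lambda>x. if P x then h x else 0)")
    case True
    have "ennreal (norm (\<integral>x. (if P x then h x else 0) \<partial>L)) \<le> (\<integral>\<^sup>+x. ennreal (norm (if P x then h x else 0)) \<partial>L)"
      by (rule integral_norm_bound_ennreal[OF True])
    also have "\<dots> = (\<integral>\<^sup>+x. i x * (i x * ennreal (norm (h x))) \<partial>L)"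
      by (intro nn_integral_cong) (auto simp: i_def)
    finally show ?thesis .
  \<comment> \<open>Without integrability the Bochner integral is 0 by convention, and the bound is
    trivial.\<close>
  qed (simp add: not_integrable_integral_eq)
  then have "(ennreal (norm (\<integral>x. (if P x then h x else 0) \<partial>L)))\<^sup>2 \<le> (\<integral>\<^sup>+x. i x * (i x * ennreal (norm (h x))) \<partial>L)\<^sup>2"
    by (intro power_mono) auto
  also have "\<dots> \<le> (\<integral>\<^sup>+x. (i x)\<^sup>2 \<partial>L) * (\<integral>\<^sup>+x. (i x * ennreal (norm (h x)))\<^sup>2 \<partial>L)"
    by (rule Cauchy_Schwarz_nn_integral) measurable
  also have "(\<integral>\<^sup>+x. (i x)\<^sup>2 \<partial>L) = (\<integral>\<^sup>+x. indicator {x\<in>space L. P x} x \<partial>L)"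
    by (intro nn_integral_cong) (auto simp: i_def indicator_def)
  also have "\<dots> = emeasure L {x\<in>space L. P x}" by (rule nn_integral_indicator) measurable
  also have "(\<integral>\<^sup>+x. (i x * ennreal (norm (h x)))\<^sup>2 \<partial>L) = (\<integral>\<^sup>+x. (if P x then ennreal ((norm (h x))\<^sup>2) else 0) \<partial>L)"
    by (intro nn_integral_cong) (auto simp: i_def ennreal_power)
  finally show ?thesis by (simp add: ennreal_power)
qed

context brownian_motion
begin

definition grid_floor :: "real \<Rightarrow> real \<Rightarrow> real" where "grid_floor \<delta> s = \<delta> * of_int \<lfloor>s / \<delta>\<rfloor>"

text \<open>On a block of length \<open>\<delta>\<close> the value is the mean of \<open>h\<close> over the preceding block, which keeps
  the approximation adapted; \<open>h\<close> counts as 0 outside the time interval.\<close>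

definition avg :: "real \<Rightarrow> (real \<Rightarrow> 'a::euclidean_space) \<Rightarrow> real \<Rightarrow> 'a" where
  "avg \<delta> h s = (1 / \<delta>) *\<^sub>R (\<integral>r. (if grid_floor \<delta> s - \<delta> \<le> r \<and> r \<le> grid_floor \<delta> s then h r else 0) \<partial>lam)"

lemma grid_floor_bounds: "0 < \<delta> \<Longrightarrow> grid_floor \<delta> s \<le> s \<and> s < grid_floor \<delta> s + \<delta>"
proof -
  assume d: "0 < \<delta>"
  have "of_int \<lfloor>s / \<delta>\<rfloor> \<le> s / \<delta>" "s / \<delta> < of_int \<lfloor>s / \<delta>\<rfloor> + 1" by linarith+
  from mult_left_mono[OF this(1) less_imp_le[OF d]] mult_strict_left_mono[OF this(2) d]
  show ?thesis using d by (simp add: grid_floor_def algebra_simps)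
qed

lemma grid_floor_measurable_borel [measurable]: "grid_floor \<delta> \<in> borel_measurable borel"
  unfolding grid_floor_def[abs_def] by measurable

lemma grid_floor_measurable [measurable]: "grid_floor \<delta> \<in> borel_measurable lam"
  by (rule measurable_lam) measurable

lemma measurable_lam_id [measurable]: "(\<lambda>x. x) \<in> borel_measurable lam"
  by (rule measurable_lam) simp

lemma lam_interval_le: "emeasure lam {r\<in>space lam. a \<le> r \<and> r \<le> b} \<le> ennreal (b - a)"
proof -
  have "emeasure lam {r\<in>space lam. a \<le> r \<and> r \<le> b} \<le> emeasure lborel {a..b}"
    unfolding lam_def by (subst emeasure_restrict_space) (auto simp: space_restrict_space intro!: emeasure_mono)
  also have "\<dots> \<le> ennreal (b - a)" by (cases "a \<le> b") auto
  finally show ?thesis .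
qed

lemma lam_interval_integral:
  assumes "0 \<le> a" "a \<le> b" "b \<le> T"
  shows "(\<integral>r. (if a \<le> r \<and> r \<le> b then c else 0) \<partial>lam) = (b - a) *\<^sub>R (c :: 'a::euclidean_space)"
proof -
  have "(\<integral>r. (if a \<le> r \<and> r \<le> b then c else 0) \<partial>lam) = (\<integral>r. indicator {a..b} r *\<^sub>R c \<partial>lborel)"
    unfolding integral_lam by (intro Bochner_Integration.integral_cong) (use assms in \<open>auto simp: indicator_def\<close>)
  also have "\<dots> = (b - a) *\<^sub>R c" using assms by (subst integral_scaleR_left) (auto simp: measure_def)
  finally show ?thesis .
qed

lemma avg_measurable:
  assumes [measurable]: "h \<in> borel_measurable lam"
  shows "avg \<delta> h \<in> borel_measurable lam"
proof -
  interpret L: finite_measure lam by (rule lam_finite)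
  show ?thesis unfolding avg_def[abs_def] by measurable
qed

lemma avg_power2_le:
  assumes [measurable]: "h \<in> borel_measurable lam" and \<delta>: "0 < \<delta>"
  shows "ennreal ((norm (avg \<delta> h s))\<^sup>2)
     \<le> ennreal (1 / \<delta>) * (\<integral>\<^sup>+r. (if grid_floor \<delta> s - \<delta> \<le> r \<and> r \<le> grid_floor \<delta> s then ennreal ((norm (h r))\<^sup>2) else 0) \<partial>lam)"
proof -
  let ?I = "\<integral>r. (if grid_floor \<delta> s - \<delta> \<le> r \<and> r \<le> grid_floor \<delta> s then h r else 0) \<partial>lam"
  let ?J = "\<integral>\<^sup>+r. (if grid_floor \<delta> s - \<delta> \<le> r \<and> r \<le> grid_floor \<delta> s then ennreal ((norm (h r))\<^sup>2) else 0) \<partial>lam"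
  have "ennreal ((norm (avg \<delta> h s))\<^sup>2) = ennreal ((1 / \<delta>)\<^sup>2) * ennreal ((norm ?I)\<^sup>2)"
    unfolding avg_def using \<delta> by (simp add: ennreal_mult[symmetric] power_mult_distrib power_divide)
  also have "\<dots> \<le> ennreal ((1 / \<delta>)\<^sup>2) * (emeasure lam {r\<in>space lam. grid_floor \<delta> s - \<delta> \<le> r \<and> r \<le> grid_floor \<delta> s} * ?J)"
    by (intro mult_left_mono norm_integral_power2_le) auto
  also have "\<dots> \<le> ennreal ((1 / \<delta>)\<^sup>2) * (ennreal (grid_floor \<delta> s - (grid_floor \<delta> s - \<delta>)) * ?J)"
    by (intro mult_left_mono mult_right_mono lam_interval_le) auto
  also have "\<dots> = (ennreal ((1 / \<delta>)\<^sup>2) * ennreal \<delta>) * ?J" by (simp add: mult.assoc)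
  also have "ennreal ((1 / \<delta>)\<^sup>2) * ennreal \<delta> = ennreal (1 / \<delta>)"
    using \<delta> by (simp add: ennreal_mult[symmetric] power2_eq_square)
  finally show ?thesis .
qed

text \<open>After exchanging the integrals, a point \<open>r\<close> lies in the window of
  \<open>s\<close> only if \<open>r \<le> s \<le> r + 2 * \<delta>\<close>, because the window
  reaches back at most two block lengths. This length against the factor \<open>1 / \<delta>\<close>
  gives the constant 2. What matters is that it does not depend on \<open>\<delta>\<close>.\<close>

lemma avg_contraction:
  assumes h[measurable]: "h \<in> borel_measurable lam" and \<delta>: "0 < \<delta>"
  shows "(\<integral>\<^sup>+s. ennreal ((norm (avg \<delta> h s))\<^sup>2) \<partial>lam) \<le> 2 * (\<integral>\<^sup>+r. ennreal ((norm (h r))\<^sup>2) \<partial>lam)"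
proof -
  interpret L: finite_measure lam by (rule lam_finite)
  interpret LL: pair_sigma_finite lam lam ..
  let ?f = "\<lambda>s r. (if grid_floor \<delta> s - \<delta> \<le> r \<and> r \<le> grid_floor \<delta> s then ennreal ((norm (h r))\<^sup>2) else 0)"
  have m: "(\<lambda>(s, r). ?f s r) \<in> borel_measurable (lam \<Otimes>\<^sub>M lam)" by measurable
  have "(\<integral>\<^sup>+s. ennreal ((norm (avg \<delta> h s))\<^sup>2) \<partial>lam) \<le> (\<integral>\<^sup>+s. ennreal (1 / \<delta>) * (\<integral>\<^sup>+r. ?f s r \<partial>lam) \<partial>lam)"
    by (intro nn_integral_mono avg_power2_le h \<delta>)
  also have "\<dots> = ennreal (1 / \<delta>) * (\<integral>\<^sup>+s. \<integral>\<^sup>+r. ?f s r \<partial>lam \<partial>lam)"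
    by (rule nn_integral_cmult) measurable
  also have "(\<integral>\<^sup>+s. \<integral>\<^sup>+r. ?f s r \<partial>lam \<partial>lam) = (\<integral>\<^sup>+r. \<integral>\<^sup>+s. ?f s r \<partial>lam \<partial>lam)"
    using LL.Fubini'[OF m] by simp
  also have "\<dots> \<le> (\<integral>\<^sup>+r. ennreal (2 * \<delta>) * ennreal ((norm (h r))\<^sup>2) \<partial>lam)"
  proof (rule nn_integral_mono)
    fix r
    have "(\<integral>\<^sup>+s. ?f s r \<partial>lam) \<le> (\<integral>\<^sup>+s. ennreal ((norm (h r))\<^sup>2) * indicator {s\<in>space lam. r \<le> s \<and> s \<le> r + 2 * \<delta>} s \<partial>lam)"
      using grid_floor_bounds[OF \<delta>] by (intro nn_integral_mono) (auto simp: indicator_def; smt (verit))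
    also have "\<dots> = ennreal ((norm (h r))\<^sup>2) * emeasure lam {s\<in>space lam. r \<le> s \<and> s \<le> r + 2 * \<delta>}"
      by (rule nn_integral_cmult_indicator) measurable
    also have "\<dots> \<le> ennreal ((norm (h r))\<^sup>2) * ennreal (r + 2 * \<delta> - r)"
      by (intro mult_left_mono lam_interval_le) auto
    finally show "(\<integral>\<^sup>+s. ?f s r \<partial>lam) \<le> ennreal (2 * \<delta>) * ennreal ((norm (h r))\<^sup>2)" by (simp add: mult.commute)
  qed
  also have "\<dots> = ennreal (2 * \<delta>) * (\<integral>\<^sup>+r. ennreal ((norm (h r))\<^sup>2) \<partial>lam)"
    by (rule nn_integral_cmult) measurable
  finally have "(\<integral>\<^sup>+s. ennreal ((norm (avg \<delta> h s))\<^sup>2) \<partial>lam)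
     \<le> ennreal (1 / \<delta>) * (ennreal (2 * \<delta>) * (\<integral>\<^sup>+r. ennreal ((norm (h r))\<^sup>2) \<partial>lam))"
    by (simp add: mult_left_mono)
  also have "\<dots> = (ennreal (1 / \<delta>) * ennreal (2 * \<delta>)) * (\<integral>\<^sup>+r. ennreal ((norm (h r))\<^sup>2) \<partial>lam)"
    by (simp add: mult.assoc)
  also have "ennreal (1 / \<delta>) * ennreal (2 * \<delta>) = 2"
    using \<delta> by (simp add: ennreal_mult[symmetric] ennreal_numeral)
  finally show ?thesis .
qed

lemma sqi_avg:
  assumes h: "sqi lam h" and \<delta>: "0 < \<delta>"
  shows "sqi lam (avg \<delta> h)" and "(\<integral>s. (norm (avg \<delta> h s))\<^sup>2 \<partial>lam) \<le> 2 * (\<integral>s. (norm (h s))\<^sup>2 \<partial>lam)"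
proof -
  have hm: "h \<in> borel_measurable lam" and am: "avg \<delta> h \<in> borel_measurable lam"
    using h avg_measurable by (auto simp: sqi_def)
  have e: "(\<integral>\<^sup>+r. ennreal ((norm (h r))\<^sup>2) \<partial>lam) = ennreal (\<integral>s. (norm (h s))\<^sup>2 \<partial>lam)"
    using sqi_norm2[OF h] by (intro nn_integral_eq_integral) auto
  note c = avg_contraction[OF hm \<delta>, unfolded e]
  have c': "(\<integral>\<^sup>+s. ennreal ((norm (avg \<delta> h s))\<^sup>2) \<partial>lam) \<le> ennreal (2 * (\<integral>s. (norm (h s))\<^sup>2 \<partial>lam))"
    using c by (simp add: ennreal_mult' ennreal_numeral)
  then show s: "sqi lam (avg \<delta> h)" using am by (subst sqi_iff_nn_integral) (auto intro: le_less_trans)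
  have "(\<integral>\<^sup>+s. ennreal ((norm (avg \<delta> h s))\<^sup>2) \<partial>lam) = ennreal (\<integral>s. (norm (avg \<delta> h s))\<^sup>2 \<partial>lam)"
    using sqi_norm2[OF s] by (intro nn_integral_eq_integral) auto
  with c' show "(\<integral>s. (norm (avg \<delta> h s))\<^sup>2 \<partial>lam) \<le> 2 * (\<integral>s. (norm (h s))\<^sup>2 \<partial>lam)" by simp
qed

lemma integrable_lam_if:
  assumes "integrable lam h"
  shows "integrable lam (\<lambda>r. if a \<le> r \<and> r \<le> b then h r else 0 :: 'a::euclidean_space)"
proof -
  have [measurable]: "h \<in> borel_measurable lam" using assms by simp
  show ?thesis by (rule Bochner_Integration.integrable_bound[OF assms]) auto
qed

lemma avg_diff:
  assumes "sqi lam h" "sqi lam g"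
  shows "avg \<delta> (\<lambda>r. h r - g r) s = avg \<delta> h s - avg \<delta> g s"
proof -
  note i = sqi_integrable[OF lam_finite assms(1), THEN integrable_lam_if] sqi_integrable[OF lam_finite assms(2), THEN integrable_lam_if]
  have "(\<integral>r. (if grid_floor \<delta> s - \<delta> \<le> r \<and> r \<le> grid_floor \<delta> s then h r - g r else 0) \<partial>lam)
     = (\<integral>r. (if grid_floor \<delta> s - \<delta> \<le> r \<and> r \<le> grid_floor \<delta> s then h r else 0) - (if grid_floor \<delta> s - \<delta> \<le> r \<and> r \<le> grid_floor \<delta> s then g r else 0) \<partial>lam)"
    by (intro Bochner_Integration.integral_cong) auto
  also have "\<dots> = (\<integral>r. (if grid_floor \<delta> s - \<delta> \<le> r \<and> r \<le> grid_floor \<delta> s then h r else 0) \<partial>lam) - (\<integral>r. (if grid_floor \<delta> s - \<delta> \<le> r \<and> r \<le> grid_floor \<delta> s then g r else 0) \<partial>lam)"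
    by (rule Bochner_Integration.integral_diff[OF i])
  finally show ?thesis unfolding avg_def by (simp add: scaleR_diff_right)
qed

lemma continuous_sqi_lam:
  fixes g :: "real \<Rightarrow> 'a::euclidean_space"
  assumes "continuous_on UNIV g"
  obtains B where "B > 0" "\<And>r. r \<in> {0..T} \<Longrightarrow> norm (g r) \<le> B" "sqi lam g"
proof -
  have "compact (g ` {0..T})" by (rule compact_continuous_image) (use assms continuous_on_subset in auto)
  then have "bounded (g ` {0..T})" by (rule compact_imp_bounded)
  then obtain B where B: "B > 0" "\<And>r. r \<in> {0..T} \<Longrightarrow> norm (g r) \<le> B" by (auto simp: bounded_pos)
  have "g \<in> borel_measurable lam" by (intro measurable_lam borel_measurable_continuous_onI assms)
  moreover have "sqi lam (\<lambda>_. B)" by (rule sqi_const[OF lam_finite])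
  ultimately have "sqi lam g"
    by (intro sqi_bound[of lam "\<lambda>_. B" g 1]) (use B in auto)
  with B show thesis by (rule that)
qed

lemma avg_norm_le:
  assumes g: "integrable lam g" and B: "B \<ge> 0" "\<And>r. r \<in> {0..T} \<Longrightarrow> norm (g r) \<le> B" and \<delta>: "0 < \<delta>"
  shows "norm (avg \<delta> g s) \<le> B"
proof -
  interpret L: finite_measure lam by (rule lam_finite)
  have "norm (\<integral>r. (if grid_floor \<delta> s - \<delta> \<le> r \<and> r \<le> grid_floor \<delta> s then g r else 0) \<partial>lam)
      \<le> (\<integral>r. (if grid_floor \<delta> s - \<delta> \<le> r \<and> r \<le> grid_floor \<delta> s then B else 0) \<partial>lam)"
    by (rule order_trans[OF integral_norm_bound])
       (rule integral_mono, use integrable_lam_if[OF g] integrable_lam_if[of "\<lambda>_. B"] B L.integrable_const in auto)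
  also have "\<dots> = (\<integral>r. B * indicator {r\<in>space lam. grid_floor \<delta> s - \<delta> \<le> r \<and> r \<le> grid_floor \<delta> s} r \<partial>lam)"
    by (intro Bochner_Integration.integral_cong) (auto simp: indicator_def)
  also have "\<dots> = B * measure lam {r\<in>space lam. grid_floor \<delta> s - \<delta> \<le> r \<and> r \<le> grid_floor \<delta> s}"
    by (subst Bochner_Integration.integral_mult_right_zero, subst Bochner_Integration.integral_indicator) (auto intro!: arg_cong2[where f = measure])
  also have "\<dots> \<le> B * \<delta>"
    using lam_interval_le[of "grid_floor \<delta> s - \<delta>" "grid_floor \<delta> s"] B \<delta>
    by (intro mult_left_mono) (auto simp: L.emeasure_eq_measure)
  finally show ?thesis unfolding avg_def using \<delta> by (simp add: field_simps)
qed

text \<open>For small steps the window lies close to \<open>s\<close> and entirely inside the time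
  interval, so the average deviates from \<open>g s\<close> by no more than the oscillation of
  \<open>g\<close> near \<open>s\<close>. At \<open>s = 0\<close> the window would stick out of the
  interval, which is why the endpoints are left to a null set.\<close>

lemma avg_continuous_tendsto:
  fixes g :: "real \<Rightarrow> 'a::euclidean_space"
  assumes g: "continuous_on UNIV g" and s: "0 < s" "s < T"
    and d: "\<And>n. 0 < d n" "d \<longlonglongrightarrow> 0"
  shows "(\<lambda>n. avg (d n) g s) \<longlonglongrightarrow> g s"
proof (rule LIMSEQ_I)
  fix \<epsilon> :: real assume \<epsilon>: "0 < \<epsilon>"
  interpret L: finite_measure lam by (rule lam_finite)
  have "sqi lam g" using continuous_sqi_lam[OF g] by blast
  then have gi: "integrable lam g" by (rule sqi_integrable[OF lam_finite])
  obtain e where e: "e > 0" "\<And>r. \<bar>r - s\<bar> < e \<Longrightarrow> norm (g r - g s) < \<epsilon> / 2"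
    using g[unfolded continuous_on_iff, rule_format, of s "\<epsilon> / 2"] \<epsilon> by (auto simp: dist_norm)
  \<comment> \<open>The window reaches back from \<open>s\<close> by less than
    \<open>2 * d n\<close>. Half of \<open>e\<close> keeps it within the modulus of continuity, half
    of \<open>s\<close> keeps its left end nonnegative, so that it has its full length.\<close>
  have "eventually (\<lambda>n. d n < min (e / 2) (s / 2)) sequentially"
    using d(2) by (rule order_tendstoD) (use e s in auto)
  then obtain n0 where n0: "\<And>n. n \<ge> n0 \<Longrightarrow> d n < e / 2 \<and> d n < s / 2" by (auto simp: eventually_sequentially)
  have "norm (avg (d n) g s - g s) < \<epsilon>" if n: "n \<ge> n0" for n
  proof -
    define a b where "a = grid_floor (d n) s - d n" and "b = grid_floor (d n) s"
    have ab: "0 \<le> a" "a \<le> b" "b \<le> T" "b - a = d n" "b \<le> s" "s < b + d n"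
      using grid_floor_bounds[OF d(1)[of n], of s] n0[OF n] s d(1)[of n] by (auto simp: a_def b_def)
    have near: "\<bar>r - s\<bar> < e" if "a \<le> r" "r \<le> b" for r using ab that n0[OF n] by auto
    have "avg (d n) g s - g s = (1 / d n) *\<^sub>R ((\<integral>r. (if a \<le> r \<and> r \<le> b then g r else 0) \<partial>lam) - (\<integral>r. (if a \<le> r \<and> r \<le> b then g s else 0) \<partial>lam))"
      unfolding lam_interval_integral[OF ab(1-3)] using d(1)[of n] ab
      by (simp add: avg_def a_def b_def scaleR_diff_right)
    also have "(\<integral>r. (if a \<le> r \<and> r \<le> b then g r else 0) \<partial>lam) - (\<integral>r. (if a \<le> r \<and> r \<le> b then g s else 0) \<partial>lam)
       = (\<integral>r. (if a \<le> r \<and> r \<le> b then g r else 0) - (if a \<le> r \<and> r \<le> b then g s else 0) \<partial>lam)"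
      by (rule Bochner_Integration.integral_diff[symmetric]) (intro integrable_lam_if gi L.integrable_const)+
    finally have eq: "avg (d n) g s - g s = (1 / d n) *\<^sub>R (\<integral>r. (if a \<le> r \<and> r \<le> b then g r else 0) - (if a \<le> r \<and> r \<le> b then g s else 0) \<partial>lam)" .
    have "norm (\<integral>r. (if a \<le> r \<and> r \<le> b then g r else 0) - (if a \<le> r \<and> r \<le> b then g s else 0) \<partial>lam)
       \<le> (\<integral>r. (if a \<le> r \<and> r \<le> b then \<epsilon> / 2 else 0) \<partial>lam)"
    proof (rule order_trans[OF integral_norm_bound], rule integral_mono)
      show "integrable lam (\<lambda>r. norm ((if a \<le> r \<and> r \<le> b then g r else 0) - (if a \<le> r \<and> r \<le> b then g s else 0)))"
        by (intro integrable_norm Bochner_Integration.integrable_diff integrable_lam_if gi L.integrable_const)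
      show "integrable lam (\<lambda>r. if a \<le> r \<and> r \<le> b then \<epsilon> / 2 else 0)" by (intro integrable_lam_if L.integrable_const)
    qed (use e(2)[OF near] \<epsilon> in \<open>auto intro: less_imp_le\<close>)
    also have "\<dots> = d n * (\<epsilon> / 2)" using lam_interval_integral[OF ab(1-3), of "\<epsilon> / 2"] ab by simp
    finally have "norm (avg (d n) g s - g s) \<le> \<epsilon> / 2"
      unfolding eq using d(1)[of n] by (simp add: field_simps)
    then show ?thesis using \<epsilon> by simp
  qed
  then show "\<exists>no. \<forall>n\<ge>no. norm (avg (d n) g s - g s) < \<epsilon>" by blast
qed

lemma avg_continuous_L2:
  fixes g :: "real \<Rightarrow> 'a::euclidean_space"
  assumes g: "continuous_on UNIV g" and d: "\<And>n. 0 < d n" "d \<longlonglongrightarrow> 0"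
  shows "(\<lambda>n. \<integral>s. (norm (g s - avg (d n) g s))\<^sup>2 \<partial>lam) \<longlonglongrightarrow> 0"
proof -
  interpret L: finite_measure lam by (rule lam_finite)
  obtain B where B: "B > 0" "\<And>r. r \<in> {0..T} \<Longrightarrow> norm (g r) \<le> B" and gs: "sqi lam g"
    using continuous_sqi_lam[OF g] by blast
  note gi = sqi_integrable[OF lam_finite gs]
  have gm[measurable]: "g \<in> borel_measurable lam" using gs by (simp add: sqi_def)
  have am[measurable]: "avg (d n) g \<in> borel_measurable lam" for n by (rule avg_measurable[OF gm])
  have "(\<lambda>n. \<integral>s. (norm (g s - avg (d n) g s))\<^sup>2 \<partial>lam) \<longlonglongrightarrow> (\<integral>s. 0 \<partial>lam)"
  proof (rule integral_dominated_convergence[where w = "\<lambda>_. (2 * B)\<^sup>2"])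
    have "AE s in lborel. s \<noteq> 0 \<and> s \<noteq> T" using AE_lborel_singleton[of 0] AE_lborel_singleton[of T] by eventually_elim auto
    then have "AE s in lam. 0 < s \<and> s < T" unfolding lam_def by (subst AE_restrict_space_iff) auto
    then show "AE s in lam. (\<lambda>n. (norm (g s - avg (d n) g s))\<^sup>2) \<longlonglongrightarrow> 0"
    proof eventually_elim
      case (elim s)
      have "(\<lambda>n. (norm (g s - avg (d n) g s))\<^sup>2) \<longlonglongrightarrow> (norm (g s - g s))\<^sup>2"
        by (intro tendsto_intros avg_continuous_tendsto g d) (use elim in auto)
      then show ?case by simp
    qed
    show "AE s in lam. norm ((norm (g s - avg (d n) g s))\<^sup>2) \<le> (2 * B)\<^sup>2" for n
    proof (rule AE_I2)
      fix s assume "s \<in> space lam"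
      then have "norm (g s) \<le> B" using B by simp
      moreover have "norm (avg (d n) g s) \<le> B" by (rule avg_norm_le[OF gi _ B(2) d(1)]) (use B in auto)
      ultimately have "norm (g s - avg (d n) g s) \<le> 2 * B" using norm_triangle_ineq4[of "g s" "avg (d n) g s"] by simp
      then show "norm ((norm (g s - avg (d n) g s))\<^sup>2) \<le> (2 * B)\<^sup>2"
        using power_mono[OF _ norm_ge_zero, of _ "2 * B" 2] by simp
    qed
  qed (simp_all add: L.integrable_const, measurable)
  then show ?thesis by simp
qed

section \<open>Density of continuous functions and convergence of the block averages\<close>

lemma bounded_sqi_lam:
  fixes h :: "real \<Rightarrow> 'a::euclidean_space"
  assumes "h \<in> borel_measurable lam" "\<And>r. r \<in> {0..T} \<Longrightarrow> norm (h r) \<le> B"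
  shows "sqi lam h"
  by (rule sqi_bound[OF sqi_const[OF lam_finite, of B] assms(1), of 1])
     (use assms(2) in \<open>force intro!: AE_I2\<close>)

lemma sqi_dominated_convergence:
  fixes f :: "real \<Rightarrow> 'a::euclidean_space"
  assumes [measurable]: "f \<in> borel_measurable lam" "\<And>n. fn n \<in> borel_measurable lam"
    and lim: "AE s in lam. (\<lambda>n. fn n s) \<longlonglongrightarrow> f s"
    and w: "integrable lam w" "\<And>n. AE s in lam. (norm (f s - fn n s))\<^sup>2 \<le> w s"
  shows "(\<lambda>n. \<integral>s. (norm (f s - fn n s))\<^sup>2 \<partial>lam) \<longlonglongrightarrow> 0"
proof -
  have "(\<lambda>n. \<integral>s. (norm (f s - fn n s))\<^sup>2 \<partial>lam) \<longlonglongrightarrow> (\<integral>s. 0 \<partial>lam)"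
  proof (rule integral_dominated_convergence[OF _ _ w(1)])
    show "AE s in lam. (\<lambda>n. (norm (f s - fn n s))\<^sup>2) \<longlonglongrightarrow> 0"
      using lim
    proof eventually_elim
      case (elim s)
      have "(\<lambda>n. (norm (f s - fn n s))\<^sup>2) \<longlonglongrightarrow> (norm (f s - f s))\<^sup>2"
        by (intro tendsto_intros elim)
      then show ?case by simp
    qed
  qed (use w(2) in auto)
  then show ?thesis by simp
qed

text \<open>Lebesgue measurability gives continuous functions converging pointwise off a negligible
  set, but without any bound. Composing them with the nearest-point projection onto the ball of
  radius \<open>B\<close> keeps continuity, does not move the limit and supplies the dominating
  constant.\<close>

lemma bounded_continuous_approx:
  fixes h :: "real \<Rightarrow> 'a::euclidean_space"
  assumes h: "h \<in> borel_measurable lam" and B: "0 < B" "\<And>r. r \<in> {0..T} \<Longrightarrow> norm (h r) \<le> B"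
    and e: "0 < e"
  obtains g where "continuous_on UNIV g" "(\<integral>s. (norm (h s - g s))\<^sup>2 \<partial>lam) < e"
proof -
  interpret L: finite_measure lam by (rule lam_finite)
  define h' where "h' = (\<lambda>r. indicator {0..T} r *\<^sub>R h r)"
  have "h' \<in> borel_measurable lborel"
    unfolding h'_def using h unfolding lam_def by (subst (asm) borel_measurable_restrict_space_iff) auto
  then have "h' \<in> borel_measurable lebesgue" by (rule measurable_completion)
  then have "h' measurable_on UNIV" by (rule lebesgue_measurable_imp_measurable_on) auto
  then obtain Z g where Z: "negligible Z" and g: "\<And>n. continuous_on UNIV (g n)"
    and lim: "\<And>x. x \<notin> Z \<Longrightarrow> (\<lambda>n. g n x) \<longlonglongrightarrow> h' x"
    unfolding measurable_on_def by auto
  \<comment> \<open>A continuous retraction onto the ball that contains the values of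
    \<open>h\<close>.\<close>
  define c where "c = closest_point (cball (0::'a) B)"
  have cc: "continuous_on S c" for S
    unfolding c_def by (rule continuous_on_closest_point) (use B in auto)
  have cB: "norm (c x) \<le> B" for x
    using closest_point_in_set[of "cball (0::'a) B" x] B by (simp add: c_def)
  have gc: "continuous_on UNIV (\<lambda>x. c (g n x))" for n
    by (rule continuous_on_compose2[OF cc g]) auto
  have "Z \<in> null_sets lebesgue" using Z by (simp add: negligible_iff_null_sets)
  then have "AE x in lebesgue. x \<notin> Z" by (rule AE_not_in)
  then have "AE x in lborel. x \<notin> Z" by (simp add: AE_completion_iff)
  then have AE: "AE x in lam. x \<notin> Z"
    unfolding lam_def by (subst AE_restrict_space_iff) auto
  have "(\<lambda>n. \<integral>s. (norm (h s - c (g n s)))\<^sup>2 \<partial>lam) \<longlonglongrightarrow> 0"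
  proof (rule sqi_dominated_convergence[OF h, where w = "\<lambda>_. 2 * B\<^sup>2 + 2 * B\<^sup>2"])
    show "(\<lambda>s. c (g n s)) \<in> borel_measurable lam" for n
      by (intro measurable_lam borel_measurable_continuous_onI gc)
    show "AE s in lam. (\<lambda>n. c (g n s)) \<longlonglongrightarrow> h s"
      using AE AE_space
    proof eventually_elim
      case (elim s)
      have "isCont c (h' s)" using cc[of UNIV] by (simp add: continuous_on_eq_continuous_at)
      then have "(\<lambda>n. c (g n s)) \<longlonglongrightarrow> c (h' s)" by (rule isCont_tendsto_compose) (use lim elim in auto)
      moreover have "h' s = h s" using elim by (simp add: h'_def)
      moreover have "c (h s) = h s" unfolding c_def by (rule closest_point_self) (use elim B in auto)
      ultimately show ?case by simp
    qed
    show "AE s in lam. (norm (h s - c (g n s)))\<^sup>2 \<le> 2 * B\<^sup>2 + 2 * B\<^sup>2" for n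
    proof (rule AE_I2)
      fix s assume "s \<in> space lam"
      then have "(norm (h s))\<^sup>2 \<le> B\<^sup>2" "(norm (c (g n s)))\<^sup>2 \<le> B\<^sup>2" using B(2)[of s] cB[of "g n s"] by (auto intro!: power_mono)
      then show "(norm (h s - c (g n s)))\<^sup>2 \<le> 2 * B\<^sup>2 + 2 * B\<^sup>2" using norm_diff_power2_le[of "h s" "c (g n s)"] by linarith
    qed
  qed (rule L.integrable_const)
  then have "eventually (\<lambda>n. (\<integral>s. (norm (h s - c (g n s)))\<^sup>2 \<partial>lam) < e) sequentially"
    by (rule order_tendstoD) (rule e)
  then obtain n where "(\<integral>s. (norm (h s - c (g n s)))\<^sup>2 \<partial>lam) < e" by (auto simp: eventually_sequentially)
  with gc show thesis by (rule that)
qed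

text \<open>Values of norm above \<open>n\<close> are replaced by 0, which converges by dominated
  convergence and leaves a bounded function to approximate.\<close>

lemma continuous_approx:
  fixes h :: "real \<Rightarrow> 'a::euclidean_space"
  assumes h: "sqi lam h" and e: "0 < e"
  obtains g where "continuous_on UNIV g" "(\<integral>s. (norm (h s - g s))\<^sup>2 \<partial>lam) < e"
proof -
  have [measurable]: "h \<in> borel_measurable lam" using h by (rule sqi_measurable)
  define hn where "hn n s = (if norm (h s) \<le> real n then h s else 0)" for n s
  have hm[measurable]: "hn n \<in> borel_measurable lam" for n unfolding hn_def[abs_def] by measurable
  have "(\<lambda>n. \<integral>s. (norm (h s - hn n s))\<^sup>2 \<partial>lam) \<longlonglongrightarrow> 0"
  proof (rule sqi_dominated_convergence[OF _ hm _ sqi_norm2[OF h]])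
    show "AE s in lam. (\<lambda>n. hn n s) \<longlonglongrightarrow> h s"
    proof (rule AE_I2)
      fix s
      obtain k :: nat where k: "norm (h s) \<le> real k" using real_arch_simple by blast
      show "(\<lambda>n. hn n s) \<longlonglongrightarrow> h s"
        by (rule tendsto_eventually) (use k in \<open>auto simp: hn_def eventually_sequentially intro!: exI[of _ k]\<close>)
    qed
  qed (auto simp: hn_def)
  then have "eventually (\<lambda>n. (\<integral>s. (norm (h s - hn n s))\<^sup>2 \<partial>lam) < e / 4) sequentially"
    by (rule order_tendstoD) (use e in simp)
  then obtain n where n: "(\<integral>s. (norm (h s - hn n s))\<^sup>2 \<partial>lam) < e / 4" by (auto simp: eventually_sequentially)
  have b: "norm (hn n s) \<le> real n + 1" for s by (simp add: hn_def)
  \<comment> \<open>Each of the two errors is doubled by the square of a sum, so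
    \<open>e / 4\<close> for each adds up to \<open>e\<close>. The bound \<open>real n + 1\<close>
    is positive also for \<open>n = 0\<close>.\<close>
  obtain g where g: "continuous_on UNIV g" "(\<integral>s. (norm (hn n s - g s))\<^sup>2 \<partial>lam) < e / 4"
    by (rule bounded_continuous_approx[OF hm, of "real n + 1" n "e / 4"]) (use b e in auto)
  have gs: "sqi lam g" using continuous_sqi_lam[OF g(1)] by blast
  have hs: "sqi lam (hn n)" by (rule bounded_sqi_lam[OF hm b])
  have "(\<integral>s. (norm (h s - g s))\<^sup>2 \<partial>lam) \<le> (\<integral>s. 2 * (norm (h s - hn n s))\<^sup>2 + 2 * (norm (hn n s - g s))\<^sup>2 \<partial>lam)"
  proof (rule integral_mono)
    show "(norm (h s - g s))\<^sup>2 \<le> 2 * (norm (h s - hn n s))\<^sup>2 + 2 * (norm (hn n s - g s))\<^sup>2" for s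
      using norm_add_power2_le[of "h s - hn n s" "hn n s - g s"] by simp
  qed (use sqi_norm2[OF sqi_diff[OF h gs]] sqi_norm2[OF sqi_diff[OF h hs]] sqi_norm2[OF sqi_diff[OF hs gs]] in auto)
  also have "\<dots> < e"
    using n g(2) sqi_norm2[OF sqi_diff[OF h hs]] sqi_norm2[OF sqi_diff[OF hs gs]] by simp
  finally show thesis using that g(1) by blast
qed

text \<open>Averaging is bounded on L2 uniformly in the step and converges on continuous functions;
  density extends the convergence to all of L2.\<close>

lemma avg_L2_tendsto:
  fixes h :: "real \<Rightarrow> 'a::euclidean_space"
  assumes h: "sqi lam h" and d: "\<And>n. 0 < d n" "d \<longlonglongrightarrow> 0"
  shows "(\<lambda>n. \<integral>s. (norm (h s - avg (d n) h s))\<^sup>2 \<partial>lam) \<longlonglongrightarrow> 0"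
proof (rule LIMSEQ_I)
  fix e :: real assume e: "0 < e"
  \<comment> \<open>With \<open>x < e / 20\<close> for the distance of \<open>h\<close> and
    \<open>g\<close> and \<open>y < e / 8\<close> for the averaging error of \<open>g\<close>, the
    final estimate is \<open>2 * x + 4 * y + 4 * (2 * x)\<close>, which is below
    \<open>e\<close>.\<close>
  obtain g where g: "continuous_on UNIV g" "(\<integral>s. (norm (h s - g s))\<^sup>2 \<partial>lam) < e / 20"
    by (rule continuous_approx[OF h, of "e / 20"]) (use e in auto)
  have gs: "sqi lam g" using continuous_sqi_lam[OF g(1)] by blast
  have "eventually (\<lambda>n. (\<integral>s. (norm (g s - avg (d n) g s))\<^sup>2 \<partial>lam) < e / 8) sequentially"
    using avg_continuous_L2[OF g(1) d] by (rule order_tendstoD) (use e in simp)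
  then obtain n0 where n0: "\<And>n. n \<ge> n0 \<Longrightarrow> (\<integral>s. (norm (g s - avg (d n) g s))\<^sup>2 \<partial>lam) < e / 8"
    by (auto simp: eventually_sequentially)
  have "(\<integral>s. (norm (h s - avg (d n) h s))\<^sup>2 \<partial>lam) < e" if n: "n \<ge> n0" for n
  proof -
    have sg: "sqi lam (\<lambda>s. h s - g s)" by (rule sqi_diff[OF h gs])
    note a = sqi_avg[OF sg d(1)[of n]]
    have i1: "integrable lam (\<lambda>s. (norm (h s - g s))\<^sup>2)" by (rule sqi_norm2[OF sg])
    have i2: "integrable lam (\<lambda>s. (norm (g s - avg (d n) g s))\<^sup>2)"
      by (rule sqi_norm2[OF sqi_diff[OF gs sqi_avg(1)[OF gs d(1)]]])
    have i3: "integrable lam (\<lambda>s. (norm (avg (d n) (\<lambda>s. h s - g s) s))\<^sup>2)" by (rule sqi_norm2[OF a(1)])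
    have "(\<integral>s. (norm (h s - avg (d n) h s))\<^sup>2 \<partial>lam) \<le>
       (\<integral>s. 2 * (norm (h s - g s))\<^sup>2 + (4 * (norm (g s - avg (d n) g s))\<^sup>2 + 4 * (norm (avg (d n) (\<lambda>s. h s - g s) s))\<^sup>2) \<partial>lam)"
    proof (rule integral_mono)
      show "integrable lam (\<lambda>s. (norm (h s - avg (d n) h s))\<^sup>2)"
        by (rule sqi_norm2[OF sqi_diff[OF h sqi_avg(1)[OF h d(1)]]])
      show "integrable lam (\<lambda>s. 2 * (norm (h s - g s))\<^sup>2 + (4 * (norm (g s - avg (d n) g s))\<^sup>2 + 4 * (norm (avg (d n) (\<lambda>s. h s - g s) s))\<^sup>2))"
        using i1 i2 i3 by simp
      fix s
      have eq: "h s - avg (d n) h s = (h s - g s) + ((g s - avg (d n) g s) - avg (d n) (\<lambda>s. h s - g s) s)"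
        unfolding avg_diff[OF h gs] by simp
      show "(norm (h s - avg (d n) h s))\<^sup>2 \<le> 2 * (norm (h s - g s))\<^sup>2 +
         (4 * (norm (g s - avg (d n) g s))\<^sup>2 + 4 * (norm (avg (d n) (\<lambda>s. h s - g s) s))\<^sup>2)"
        using norm_add_power2_le[of "h s - g s" "(g s - avg (d n) g s) - avg (d n) (\<lambda>s. h s - g s) s"]
          norm_diff_power2_le[of "g s - avg (d n) g s" "avg (d n) (\<lambda>s. h s - g s) s"]
        unfolding eq[symmetric] by linarith
    qed
    also have "\<dots> = 2 * (\<integral>s. (norm (h s - g s))\<^sup>2 \<partial>lam) + (4 * (\<integral>s. (norm (g s - avg (d n) g s))\<^sup>2 \<partial>lam)
         + 4 * (\<integral>s. (norm (avg (d n) (\<lambda>s. h s - g s) s))\<^sup>2 \<partial>lam))"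
      using i1 i2 i3 by simp
    also have "\<dots> < e" using a(2) g(2) n0[OF n] by simp
    finally show ?thesis .
  qed
  then show "\<exists>no. \<forall>n\<ge>no. norm ((\<integral>s. (norm (h s - avg (d n) h s))\<^sup>2 \<partial>lam) - 0) < e"
    by (intro exI[of _ n0]) simp
qed

section \<open>Progressive processes and existence of the Ito integral\<close>

abbreviation Rt :: "real \<Rightarrow> real measure" where "Rt t \<equiv> restrict_space borel {0..t}"

abbreviation prog :: "(real \<Rightarrow> 'w \<Rightarrow> 'a::topological_space) \<Rightarrow> bool" where
  "prog X \<equiv> progressive M (aug_filtration M W) T X"

lemma progI:
  "(\<And>t. t \<in> {0..T} \<Longrightarrow> (\<lambda>z. X (fst z) (snd z)) \<in> borel_measurable (Rt t \<Otimes>\<^sub>M Fs t)) \<Longrightarrow> prog X"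
  unfolding progressive_def by (simp add: case_prod_beta')

lemma progD:
  "prog X \<Longrightarrow> t \<in> {0..T} \<Longrightarrow> (\<lambda>z. X (fst z) (snd z)) \<in> borel_measurable (Rt t \<Otimes>\<^sub>M Fs t)"
  unfolding progressive_def by (simp add: case_prod_beta')

lemma measurable_N_Rt: "(\<lambda>z. z) \<in> measurable N (Rt T \<Otimes>\<^sub>M Fs T)"
proof -
  have "(\<lambda>x. x) \<in> measurable lam (Rt T)" using sets_lam by (auto intro!: measurable_ident_sets)
  moreover have "(\<lambda>x. x) \<in> measurable M (Fs T)"
    using aug_filtration_subset[of T] by (auto simp: measurable_def sets_Fs)
  ultimately have "(\<lambda>z. (fst z, snd z)) \<in> measurable N (Rt T \<Otimes>\<^sub>M Fs T)"
    by (intro measurable_Pair measurable_compose[OF measurable_fst_N] measurable_compose[OF measurable_snd_N])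
  then show ?thesis by simp
qed

lemma prog_measurable_N: "prog X \<Longrightarrow> (\<lambda>z. X (fst z) (snd z)) \<in> borel_measurable N"
  using measurable_compose[OF measurable_N_Rt progD[of X T]] T by simp

lemma prog_measurable_Fs:
  assumes "prog X" "t \<in> {0..T}"
  shows "X t \<in> borel_measurable (Fs t)"
proof -
  have "(\<lambda>\<omega>. (t, \<omega>)) \<in> measurable (Fs t) (Rt t \<Otimes>\<^sub>M Fs t)"
    using assms(2) by (intro measurable_Pair) (auto simp: space_restrict_space)
  from measurable_compose[OF this progD[OF assms]] show ?thesis by simp
qed

lemma prog_measurable_M: "prog X \<Longrightarrow> t \<in> {0..T} \<Longrightarrow> X t \<in> borel_measurable M"
  by (rule measurable_Fs_M[OF prog_measurable_Fs])

lemma prog_det: "f \<in> borel_measurable borel \<Longrightarrow> prog (\<lambda>s \<omega>. f s)"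
  by (intro progI measurable_compose[OF measurable_fst] measurable_restrict_space1) simp

lemma prog_lim:
  fixes X :: "nat \<Rightarrow> real \<Rightarrow> 'w \<Rightarrow> 'a::euclidean_space"
  assumes "\<And>k. prog (X k)"
  shows "prog (\<lambda>s \<omega>. lim (\<lambda>k. X k s \<omega>))"
  by (intro progI borel_measurable_lim_metric progD[OF assms])

text \<open>Up to time \<open>t\<close> a progressive process is jointly measurable with respect to
  the sigma-algebra of time \<open>t\<close>, so integrating over times up to \<open>t\<close> stays
  within it. The parameter space \<open>K\<close> allows two uses: the sigma-algebra of time
  \<open>t\<close> itself for block averages, and its product with the time interval for running
  integrals.\<close>

lemma prog_integral_measurable:
  fixes X :: "real \<Rightarrow> 'w \<Rightarrow> 'a::euclidean_space"
  assumes X: "prog X" and t: "t \<in> {0..T}" and w: "w \<in> measurable K (Fs t)"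
    and P: "Measurable.pred (K \<Otimes>\<^sub>M Rt t) (\<lambda>z. P (fst z) (snd z))"
  shows "(\<lambda>y. \<integral>r. (if P y r \<and> r \<le> t then X r (w y) else 0) \<partial>lam) \<in> borel_measurable K"
proof -
  define Lt where "Lt = restrict_space lborel {0..t}"
  have sL: "sets Lt = sets (Rt t)" by (simp add: Lt_def sets_restrict_space)
  interpret Lt: finite_measure Lt
    by (rule finite_measureI) (use t in \<open>simp add: Lt_def emeasure_restrict_space space_restrict_space\<close>)
  have sK: "sets (K \<Otimes>\<^sub>M Lt) = sets (K \<Otimes>\<^sub>M Rt t)" using sL by (rule sets_pair_measure_cong[OF refl])
  have id: "(\<lambda>x. x) \<in> measurable Lt (Rt t)" by (rule measurable_ident_sets[OF sL])
  have "(\<lambda>z. (snd z, w (fst z))) \<in> measurable (K \<Otimes>\<^sub>M Lt) (Rt t \<Otimes>\<^sub>M Fs t)"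
    by (intro measurable_Pair measurable_compose[OF measurable_snd id] measurable_compose[OF measurable_fst w])
  from measurable_compose[OF this progD[OF X t]]
  have Xm: "(\<lambda>z. X (snd z) (w (fst z))) \<in> borel_measurable (K \<Otimes>\<^sub>M Lt)" by simp
  have Pm: "Measurable.pred (K \<Otimes>\<^sub>M Lt) (\<lambda>z. P (fst z) (snd z))"
    using P unfolding measurable_cong_sets[OF sK refl] .
  have "(\<lambda>(y, r). if P y r then X r (w y) else 0) \<in> borel_measurable (K \<Otimes>\<^sub>M Lt)"
    using Xm Pm unfolding case_prod_beta' by (intro measurable_If) (auto simp: pred_def)
  then have "(\<lambda>y. \<integral>r. (if P y r then X r (w y) else 0) \<partial>Lt) \<in> borel_measurable K"
    by (rule Lt.borel_measurable_lebesgue_integral)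
  moreover have "(\<integral>r. (if P y r then X r (w y) else 0) \<partial>Lt) = (\<integral>r. (if P y r \<and> r \<le> t then X r (w y) else 0) \<partial>lam)" for y
    unfolding Lt_def integral_lam using t
    by (subst integral_restrict_space) (auto intro!: Bochner_Integration.integral_cong simp: indicator_def)
  ultimately show ?thesis by simp
qed

text \<open>The cut at \<open>s\<close> sits in the integrand rather than in the domain, which makes
  measurability jointly in time and chance accessible. Beyond \<open>T\<close> the value stays
  constant.\<close>

definition running_integral :: "(real \<Rightarrow> 'w \<Rightarrow> 'a::euclidean_space) \<Rightarrow> real \<Rightarrow> 'w \<Rightarrow> 'a" where
  "running_integral X s \<omega> = (\<integral>r. (if r \<le> s then X r \<omega> else 0) \<partial>lam)"

lemma running_integral_eq: "s \<le> T \<Longrightarrow> set_lebesgue_integral lborel {0..s} (\<lambda>r. X r \<omega>) = running_integral X s \<omega>"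
  unfolding running_integral_def by (subst set_integral_lam) (auto intro!: Bochner_Integration.integral_cong simp: indicator_def)

lemma prog_running_integral:
  assumes "prog X"
  shows "prog (running_integral X)"
proof (rule progI)
  fix t assume t: "t \<in> {0..T}"
  have "(\<lambda>z. \<integral>r. (if r \<le> fst z \<and> r \<le> t then X r (snd z) else 0) \<partial>lam) \<in> borel_measurable (Rt t \<Otimes>\<^sub>M Fs t)"
  proof (rule prog_integral_measurable[OF assms t measurable_snd])
    have [measurable]: "(\<lambda>x. x) \<in> borel_measurable (Rt t)" by (rule measurable_restrict_space1) simp
    have [measurable]: "(\<lambda>z. fst (fst z)) \<in> borel_measurable ((Rt t \<Otimes>\<^sub>M Fs t) \<Otimes>\<^sub>M Rt t)"
      "(\<lambda>z. snd z) \<in> borel_measurable ((Rt t \<Otimes>\<^sub>M Fs t) \<Otimes>\<^sub>M Rt t)" by measurable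
    show "Measurable.pred ((Rt t \<Otimes>\<^sub>M Fs t) \<Otimes>\<^sub>M Rt t) (\<lambda>z. snd z \<le> fst (fst z))"
      unfolding pred_def by (rule borel_measurable_le) measurable
  qed
  moreover have "(if r \<le> s \<and> r \<le> t then X r \<omega> else 0) = (if r \<le> s then X r \<omega> else 0)" if "s \<le> t" for r s \<omega>
    using that by auto
  ultimately show "(\<lambda>z. running_integral X (fst z) (snd z)) \<in> borel_measurable (Rt t \<Otimes>\<^sub>M Fs t)"
    unfolding running_integral_def by (subst measurable_cong[where g = "\<lambda>z. \<integral>r. (if r \<le> fst z \<and> r \<le> t then X r (snd z) else 0) \<partial>lam"])
      (auto simp: space_pair_measure space_restrict_space)
qed

text \<open>Continuity of the paths turns measurability at each time into joint measurability: W is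
  evaluated at the grid point before the current time. That takes countably many grid values, and
  clamping them to \<open>{0..t}\<close> keeps every approximation measurable at time
  \<open>t\<close>.\<close>

lemma W_joint:
  assumes t: "0 \<le> t"
  shows "(\<lambda>z. W j (fst z) (snd z)) \<in> borel_measurable (Rt t \<Otimes>\<^sub>M Fs t)"
proof -
  define d where "d n = 1 / real (Suc n)" for n
  have d: "0 < d n" for n by (simp add: d_def)
  have d0: "d \<longlonglongrightarrow> 0" unfolding d_def by (rule LIMSEQ_Suc[OF lim_1_over_n])
  have fst': "fst \<in> borel_measurable (Rt t \<Otimes>\<^sub>M Fs t)"
    by (rule measurable_compose[OF measurable_fst, of "\<lambda>x. x", simplified]) (rule measurable_restrict_space1, simp)
  define Y where "Y n z = W j (max 0 (min t (grid_floor (d n) (fst z)))) (snd z)" for n and z :: "real \<times> 'w"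
  have Ym: "Y n \<in> borel_measurable (Rt t \<Otimes>\<^sub>M Fs t)" for n
  proof -
    have m: "(\<lambda>z. W j (max 0 (min t (d n * of_int i))) (snd z)) \<in> borel_measurable (Rt t \<Otimes>\<^sub>M Fs t)" for i :: int
      by (rule measurable_compose[OF measurable_snd W_measurable_Fs]) (use t in auto)
    have "(\<lambda>z. \<lfloor>fst z / d n\<rfloor>) \<in> measurable (Rt t \<Otimes>\<^sub>M Fs t) (count_space UNIV)"
      using fst' by measurable
    from measurable_compose_countable[OF m this] show ?thesis unfolding Y_def grid_floor_def by simp
  qed
  show ?thesis
  proof (rule borel_measurable_LIMSEQ_metric[OF Ym])
    fix z assume "z \<in> space (Rt t \<Otimes>\<^sub>M Fs t)"
    then have z: "0 \<le> fst z" "fst z \<le> t" by (auto simp: space_pair_measure space_restrict_space)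
    have "(\<lambda>n. grid_floor (d n) (fst z)) \<longlonglongrightarrow> fst z"
    proof (rule tendsto_sandwich)
      show "\<forall>\<^sub>F n in sequentially. fst z - d n \<le> grid_floor (d n) (fst z)"
        using grid_floor_bounds[OF d] by (intro always_eventually allI) (smt (verit))
      show "\<forall>\<^sub>F n in sequentially. grid_floor (d n) (fst z) \<le> fst z"
        using grid_floor_bounds[OF d] by (intro always_eventually allI) auto
      show "(\<lambda>n. fst z - d n) \<longlonglongrightarrow> fst z" using tendsto_diff[OF tendsto_const d0, of "fst z"] by simp
    qed simp
    then have l: "(\<lambda>n. max 0 (min t (grid_floor (d n) (fst z)))) \<longlonglongrightarrow> max 0 (min t (fst z))"
      by (intro tendsto_intros)
    have e: "max 0 (min t (fst z)) = fst z" using z by auto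
    show "(\<lambda>n. Y n z) \<longlonglongrightarrow> W j (fst z) (snd z)"
      unfolding Y_def
      by (rule continuous_on_tendsto_compose[OF W_continuous[of j "snd z"] l[unfolded e]]) (use z in auto)
  qed
qed

text \<open>Up to time \<open>t\<close>, a cell starting after \<open>t\<close> contributes nothing,
  so only those \<open>\<xi> k\<close> enter that are known at time \<open>t\<close>.\<close>

lemma prog_simple_ito:
  fixes \<xi> :: "nat \<Rightarrow> 'w \<Rightarrow> 'a::euclidean_space"
  assumes ad: "adm_simple M (aug_filtration M W) T ts m \<xi>"
  shows "prog (simple_ito W j ts m \<xi>)"
proof (rule progI)
  fix t assume t: "t \<in> {0..T}"
  have id: "(\<lambda>x. x) \<in> borel_measurable (Rt t)" by (rule measurable_restrict_space1) simp
  have Wm: "(\<lambda>z. W j (min a (fst z)) (snd z)) \<in> borel_measurable (Rt t \<Otimes>\<^sub>M Fs t)" if a: "0 \<le> a" for a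
  proof -
    have "(\<lambda>s. min a s) \<in> measurable (Rt t) (Rt t)"
      by (rule measurable_restrict_space2) (use a id in \<open>auto simp: space_restrict_space\<close>)
    then have "(\<lambda>z. (min a (fst z), snd z)) \<in> measurable (Rt t \<Otimes>\<^sub>M Fs t) (Rt t \<Otimes>\<^sub>M Fs t)"
      by (intro measurable_Pair measurable_compose[OF measurable_fst] measurable_snd)
    from measurable_compose[OF this W_joint] t show ?thesis by simp
  qed
  have "(\<lambda>z. (W j (min (ts (Suc k)) (fst z)) (snd z) - W j (min (ts k) (fst z)) (snd z)) *\<^sub>R \<xi> k (snd z)) \<in> borel_measurable (Rt t \<Otimes>\<^sub>M Fs t)"
    if k: "k < m" for k
  proof (cases "ts k \<le> t")
    case True
    have "(\<lambda>z. \<xi> k (snd z)) \<in> borel_measurable (Rt t \<Otimes>\<^sub>M Fs t)"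
      by (rule measurable_compose[OF measurable_snd measurable_Fs_mono[OF adm_simpleD(3)[OF ad k] True]])
    then show ?thesis using adm_simpleD(1)[OF ad, of k] adm_simpleD(1)[OF ad, of "Suc k"] k
      by (intro borel_measurable_scaleR borel_measurable_diff Wm) auto
  next
    case False
    then show ?thesis using adm_simpleD(2)[OF ad k]
      by (subst measurable_cong[where g = "\<lambda>_. 0"]) (auto simp: space_pair_measure space_restrict_space min_def)
  qed
  then show "(\<lambda>z. simple_ito W j ts m \<xi> (fst z) (snd z)) \<in> borel_measurable (Rt t \<Otimes>\<^sub>M Fs t)"
    unfolding simple_ito_def by (intro borel_measurable_sum) auto
qed

lemma L2F_iff:
  fixes X :: "real \<Rightarrow> 'w \<Rightarrow> 'a::euclidean_space"
  shows "L2F M (aug_filtration M W) T X \<longleftrightarrow> prog X \<and> sqi N (\<lambda>z. X (fst z) (snd z))"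
proof -
  have "prog X \<Longrightarrow> (\<integral>\<^sup>+\<omega>. (\<integral>\<^sup>+s. indicator {0..T} s * ennreal ((norm (X s \<omega>))\<^sup>2) \<partial>lborel) \<partial>M) < \<infinity>
     \<longleftrightarrow> sqi N (\<lambda>z. X (fst z) (snd z))"
    using prog_measurable_N[of X] by (subst nn_integral_process) (auto simp: case_prod_beta' sqi_iff_nn_integral)
  then show ?thesis unfolding L2F_def by blast
qed

lemma sqi_prog_integral:
  fixes X :: "real \<Rightarrow> 'w \<Rightarrow> 'a::euclidean_space"
  assumes X: "sqi N (\<lambda>z. X (fst z) (snd z))"
    and m: "(\<lambda>\<omega>. \<integral>r. (if P r then X r \<omega> else 0) \<partial>lam) \<in> borel_measurable M"
    and P[measurable]: "Measurable.pred lam P"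
  shows "sqi M (\<lambda>\<omega>. \<integral>r. (if P r then X r \<omega> else 0) \<partial>lam)"
    and "(\<integral>\<^sup>+\<omega>. ennreal ((norm (\<integral>r. (if P r then X r \<omega> else 0) \<partial>lam))\<^sup>2) \<partial>M)
        \<le> ennreal T * (\<integral>\<^sup>+z. (if P (fst z) then ennreal ((norm (X (fst z) (snd z)))\<^sup>2) else 0) \<partial>N)"
proof -
  have Xm[measurable]: "(\<lambda>z. X (fst z) (snd z)) \<in> borel_measurable N" using X by (rule sqi_measurable)
  have Xs: "(\<lambda>r. X r \<omega>) \<in> borel_measurable lam" if "\<omega> \<in> space M" for \<omega>
  proof -
    have "(\<lambda>r. (r, \<omega>)) \<in> measurable lam N" unfolding N_def using that by (intro measurable_Pair) auto
    from measurable_compose[OF this Xm] show ?thesis by simp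
  qed
  have "(\<integral>\<^sup>+\<omega>. ennreal ((norm (\<integral>r. (if P r then X r \<omega> else 0) \<partial>lam))\<^sup>2) \<partial>M)
     \<le> (\<integral>\<^sup>+\<omega>. ennreal T * (\<integral>\<^sup>+r. (if P r then ennreal ((norm (X r \<omega>))\<^sup>2) else 0) \<partial>lam) \<partial>M)"
  proof (rule nn_integral_mono)
    fix \<omega> assume w: "\<omega> \<in> space M"
    have "{r\<in>space lam. 0 \<le> r \<and> r \<le> T} \<in> sets lam" by measurable
    then have "emeasure lam {r\<in>space lam. P r} \<le> emeasure lam {r\<in>space lam. 0 \<le> r \<and> r \<le> T}"
      by (rule emeasure_mono[rotated]) auto
    also have "\<dots> \<le> ennreal T" using lam_interval_le[of 0 T] by simp
    finally show "ennreal ((norm (\<integral>r. (if P r then X r \<omega> else 0) \<partial>lam))\<^sup>2)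
       \<le> ennreal T * (\<integral>\<^sup>+r. (if P r then ennreal ((norm (X r \<omega>))\<^sup>2) else 0) \<partial>lam)"
      by (intro order_trans[OF norm_integral_power2_le[OF Xs[OF w] P]] mult_right_mono) auto
  qed
  also have "\<dots> = ennreal T * (\<integral>\<^sup>+\<omega>. \<integral>\<^sup>+r. (if P r then ennreal ((norm (X r \<omega>))\<^sup>2) else 0) \<partial>lam \<partial>M)"
  proof (rule nn_integral_cmult)
    have "(\<lambda>z. if P (fst z) then ennreal ((norm (X (fst z) (snd z)))\<^sup>2) else 0) \<in> borel_measurable (lam \<Otimes>\<^sub>M M)"
      unfolding N_def[symmetric] by measurable
    then have "(\<lambda>(\<omega>, r). if P r then ennreal ((norm (X r \<omega>))\<^sup>2) else 0) \<in> borel_measurable (M \<Otimes>\<^sub>M lam)"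
      by (subst measurable_pair_swap_iff) (simp add: case_prod_beta' cong: if_cong)
    then show "(\<lambda>\<omega>. \<integral>\<^sup>+r. (if P r then ennreal ((norm (X r \<omega>))\<^sup>2) else 0) \<partial>lam) \<in> borel_measurable M"
      by (rule lamM.M1.borel_measurable_nn_integral)
  qed
  also have "(\<integral>\<^sup>+\<omega>. \<integral>\<^sup>+r. (if P r then ennreal ((norm (X r \<omega>))\<^sup>2) else 0) \<partial>lam \<partial>M)
     = (\<integral>\<^sup>+z. (if P (fst z) then ennreal ((norm (X (fst z) (snd z)))\<^sup>2) else 0) \<partial>N)"
    by (subst nn_integral_N') (auto cong: if_cong)
  finally show le: "(\<integral>\<^sup>+\<omega>. ennreal ((norm (\<integral>r. (if P r then X r \<omega> else 0) \<partial>lam))\<^sup>2) \<partial>M)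
        \<le> ennreal T * (\<integral>\<^sup>+z. (if P (fst z) then ennreal ((norm (X (fst z) (snd z)))\<^sup>2) else 0) \<partial>N)" .
  also have "\<dots> \<le> ennreal T * (\<integral>\<^sup>+z. ennreal ((norm (X (fst z) (snd z)))\<^sup>2) \<partial>N)"
    by (intro mult_left_mono nn_integral_mono) auto
  also have "\<dots> < \<infinity>"
  proof -
    have "(\<integral>\<^sup>+z. ennreal ((norm (X (fst z) (snd z)))\<^sup>2) \<partial>N) < \<infinity>" using X by (subst (asm) sqi_iff_nn_integral) auto
    then show ?thesis by (auto simp: ennreal_mult_less_top)
  qed
  finally show "sqi M (\<lambda>\<omega>. \<integral>r. (if P r then X r \<omega> else 0) \<partial>lam)"
    using m by (subst sqi_iff_nn_integral) auto
qed

lemma AE_sections_sqi: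
  fixes X :: "real \<Rightarrow> 'w \<Rightarrow> 'a::euclidean_space"
  assumes X: "sqi N (\<lambda>z. X (fst z) (snd z))"
  shows "AE \<omega> in M. sqi lam (\<lambda>r. X r \<omega>)"
proof -
  have Xm[measurable]: "(\<lambda>z. X (fst z) (snd z)) \<in> borel_measurable N" using X by (rule sqi_measurable)
  have "(\<integral>\<^sup>+\<omega>. \<integral>\<^sup>+r. ennreal ((norm (X r \<omega>))\<^sup>2) \<partial>lam \<partial>M) = (\<integral>\<^sup>+z. ennreal ((norm (X (fst z) (snd z)))\<^sup>2) \<partial>N)"
    by (subst nn_integral_N') auto
  also have "\<dots> < \<infinity>" using X by (subst (asm) sqi_iff_nn_integral) auto
  finally have fin: "(\<integral>\<^sup>+\<omega>. \<integral>\<^sup>+r. ennreal ((norm (X r \<omega>))\<^sup>2) \<partial>lam \<partial>M) < \<infinity>" .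
  have "(\<lambda>z. ennreal ((norm (X (fst z) (snd z)))\<^sup>2)) \<in> borel_measurable (lam \<Otimes>\<^sub>M M)"
    unfolding N_def[symmetric] by measurable
  then have "(\<lambda>(\<omega>, r). ennreal ((norm (X r \<omega>))\<^sup>2)) \<in> borel_measurable (M \<Otimes>\<^sub>M lam)"
    by (subst measurable_pair_swap_iff) (simp add: case_prod_beta')
  then have "(\<lambda>\<omega>. \<integral>\<^sup>+r. ennreal ((norm (X r \<omega>))\<^sup>2) \<partial>lam) \<in> borel_measurable M"
    by (rule lamM.M1.borel_measurable_nn_integral)
  then have "AE \<omega> in M. (\<integral>\<^sup>+r. ennreal ((norm (X r \<omega>))\<^sup>2) \<partial>lam) \<noteq> \<infinity>"
    by (rule nn_integral_noteq_infinite) (use fin in simp)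
  then show ?thesis using AE_space
  proof eventually_elim
    case (elim \<omega>)
    have "(\<lambda>r. (r, \<omega>)) \<in> measurable lam N" unfolding N_def using elim by (intro measurable_Pair) auto
    from measurable_compose[OF this Xm] have "(\<lambda>r. X r \<omega>) \<in> borel_measurable lam" by simp
    then show ?case using elim by (subst sqi_iff_nn_integral) (auto simp: less_top)
  qed
qed

text \<open>Block averages are formed path by path. Almost every path is in L2 of time, so its error
  tends to 0, and dominated convergence over the paths gives convergence over
  \<open>N\<close>.\<close>

lemma simple_approx:
  fixes H :: "real \<Rightarrow> 'w \<Rightarrow> 'a::euclidean_space"
  assumes H: "prog H" "sqi N (\<lambda>z. H (fst z) (snd z))" and e: "0 < e"
  shows "\<exists>ts m \<xi>. adm_simple M (aug_filtration M W) T ts m \<xi> \<and>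
     (\<integral>\<^sup>+z. ennreal ((norm (H (fst z) (snd z) - simple_proc ts m \<xi> (fst z) (snd z)))\<^sup>2) \<partial>N) < ennreal e"
proof -
  have Hm[measurable]: "(\<lambda>z. H (fst z) (snd z)) \<in> borel_measurable N" using H(2) by (rule sqi_measurable)
  \<comment> \<open>This step divides the time interval exactly into \<open>Suc n\<close> blocks, so
    that the last partition point is \<open>T\<close>.\<close>
  define d where "d n = T / real (Suc n)" for n
  have d: "0 < d n" for n using T by (simp add: d_def)
  have d0: "d \<longlonglongrightarrow> 0"
    using tendsto_mult_left[OF LIMSEQ_Suc[OF lim_1_over_n], of T] by (simp add: d_def[abs_def])
  define ts where "ts n i = real i * d n" for n i :: nat
  \<comment> \<open>The value on the block starting at \<open>ts n i\<close> averages over the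
    preceding block and is therefore known at \<open>ts n i\<close>. For \<open>i = 0\<close> the
    window meets the time interval only in the point 0, and the value is 0.\<close>
  define \<xi> where "\<xi> n i \<omega> = (1 / d n) *\<^sub>R (\<integral>r. (if ts n i - d n \<le> r \<and> r \<le> ts n i then H r \<omega> else 0) \<partial>lam)" for n i :: nat and \<omega>
  have ts_le: "ts n i \<le> T" if "i < Suc n" for n i
  proof -
    have "real i * d n \<le> real (Suc n) * d n" using that d[of n] by (intro mult_right_mono) auto
    then show ?thesis by (simp add: ts_def d_def)
  qed
  have \<xi>m: "\<xi> n i \<in> borel_measurable (Fs (ts n i))" if i: "i < Suc n" for n i
  proof -
    have t: "ts n i \<in> {0..T}" using ts_le[OF i] d[of n] by (auto simp: ts_def)
    have "(\<lambda>\<omega>. \<integral>r. (if (ts n i - d n \<le> r) \<and> r \<le> ts n i then H r \<omega> else 0) \<partial>lam) \<in> borel_measurable (Fs (ts n i))"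
    proof (rule prog_integral_measurable[OF H(1) t, of "\<lambda>x. x"])
      have [measurable]: "(\<lambda>x. x) \<in> borel_measurable (Rt (ts n i))" by (rule measurable_restrict_space1) simp
      show "Measurable.pred (Fs (ts n i) \<Otimes>\<^sub>M Rt (ts n i)) (\<lambda>z. ts n i - d n \<le> snd z)" by measurable
    qed simp
    then show ?thesis unfolding \<xi>_def by (intro borel_measurable_scaleR borel_measurable_const)
  qed
  have \<xi>s: "sqi M (\<xi> n i)" if i: "i < Suc n" for n i
  proof -
    have "(\<lambda>\<omega>. d n *\<^sub>R \<xi> n i \<omega>) \<in> borel_measurable M"
      using measurable_Fs_M[OF \<xi>m[OF i]] by (intro borel_measurable_scaleR borel_measurable_const)
    then have "(\<lambda>\<omega>. \<integral>r. (if ts n i - d n \<le> r \<and> r \<le> ts n i then H r \<omega> else 0) \<partial>lam) \<in> borel_measurable M"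
      unfolding \<xi>_def using d[of n] by simp
    from sqi_prog_integral(1)[OF H(2) this] show ?thesis unfolding \<xi>_def by (intro sqi_scaleR) measurable
  qed
  have ad: "adm_simple M (aug_filtration M W) T (ts n) (Suc n) (\<xi> n)" for n
    unfolding adm_simple_def
  proof (intro conjI allI impI)
    show "ts n 0 = 0" "ts n (Suc n) = T" by (auto simp: ts_def d_def)
    fix i assume i: "i < Suc n"
    show "ts n i < ts n (Suc i)" using d[of n] by (simp add: ts_def distrib_right)
    show "\<xi> n i \<in> borel_measurable (Fs (ts n i))" by (rule \<xi>m[OF i])
    show "(\<integral>\<^sup>+\<omega>. ennreal ((norm (\<xi> n i \<omega>))\<^sup>2) \<partial>M) < \<infinity>"
      using \<xi>s[OF i] sqi_iff_nn_integral[OF sqi_measurable[OF \<xi>s[OF i]]] by simp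
  qed
  \<comment> \<open>The last block is half-open, so \<open>T\<close> is excluded. For the other
    times the block containing \<open>s\<close> has index \<open>i\<close>, and
    \<open>ts n i\<close> is \<open>grid_floor (d n) s\<close>.\<close>
  have sp: "simple_proc (ts n) (Suc n) (\<xi> n) s \<omega> = avg (d n) (\<lambda>r. H r \<omega>) s" if s: "0 \<le> s" "s < T" for n s \<omega>
  proof -
    define i where "i = nat \<lfloor>s / d n\<rfloor>"
    have ri: "real i = of_int \<lfloor>s / d n\<rfloor>" using s d[of n] by (simp add: i_def)
    have "s / T < 1" using s T by simp
    then have "s / T * real (Suc n) < 1 * real (Suc n)" by (intro mult_strict_right_mono) auto
    then have "s / d n < real (Suc n)" by (simp add: d_def)
    then have iS: "i < Suc n" using ri by linarith
    have ind: "indicator {ts n k..<ts n (Suc k)} s = (if k = i then 1 else 0 :: real)" for k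
    proof -
      have "s \<in> {ts n k..<ts n (Suc k)} \<longleftrightarrow> real k \<le> s / d n \<and> s / d n < real k + 1"
        using d[of n] by (simp add: ts_def field_simps)
      also have "\<dots> \<longleftrightarrow> k = i" using ri by linarith
      finally show ?thesis by (simp add: indicator_def)
    qed
    have "simple_proc (ts n) (Suc n) (\<xi> n) s \<omega> = (\<Sum>k<Suc n. if k = i then \<xi> n k \<omega> else 0)"
      unfolding simple_proc_def ind by (intro sum.cong) auto
    also have "\<dots> = \<xi> n i \<omega>" using iS by (subst sum.delta) auto
    also have "\<dots> = avg (d n) (\<lambda>r. H r \<omega>) s"
      unfolding \<xi>_def avg_def grid_floor_def ts_def ri by (simp add: mult.commute)
    finally show ?thesis .
  qed
  define \<phi> where "\<phi> n \<omega> = (\<integral>\<^sup>+s. ennreal ((norm (H s \<omega> - simple_proc (ts n) (Suc n) (\<xi> n) s \<omega>))\<^sup>2) \<partial>lam)" for n \<omega>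
  have spm[measurable]: "(\<lambda>z. simple_proc (ts n) (Suc n) (\<xi> n) (fst z) (snd z)) \<in> borel_measurable N" for n
    using sqi_measurable[OF sqi_simple_proc[OF \<xi>s]] by (simp add: case_prod_beta')
  have swap: "(\<lambda>\<omega>. \<integral>\<^sup>+r. f (r, \<omega>) \<partial>lam) \<in> borel_measurable M" if "f \<in> borel_measurable N" for f :: "_ \<Rightarrow> ennreal"
  proof -
    have "(\<lambda>(\<omega>, r). f (r, \<omega>)) \<in> borel_measurable (M \<Otimes>\<^sub>M lam)"
      using that unfolding N_def by (subst measurable_pair_swap_iff) (simp add: case_prod_beta')
    then show ?thesis by (rule lamM.M1.borel_measurable_nn_integral)
  qed
  have m1: "(\<lambda>z. ennreal ((norm (H (fst z) (snd z) - simple_proc (ts n) (Suc n) (\<xi> n) (fst z) (snd z)))\<^sup>2)) \<in> borel_measurable N" for n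
    by measurable
  have \<phi>m: "\<phi> n \<in> borel_measurable M" for n
    using swap[OF m1[of n]] unfolding \<phi>_def by simp
  \<comment> \<open>The constant is \<open>2 + 2 * 2\<close>: the square of a difference doubles
    both parts, and averaging costs another factor 2.\<close>
  define w where "w \<omega> = 6 * (\<integral>\<^sup>+s. ennreal ((norm (H s \<omega>))\<^sup>2) \<partial>lam)" for \<omega>
  have m2: "(\<lambda>z. ennreal ((norm (H (fst z) (snd z)))\<^sup>2)) \<in> borel_measurable N" by measurable
  have wm: "w \<in> borel_measurable M" using swap[OF m2] unfolding w_def by simp
  have "(\<integral>\<^sup>+\<omega>. w \<omega> \<partial>M) = 6 * (\<integral>\<^sup>+z. ennreal ((norm (H (fst z) (snd z)))\<^sup>2) \<partial>N)"
    unfolding w_def using swap[OF m2] nn_integral_N'[OF m2] by (simp add: nn_integral_cmult)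
  also have "\<dots> < \<infinity>" using H(2) sqi_iff_nn_integral[OF Hm] by (auto simp: ennreal_mult_less_top)
  finally have wfin: "(\<integral>\<^sup>+\<omega>. w \<omega> \<partial>M) < \<infinity>" .
  have aeT: "AE s in lam. 0 \<le> s \<and> s < T"
  proof -
    have "AE s in lborel. s \<noteq> T" by (rule AE_lborel_singleton)
    then show ?thesis unfolding lam_def by (subst AE_restrict_space_iff) auto
  qed
  have main: "AE \<omega> in M. (\<forall>n. \<phi> n \<omega> \<le> w \<omega>) \<and> (\<lambda>n. \<phi> n \<omega>) \<longlonglongrightarrow> 0"
    using AE_sections_sqi[OF H(2)]
  proof eventually_elim
    case (elim \<omega>)
    let ?h = "\<lambda>r. H r \<omega>"
    have sa: "sqi lam (avg (d n) ?h)" for n by (rule sqi_avg(1)[OF elim d])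
    have sd: "sqi lam (\<lambda>s. ?h s - avg (d n) ?h s)" for n by (rule sqi_diff[OF elim sa])
    have eq: "\<phi> n \<omega> = ennreal (\<integral>s. (norm (?h s - avg (d n) ?h s))\<^sup>2 \<partial>lam)" for n
    proof -
      have "\<phi> n \<omega> = (\<integral>\<^sup>+s. ennreal ((norm (?h s - avg (d n) ?h s))\<^sup>2) \<partial>lam)"
        unfolding \<phi>_def by (rule nn_integral_cong_AE, rule AE_mp[OF aeT], rule AE_I2) (simp add: sp)
      also have "\<dots> = ennreal (\<integral>s. (norm (?h s - avg (d n) ?h s))\<^sup>2 \<partial>lam)"
        using sqi_norm2[OF sd[of n]] by (intro nn_integral_eq_integral) auto
      finally show ?thesis .
    qed
    have "w \<omega> = ennreal (6 * (\<integral>s. (norm (?h s))\<^sup>2 \<partial>lam))"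
      unfolding w_def using sqi_norm2[OF elim] by (subst nn_integral_eq_integral) (auto simp: ennreal_mult' ennreal_numeral)
    moreover have "(\<integral>s. (norm (?h s - avg (d n) ?h s))\<^sup>2 \<partial>lam) \<le> 6 * (\<integral>s. (norm (?h s))\<^sup>2 \<partial>lam)" for n
    proof -
      have "(\<integral>s. (norm (?h s - avg (d n) ?h s))\<^sup>2 \<partial>lam) \<le> (\<integral>s. 2 * (norm (?h s))\<^sup>2 + 2 * (norm (avg (d n) ?h s))\<^sup>2 \<partial>lam)"
        by (rule integral_mono) (use sqi_norm2[OF sd] sqi_norm2[OF sa] sqi_norm2[OF elim] norm_diff_power2_le in auto)
      also have "\<dots> = 2 * (\<integral>s. (norm (?h s))\<^sup>2 \<partial>lam) + 2 * (\<integral>s. (norm (avg (d n) ?h s))\<^sup>2 \<partial>lam)"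
        using sqi_norm2[OF sa] sqi_norm2[OF elim] by simp
      also have "\<dots> \<le> 6 * (\<integral>s. (norm (?h s))\<^sup>2 \<partial>lam)" using sqi_avg(2)[OF elim d[of n]] by simp
      finally show ?thesis .
    qed
    ultimately have "\<forall>n. \<phi> n \<omega> \<le> w \<omega>" unfolding eq by (simp add: ennreal_leI)
    moreover have "(\<lambda>n. \<phi> n \<omega>) \<longlonglongrightarrow> ennreal 0"
      unfolding eq by (rule tendsto_ennrealI[OF avg_L2_tendsto[OF elim d d0]])
    ultimately show ?case by simp
  qed
  have "(\<lambda>n. \<integral>\<^sup>+\<omega>. \<phi> n \<omega> \<partial>M) \<longlonglongrightarrow> (\<integral>\<^sup>+\<omega>. 0 \<partial>M)"
  proof (rule nn_integral_dominated_convergence[OF \<phi>m _ wm _ wfin])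
    show "AE \<omega> in M. \<phi> n \<omega> \<le> w \<omega>" for n using main by eventually_elim blast
    show "AE \<omega> in M. (\<lambda>n. \<phi> n \<omega>) \<longlonglongrightarrow> 0" using main by eventually_elim blast
  qed simp
  then have "eventually (\<lambda>n. (\<integral>\<^sup>+\<omega>. \<phi> n \<omega> \<partial>M) < ennreal e) sequentially"
    by (rule order_tendstoD) (use e in simp)
  then obtain n where n: "(\<integral>\<^sup>+\<omega>. \<phi> n \<omega> \<partial>M) < ennreal e" by (auto simp: eventually_sequentially)
  have "(\<integral>\<^sup>+z. ennreal ((norm (H (fst z) (snd z) - simple_proc (ts n) (Suc n) (\<xi> n) (fst z) (snd z)))\<^sup>2) \<partial>N) = (\<integral>\<^sup>+\<omega>. \<phi> n \<omega> \<partial>M)"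
    unfolding \<phi>_def by (subst nn_integral_N'[OF m1]) simp
  with n show ?thesis
    by (intro exI[of _ "ts n"] exI[of _ "Suc n"] exI[of _ "\<xi> n"] conjI ad) simp
qed

text \<open>The two processes live on different partitions, so the square of the difference is
  expanded into three pairings, each given by \<open>simple_pairing\<close>. They reassemble to the
  squared distance cut off at \<open>t\<close>.\<close>

lemma simple_ito_diff:
  fixes \<xi> \<xi>' :: "nat \<Rightarrow> 'w \<Rightarrow> 'a::euclidean_space"
  assumes ad: "adm_simple M (aug_filtration M W) T ts m \<xi>" and ad': "adm_simple M (aug_filtration M W) T ts' m' \<xi>'"
    and t: "t \<in> {0..T}"
  shows "(\<integral>\<omega>. (norm (simple_ito W j ts m \<xi> t \<omega> - simple_ito W j ts' m' \<xi>' t \<omega>))\<^sup>2 \<partial>M)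
    \<le> (\<integral>z. (norm (simple_proc ts m \<xi> (fst z) (snd z) - simple_proc ts' m' \<xi>' (fst z) (snd z)))\<^sup>2 \<partial>N)"
proof -
  have norm_eq: "(norm (x - y))\<^sup>2 = x \<bullet> x - 2 * (x \<bullet> y) + y \<bullet> y" for x y :: 'a
    by (simp add: power2_norm_eq_inner inner_diff_left inner_diff_right inner_commute)
  let ?a = "simple_ito W j ts m \<xi> t" and ?b = "simple_ito W j ts' m' \<xi>' t"
  let ?p = "\<lambda>z. simple_proc ts m \<xi> (fst z) (snd z)" and ?q = "\<lambda>z. simple_proc ts' m' \<xi>' (fst z) (snd z)"
  let ?i = "\<lambda>z. indicator {..min t t} (fst z) :: real"
  have s: "sqi M ?a" "sqi M ?b" using simple_ito_sqi[OF ad] simple_ito_sqi[OF ad'] t by auto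
  have p: "sqi N ?p" "sqi N ?q"
    using sqi_simple_proc[OF adm_simpleD(4)[OF ad]] sqi_simple_proc[OF adm_simpleD(4)[OF ad']] by (simp_all add: case_prod_beta')
  have ip: "sqi N (\<lambda>z. ?i z *\<^sub>R ?p z)" "sqi N (\<lambda>z. ?i z *\<^sub>R ?q z)" by (intro sqi_indicator p; simp)+
  note SP = simple_pairing[OF _ _ t t, of _ _ _ _ _ _ j j, unfolded if_P[OF refl]]
  have "(\<integral>\<omega>. (norm (?a \<omega> - ?b \<omega>))\<^sup>2 \<partial>M) = (\<integral>\<omega>. ?a \<omega> \<bullet> ?a \<omega> \<partial>M) - 2 * (\<integral>\<omega>. ?a \<omega> \<bullet> ?b \<omega> \<partial>M) + (\<integral>\<omega>. ?b \<omega> \<bullet> ?b \<omega> \<partial>M)"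
    unfolding norm_eq using sqi_inner[OF s(1) s(1)] sqi_inner[OF s(1) s(2)] sqi_inner[OF s(2) s(2)] by simp
  also have "\<dots> = (\<integral>z. (?i z *\<^sub>R ?p z) \<bullet> ?p z \<partial>N) - 2 * (\<integral>z. (?i z *\<^sub>R ?p z) \<bullet> ?q z \<partial>N) + (\<integral>z. (?i z *\<^sub>R ?q z) \<bullet> ?q z \<partial>N)"
    unfolding SP[OF ad ad] SP[OF ad ad'] SP[OF ad' ad'] ..
  also have "\<dots> = (\<integral>z. (?i z *\<^sub>R ?p z) \<bullet> ?p z - 2 * ((?i z *\<^sub>R ?p z) \<bullet> ?q z) + (?i z *\<^sub>R ?q z) \<bullet> ?q z \<partial>N)"
    using sqi_inner[OF ip(1) p(1)] sqi_inner[OF ip(1) p(2)] sqi_inner[OF ip(2) p(2)]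
    by (simp del: inner_scaleR_left)
  also have "\<dots> \<le> (\<integral>z. (norm (?p z - ?q z))\<^sup>2 \<partial>N)"
  proof (rule integral_mono)
    show "integrable N (\<lambda>z. (?i z *\<^sub>R ?p z) \<bullet> ?p z - 2 * ((?i z *\<^sub>R ?p z) \<bullet> ?q z) + (?i z *\<^sub>R ?q z) \<bullet> ?q z)"
      using sqi_inner[OF ip(1) p(1)] sqi_inner[OF ip(1) p(2)] sqi_inner[OF ip(2) p(2)]
      by (simp del: inner_scaleR_left)
    show "integrable N (\<lambda>z. (norm (?p z - ?q z))\<^sup>2)" by (rule sqi_norm2[OF sqi_diff[OF p]])
    fix z
    show "(?i z *\<^sub>R ?p z) \<bullet> ?p z - 2 * ((?i z *\<^sub>R ?p z) \<bullet> ?q z) + (?i z *\<^sub>R ?q z) \<bullet> ?q z \<le> (norm (?p z - ?q z))\<^sup>2"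
    proof (cases "fst z \<le> t")
      case True
      then show ?thesis unfolding norm_eq by (simp add: indicator_def)
    next
      case False
      then show ?thesis by (simp add: indicator_def)
    qed
  qed
  finally show ?thesis .
qed

text \<open>Along a rapidly convergent sequence the elementary integrals converge almost surely for each
  fixed time, so their pointwise limit is a progressive version; no maximal inequality is needed.\<close>

theorem ito_exists:
  fixes H :: "real \<Rightarrow> 'w \<Rightarrow> 'a::euclidean_space"
  assumes H: "prog H" "sqi N (\<lambda>z. H (fst z) (snd z))"
  shows "\<exists>I. is_ito M (aug_filtration M W) W j T H I \<and> prog I"
proof -
  have Hm: "(\<lambda>z. H (fst z) (snd z)) \<in> borel_measurable N" using H(2) by (rule sqi_measurable)
  let ?Q = "\<lambda>k p. adm_simple M (aug_filtration M W) T (fst p) (fst (snd p)) (snd (snd p)) \<and>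
     (\<integral>\<^sup>+z. ennreal ((norm (H (fst z) (snd z) - simple_proc (fst p) (fst (snd p)) (snd (snd p)) (fst z) (snd z)))\<^sup>2) \<partial>N) < ennreal ((1/4)^k)"
  have "\<exists>p. ?Q k p" for k :: nat
  proof -
    obtain ts m \<xi> where "adm_simple M (aug_filtration M W) T ts m \<xi>"
      "(\<integral>\<^sup>+z. ennreal ((norm (H (fst z) (snd z) - simple_proc ts m \<xi> (fst z) (snd z)))\<^sup>2) \<partial>N) < ennreal ((1/4)^k)"
      using simple_approx[OF H, of "(1/4)^k"] by auto
    then show ?thesis by (intro exI[of _ "(ts, m, \<xi>)"]) simp
  qed
  then obtain p where p: "?Q k (p k)" for k by (rule that[OF someI_ex])
  define ts m \<xi> where "ts k = fst (p k)" and "m k = fst (snd (p k))" and "\<xi> k = snd (snd (p k))" for k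
  have ad: "adm_simple M (aug_filtration M W) T (ts k) (m k) (\<xi> k)"
    and ap: "(\<integral>\<^sup>+z. ennreal ((norm (H (fst z) (snd z) - simple_proc (ts k) (m k) (\<xi> k) (fst z) (snd z)))\<^sup>2) \<partial>N) < ennreal ((1/4)^k)" for k
    using p[of k] unfolding ts_def m_def \<xi>_def by blast+
  define P where "P k z = simple_proc (ts k) (m k) (\<xi> k) (fst z) (snd z)" for k z
  define S where "S k = simple_ito W j (ts k) (m k) (\<xi> k)" for k
  have Ps: "sqi N (P k)" for k
    using sqi_simple_proc[OF adm_simpleD(4)[OF ad[of k]]] by (simp add: P_def[abs_def] case_prod_beta')
  have sd: "sqi N (\<lambda>z. H (fst z) (snd z) - P k z)" for k by (rule sqi_diff[OF H(2) Ps])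
  have ap': "(\<integral>z. (norm (H (fst z) (snd z) - P k z))\<^sup>2 \<partial>N) \<le> (1/4)^k" for k
  proof -
    have "ennreal (\<integral>z. (norm (H (fst z) (snd z) - P k z))\<^sup>2 \<partial>N) = (\<integral>\<^sup>+z. ennreal ((norm (H (fst z) (snd z) - P k z))\<^sup>2) \<partial>N)"
      using sqi_norm2[OF sd] by (intro nn_integral_eq_integral[symmetric]) auto
    also have "\<dots> \<le> ennreal ((1/4)^k)" using ap[of k] by (simp add: P_def)
    finally show ?thesis by simp
  qed
  have Ss: "t \<in> {0..T} \<Longrightarrow> sqi M (S k t)" for k t unfolding S_def using simple_ito_sqi[OF ad] by simp
  \<comment> \<open>Both approximants are compared with \<open>H\<close>; each error enters with
    factor 2, and the one for \<open>l\<close> is at most \<open>(1/4)^k\<close>, whence the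
    constant 4.\<close>
  have cau: "(\<integral>\<^sup>+\<omega>. ennreal ((norm (S l t \<omega> - S k t \<omega>))\<^sup>2) \<partial>M) \<le> ennreal (4 * (1/4)^k)"
    if t: "t \<in> {0..T}" and kl: "k \<le> l" for t k l
  proof -
    have "(\<integral>\<^sup>+\<omega>. ennreal ((norm (S l t \<omega> - S k t \<omega>))\<^sup>2) \<partial>M) = ennreal (\<integral>\<omega>. (norm (S l t \<omega> - S k t \<omega>))\<^sup>2 \<partial>M)"
      using sqi_norm2[OF sqi_diff[OF Ss[OF t] Ss[OF t]]] by (intro nn_integral_eq_integral) auto
    also have "(\<integral>\<omega>. (norm (S l t \<omega> - S k t \<omega>))\<^sup>2 \<partial>M) \<le> (\<integral>z. (norm (P l z - P k z))\<^sup>2 \<partial>N)"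
      unfolding S_def P_def by (rule simple_ito_diff[OF ad ad t])
    also have "\<dots> \<le> (\<integral>z. 2 * (norm (H (fst z) (snd z) - P k z))\<^sup>2 + 2 * (norm (H (fst z) (snd z) - P l z))\<^sup>2 \<partial>N)"
    proof (rule integral_mono)
      show "(norm (P l z - P k z))\<^sup>2 \<le> 2 * (norm (H (fst z) (snd z) - P k z))\<^sup>2 + 2 * (norm (H (fst z) (snd z) - P l z))\<^sup>2" for z
        using norm_diff_power2_le[of "H (fst z) (snd z) - P k z" "H (fst z) (snd z) - P l z"] by simp
    qed (use sqi_norm2[OF sd] sqi_norm2[OF sqi_diff[OF Ps Ps]] in auto)
    also have "\<dots> \<le> 2 * (1/4)^k + 2 * (1/4)^l" using sqi_norm2[OF sd] ap'[of k] ap'[of l] by simp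
    also have "\<dots> \<le> 4 * (1/4)^k" using power_decreasing[OF kl, of "1/4 :: real"] by simp
    finally show ?thesis by (simp add: ennreal_leI)
  qed
  \<comment> \<open>One formula for all times and outcomes: this is what makes the process
    progressive. At each time the sequence diverges at most on a null set.\<close>
  define I where "I t \<omega> = lim (\<lambda>k. S k t \<omega>)" for t \<omega>
  have I_lim: "(\<integral>\<^sup>+\<omega>. ennreal ((norm (I t \<omega> - S k t \<omega>))\<^sup>2) \<partial>M) \<le> ennreal (4 * (1/4)^k)" if t: "t \<in> {0..T}" for t k
    unfolding I_def
    by (rule rapidly_Cauchy_limit[OF finite_measure_axioms sqi_measurable[OF Ss[OF t]] cau[OF t]])
  have "prog I"
    unfolding I_def[abs_def] S_def by (intro prog_lim prog_simple_ito ad)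
  moreover have "is_ito M (aug_filtration M W) W j T H I"
    unfolding is_ito_def
  proof (intro conjI exI[of _ ts] exI[of _ m] exI[of _ \<xi>] allI ballI ad)
    show "I t \<in> borel_measurable M" if "t \<in> {0..T}" for t by (rule prog_measurable_M[OF \<open>prog I\<close> that])
    have l4: "(\<lambda>k. ennreal (c * (1/4)^k)) \<longlonglongrightarrow> 0" for c
    proof -
      have "(\<lambda>k. c * (1/4)^k) \<longlonglongrightarrow> c * 0" by (intro tendsto_mult_left LIMSEQ_power_zero) simp
      from tendsto_ennrealI[OF this] show ?thesis by simp
    qed
    have "(\<lambda>(s, \<omega>). H s \<omega> - simple_proc (ts k) (m k) (\<xi> k) s \<omega>) \<in> borel_measurable N" for k
      using Hm sqi_measurable[OF Ps[of k]] by (simp add: P_def[abs_def] case_prod_beta')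
    note np = nn_integral_process[OF this]
    show "(\<lambda>k. \<integral>\<^sup>+\<omega>. (\<integral>\<^sup>+s. indicator {0..T} s *
              ennreal ((norm (H s \<omega> - simple_proc (ts k) (m k) (\<xi> k) s \<omega>))\<^sup>2) \<partial>lborel) \<partial>M) \<longlonglongrightarrow> 0"
      unfolding np
      by (rule tendsto_sandwich[OF _ _ tendsto_const l4[of 1]])
         (use ap in \<open>auto intro!: always_eventually less_imp_le\<close>)
    show "(\<lambda>k. \<integral>\<^sup>+\<omega>. ennreal ((norm (I t \<omega> - simple_ito W j (ts k) (m k) (\<xi> k) t \<omega>))\<^sup>2) \<partial>M) \<longlonglongrightarrow> 0" if "t \<in> {0..T}" for t
      by (rule tendsto_sandwich[OF _ _ tendsto_const l4[of 4]])
         (use I_lim[OF that] in \<open>auto intro!: always_eventually simp: S_def\<close>)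
  qed
  ultimately show ?thesis by blast
qed

section \<open>Ito processes\<close>

abbreviation L2 :: "(real \<Rightarrow> 'w \<Rightarrow> 'a::euclidean_space) \<Rightarrow> bool" where
  "L2 X \<equiv> L2F M (aug_filtration M W) T X"

abbreviation ito :: "'d \<Rightarrow> (real \<Rightarrow> 'w \<Rightarrow> 'a::euclidean_space) \<Rightarrow> (real \<Rightarrow> 'w \<Rightarrow> 'a) \<Rightarrow> bool" where
  "ito j H I \<equiv> is_ito M (aug_filtration M W) W j T H I"

lemma L2_prog: "L2 X \<Longrightarrow> prog X" and L2_sqi: "L2 X \<Longrightarrow> sqi N (\<lambda>z. X (fst z) (snd z))"
  by (auto simp: L2F_iff)

section \<open>Closure properties of progressive and square-integrable processes\<close>

lemma prog_add:
  fixes X Y :: "real \<Rightarrow> 'w \<Rightarrow> 'a::euclidean_space"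
  shows "prog X \<Longrightarrow> prog Y \<Longrightarrow> prog (\<lambda>s \<omega>. X s \<omega> + Y s \<omega>)"
  by (rule progI, rule borel_measurable_add) (blast intro: progD)+

lemma prog_scaleR:
  fixes X :: "real \<Rightarrow> 'w \<Rightarrow> 'a::euclidean_space"
  shows "prog X \<Longrightarrow> prog (\<lambda>s \<omega>. c *\<^sub>R X s \<omega>)"
  by (rule progI, rule borel_measurable_scaleR[OF borel_measurable_const]) (blast intro: progD)

lemma prog_const: "prog (\<lambda>s \<omega>. c)"
  by (intro progI) simp

lemma prog_sum:
  fixes X :: "'i \<Rightarrow> real \<Rightarrow> 'w \<Rightarrow> 'a::euclidean_space"
  shows "(\<And>i. i \<in> I \<Longrightarrow> prog (X i)) \<Longrightarrow> prog (\<lambda>s \<omega>. \<Sum>i\<in>I. X i s \<omega>)"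
  by (rule progI, rule borel_measurable_sum) (blast intro: progD)

lemma L2_add: "L2 X \<Longrightarrow> L2 Y \<Longrightarrow> L2 (\<lambda>s \<omega>. X s \<omega> + Y s \<omega>)"
  by (simp add: L2F_iff prog_add sqi_add)

lemma L2_scaleR: "L2 X \<Longrightarrow> L2 (\<lambda>s \<omega>. c *\<^sub>R X s \<omega>)"
  by (simp add: L2F_iff prog_scaleR sqi_scaleR)

lemma L2_lincomb: "L2 X \<Longrightarrow> L2 Y \<Longrightarrow> L2 (\<lambda>s \<omega>. X s \<omega> + c *\<^sub>R Y s \<omega>)"
  by (intro L2_add L2_scaleR)

lemma L2_sum: "(\<And>i. i \<in> I \<Longrightarrow> L2 (X i)) \<Longrightarrow> L2 (\<lambda>s \<omega>. \<Sum>i\<in>I. X i s \<omega>)"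
  by (simp add: L2F_iff prog_sum sqi_sum)

lemma L2_zero: "L2 (\<lambda>s \<omega>. 0)"
  by (simp add: L2F_iff prog_const)

lemma ito_cong_AE:
  assumes ito: "ito j H I" and I': "\<And>t. t \<in> {0..T} \<Longrightarrow> I' t \<in> borel_measurable M"
    and ae: "\<And>t. t \<in> {0..T} \<Longrightarrow> AE \<omega> in M. I t \<omega> = I' t \<omega>"
  shows "ito j H I'"
proof -
  have "(\<integral>\<^sup>+\<omega>. ennreal ((norm (I t \<omega> - f \<omega>))\<^sup>2) \<partial>M) = (\<integral>\<^sup>+\<omega>. ennreal ((norm (I' t \<omega> - f \<omega>))\<^sup>2) \<partial>M)" if "t \<in> {0..T}" for t f
    by (rule nn_integral_cong_AE) (use ae[OF that] in \<open>auto elim: eventually_mono\<close>)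
  then show ?thesis using ito I' unfolding is_ito_def by auto
qed

lemma ito_measurable: "ito j H I \<Longrightarrow> t \<in> {0..T} \<Longrightarrow> I t \<in> borel_measurable M"
  by (simp add: is_ito_def)

text \<open>The same approximating sequence serves both integrands. This is what lets a fixed point
  known only almost everywhere be substituted into the state equation.\<close>

lemma ito_cong_integrand:
  fixes H H' :: "real \<Rightarrow> 'w \<Rightarrow> 'a::euclidean_space"
  assumes ito: "ito j H I" and H: "L2 H" "L2 H'"
    and ae: "AE z in N. H (fst z) (snd z) = H' (fst z) (snd z)"
  shows "ito j H' I"
proof -
  obtain ts m \<xi> where ad: "\<And>k. adm_simple M (aug_filtration M W) T (ts k) (m k) (\<xi> k)"
    and l1: "(\<lambda>k. \<integral>\<^sup>+\<omega>. (\<integral>\<^sup>+s. indicator {0..T} s *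
              ennreal ((norm (H s \<omega> - simple_proc (ts k) (m k) (\<xi> k) s \<omega>))\<^sup>2) \<partial>lborel) \<partial>M) \<longlonglongrightarrow> 0"
    and l2: "\<And>t. t \<in> {0..T} \<Longrightarrow> (\<lambda>k. \<integral>\<^sup>+\<omega>. ennreal ((norm (I t \<omega> - simple_ito W j (ts k) (m k) (\<xi> k) t \<omega>))\<^sup>2) \<partial>M) \<longlonglongrightarrow> 0"
    and Im: "\<And>t. t \<in> {0..T} \<Longrightarrow> I t \<in> borel_measurable M"
    using ito unfolding is_ito_def by blast
  have sp: "(\<lambda>z. simple_proc (ts k) (m k) (\<xi> k) (fst z) (snd z)) \<in> borel_measurable N" for k
    using sqi_measurable[OF sqi_simple_proc[OF adm_simpleD(4)[OF ad[of k]]]] by (simp add: case_prod_beta')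
  have m: "(\<lambda>(s, \<omega>). H s \<omega> - simple_proc (ts k) (m k) (\<xi> k) s \<omega>) \<in> borel_measurable N"
     "(\<lambda>(s, \<omega>). H' s \<omega> - simple_proc (ts k) (m k) (\<xi> k) s \<omega>) \<in> borel_measurable N" for k
    using sqi_measurable[OF L2_sqi[OF H(1)]] sqi_measurable[OF L2_sqi[OF H(2)]] sp[of k] by (auto simp: case_prod_beta')
  have "(\<integral>\<^sup>+z. ennreal ((norm (H (fst z) (snd z) - simple_proc (ts k) (m k) (\<xi> k) (fst z) (snd z)))\<^sup>2) \<partial>N)
      = (\<integral>\<^sup>+z. ennreal ((norm (H' (fst z) (snd z) - simple_proc (ts k) (m k) (\<xi> k) (fst z) (snd z)))\<^sup>2) \<partial>N)" for k
    by (rule nn_integral_cong_AE) (use ae in \<open>auto elim: eventually_mono\<close>)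
  then have "(\<integral>\<^sup>+\<omega>. (\<integral>\<^sup>+s. indicator {0..T} s * ennreal ((norm (H s \<omega> - simple_proc (ts k) (m k) (\<xi> k) s \<omega>))\<^sup>2) \<partial>lborel) \<partial>M)
      = (\<integral>\<^sup>+\<omega>. (\<integral>\<^sup>+s. indicator {0..T} s * ennreal ((norm (H' s \<omega> - simple_proc (ts k) (m k) (\<xi> k) s \<omega>))\<^sup>2) \<partial>lborel) \<partial>M)" for k
    unfolding nn_integral_process[OF m(1)] nn_integral_process[OF m(2)] .
  from l1[unfolded this] show ?thesis
    unfolding is_ito_def using ad l2 Im by blast
qed

lemma ito_pairing_same:
  fixes H H' :: "real \<Rightarrow> 'w \<Rightarrow> 'a::euclidean_space"
  assumes "ito j H I" "sqi N (\<lambda>z. H (fst z) (snd z))" "ito j H' I'" "sqi N (\<lambda>z. H' (fst z) (snd z))"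
    "t \<in> {0..T}" "t' \<in> {0..T}"
  shows "(\<integral>\<omega>. I t \<omega> \<bullet> I' t' \<omega> \<partial>M) = (\<integral>z. (indicator {..min t t'} (fst z) *\<^sub>R H (fst z) (snd z)) \<bullet> H' (fst z) (snd z) \<partial>N)"
  using ito_pairing[OF assms] by (simp only: simp_thms if_True)

text \<open>Linearity without refining partitions: some integral of the combination exists, and the
  isometry identifies it with the combination of the two integrals.\<close>

lemma ito_lincomb:
  fixes H1 H2 :: "real \<Rightarrow> 'w \<Rightarrow> 'a::euclidean_space"
  assumes i1: "ito j H1 I1" and i2: "ito j H2 I2" and H: "L2 H1" "L2 H2"
  shows "ito j (\<lambda>s \<omega>. H1 s \<omega> + c *\<^sub>R H2 s \<omega>) (\<lambda>t \<omega>. I1 t \<omega> + c *\<^sub>R I2 t \<omega>)"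
proof -
  let ?H = "\<lambda>s \<omega>. H1 s \<omega> + c *\<^sub>R H2 s \<omega>"
  have H3: "L2 ?H" by (rule L2_lincomb[OF H])
  note s1 = L2_sqi[OF H(1)] and s2 = L2_sqi[OF H(2)] and s3 = L2_sqi[OF H3]
  obtain K where K: "ito j ?H K" using ito_exists[OF L2_prog[OF H3] s3] by blast
  have "AE \<omega> in M. K t \<omega> = I1 t \<omega> + c *\<^sub>R I2 t \<omega>" if t: "t \<in> {0..T}" for t
  proof -
    have sq: "sqi M (K t)" "sqi M (I1 t)" "sqi M (I2 t)"
      using ito_sqi[OF K s3 t] ito_sqi[OF i1 s1 t] ito_sqi[OF i2 s2 t] by auto
    define D where "D \<omega> = K t \<omega> - (I1 t \<omega> + c *\<^sub>R I2 t \<omega>)" for \<omega>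
    have Ds: "sqi M D" unfolding D_def by (intro sqi_diff sqi_add sqi_scaleR sq)
    \<comment> \<open>\<open>V\<close> ranges over all integrals with respect to component
      \<open>j\<close>. By the isometry, the integral of the combination and the combination of the
      integrals have the same inner product with each of them.\<close>
    have orth: "(\<integral>\<omega>. D \<omega> \<bullet> V t \<omega> \<partial>M) = 0" if V: "ito j G V" and G: "L2 G" for G V
    proof -
      let ?i = "\<lambda>z. indicator {..min t t} (fst z) :: real"
      note sG = L2_sqi[OF G] and sV = ito_sqi[OF V L2_sqi[OF G] t]
      have ii: "sqi N (\<lambda>z. ?i z *\<^sub>R H1 (fst z) (snd z))" "sqi N (\<lambda>z. ?i z *\<^sub>R H2 (fst z) (snd z))"
        by (intro sqi_indicator s1 s2; simp)+
      note PA = ito_pairing_same[OF _ _ V sG t t]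
      have "(\<integral>\<omega>. K t \<omega> \<bullet> V t \<omega> \<partial>M) = (\<integral>z. (?i z *\<^sub>R H1 (fst z) (snd z)) \<bullet> G (fst z) (snd z) + c * ((?i z *\<^sub>R H2 (fst z) (snd z)) \<bullet> G (fst z) (snd z)) \<partial>N)"
        unfolding PA[OF K s3] by (intro Bochner_Integration.integral_cong) (auto simp: inner_add_left algebra_simps)
      also have "\<dots> = (\<integral>z. (?i z *\<^sub>R H1 (fst z) (snd z)) \<bullet> G (fst z) (snd z) \<partial>N) + c * (\<integral>z. (?i z *\<^sub>R H2 (fst z) (snd z)) \<bullet> G (fst z) (snd z) \<partial>N)"
        using sqi_inner[OF ii(1) sG] sqi_inner[OF ii(2) sG] by (simp del: inner_scaleR_left)
      also have "\<dots> = (\<integral>\<omega>. I1 t \<omega> \<bullet> V t \<omega> \<partial>M) + c * (\<integral>\<omega>. I2 t \<omega> \<bullet> V t \<omega> \<partial>M)"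
        unfolding PA[OF i1 s1] PA[OF i2 s2] ..
      finally have eq: "(\<integral>\<omega>. K t \<omega> \<bullet> V t \<omega> \<partial>M) = (\<integral>\<omega>. I1 t \<omega> \<bullet> V t \<omega> \<partial>M) + c * (\<integral>\<omega>. I2 t \<omega> \<bullet> V t \<omega> \<partial>M)" .
      have "(\<integral>\<omega>. D \<omega> \<bullet> V t \<omega> \<partial>M) = (\<integral>\<omega>. K t \<omega> \<bullet> V t \<omega> - (I1 t \<omega> \<bullet> V t \<omega> + c * (I2 t \<omega> \<bullet> V t \<omega>)) \<partial>M)"
        unfolding D_def by (intro Bochner_Integration.integral_cong) (auto simp: inner_diff_left inner_add_left)
      also have "\<dots> = (\<integral>\<omega>. K t \<omega> \<bullet> V t \<omega> \<partial>M) - ((\<integral>\<omega>. I1 t \<omega> \<bullet> V t \<omega> \<partial>M) + c * (\<integral>\<omega>. I2 t \<omega> \<bullet> V t \<omega> \<partial>M))"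
        using sqi_inner[OF sq(1) sV] sqi_inner[OF sq(2) sV] sqi_inner[OF sq(3) sV] by simp
      finally show ?thesis using eq by simp
    qed
    \<comment> \<open>\<open>D\<close> is itself built from three integrals with respect to
      component \<open>j\<close>, so its squared norm is a combination of vanishing
      pairings.\<close>
    have "(\<integral>\<omega>. (norm (D \<omega>))\<^sup>2 \<partial>M) = (\<integral>\<omega>. D \<omega> \<bullet> K t \<omega> - (D \<omega> \<bullet> I1 t \<omega> + c * (D \<omega> \<bullet> I2 t \<omega>)) \<partial>M)"
    proof (intro Bochner_Integration.integral_cong refl)
      fix \<omega>
      have "D \<omega> \<bullet> D \<omega> = D \<omega> \<bullet> (K t \<omega> - (I1 t \<omega> + c *\<^sub>R I2 t \<omega>))" by (simp add: D_def)
      then show "(norm (D \<omega>))\<^sup>2 = D \<omega> \<bullet> K t \<omega> - (D \<omega> \<bullet> I1 t \<omega> + c * (D \<omega> \<bullet> I2 t \<omega>))"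
        unfolding power2_norm_eq_inner by (simp add: inner_diff_right inner_add_right)
    qed
    also have "\<dots> = 0"
      using sqi_inner[OF Ds sq(1)] sqi_inner[OF Ds sq(2)] sqi_inner[OF Ds sq(3)]
        orth[OF K H3] orth[OF i1 H(1)] orth[OF i2 H(2)] by simp
    finally have "AE \<omega> in M. D \<omega> = 0" by (rule sqi_AE_zero[OF Ds])
    then show ?thesis by (simp add: D_def)
  qed
  note eq = this
  show ?thesis
  proof (rule ito_cong_AE[OF K])
    fix t assume t: "t \<in> {0..T}"
    show "(\<lambda>\<omega>. I1 t \<omega> + c *\<^sub>R I2 t \<omega>) \<in> borel_measurable M"
      using ito_measurable[OF i1 t] ito_measurable[OF i2 t] by measurable
  qed (rule eq)
qed

lemma ito_isometry:
  fixes H :: "real \<Rightarrow> 'w \<Rightarrow> 'a::euclidean_space"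
  assumes I: "ito j H I" and H: "L2 H" and t: "t \<in> {0..T}"
  shows "(\<integral>\<^sup>+\<omega>. ennreal ((norm (I t \<omega>))\<^sup>2) \<partial>M) = (\<integral>\<^sup>+z. (if fst z \<le> t then ennreal ((norm (H (fst z) (snd z)))\<^sup>2) else 0) \<partial>N)"
proof -
  note sH = L2_sqi[OF H]
  let ?i = "\<lambda>z. indicator {..min t t} (fst z) :: real"
  have si: "sqi N (\<lambda>z. ?i z *\<^sub>R H (fst z) (snd z))" by (intro sqi_indicator sH) simp
  have "(\<integral>\<^sup>+\<omega>. ennreal ((norm (I t \<omega>))\<^sup>2) \<partial>M) = ennreal (\<integral>\<omega>. (norm (I t \<omega>))\<^sup>2 \<partial>M)"
    using sqi_norm2[OF ito_sqi[OF I sH t]] by (intro nn_integral_eq_integral) auto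
  also have "(\<integral>\<omega>. (norm (I t \<omega>))\<^sup>2 \<partial>M) = (\<integral>z. (?i z *\<^sub>R H (fst z) (snd z)) \<bullet> H (fst z) (snd z) \<partial>N)"
    unfolding power2_norm_eq_inner by (rule ito_pairing_same[OF I sH I sH t t])
  also have "\<dots> = (\<integral>z. (norm (?i z *\<^sub>R H (fst z) (snd z)))\<^sup>2 \<partial>N)"
    by (intro Bochner_Integration.integral_cong) (auto simp: indicator_def power2_norm_eq_inner)
  also have "ennreal \<dots> = (\<integral>\<^sup>+z. ennreal ((norm (?i z *\<^sub>R H (fst z) (snd z)))\<^sup>2) \<partial>N)"
    using sqi_norm2[OF si] by (intro nn_integral_eq_integral[symmetric]) auto
  also have "\<dots> = (\<integral>\<^sup>+z. (if fst z \<le> t then ennreal ((norm (H (fst z) (snd z)))\<^sup>2) else 0) \<partial>N)"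
    by (intro nn_integral_cong) (auto simp: indicator_def)
  finally show ?thesis .
qed

text \<open>Drift \<open>a\<close> and diffusions \<open>H\<close> are recorded separately from
  \<open>V\<close>, so that one predicate covers both a Picard step, whose coefficients come from
  the previous iterate, and a solution, whose coefficients come from \<open>V\<close> itself. As in
  \<open>is_state\<close>, the equation holds almost surely at each fixed time.\<close>

definition ito_process :: "'a \<Rightarrow> (real \<Rightarrow> 'w \<Rightarrow> 'a) \<Rightarrow> ('d \<Rightarrow> real \<Rightarrow> 'w \<Rightarrow> 'a) \<Rightarrow> (real \<Rightarrow> 'w \<Rightarrow> 'a::euclidean_space) \<Rightarrow> bool" where
  "ito_process y a H V \<longleftrightarrow> (\<exists>I. (\<forall>j. ito j (H j) (I j)) \<and>
     (\<forall>t\<in>{0..T}. AE \<omega> in M. V t \<omega> = y + running_integral a t \<omega> + (\<Sum>j\<in>UNIV. I j t \<omega>)))"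

lemma running_integral_lincomb:
  assumes "integrable lam (\<lambda>r. a r \<omega>)" "integrable lam (\<lambda>r. a' r \<omega>)"
  shows "running_integral (\<lambda>s \<omega>. a s \<omega> + c *\<^sub>R a' s \<omega>) t \<omega> = running_integral a t \<omega> + c *\<^sub>R running_integral a' t \<omega>"
proof -
  have i: "integrable lam (\<lambda>r. if r \<le> t then f r else 0 :: 'b)" if "integrable lam f" for f :: "real \<Rightarrow> 'b::euclidean_space"
  proof -
    have [measurable]: "f \<in> borel_measurable lam" using that by simp
    show ?thesis by (rule Bochner_Integration.integrable_bound[OF that]) auto
  qed
  have "running_integral (\<lambda>s \<omega>. a s \<omega> + c *\<^sub>R a' s \<omega>) t \<omega> = (\<integral>r. (if r \<le> t then a r \<omega> else 0) + c *\<^sub>R (if r \<le> t then a' r \<omega> else 0) \<partial>lam)"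
    unfolding running_integral_def by (intro Bochner_Integration.integral_cong) auto
  also have "\<dots> = running_integral a t \<omega> + c *\<^sub>R running_integral a' t \<omega>"
    unfolding running_integral_def using i[OF assms(1)] i[OF assms(2)] by simp
  finally show ?thesis .
qed

lemma AE_section_integrable:
  fixes X :: "real \<Rightarrow> 'w \<Rightarrow> 'a::euclidean_space"
  assumes "L2 X"
  shows "AE \<omega> in M. integrable lam (\<lambda>r. X r \<omega>)"
  using AE_sections_sqi[OF L2_sqi[OF assms]] by eventually_elim (rule sqi_integrable[OF lam_finite])

lemma ito_process_lincomb:
  assumes V: "ito_process y a H V" and V': "ito_process y' a' H' V'"
    and L2: "L2 a" "L2 a'" "\<And>j. L2 (H j)" "\<And>j. L2 (H' j)"
  shows "ito_process (y + c *\<^sub>R y') (\<lambda>s \<omega>. a s \<omega> + c *\<^sub>R a' s \<omega>) (\<lambda>j s \<omega>. H j s \<omega> + c *\<^sub>R H' j s \<omega>) (\<lambda>s \<omega>. V s \<omega> + c *\<^sub>R V' s \<omega>)"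
proof -
  obtain I where I: "\<And>j. ito j (H j) (I j)" "\<And>t. t \<in> {0..T} \<Longrightarrow> AE \<omega> in M. V t \<omega> = y + running_integral a t \<omega> + (\<Sum>j\<in>UNIV. I j t \<omega>)"
    using V unfolding ito_process_def by blast
  obtain I' where I': "\<And>j. ito j (H' j) (I' j)" "\<And>t. t \<in> {0..T} \<Longrightarrow> AE \<omega> in M. V' t \<omega> = y' + running_integral a' t \<omega> + (\<Sum>j\<in>UNIV. I' j t \<omega>)"
    using V' unfolding ito_process_def by blast
  show ?thesis unfolding ito_process_def
  proof (intro exI[of _ "\<lambda>j t \<omega>. I j t \<omega> + c *\<^sub>R I' j t \<omega>"] conjI allI ballI)
    show "ito j (\<lambda>s \<omega>. H j s \<omega> + c *\<^sub>R H' j s \<omega>) (\<lambda>t \<omega>. I j t \<omega> + c *\<^sub>R I' j t \<omega>)" for j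
      by (rule ito_lincomb[OF I(1) I'(1) L2(3) L2(4)])
    fix t assume t: "t \<in> {0..T}"
    show "AE \<omega> in M. V t \<omega> + c *\<^sub>R V' t \<omega> = y + c *\<^sub>R y' + running_integral (\<lambda>s \<omega>. a s \<omega> + c *\<^sub>R a' s \<omega>) t \<omega> + (\<Sum>j\<in>UNIV. I j t \<omega> + c *\<^sub>R I' j t \<omega>)"
      using I(2)[OF t] I'(2)[OF t] AE_section_integrable[OF L2(1)] AE_section_integrable[OF L2(2)]
    proof eventually_elim
      case (elim \<omega>)
      show ?case unfolding running_integral_lincomb[where a = a and a' = a' and \<omega> = \<omega>, OF elim(3,4)] elim(1,2)
        by (simp add: sum.distrib scaleR_sum_right scaleR_add_right algebra_simps)
    qed
  qed
qed

lemma ito_process_exists: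
  assumes L2: "L2 a" "\<And>j. L2 (H j)"
  shows "\<exists>V. prog V \<and> ito_process y a H V"
proof -
  have "\<forall>j. \<exists>I. ito j (H j) I \<and> prog I" using ito_exists[OF L2_prog[OF L2(2)] L2_sqi[OF L2(2)]] by blast
  then obtain I where I: "\<And>j. ito j (H j) (I j)" "\<And>j. prog (I j)" by metis
  have "prog (\<lambda>t \<omega>. y + running_integral a t \<omega> + (\<Sum>j\<in>UNIV. I j t \<omega>))"
    by (intro prog_add prog_sum prog_const prog_running_integral L2_prog[OF L2(1)] I(2))
  moreover have "ito_process y a H (\<lambda>t \<omega>. y + running_integral a t \<omega> + (\<Sum>j\<in>UNIV. I j t \<omega>))"
    unfolding ito_process_def using I(1) by auto
  ultimately show ?thesis by blast
qed

lemma running_integral_sq_le: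
  fixes a :: "real \<Rightarrow> 'w \<Rightarrow> 'a::euclidean_space"
  assumes a: "L2 a" and t: "t \<in> {0..T}"
  shows "sqi M (running_integral a t)"
    and "(\<integral>\<^sup>+\<omega>. ennreal ((norm (running_integral a t \<omega>))\<^sup>2) \<partial>M) \<le> ennreal T * (\<integral>\<^sup>+z. (if fst z \<le> t then ennreal ((norm (a (fst z) (snd z)))\<^sup>2) else 0) \<partial>N)"
proof -
  have "(\<lambda>\<omega>. running_integral a t \<omega>) \<in> borel_measurable M" by (rule prog_measurable_M[OF prog_running_integral[OF L2_prog[OF a]] t])
  note p = sqi_prog_integral[OF L2_sqi[OF a] this[unfolded running_integral_def]]
  show "sqi M (running_integral a t)" using p(1) unfolding running_integral_def[abs_def] by simp
  show "(\<integral>\<^sup>+\<omega>. ennreal ((norm (running_integral a t \<omega>))\<^sup>2) \<partial>M) \<le> ennreal T * (\<integral>\<^sup>+z. (if fst z \<le> t then ennreal ((norm (a (fst z) (snd z)))\<^sup>2) else 0) \<partial>N)"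
    using p(2) unfolding running_integral_def by simp
qed

lemma norm_power2_three_le:
  "(norm (x + y + z :: 'a::real_normed_vector))\<^sup>2 \<le> 4 * ((norm x)\<^sup>2 + (norm y)\<^sup>2 + (norm z)\<^sup>2)"
proof -
  have "p \<le> 2 * q + 2 * c \<Longrightarrow> q \<le> 2 * a + 2 * b \<Longrightarrow> 0 \<le> c \<Longrightarrow> p \<le> 4 * (a + b + c)" for p q a b c :: real
    by (simp add: distrib_left)
  from this[OF norm_add_power2_le norm_add_power2_le] show ?thesis by simp
qed

text \<open>The factor 4 comes from a sum of three terms, \<open>CARD('d)\<close> from the sum over
  the components, and \<open>T\<close> from Cauchy-Schwarz in time. The integrals on the right stop
  at \<open>t\<close>, which is what makes an exponentially weighted estimate possible.\<close>

lemma ito_process_bound: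
  fixes V :: "real \<Rightarrow> 'w \<Rightarrow> 'a::euclidean_space"
  assumes V: "ito_process y a H V" and L2: "L2 a" "\<And>j. L2 (H j)" and t: "t \<in> {0..T}"
  shows "(\<integral>\<^sup>+\<omega>. ennreal ((norm (V t \<omega>))\<^sup>2) \<partial>M) \<le>
     ennreal (4 * real CARD('d)) * (ennreal ((norm y)\<^sup>2) + ennreal T * (\<integral>\<^sup>+z. (if fst z \<le> t then ennreal ((norm (a (fst z) (snd z)))\<^sup>2) else 0) \<partial>N)
        + (\<Sum>j\<in>UNIV. \<integral>\<^sup>+z. (if fst z \<le> t then ennreal ((norm (H j (fst z) (snd z)))\<^sup>2) else 0) \<partial>N))"
proof -
  obtain I where I: "\<And>j. ito j (H j) (I j)" "\<And>t. t \<in> {0..T} \<Longrightarrow> AE \<omega> in M. V t \<omega> = y + running_integral a t \<omega> + (\<Sum>j\<in>UNIV. I j t \<omega>)"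
    using V unfolding ito_process_def by blast
  have [measurable]: "running_integral a t \<in> borel_measurable M" "I j t \<in> borel_measurable M" for j
    using sqi_measurable[OF running_integral_sq_le(1)[OF L2(1) t]] sqi_measurable[OF ito_sqi[OF I(1) L2_sqi[OF L2(2)] t]] by auto
  \<comment> \<open>Since the number of components is at least 1, its factor may be spread over all
    three terms, leaving one common constant.\<close>
  have d1: "1 \<le> real CARD('d)" by (simp add: Suc_leI)
  have "(\<integral>\<^sup>+\<omega>. ennreal ((norm (V t \<omega>))\<^sup>2) \<partial>M) \<le>
     (\<integral>\<^sup>+\<omega>. ennreal (4 * real CARD('d)) * (ennreal ((norm y)\<^sup>2) + ennreal ((norm (running_integral a t \<omega>))\<^sup>2) + (\<Sum>j\<in>UNIV. ennreal ((norm (I j t \<omega>))\<^sup>2))) \<partial>M)"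
  proof (rule nn_integral_mono_AE, rule AE_mp[OF I(2)[OF t]], intro AE_I2 impI)
    fix \<omega> assume e: "V t \<omega> = y + running_integral a t \<omega> + (\<Sum>j\<in>UNIV. I j t \<omega>)"
    let ?n = "real CARD('d)"
    have "(norm (V t \<omega>))\<^sup>2 \<le> 4 * ((norm y)\<^sup>2 + (norm (running_integral a t \<omega>))\<^sup>2 + (norm (\<Sum>j\<in>UNIV. I j t \<omega>))\<^sup>2)"
      unfolding e by (rule norm_power2_three_le)
    also have "\<dots> \<le> 4 * (?n * (norm y)\<^sup>2 + ?n * (norm (running_integral a t \<omega>))\<^sup>2 + ?n * (\<Sum>j\<in>UNIV. (norm (I j t \<omega>))\<^sup>2))"
      using norm_sum_power2_le[of UNIV "\<lambda>j. I j t \<omega>"] mult_right_mono[OF d1, of "(norm y)\<^sup>2"] mult_right_mono[OF d1, of "(norm (running_integral a t \<omega>))\<^sup>2"]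
      by simp
    also have "\<dots> = 4 * ?n * ((norm y)\<^sup>2 + (norm (running_integral a t \<omega>))\<^sup>2 + (\<Sum>j\<in>UNIV. (norm (I j t \<omega>))\<^sup>2))"
      by (simp add: algebra_simps)
    finally have "ennreal ((norm (V t \<omega>))\<^sup>2) \<le> ennreal (4 * ?n * ((norm y)\<^sup>2 + (norm (running_integral a t \<omega>))\<^sup>2 + (\<Sum>j\<in>UNIV. (norm (I j t \<omega>))\<^sup>2)))"
      by (rule ennreal_leI)
    also have "\<dots> = ennreal (4 * ?n) * (ennreal ((norm y)\<^sup>2) + ennreal ((norm (running_integral a t \<omega>))\<^sup>2) + (\<Sum>j\<in>UNIV. ennreal ((norm (I j t \<omega>))\<^sup>2)))"
      by (simp add: ennreal_mult sum_nonneg sum_ennreal)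
    finally show "ennreal ((norm (V t \<omega>))\<^sup>2) \<le> ennreal (4 * ?n) * (ennreal ((norm y)\<^sup>2) + ennreal ((norm (running_integral a t \<omega>))\<^sup>2) + (\<Sum>j\<in>UNIV. ennreal ((norm (I j t \<omega>))\<^sup>2)))" .
  qed
  also have "\<dots> = ennreal (4 * real CARD('d)) * (ennreal ((norm y)\<^sup>2) + (\<integral>\<^sup>+\<omega>. ennreal ((norm (running_integral a t \<omega>))\<^sup>2) \<partial>M)
      + (\<Sum>j\<in>UNIV. \<integral>\<^sup>+\<omega>. ennreal ((norm (I j t \<omega>))\<^sup>2) \<partial>M))"
    by (simp add: nn_integral_cmult nn_integral_add nn_integral_sum emeasure_space_1 del: sum_ennreal)
  also have "\<dots> \<le> ennreal (4 * real CARD('d)) * (ennreal ((norm y)\<^sup>2) + ennreal T * (\<integral>\<^sup>+z. (if fst z \<le> t then ennreal ((norm (a (fst z) (snd z)))\<^sup>2) else 0) \<partial>N)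
        + (\<Sum>j\<in>UNIV. \<integral>\<^sup>+z. (if fst z \<le> t then ennreal ((norm (H j (fst z) (snd z)))\<^sup>2) else 0) \<partial>N))"
    unfolding ito_isometry[OF I(1) L2(2) t] by (intro mult_left_mono add_mono running_integral_sq_le(2)[OF L2(1) t]) auto
  finally show ?thesis .
qed

end

section \<open>Linear stochastic differential equations\<close>

lemma norm_matrix_vector_le:
  fixes E :: "real^'b::finite^'a::finite"
  shows "norm (E *v x) \<le> real CARD('a) * norm E * norm x"
proof -
  have "norm (E *v x) \<le> (\<Sum>i\<in>UNIV. \<bar>(E *v x) $ i\<bar>)" by (rule norm_le_l1_cart)
  also have "\<dots> \<le> (\<Sum>i\<in>(UNIV::'a set). norm E * norm x)"
  proof (rule sum_mono)
    fix i
    have "\<bar>(E *v x) $ i\<bar> = \<bar>E $ i \<bullet> x\<bar>" by (simp add: matrix_vector_mult_def inner_vec_def)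
    also have "\<dots> \<le> norm (E $ i) * norm x" by (rule Cauchy_Schwarz_ineq2)
    also have "\<dots> \<le> norm E * norm x" by (intro mult_right_mono Finite_Cartesian_Product.norm_nth_le) auto
    finally show "\<bar>(E *v x) $ i\<bar> \<le> norm E * norm x" .
  qed
  finally show ?thesis by simp
qed

lemma borel_measurable_matrix_vector:
  fixes f :: "'c \<Rightarrow> real^'b::finite^'a::finite"
  assumes "f \<in> borel_measurable L" "g \<in> borel_measurable L"
  shows "(\<lambda>x. f x *v g x) \<in> borel_measurable L"
proof (rule borel_measurable_continuous_Pair[OF assms])
  show "continuous_on UNIV (\<lambda>x. fst x *v snd x :: real^'a)"
    unfolding matrix_vector_mult_def by (intro continuous_intros)
qed

definition bounded_measurable :: "(real \<Rightarrow> real^'b::finite^'a::finite) \<Rightarrow> bool" where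
  "bounded_measurable E \<longleftrightarrow> E \<in> borel_measurable borel \<and> bounded (range E)"

lemma bounded_measurable_bound:
  fixes E :: "real \<Rightarrow> real^'b::finite^'a::finite"
  assumes "bounded_measurable E"
  obtains K where "K \<ge> 0" "\<And>s x. norm (E s *v x) \<le> K * norm x"
proof -
  obtain c where c: "\<And>s. norm (E s) \<le> c" using assms by (auto simp: bounded_measurable_def bounded_iff)
  then have "0 \<le> c" using norm_ge_zero order_trans by blast
  have "norm (E s *v x) \<le> (real CARD('a) * c) * norm x" for s x
  proof -
    have "norm (E s *v x) \<le> real CARD('a) * norm (E s) * norm x" by (rule norm_matrix_vector_le)
    also have "\<dots> \<le> (real CARD('a) * c) * norm x" by (intro mult_right_mono mult_left_mono c) auto
    finally show ?thesis .
  qed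
  with \<open>0 \<le> c\<close> show thesis by (intro that[of "real CARD('a) * c"]) auto
qed

context brownian_motion
begin

lemma prog_mv:
  fixes E :: "real \<Rightarrow> real^'b::finite^'a::finite"
  shows "E \<in> borel_measurable borel \<Longrightarrow> prog X \<Longrightarrow> prog (\<lambda>s \<omega>. E s *v X s \<omega>)"
  by (rule progI, rule borel_measurable_matrix_vector) (blast intro: progD[OF prog_det] progD)+

lemma L2_mv:
  fixes E :: "real \<Rightarrow> real^'b::finite^'a::finite"
  assumes E: "bounded_measurable E" and X: "L2 X"
  shows "L2 (\<lambda>s \<omega>. E s *v X s \<omega>)"
proof -
  obtain K where K: "K \<ge> 0" "\<And>s x. norm (E s *v x) \<le> K * norm x" using bounded_measurable_bound[OF E] by blast
  have p: "prog (\<lambda>s \<omega>. E s *v X s \<omega>)" using E by (intro prog_mv L2_prog[OF X]) (simp add: bounded_measurable_def)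
  moreover have "sqi N (\<lambda>z. E (fst z) *v X (fst z) (snd z))"
    by (rule sqi_bound[OF L2_sqi[OF X] prog_measurable_N[OF p], of K]) (simp add: K)
  ultimately show ?thesis by (simp add: L2F_iff)
qed

text \<open>The set of agreement is measurable, so the order of the two almost-everywhere
  quantifiers in Fubini's theorem may be exchanged.\<close>

lemma AE_N_sections:
  fixes a a' :: "real \<Rightarrow> 'w \<Rightarrow> 'a::euclidean_space"
  assumes m: "(\<lambda>z. a (fst z) (snd z)) \<in> borel_measurable N" "(\<lambda>z. a' (fst z) (snd z)) \<in> borel_measurable N"
    and ae: "AE z in N. a (fst z) (snd z) = a' (fst z) (snd z)"
  shows "AE \<omega> in M. AE s in lam. a s \<omega> = a' s \<omega>"
proof -
  have "(\<lambda>z. a (fst z) (snd z) - a' (fst z) (snd z)) \<in> borel_measurable N" using m by measurable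
  from measurable_sets[OF this, of "{0}"]
  have "{z\<in>space (lam \<Otimes>\<^sub>M M). a (fst z) (snd z) = a' (fst z) (snd z)} \<in> sets (lam \<Otimes>\<^sub>M M)"
    by (simp add: N_def vimage_def Int_def conj_commute)
  from lamM.AE_commute[OF this] lamM.AE_pair[OF ae[unfolded N_def]] show ?thesis by simp
qed

lemma ito_process_cong:
  assumes V: "ito_process y a H V" and L2: "L2 a" "L2 a'" "\<And>j. L2 (H j)" "\<And>j. L2 (H' j)"
    and ae: "AE z in N. a (fst z) (snd z) = a' (fst z) (snd z)" "\<And>j. AE z in N. H j (fst z) (snd z) = H' j (fst z) (snd z)"
  shows "ito_process y a' H' V"
proof -
  obtain I where I: "\<And>j. ito j (H j) (I j)" "\<And>t. t \<in> {0..T} \<Longrightarrow> AE \<omega> in M. V t \<omega> = y + running_integral a t \<omega> + (\<Sum>j\<in>UNIV. I j t \<omega>)"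
    using V unfolding ito_process_def by blast
  have "AE \<omega> in M. V t \<omega> = y + running_integral a' t \<omega> + (\<Sum>j\<in>UNIV. I j t \<omega>)" if t: "t \<in> {0..T}" for t
    using I(2)[OF t] AE_N_sections[OF sqi_measurable[OF L2_sqi[OF L2(1)]] sqi_measurable[OF L2_sqi[OF L2(2)]] ae(1)] AE_space
  proof eventually_elim
    case (elim \<omega>)
    have sec: "(\<lambda>r. b r \<omega>) \<in> borel_measurable lam" if "L2 b" for b :: "real \<Rightarrow> 'w \<Rightarrow> 'a"
    proof -
      have "(\<lambda>r. (r, \<omega>)) \<in> measurable lam N" unfolding N_def using elim by (intro measurable_Pair) auto
      from measurable_compose[OF this sqi_measurable[OF L2_sqi[OF that]]] show ?thesis by simp
    qed
    note [measurable] = sec[OF L2(1)] sec[OF L2(2)]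
    have "running_integral a t \<omega> = running_integral a' t \<omega>"
      unfolding running_integral_def by (rule integral_cong_AE) (measurable, use elim(2) in \<open>auto elim: eventually_mono\<close>)
    then show ?case using elim by simp
  qed
  moreover have "ito j (H' j) (I j)" for j by (rule ito_cong_integrand[OF I(1) L2(3) L2(4) ae(2)])
  ultimately show ?thesis unfolding ito_process_def by blast
qed

lemma N_le_uniform:
  fixes Y :: "real \<times> 'w \<Rightarrow> 'a::euclidean_space"
  assumes Y: "Y \<in> borel_measurable N" and b: "\<And>s. s \<in> {0..T} \<Longrightarrow> (\<integral>\<^sup>+\<omega>. ennreal ((norm (Y (s, \<omega>)))\<^sup>2) \<partial>M) \<le> c"
  shows "(\<integral>\<^sup>+z. ennreal ((norm (Y z))\<^sup>2) \<partial>N) \<le> ennreal T * c"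
proof -
  note [measurable] = Y
  have "(\<integral>\<^sup>+z. ennreal ((norm (Y z))\<^sup>2) \<partial>N) = (\<integral>\<^sup>+s. \<integral>\<^sup>+\<omega>. ennreal ((norm (Y (s, \<omega>)))\<^sup>2) \<partial>M \<partial>lam)"
    by (rule nn_integral_N) measurable
  also have "\<dots> \<le> (\<integral>\<^sup>+s. c \<partial>lam)" by (intro nn_integral_mono b) simp
  also have "\<dots> = c * emeasure lam (space lam)" by (rule nn_integral_const)
  also have "emeasure lam (space lam) = ennreal T"
    using T by (simp add: lam_def emeasure_restrict_space space_restrict_space)
  finally show ?thesis by (simp add: mult.commute)
qed

text \<open>The isometry bound does not depend on the time. It thus controls every single time, in
  particular \<open>T\<close>, about which square integrability over \<open>N\<close> says
  nothing.\<close>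

lemma ito_process_L2:
  assumes V: "ito_process y a H V" and p: "prog V" and L2: "L2 a" "\<And>j. L2 (H j)"
  obtains c where "c \<ge> 0" "\<And>t. t \<in> {0..T} \<Longrightarrow> (\<integral>\<^sup>+\<omega>. ennreal ((norm (V t \<omega>))\<^sup>2) \<partial>M) \<le> ennreal c" "L2 V"
proof -
  define q where "q X = (\<integral>\<^sup>+z. ennreal ((norm (X (fst z) (snd z)))\<^sup>2) \<partial>N)" for X :: "real \<Rightarrow> 'w \<Rightarrow> 'a"
  have fin: "q X < top" if "L2 X" for X
    using L2_sqi[OF that] sqi_iff_nn_integral[OF sqi_measurable[OF L2_sqi[OF that]]] unfolding q_def by simp
  define C where "C = ennreal (4 * real CARD('d)) * (ennreal ((norm y)\<^sup>2) + ennreal T * q a + (\<Sum>j\<in>UNIV. q (H j)))"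
  have le: "(\<integral>\<^sup>+z. (if fst z \<le> t then ennreal ((norm (X (fst z) (snd z)))\<^sup>2) else 0) \<partial>N) \<le> q X" for X t
    unfolding q_def by (intro nn_integral_mono) auto
  have b: "(\<integral>\<^sup>+\<omega>. ennreal ((norm (V t \<omega>))\<^sup>2) \<partial>M) \<le> C" if "t \<in> {0..T}" for t
    unfolding C_def by (rule order_trans[OF ito_process_bound[OF V L2 that]]) (intro mult_left_mono add_mono sum_mono le order_refl; simp)
  have "C < top" unfolding C_def using fin[OF L2(1)] fin[OF L2(2)] by (simp add: ennreal_mult_less_top)
  then obtain c where c: "c \<ge> 0" "C = ennreal c" by (cases C) auto
  have m: "(\<lambda>z. V (fst z) (snd z)) \<in> borel_measurable N" by (rule prog_measurable_N[OF p])
  have "(\<integral>\<^sup>+z. ennreal ((norm (V (fst z) (snd z)))\<^sup>2) \<partial>N) \<le> ennreal T * C"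
    by (rule N_le_uniform[OF m]) (use b in simp)
  also have "\<dots> < \<infinity>" using c by (simp add: ennreal_mult_less_top)
  finally have "L2 V" using p m by (simp add: L2F_iff sqi_iff_nn_integral)
  with c b show thesis by (intro that[of c]) auto
qed

text \<open>Integrating \<open>exp (\<beta> * s)\<close> over time gains a factor
  \<open>1 / \<beta>\<close>; the contraction of the Picard iteration rests on this gain.\<close>

lemma exp_growth_step:
  fixes Y :: "real \<times> 'w \<Rightarrow> 'a::euclidean_space"
  assumes Y: "Y \<in> borel_measurable N" and c: "c \<ge> 0" "\<beta> > 0" and t: "t \<in> {0..T}"
    and b: "\<And>s. s \<in> {0..T} \<Longrightarrow> (\<integral>\<^sup>+\<omega>. ennreal ((norm (Y (s, \<omega>)))\<^sup>2) \<partial>M) \<le> ennreal (c * exp (\<beta> * s))"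
  shows "(\<integral>\<^sup>+z. (if fst z \<le> t then ennreal ((norm (Y z))\<^sup>2) else 0) \<partial>N) \<le> ennreal (c / \<beta> * exp (\<beta> * t))"
proof -
  note [measurable] = Y
  have fm[measurable]: "fst \<in> borel_measurable N" using measurable_fst_N_borel[of "\<lambda>x. x"] by simp
  have "(\<integral>\<^sup>+z. (if fst z \<le> t then ennreal ((norm (Y z))\<^sup>2) else 0) \<partial>N)
     = (\<integral>\<^sup>+s. \<integral>\<^sup>+\<omega>. (if s \<le> t then ennreal ((norm (Y (s, \<omega>)))\<^sup>2) else 0) \<partial>M \<partial>lam)"
    by (subst nn_integral_N) (auto cong: if_cong)
  also have "\<dots> \<le> (\<integral>\<^sup>+s. ennreal (c * exp (\<beta> * s)) * indicator {0..t} s \<partial>lam)"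
    by (rule nn_integral_mono) (use b in \<open>auto simp: indicator_def\<close>)
  also have "\<dots> = (\<integral>\<^sup>+s. ennreal (c * exp (\<beta> * s)) * indicator {0..t} s \<partial>lborel)"
    unfolding nn_integral_lam using t by (intro nn_integral_cong) (auto simp: indicator_def)
  also have "\<dots> = ennreal (c / \<beta> * exp (\<beta> * t) - c / \<beta> * exp (\<beta> * 0))"
    by (rule nn_integral_FTC_Icc) (use c t in \<open>auto intro!: derivative_eq_intros\<close>)
  also have "\<dots> \<le> ennreal (c / \<beta> * exp (\<beta> * t))" using c by (intro ennreal_leI) simp
  finally show ?thesis .
qed

text \<open>The initial value and the inhomogeneities are common to both steps and cancel. The
  difference is again an Ito process, started at 0, with coefficients linear in
  \<open>Z1 - Z2\<close>.\<close>

lemma linear_step_estimate: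
  fixes A :: "real \<Rightarrow> real^'n::finite^'n" and C :: "'d \<Rightarrow> real \<Rightarrow> real^'n^'n"
  assumes A: "bounded_measurable A" and C: "\<And>j. bounded_measurable (C j)" and b: "L2 b" and d: "\<And>j. L2 (d j)"
  obtains \<kappa> where "\<kappa> \<ge> 0" "\<And>Z1 Z2 V1 V2 t. L2 Z1 \<Longrightarrow> L2 Z2 \<Longrightarrow>
     ito_process x0 (\<lambda>s \<omega>. A s *v Z1 s \<omega> + b s \<omega>) (\<lambda>j s \<omega>. C j s *v Z1 s \<omega> + d j s \<omega>) V1 \<Longrightarrow>
     ito_process x0 (\<lambda>s \<omega>. A s *v Z2 s \<omega> + b s \<omega>) (\<lambda>j s \<omega>. C j s *v Z2 s \<omega> + d j s \<omega>) V2 \<Longrightarrow> t \<in> {0..T} \<Longrightarrow>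
     (\<integral>\<^sup>+\<omega>. ennreal ((norm (V1 t \<omega> - V2 t \<omega>))\<^sup>2) \<partial>M) \<le>
       ennreal \<kappa> * (\<integral>\<^sup>+z. (if fst z \<le> t then ennreal ((norm (Z1 (fst z) (snd z) - Z2 (fst z) (snd z)))\<^sup>2) else 0) \<partial>N)"
proof -
  obtain KA where KA: "KA \<ge> 0" "\<And>s x. norm (A s *v x) \<le> KA * norm x" using bounded_measurable_bound[OF A] by blast
  have "\<forall>j. \<exists>K\<ge>0. \<forall>s x. norm (C j s *v x) \<le> K * norm x" using bounded_measurable_bound[OF C] by metis
  then obtain KC where KC: "\<And>j. KC j \<ge> 0" "\<And>j s x. norm (C j s *v x) \<le> KC j * norm x" by metis
  \<comment> \<open>The outer factor is the one of \<open>ito_process_bound\<close>; inside, the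
    drift contributes \<open>T * KA\<^sup>2\<close> and each diffusion the square of its own
    operator bound.\<close>
  define \<kappa> where "\<kappa> = (4 * real CARD('d)) * (T * KA\<^sup>2 + (\<Sum>j\<in>UNIV. (KC j)\<^sup>2))"
  show thesis
  proof (rule that[of \<kappa>])
    show "\<kappa> \<ge> 0" unfolding \<kappa>_def using T by (intro mult_nonneg_nonneg add_nonneg_nonneg sum_nonneg) auto
    fix Z1 Z2 V1 V2 t assume L: "L2 Z1" "L2 Z2"
      and V1: "ito_process x0 (\<lambda>s \<omega>. A s *v Z1 s \<omega> + b s \<omega>) (\<lambda>j s \<omega>. C j s *v Z1 s \<omega> + d j s \<omega>) V1"
      and V2: "ito_process x0 (\<lambda>s \<omega>. A s *v Z2 s \<omega> + b s \<omega>) (\<lambda>j s \<omega>. C j s *v Z2 s \<omega> + d j s \<omega>) V2" and t: "t \<in> {0..T}"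
    note la = L2_add[OF L2_mv[OF A L(1)] b] L2_add[OF L2_mv[OF A L(2)] b]
      and lh = L2_add[OF L2_mv[OF C L(1)] d] L2_add[OF L2_mv[OF C L(2)] d]
    define Q where "Q = (\<integral>\<^sup>+z. (if fst z \<le> t then ennreal ((norm (Z1 (fst z) (snd z) - Z2 (fst z) (snd z)))\<^sup>2) else 0) \<partial>N)"
    have fm[measurable]: "fst \<in> borel_measurable N" using measurable_fst_N_borel[of "\<lambda>x. x"] by simp
    have zm[measurable]: "(\<lambda>z. Z1 (fst z) (snd z)) \<in> borel_measurable N" "(\<lambda>z. Z2 (fst z) (snd z)) \<in> borel_measurable N"
      using L sqi_measurable[OF L2_sqi] by auto
    have bound: "(\<integral>\<^sup>+z. (if fst z \<le> t then ennreal ((norm (E (fst z) *v Z1 (fst z) (snd z) + e z + (-1) *\<^sub>R (E (fst z) *v Z2 (fst z) (snd z) + e z)))\<^sup>2) else 0) \<partial>N)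
        \<le> ennreal (K\<^sup>2) * Q" if K: "\<And>s x. norm (E s *v x) \<le> K * norm x" for E :: "real \<Rightarrow> real^'n^'n" and e K
    proof -
      have "(\<integral>\<^sup>+z. (if fst z \<le> t then ennreal ((norm (E (fst z) *v Z1 (fst z) (snd z) + e z + (-1) *\<^sub>R (E (fst z) *v Z2 (fst z) (snd z) + e z)))\<^sup>2) else 0) \<partial>N)
        \<le> (\<integral>\<^sup>+z. ennreal (K\<^sup>2) * (if fst z \<le> t then ennreal ((norm (Z1 (fst z) (snd z) - Z2 (fst z) (snd z)))\<^sup>2) else 0) \<partial>N)"
      proof (rule nn_integral_mono)
        fix z
        have "E (fst z) *v Z1 (fst z) (snd z) + e z + (-1) *\<^sub>R (E (fst z) *v Z2 (fst z) (snd z) + e z) = E (fst z) *v (Z1 (fst z) (snd z) - Z2 (fst z) (snd z))"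
          by (simp add: matrix_vector_mult_diff_distrib)
        moreover have "(norm (E (fst z) *v (Z1 (fst z) (snd z) - Z2 (fst z) (snd z))))\<^sup>2 \<le> K\<^sup>2 * (norm (Z1 (fst z) (snd z) - Z2 (fst z) (snd z)))\<^sup>2"
          using power_mono[OF K norm_ge_zero, of "fst z" "Z1 (fst z) (snd z) - Z2 (fst z) (snd z)" 2] by (simp add: power_mult_distrib)
        ultimately show "(if fst z \<le> t then ennreal ((norm (E (fst z) *v Z1 (fst z) (snd z) + e z + (-1) *\<^sub>R (E (fst z) *v Z2 (fst z) (snd z) + e z)))\<^sup>2) else 0)
           \<le> ennreal (K\<^sup>2) * (if fst z \<le> t then ennreal ((norm (Z1 (fst z) (snd z) - Z2 (fst z) (snd z)))\<^sup>2) else 0)"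
          by (auto simp flip: ennreal_mult intro!: ennreal_leI)
      qed
      also have "\<dots> = ennreal (K\<^sup>2) * Q" unfolding Q_def by (rule nn_integral_cmult) measurable
      finally show ?thesis .
    qed
    note IB = ito_process_bound[OF ito_process_lincomb[OF V1 V2 la lh, where c = "-1"] L2_lincomb[OF la] L2_lincomb[OF lh] t]
    have "(\<integral>\<^sup>+\<omega>. ennreal ((norm (V1 t \<omega> - V2 t \<omega>))\<^sup>2) \<partial>M) = (\<integral>\<^sup>+\<omega>. ennreal ((norm (V1 t \<omega> + (-1) *\<^sub>R V2 t \<omega>))\<^sup>2) \<partial>M)" by simp
    also have "\<dots> \<le> ennreal (4 * real CARD('d)) * (ennreal ((norm (x0 + (-1) *\<^sub>R x0))\<^sup>2) + ennreal T * (ennreal (KA\<^sup>2) * Q) + (\<Sum>j\<in>UNIV. ennreal ((KC j)\<^sup>2) * Q))"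
      by (rule order_trans[OF IB])
         (intro mult_left_mono add_mono sum_mono order_refl bound KA KC; simp)
    also have "\<dots> = ennreal (4 * real CARD('d)) * (ennreal (T * KA\<^sup>2) * Q + ennreal (\<Sum>j\<in>UNIV. (KC j)\<^sup>2) * Q)"
      using T by (simp add: ennreal_mult mult.assoc sum_distrib_right flip: sum_ennreal)
    also have "\<dots> = ennreal \<kappa> * Q"
      unfolding \<kappa>_def using T by (simp add: ennreal_mult ennreal_plus sum_nonneg mult.assoc distrib_right)
    finally show "(\<integral>\<^sup>+\<omega>. ennreal ((norm (V1 t \<omega> - V2 t \<omega>))\<^sup>2) \<partial>M) \<le> ennreal \<kappa> * Q" .
  qed
qed

end

lemma ennreal_two_sum: "0 \<le> a \<Longrightarrow> 0 \<le> b \<Longrightarrow> 2 * ennreal a + 2 * ennreal b = ennreal (2 * a + 2 * b)"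
  by (simp add: ennreal_mult' ennreal_numeral)

lemma nn_integral_norm_add_le:
  fixes f g :: "'a \<Rightarrow> 'b::euclidean_space"
  assumes [measurable]: "f \<in> borel_measurable L" "g \<in> borel_measurable L"
  shows "(\<integral>\<^sup>+x. ennreal ((norm (f x + g x))\<^sup>2) \<partial>L) \<le> 2 * (\<integral>\<^sup>+x. ennreal ((norm (f x))\<^sup>2) \<partial>L) + 2 * (\<integral>\<^sup>+x. ennreal ((norm (g x))\<^sup>2) \<partial>L)"
proof -
  have "(\<integral>\<^sup>+x. ennreal ((norm (f x + g x))\<^sup>2) \<partial>L) \<le> (\<integral>\<^sup>+x. 2 * ennreal ((norm (f x))\<^sup>2) + 2 * ennreal ((norm (g x))\<^sup>2) \<partial>L)"
    by (intro nn_integral_mono) (simp add: ennreal_two_sum norm_add_power2_le ennreal_leI del: ennreal_plus)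
  also have "\<dots> = 2 * (\<integral>\<^sup>+x. ennreal ((norm (f x))\<^sup>2) \<partial>L) + 2 * (\<integral>\<^sup>+x. ennreal ((norm (g x))\<^sup>2) \<partial>L)"
    by (subst nn_integral_add) (auto simp: nn_integral_cmult)
  finally show ?thesis .
qed

context brownian_motion
begin

text \<open>Picard iteration: measured against \<open>exp (\<beta> t)\<close> with \<open>\<beta>\<close> large, one step shrinks mean square
  distances by the factor 1/4.\<close>

theorem sde_exists:
  fixes A :: "real \<Rightarrow> real^'n::finite^'n" and C :: "'d \<Rightarrow> real \<Rightarrow> real^'n^'n"
  assumes A: "bounded_measurable A" and C: "\<And>j. bounded_measurable (C j)" and b: "L2 b" and d: "\<And>j. L2 (d j)"
  shows "\<exists>X. L2 X \<and> ito_process x0 (\<lambda>s \<omega>. A s *v X s \<omega> + b s \<omega>) (\<lambda>j s \<omega>. C j s *v X s \<omega> + d j s \<omega>) X"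
proof -
  define step where "step Z V \<longleftrightarrow> ito_process x0 (\<lambda>s \<omega>. A s *v Z s \<omega> + b s \<omega>) (\<lambda>j s \<omega>. C j s *v Z s \<omega> + d j s \<omega>) V" for Z V
  obtain \<kappa> where \<kappa>: "\<kappa> \<ge> 0" and est: "\<And>Z1 Z2 V1 V2 t. L2 Z1 \<Longrightarrow> L2 Z2 \<Longrightarrow> step Z1 V1 \<Longrightarrow> step Z2 V2 \<Longrightarrow> t \<in> {0..T} \<Longrightarrow>
     (\<integral>\<^sup>+\<omega>. ennreal ((norm (V1 t \<omega> - V2 t \<omega>))\<^sup>2) \<partial>M) \<le>
       ennreal \<kappa> * (\<integral>\<^sup>+z. (if fst z \<le> t then ennreal ((norm (Z1 (fst z) (snd z) - Z2 (fst z) (snd z)))\<^sup>2) else 0) \<partial>N)"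
    by (rule linear_step_estimate[where ?x0.0 = x0 and C = C and d = d, OF A C b d])
       (rule that, assumption, unfold step_def, blast)
  have la: "L2 (\<lambda>s \<omega>. A s *v Z s \<omega> + b s \<omega>)" and lh: "L2 (\<lambda>s \<omega>. C j s *v Z s \<omega> + d j s \<omega>)" if "L2 Z" for Z j
    by (intro L2_add L2_mv A C b d that)+
  have step_ex: "\<exists>V. L2 V \<and> step Z V" if Z: "L2 Z" for Z
  proof -
    obtain V where V: "prog V" "step Z V" using ito_process_exists[OF la[OF Z], of "\<lambda>j s \<omega>. C j s *v Z s \<omega> + d j s \<omega>" x0, OF lh[OF Z]]
      unfolding step_def by blast
    have "L2 V" by (rule ito_process_L2[OF V(2)[unfolded step_def] V(1) la[OF Z] lh[OF Z]])
    with V show ?thesis by blast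
  qed
  \<comment> \<open>Dependent choice is needed because a step only exists and is not given by a
    function; the clause for \<open>k = 0\<close> pins the start of the iteration to 0.\<close>
  have "\<exists>Z. \<forall>k. (L2 (Z k) \<and> (k = 0 \<longrightarrow> Z k = (\<lambda>s \<omega>. 0))) \<and> step (Z k) (Z (Suc k))"
  proof (rule dependent_nat_choice)
    show "\<exists>Z. L2 Z \<and> (0 = (0::nat) \<longrightarrow> Z = (\<lambda>s \<omega>. 0))" using L2_zero by blast
    show "\<exists>V. (L2 V \<and> (Suc k = 0 \<longrightarrow> V = (\<lambda>s \<omega>. 0))) \<and> step Z V" if "L2 Z \<and> (k = 0 \<longrightarrow> Z = (\<lambda>s \<omega>. 0))" for Z k
      using step_ex[of Z] that by auto
  qed
  then obtain Z where Z: "\<And>k. L2 (Z k)" and Z0: "Z 0 = (\<lambda>s \<omega>. 0)" and Zs: "\<And>k. step (Z k) (Z (Suc k))" by blast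
  have Zm[measurable]: "(\<lambda>z. Z k (fst z) (snd z)) \<in> borel_measurable N" for k by (rule sqi_measurable[OF L2_sqi[OF Z]])
  have ZM[measurable]: "t \<in> {0..T} \<Longrightarrow> Z k t \<in> borel_measurable M" for k t by (rule prog_measurable_M[OF L2_prog[OF Z]])
  have "\<exists>c1\<ge>0. \<forall>t\<in>{0..T}. (\<integral>\<^sup>+\<omega>. ennreal ((norm (Z (Suc 0) t \<omega>))\<^sup>2) \<partial>M) \<le> ennreal c1"
    by (rule ito_process_L2[OF Zs[of 0, unfolded step_def] L2_prog[OF Z] la[OF Z] lh[OF Z]]) blast
  then obtain c1 where c1: "c1 \<ge> 0" "\<And>t. t \<in> {0..T} \<Longrightarrow> (\<integral>\<^sup>+\<omega>. ennreal ((norm (Z (Suc 0) t \<omega>))\<^sup>2) \<partial>M) \<le> ennreal c1"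
    by blast
  \<comment> \<open>Large enough for \<open>\<kappa> / \<beta> \<le> 1 / 4\<close>; the summand 1
    keeps it positive when \<open>\<kappa>\<close> is 0.\<close>
  define \<beta> where "\<beta> = 4 * \<kappa> + 1"
  have \<beta>: "\<beta> > 0" "\<kappa> / \<beta> \<le> 1 / 4" using \<kappa> by (auto simp: \<beta>_def field_simps)
  \<comment> \<open>The bound has to reproduce itself: \<open>c / 2\<close> from the contracted part
    plus \<open>2 * c1\<close> from the first iterate is again \<open>c\<close>.\<close>
  define c where "c = 4 * c1"
  have c: "c \<ge> 0" using c1 by (simp add: c_def)
  have kb: "\<kappa> * (e / \<beta> * x) \<le> e / 4 * x" if "e \<ge> 0" "x \<ge> 0" for e x
  proof -
    have "\<kappa> * (e / \<beta> * x) = (\<kappa> / \<beta>) * (e * x)" by simp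
    also have "\<dots> \<le> (1 / 4) * (e * x)" using \<beta>(2) that by (intro mult_right_mono) auto
    finally show ?thesis by simp
  qed
  have step_bound: "(\<integral>\<^sup>+\<omega>. ennreal ((norm (V1 t \<omega> - V2 t \<omega>))\<^sup>2) \<partial>M) \<le> ennreal (e / 4 * exp (\<beta> * t))"
    if L: "L2 Z1" "L2 Z2" "step Z1 V1" "step Z2 V2" and t: "t \<in> {0..T}" and e: "e \<ge> 0"
      and bd: "\<And>s. s \<in> {0..T} \<Longrightarrow> (\<integral>\<^sup>+\<omega>. ennreal ((norm (Z1 s \<omega> - Z2 s \<omega>))\<^sup>2) \<partial>M) \<le> ennreal (e * exp (\<beta> * s))" for Z1 Z2 V1 V2 t e
  proof -
    have "(\<lambda>z. Z1 (fst z) (snd z) - Z2 (fst z) (snd z)) \<in> borel_measurable N"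
      using sqi_measurable[OF L2_sqi[OF L(1)]] sqi_measurable[OF L2_sqi[OF L(2)]] by measurable
    from exp_growth_step[OF this e \<beta>(1) t] bd
    have "(\<integral>\<^sup>+z. (if fst z \<le> t then ennreal ((norm (Z1 (fst z) (snd z) - Z2 (fst z) (snd z)))\<^sup>2) else 0) \<partial>N) \<le> ennreal (e / \<beta> * exp (\<beta> * t))"
      by simp
    then have "(\<integral>\<^sup>+\<omega>. ennreal ((norm (V1 t \<omega> - V2 t \<omega>))\<^sup>2) \<partial>M) \<le> ennreal \<kappa> * ennreal (e / \<beta> * exp (\<beta> * t))"
      using est[OF L t] by (meson mult_left_mono order_trans zero_le)
    also have "\<dots> = ennreal (\<kappa> * (e / \<beta> * exp (\<beta> * t)))" by (rule ennreal_mult'[OF \<kappa>, symmetric])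
    also have "\<dots> \<le> ennreal (e / 4 * exp (\<beta> * t))" by (intro ennreal_leI kb e) simp
    finally show ?thesis .
  qed
  \<comment> \<open>A bound uniform in the number of steps: each iterate is compared with the first
    one, where a step from \<open>Z l\<close> and a step from 0 are contracted against each
    other.\<close>
  have bounded: "t \<in> {0..T} \<Longrightarrow> (\<integral>\<^sup>+\<omega>. ennreal ((norm (Z l t \<omega>))\<^sup>2) \<partial>M) \<le> ennreal (c * exp (\<beta> * t))" for l t
  proof (induction l arbitrary: t)
    case 0
    then show ?case by (simp add: Z0)
  next
    case (Suc l)
    note t = Suc.prems
    have 1: "(\<integral>\<^sup>+\<omega>. ennreal ((norm (Z (Suc l) t \<omega> - Z (Suc 0) t \<omega>))\<^sup>2) \<partial>M) \<le> ennreal (c / 4 * exp (\<beta> * t))"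
      by (rule step_bound[OF Z Z Zs Zs t c]) (use Suc.IH in \<open>simp add: Z0\<close>)
    note [measurable] = ZM[OF t]
    have "(\<integral>\<^sup>+\<omega>. ennreal ((norm ((Z (Suc l) t \<omega> - Z (Suc 0) t \<omega>) + Z (Suc 0) t \<omega>))\<^sup>2) \<partial>M) \<le>
       2 * (\<integral>\<^sup>+\<omega>. ennreal ((norm (Z (Suc l) t \<omega> - Z (Suc 0) t \<omega>))\<^sup>2) \<partial>M) + 2 * (\<integral>\<^sup>+\<omega>. ennreal ((norm (Z (Suc 0) t \<omega>))\<^sup>2) \<partial>M)"
      by (rule nn_integral_norm_add_le) measurable
    also have "\<dots> \<le> 2 * ennreal (c / 4 * exp (\<beta> * t)) + 2 * ennreal c1"
      by (intro add_mono mult_left_mono 1 c1 t) auto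
    also have "\<dots> = ennreal (2 * (c / 4 * exp (\<beta> * t)) + 2 * c1)"
      using c c1(1) by (intro ennreal_two_sum) auto
    also have "\<dots> \<le> ennreal (c * exp (\<beta> * t))"
    proof (rule ennreal_leI)
      have "1 \<le> exp (\<beta> * t)" using \<beta> t by auto
      then have "2 * c1 * 1 \<le> 2 * c1 * exp (\<beta> * t)" using c1 by (intro mult_left_mono) auto
      then show "2 * (c / 4 * exp (\<beta> * t)) + 2 * c1 \<le> c * exp (\<beta> * t)" by (simp add: c_def)
    qed
    finally show ?case by simp
  qed
  have cauchy: "t \<in> {0..T} \<Longrightarrow> (\<integral>\<^sup>+\<omega>. ennreal ((norm (Z (k + l) t \<omega> - Z k t \<omega>))\<^sup>2) \<partial>M) \<le> ennreal (c * (1/4)^k * exp (\<beta> * t))" for k l t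
  proof (induction k arbitrary: t)
    case 0
    then show ?case using bounded[of t l] by (simp add: Z0)
  next
    case (Suc k)
    have "(\<integral>\<^sup>+\<omega>. ennreal ((norm (Z (Suc (k + l)) t \<omega> - Z (Suc k) t \<omega>))\<^sup>2) \<partial>M) \<le> ennreal (c * (1/4)^k / 4 * exp (\<beta> * t))"
      by (rule step_bound[OF Z Z Zs Zs Suc.prems _ Suc.IH]) (use c in auto)
    then show ?case by simp
  qed
  define K where "K = T * (c * exp (\<beta> * T))"
  have NC: "(\<integral>\<^sup>+z. ennreal ((norm (Z m (fst z) (snd z) - Z k (fst z) (snd z)))\<^sup>2) \<partial>N) \<le> ennreal (K * (1/4)^k)" if km: "k \<le> m" for k m
  proof -
    have "(\<integral>\<^sup>+z. ennreal ((norm (Z m (fst z) (snd z) - Z k (fst z) (snd z)))\<^sup>2) \<partial>N) \<le> ennreal T * ennreal (c * (1/4)^k * exp (\<beta> * T))"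
    proof (rule N_le_uniform)
      fix s assume s: "s \<in> {0..T}"
      have "(\<integral>\<^sup>+\<omega>. ennreal ((norm (Z (k + (m - k)) s \<omega> - Z k s \<omega>))\<^sup>2) \<partial>M) \<le> ennreal (c * (1/4)^k * exp (\<beta> * s))"
        by (rule cauchy[OF s])
      also have "\<dots> \<le> ennreal (c * (1/4)^k * exp (\<beta> * T))"
        using s c \<beta> by (intro ennreal_leI mult_left_mono) auto
      finally show "(\<integral>\<^sup>+\<omega>. ennreal ((norm (Z m (fst (s, \<omega>)) (snd (s, \<omega>)) - Z k (fst (s, \<omega>)) (snd (s, \<omega>))))\<^sup>2) \<partial>M) \<le> ennreal (c * (1/4)^k * exp (\<beta> * T))"
        using km by simp
    qed measurable
    also have "\<dots> = ennreal (K * (1/4)^k)" using T c by (simp add: K_def ennreal_mult[symmetric] mult_ac)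
    finally show ?thesis .
  qed
  define Y where "Y s \<omega> = lim (\<lambda>k. Z k s \<omega>)" for s \<omega>
  have pY: "prog Y" unfolding Y_def[abs_def] by (rule prog_lim[OF L2_prog[OF Z]])
  note Ym[measurable] = prog_measurable_N[OF pY]
  have YZ: "(\<integral>\<^sup>+z. ennreal ((norm (Y (fst z) (snd z) - Z k (fst z) (snd z)))\<^sup>2) \<partial>N) \<le> ennreal (K * (1/4)^k)" for k
    unfolding Y_def by (rule rapidly_Cauchy_limit[OF N_finite Zm NC])
  have l4: "(\<lambda>k. ennreal (e * (1/4)^k)) \<longlonglongrightarrow> 0" for e
  proof -
    have "(\<lambda>k. e * (1/4)^k) \<longlonglongrightarrow> e * 0" by (intro tendsto_mult_left LIMSEQ_power_zero) simp
    from tendsto_ennrealI[OF this] show ?thesis by simp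
  qed
  have "(\<lambda>k. \<integral>\<^sup>+z. ennreal ((norm (Y (fst z) (snd z) - Z k (fst z) (snd z)))\<^sup>2) \<partial>N) \<longlonglongrightarrow> 0"
    by (rule tendsto_sandwich[OF _ _ tendsto_const l4[of K]]) (use YZ in auto)
  from sqi_of_limit[OF this Ym L2_sqi[OF Z]] have LY: "L2 Y" using pY by (simp add: L2F_iff)
  \<comment> \<open>\<open>Y\<close> is a limit over time and chance together and need not satisfy
    the equation at a given time. One further step started from \<open>Y\<close> satisfies its own
    equation at every time; it agrees with \<open>Y\<close> almost everywhere, as both are limits of
    the same iterates, and may therefore replace \<open>Y\<close> in the coefficients.\<close>
  obtain X where X: "L2 X" "step Y X" using step_ex[OF LY] by blast
  note Xm[measurable] = sqi_measurable[OF L2_sqi[OF X(1)]]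
  have XZ: "(\<integral>\<^sup>+z. ennreal ((norm (X (fst z) (snd z) - Z (Suc k) (fst z) (snd z)))\<^sup>2) \<partial>N) \<le> ennreal (T * \<kappa> * K * (1/4)^k)" for k
  proof -
    have "(\<integral>\<^sup>+z. ennreal ((norm (X (fst z) (snd z) - Z (Suc k) (fst z) (snd z)))\<^sup>2) \<partial>N) \<le> ennreal T * (ennreal \<kappa> * ennreal (K * (1/4)^k))"
    proof (rule N_le_uniform)
      fix s assume s: "s \<in> {0..T}"
      have "(\<integral>\<^sup>+\<omega>. ennreal ((norm (X s \<omega> - Z (Suc k) s \<omega>))\<^sup>2) \<partial>M) \<le>
          ennreal \<kappa> * (\<integral>\<^sup>+z. (if fst z \<le> s then ennreal ((norm (Y (fst z) (snd z) - Z k (fst z) (snd z)))\<^sup>2) else 0) \<partial>N)"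
        by (rule est[OF LY Z X(2) Zs s])
      also have "\<dots> \<le> ennreal \<kappa> * (\<integral>\<^sup>+z. ennreal ((norm (Y (fst z) (snd z) - Z k (fst z) (snd z)))\<^sup>2) \<partial>N)"
        by (intro mult_left_mono nn_integral_mono) auto
      also have "\<dots> \<le> ennreal \<kappa> * ennreal (K * (1/4)^k)" by (intro mult_left_mono YZ) auto
      finally show "(\<integral>\<^sup>+\<omega>. ennreal ((norm (X (fst (s, \<omega>)) (snd (s, \<omega>)) - Z (Suc k) (fst (s, \<omega>)) (snd (s, \<omega>))))\<^sup>2) \<partial>M) \<le> ennreal \<kappa> * ennreal (K * (1/4)^k)"
        by simp
    qed measurable
    also have "\<dots> = ennreal (T * \<kappa> * K * (1/4)^k)"
      using T \<kappa> c by (simp add: K_def ennreal_mult[symmetric] mult_ac)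
    finally show ?thesis .
  qed
  have XY: "AE z in N. Y (fst z) (snd z) = X (fst z) (snd z)"
  proof -
    have bd: "(\<integral>\<^sup>+z. ennreal ((norm (X (fst z) (snd z) - Y (fst z) (snd z)))\<^sup>2) \<partial>N) \<le> ennreal ((2 * (T * \<kappa> * K) + 2 * K) * (1/4)^k)" for k
    proof -
      have "(\<integral>\<^sup>+z. ennreal ((norm (X (fst z) (snd z) - Y (fst z) (snd z)))\<^sup>2) \<partial>N)
         = (\<integral>\<^sup>+z. ennreal ((norm ((X (fst z) (snd z) - Z (Suc k) (fst z) (snd z)) + (Z (Suc k) (fst z) (snd z) - Y (fst z) (snd z))))\<^sup>2) \<partial>N)" by simp
      also have "\<dots> \<le> 2 * (\<integral>\<^sup>+z. ennreal ((norm (X (fst z) (snd z) - Z (Suc k) (fst z) (snd z)))\<^sup>2) \<partial>N) + 2 * (\<integral>\<^sup>+z. ennreal ((norm (Z (Suc k) (fst z) (snd z) - Y (fst z) (snd z)))\<^sup>2) \<partial>N)"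
        by (rule nn_integral_norm_add_le) measurable
      also have "\<dots> = 2 * (\<integral>\<^sup>+z. ennreal ((norm (X (fst z) (snd z) - Z (Suc k) (fst z) (snd z)))\<^sup>2) \<partial>N) + 2 * (\<integral>\<^sup>+z. ennreal ((norm (Y (fst z) (snd z) - Z (Suc k) (fst z) (snd z)))\<^sup>2) \<partial>N)"
        unfolding norm_minus_commute[of "Z (Suc k) _ _" "Y _ _"] ..
      also have "\<dots> \<le> 2 * ennreal (T * \<kappa> * K * (1/4)^k) + 2 * ennreal (K * (1/4)^Suc k)"
        by (intro add_mono mult_left_mono XZ YZ) auto
      also have "\<dots> \<le> 2 * ennreal (T * \<kappa> * K * (1/4)^k) + 2 * ennreal (K * (1/4)^k)"
        using T c by (intro add_left_mono mult_left_mono ennreal_leI) (auto simp: K_def)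
      also have "\<dots> = ennreal (2 * (T * \<kappa> * K * (1/4)^k) + 2 * (K * (1/4)^k))"
        using T \<kappa> c by (intro ennreal_two_sum) (auto simp: K_def)
      also have "\<dots> = ennreal ((2 * (T * \<kappa> * K) + 2 * K) * (1/4)^k)" by (simp add: distrib_right mult.assoc del: ennreal_plus)
      finally show ?thesis .
    qed
    have "(\<integral>\<^sup>+z. ennreal ((norm (X (fst z) (snd z) - Y (fst z) (snd z)))\<^sup>2) \<partial>N) \<le> 0"
      by (rule LIMSEQ_le_const[OF l4]) (use bd in blast)
    then have "(\<integral>\<^sup>+z. ennreal ((norm (X (fst z) (snd z) - Y (fst z) (snd z)))\<^sup>2) \<partial>N) = 0" by simp
    then have "AE z in N. ennreal ((norm (X (fst z) (snd z) - Y (fst z) (snd z)))\<^sup>2) = 0"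
      by (subst (asm) nn_integral_0_iff_AE) measurable
    then show ?thesis by eventually_elim simp
  qed
  have "ito_process x0 (\<lambda>s \<omega>. A s *v X s \<omega> + b s \<omega>) (\<lambda>j s \<omega>. C j s *v X s \<omega> + d j s \<omega>) X"
    by (rule ito_process_cong[OF X(2)[unfolded step_def] la[OF LY] la[OF X(1)] lh[OF LY] lh[OF X(1)]])
       (use XY in \<open>auto elim!: eventually_mono\<close>)
  with X(1) show ?thesis by blast
qed

section \<open>Duality\<close>

lemma L2_running_integral:
  fixes a :: "real \<Rightarrow> 'w \<Rightarrow> 'a::euclidean_space"
  assumes a: "L2 a"
  shows "L2 (running_integral a)"
proof -
  define q where "q = (\<integral>\<^sup>+z. ennreal ((norm (a (fst z) (snd z)))\<^sup>2) \<partial>N)"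
  have "q < top" using L2_sqi[OF a] sqi_iff_nn_integral[OF sqi_measurable[OF L2_sqi[OF a]]] unfolding q_def by simp
  have p: "prog (running_integral a)" by (rule prog_running_integral[OF L2_prog[OF a]])
  note m = prog_measurable_N[OF p]
  have "(\<integral>\<^sup>+z. ennreal ((norm (running_integral a (fst z) (snd z)))\<^sup>2) \<partial>N) \<le> ennreal T * (ennreal T * q)"
  proof (rule N_le_uniform[OF m])
    fix s assume s: "s \<in> {0..T}"
    have "(\<integral>\<^sup>+z. (if fst z \<le> s then ennreal ((norm (a (fst z) (snd z)))\<^sup>2) else 0) \<partial>N) \<le> q"
      unfolding q_def by (intro nn_integral_mono) auto
    then show "(\<integral>\<^sup>+\<omega>. ennreal ((norm (running_integral a (fst (s, \<omega>)) (snd (s, \<omega>))))\<^sup>2) \<partial>M) \<le> ennreal T * q"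
      using running_integral_sq_le(2)[OF a s] by (simp) (meson mult_left_mono order_trans zero_le)
  qed
  also have "\<dots> < \<infinity>" using \<open>q < top\<close> by (simp add: ennreal_mult_less_top)
  finally show ?thesis using p m by (simp add: L2F_iff sqi_iff_nn_integral)
qed

lemma AE_sqi_at:
  fixes a :: "real \<Rightarrow> 'w \<Rightarrow> 'a::euclidean_space"
  assumes a: "L2 a"
  shows "AE s in lam. a s \<in> borel_measurable (Fs s) \<and> sqi M (a s)"
proof -
  have "AE s in lam. integrable M (\<lambda>\<omega>. (norm (a (fst (s, \<omega>)) (snd (s, \<omega>))))\<^sup>2)"
    by (rule lamM.AE_integrable_fst') (use sqi_norm2[OF L2_sqi[OF a]] in \<open>simp add: N_def\<close>)
  then show ?thesis using AE_space
  proof eventually_elim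
    case (elim s)
    then have "s \<in> {0..T}" by simp
    then show ?case using elim prog_measurable_Fs[OF L2_prog[OF a]] prog_measurable_M[OF L2_prog[OF a]] by (auto simp: sqi_def)
  qed
qed

lemma integral_running_integral:
  fixes a :: "real \<Rightarrow> 'w \<Rightarrow> 'a::euclidean_space"
  assumes a: "L2 a" and \<zeta>: "sqi M \<zeta>"
  shows "(\<integral>\<omega>. \<zeta> \<omega> \<bullet> running_integral a T \<omega> \<partial>M) = (\<integral>z. \<zeta> (snd z) \<bullet> a (fst z) (snd z) \<partial>N)"
proof -
  have i: "integrable N (\<lambda>z. \<zeta> (snd z) \<bullet> a (fst z) (snd z))" by (rule sqi_inner[OF sqi_snd[OF \<zeta>] L2_sqi[OF a]])
  have "(\<integral>z. \<zeta> (snd z) \<bullet> a (fst z) (snd z) \<partial>N) = (\<integral>\<omega>. \<integral>s. \<zeta> \<omega> \<bullet> a s \<omega> \<partial>lam \<partial>M)"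
    using lamM.integral_snd[of "\<lambda>s \<omega>. \<zeta> \<omega> \<bullet> a s \<omega>"] i by (simp add: N_def case_prod_beta')
  also have "\<dots> = (\<integral>\<omega>. \<zeta> \<omega> \<bullet> running_integral a T \<omega> \<partial>M)"
  proof (rule integral_cong_AE)
    have "AE \<omega> in M. integrable lam (\<lambda>r. a r \<omega>)" by (rule AE_section_integrable[OF a])
    then show "AE \<omega> in M. (\<integral>s. \<zeta> \<omega> \<bullet> a s \<omega> \<partial>lam) = \<zeta> \<omega> \<bullet> running_integral a T \<omega>"
    proof eventually_elim
      case (elim \<omega>)
      have "running_integral a T \<omega> = (\<integral>r. a r \<omega> \<partial>lam)"
        unfolding running_integral_def by (intro Bochner_Integration.integral_cong) auto
      then show ?case using integral_inner_right[OF elim, of "\<zeta> \<omega>"] by simp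
    qed
    show "(\<lambda>\<omega>. \<integral>s. \<zeta> \<omega> \<bullet> a s \<omega> \<partial>lam) \<in> borel_measurable M"
      using lamM.integrable_snd[of "\<lambda>s \<omega>. \<zeta> \<omega> \<bullet> a s \<omega>"] i by (simp add: N_def case_prod_beta' borel_measurable_integrable)
    show "(\<lambda>\<omega>. \<zeta> \<omega> \<bullet> running_integral a T \<omega>) \<in> borel_measurable M"
      using sqi_measurable[OF \<zeta>] sqi_measurable[OF running_integral_sq_le(1)[OF a, of T]] T by (intro borel_measurable_inner) auto
  qed
  finally show ?thesis by simp
qed

text \<open>At almost every time \<open>a s\<close> is square-integrable and known at
  \<open>s\<close>, so the martingale property applies under the time integral. \<open>V\<close> is
  a jointly measurable version of \<open>S\<close>, needed because an Ito integral as defined is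
  measurable only at each time separately.\<close>

lemma martingale_integral:
  fixes a :: "real \<Rightarrow> 'w \<Rightarrow> 'a::euclidean_space"
  assumes a: "L2 a" and V: "sqi N (\<lambda>z. V (fst z) (snd z))" and ST: "sqi M (S T)"
    and mart: "\<And>s \<eta>. s \<in> {0..T} \<Longrightarrow> \<eta> \<in> borel_measurable (Fs s) \<Longrightarrow> sqi M \<eta> \<Longrightarrow> (\<integral>\<omega>. S T \<omega> \<bullet> \<eta> \<omega> \<partial>M) = (\<integral>\<omega>. S s \<omega> \<bullet> \<eta> \<omega> \<partial>M)"
    and VS: "\<And>s. s \<in> {0..T} \<Longrightarrow> AE \<omega> in M. V s \<omega> = S s \<omega>" and Sm: "\<And>s. s \<in> {0..T} \<Longrightarrow> S s \<in> borel_measurable M"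
  shows "(\<integral>z. S T (snd z) \<bullet> a (fst z) (snd z) \<partial>N) = (\<integral>z. V (fst z) (snd z) \<bullet> a (fst z) (snd z) \<partial>N)"
proof -
  have "(\<integral>z. S T (snd z) \<bullet> a (fst z) (snd z) \<partial>N) = (\<integral>s. \<integral>\<omega>. S T \<omega> \<bullet> a s \<omega> \<partial>M \<partial>lam)"
    by (subst integral_N[OF sqi_inner[OF sqi_snd[OF ST] L2_sqi[OF a]]]) simp
  also have "\<dots> = (\<integral>s. \<integral>\<omega>. V s \<omega> \<bullet> a s \<omega> \<partial>M \<partial>lam)"
  proof (rule integral_cong_AE)
    have i1: "integrable (lam \<Otimes>\<^sub>M M) (\<lambda>z. S T (snd z) \<bullet> a (fst z) (snd z))" and i2: "integrable (lam \<Otimes>\<^sub>M M) (\<lambda>z. V (fst z) (snd z) \<bullet> a (fst z) (snd z))"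
      using sqi_inner[OF sqi_snd[OF ST] L2_sqi[OF a]] sqi_inner[OF V L2_sqi[OF a]] by (auto simp: N_def)
    show "(\<lambda>s. \<integral>\<omega>. S T \<omega> \<bullet> a s \<omega> \<partial>M) \<in> borel_measurable lam" "(\<lambda>s. \<integral>\<omega>. V s \<omega> \<bullet> a s \<omega> \<partial>M) \<in> borel_measurable lam"
      using lamM.integrable_fst'[OF i1] lamM.integrable_fst'[OF i2] by auto
    have Vm: "AE s in lam. V s \<in> borel_measurable M"
    proof (rule AE_I2)
      fix s assume "s \<in> space lam"
      then have "(\<lambda>\<omega>. (s, \<omega>)) \<in> measurable M N" unfolding N_def by (intro measurable_Pair) auto
      from measurable_compose[OF this sqi_measurable[OF V]] show "V s \<in> borel_measurable M" by simp
    qed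
    show "AE s in lam. (\<integral>\<omega>. S T \<omega> \<bullet> a s \<omega> \<partial>M) = (\<integral>\<omega>. V s \<omega> \<bullet> a s \<omega> \<partial>M)"
      using AE_sqi_at[OF a] Vm AE_space
    proof eventually_elim
      case (elim s)
      then have s: "s \<in> {0..T}" by simp
      have "(\<integral>\<omega>. S T \<omega> \<bullet> a s \<omega> \<partial>M) = (\<integral>\<omega>. S s \<omega> \<bullet> a s \<omega> \<partial>M)" by (rule mart[OF s]) (use elim in auto)
      also have "\<dots> = (\<integral>\<omega>. V s \<omega> \<bullet> a s \<omega> \<partial>M)"
      proof (rule integral_cong_AE)
        have [measurable]: "S s \<in> borel_measurable M" "V s \<in> borel_measurable M" "a s \<in> borel_measurable M"
          using Sm[OF s] elim by (auto simp: sqi_def)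
        show "(\<lambda>\<omega>. S s \<omega> \<bullet> a s \<omega>) \<in> borel_measurable M" "(\<lambda>\<omega>. V s \<omega> \<bullet> a s \<omega>) \<in> borel_measurable M" by measurable
        show "AE \<omega> in M. S s \<omega> \<bullet> a s \<omega> = V s \<omega> \<bullet> a s \<omega>" using VS[OF s] by eventually_elim simp
      qed
      finally show ?case .
    qed
  qed
  also have "\<dots> = (\<integral>z. V (fst z) (snd z) \<bullet> a (fst z) (snd z) \<partial>N)"
    by (subst integral_N[OF sqi_inner[OF V L2_sqi[OF a]]]) simp
  finally show ?thesis .
qed

text \<open>Fubini's theorem on the triangle \<open>r \<le> s\<close>. The diagonal, on which the
  complementary cut-offs overlap, is a null set.\<close>

lemma lam_integration_by_parts:
  fixes a f :: "real \<Rightarrow> 'a::euclidean_space"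
  assumes a: "integrable lam a" and f: "integrable lam f"
  shows "(\<integral>s. (\<integral>r. (if r \<le> s then a r else 0) \<partial>lam) \<bullet> f s \<partial>lam)
     = (\<integral>r. ((\<integral>s. f s \<partial>lam) - (\<integral>s. (if s \<le> r then f s else 0) \<partial>lam)) \<bullet> a r \<partial>lam)"
proof -
  interpret L: finite_measure lam by (rule lam_finite)
  interpret LL: pair_sigma_finite lam lam ..
  have [measurable]: "a \<in> borel_measurable lam" "f \<in> borel_measurable lam" using a f by auto
  have ia: "integrable lam (\<lambda>r. if P r then a r else 0)" if [measurable]: "Measurable.pred lam P" for P
    by (rule Bochner_Integration.integrable_bound[OF a]) auto
  have if': "integrable lam (\<lambda>r. if P r then f r else 0)" if [measurable]: "Measurable.pred lam P" for P
    by (rule Bochner_Integration.integrable_bound[OF f]) auto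
  define g where "g s r = (if r \<le> s then a r \<bullet> f s else 0)" for s r
  have ig: "integrable (lam \<Otimes>\<^sub>M lam) (\<lambda>(s, r). g s r)"
  proof (rule LL.Fubini_integrable)
    show m: "(\<lambda>(s, r). g s r) \<in> borel_measurable (lam \<Otimes>\<^sub>M lam)" unfolding g_def by measurable
    have ab: "integrable lam (\<lambda>s. (\<integral>r. norm (a r) \<partial>lam) * norm (f s))" using f by simp
    have gb: "norm (g s r) \<le> norm (a r) * norm (f s)" for s r
      unfolding g_def using Cauchy_Schwarz_ineq2[of "a r" "f s"] by auto
    have gi: "s \<in> space lam \<Longrightarrow> integrable lam (\<lambda>r. g s r)" for s
    proof (rule Bochner_Integration.integrable_bound[of lam "\<lambda>r. norm (a r) * norm (f s)"])
      show "integrable lam (\<lambda>r. norm (a r) * norm (f s))" using a by simp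
      show "(\<lambda>r. g s r) \<in> borel_measurable lam" unfolding g_def by measurable
      show "AE r in lam. norm (g s r) \<le> norm (norm (a r) * norm (f s))" using gb by simp
    qed
    show "AE s in lam. integrable lam (\<lambda>r. (\<lambda>(s, r). g s r) (s, r))" by (rule AE_I2) (simp add: gi)
    show "integrable lam (\<lambda>s. \<integral>r. norm ((\<lambda>(s, r). g s r) (s, r)) \<partial>lam)"
    proof (rule Bochner_Integration.integrable_bound[OF ab])
      show "(\<lambda>s. \<integral>r. norm ((\<lambda>(s, r). g s r) (s, r)) \<partial>lam) \<in> borel_measurable lam"
        unfolding g_def by measurable
      show "AE s in lam. norm (\<integral>r. norm ((\<lambda>(s, r). g s r) (s, r)) \<partial>lam) \<le> norm ((\<integral>r. norm (a r) \<partial>lam) * norm (f s))"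
      proof (rule AE_I2)
        fix s assume s: "s \<in> space lam"
        have "(\<integral>r. norm (g s r) \<partial>lam) \<le> (\<integral>r. norm (a r) * norm (f s) \<partial>lam)"
          by (rule integral_mono) (use gi[OF s] a gb in auto)
        then show "norm (\<integral>r. norm ((\<lambda>(s, r). g s r) (s, r)) \<partial>lam) \<le> norm ((\<integral>r. norm (a r) \<partial>lam) * norm (f s))"
          by simp
      qed
    qed
  qed
  have "(\<integral>s. (\<integral>r. (if r \<le> s then a r else 0) \<partial>lam) \<bullet> f s \<partial>lam) = (\<integral>s. \<integral>r. g s r \<partial>lam \<partial>lam)"
  proof (intro Bochner_Integration.integral_cong refl)
    fix s
    have "(\<integral>r. (if r \<le> s then a r else 0) \<partial>lam) \<bullet> f s = (\<integral>r. (if r \<le> s then a r else 0) \<bullet> f s \<partial>lam)"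
      by (rule integral_inner_left[symmetric]) (rule ia, measurable)
    also have "\<dots> = (\<integral>r. g s r \<partial>lam)" unfolding g_def by (intro Bochner_Integration.integral_cong) auto
    finally show "(\<integral>r. (if r \<le> s then a r else 0) \<partial>lam) \<bullet> f s = (\<integral>r. g s r \<partial>lam)" .
  qed
  also have "\<dots> = (\<integral>r. \<integral>s. g s r \<partial>lam \<partial>lam)" by (rule LL.Fubini_integral[OF ig, symmetric])
  also have "\<dots> = (\<integral>r. ((\<integral>s. f s \<partial>lam) - (\<integral>s. (if s \<le> r then f s else 0) \<partial>lam)) \<bullet> a r \<partial>lam)"
  proof (intro Bochner_Integration.integral_cong refl)
    fix r
    have "(\<integral>s. f s \<partial>lam) - (\<integral>s. (if s \<le> r then f s else 0) \<partial>lam) = (\<integral>s. f s - (if s \<le> r then f s else 0) \<partial>lam)"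
      by (rule Bochner_Integration.integral_diff[symmetric, OF f]) (rule if', measurable)
    also have "\<dots> = (\<integral>s. (if r \<le> s then f s else 0) \<partial>lam)"
    proof (rule integral_cong_AE)
      have "AE s in lborel. s \<noteq> r" by (rule AE_lborel_singleton)
      then have "AE s in lam. s \<noteq> r" unfolding lam_def by (subst AE_restrict_space_iff) auto
      then show "AE s in lam. f s - (if s \<le> r then f s else 0) = (if r \<le> s then f s else 0)"
        by eventually_elim auto
    qed measurable
    finally have "((\<integral>s. f s \<partial>lam) - (\<integral>s. (if s \<le> r then f s else 0) \<partial>lam)) \<bullet> a r = (\<integral>s. (if r \<le> s then f s else 0) \<bullet> a r \<partial>lam)"
      by (simp, intro integral_inner_left[symmetric] if') measurable
    also have "\<dots> = (\<integral>s. g s r \<partial>lam)"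
      unfolding g_def by (intro Bochner_Integration.integral_cong) (auto simp: inner_commute)
    finally show "(\<integral>s. g s r \<partial>lam) = ((\<integral>s. f s \<partial>lam) - (\<integral>s. (if s \<le> r then f s else 0) \<partial>lam)) \<bullet> a r" by simp
  qed
  finally show ?thesis .
qed

lemma sqi_running_integral_T:
  assumes "L2 f"
  shows "sqi M (running_integral f T)"
  by (rule running_integral_sq_le(1)[OF assms]) (use T in simp)

lemma integration_by_parts:
  fixes a f :: "real \<Rightarrow> 'w \<Rightarrow> 'a::euclidean_space"
  assumes a: "L2 a" and f: "L2 f"
  shows "(\<integral>z. running_integral a (fst z) (snd z) \<bullet> f (fst z) (snd z) \<partial>N)
     = (\<integral>z. (running_integral f T (snd z) - running_integral f (fst z) (snd z)) \<bullet> a (fst z) (snd z) \<partial>N)"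
proof -
  have i1: "integrable (lam \<Otimes>\<^sub>M M) (\<lambda>(s, \<omega>). running_integral a s \<omega> \<bullet> f s \<omega>)"
    using sqi_inner[OF L2_sqi[OF L2_running_integral[OF a]] L2_sqi[OF f]] by (simp add: N_def case_prod_beta')
  have i2: "integrable (lam \<Otimes>\<^sub>M M) (\<lambda>(s, \<omega>). (running_integral f T \<omega> - running_integral f s \<omega>) \<bullet> a s \<omega>)"
    using sqi_inner[OF sqi_diff[OF sqi_snd[OF sqi_running_integral_T[OF f]] L2_sqi[OF L2_running_integral[OF f]]] L2_sqi[OF a]] by (simp add: N_def case_prod_beta')
  have "(\<integral>z. running_integral a (fst z) (snd z) \<bullet> f (fst z) (snd z) \<partial>N) = (\<integral>\<omega>. \<integral>s. running_integral a s \<omega> \<bullet> f s \<omega> \<partial>lam \<partial>M)"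
    using lamM.integral_snd[OF i1] by (simp add: N_def case_prod_beta')
  also have "\<dots> = (\<integral>\<omega>. \<integral>s. (running_integral f T \<omega> - running_integral f s \<omega>) \<bullet> a s \<omega> \<partial>lam \<partial>M)"
  proof (rule integral_cong_AE)
    show "(\<lambda>\<omega>. \<integral>s. running_integral a s \<omega> \<bullet> f s \<omega> \<partial>lam) \<in> borel_measurable M" "(\<lambda>\<omega>. \<integral>s. (running_integral f T \<omega> - running_integral f s \<omega>) \<bullet> a s \<omega> \<partial>lam) \<in> borel_measurable M"
      using lamM.integrable_snd[OF i1] lamM.integrable_snd[OF i2] by auto
    show "AE \<omega> in M. (\<integral>s. running_integral a s \<omega> \<bullet> f s \<omega> \<partial>lam) = (\<integral>s. (running_integral f T \<omega> - running_integral f s \<omega>) \<bullet> a s \<omega> \<partial>lam)"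
      using AE_section_integrable[OF a] AE_section_integrable[OF f]
    proof eventually_elim
      case (elim \<omega>)
      have "running_integral f T \<omega> = (\<integral>r. f r \<omega> \<partial>lam)"
        unfolding running_integral_def by (intro Bochner_Integration.integral_cong) auto
      then show ?case using lam_integration_by_parts[OF elim] unfolding running_integral_def by simp
    qed
  qed
  also have "\<dots> = (\<integral>z. (running_integral f T (snd z) - running_integral f (fst z) (snd z)) \<bullet> a (fst z) (snd z) \<partial>N)"
    using lamM.integral_snd[OF i2] by (simp add: N_def case_prod_beta')
  finally show ?thesis .
qed

end

lemma sqi_inner_sum:
  fixes f :: "'i \<Rightarrow> 'a \<Rightarrow> 'b::euclidean_space"
  assumes "\<And>i. i \<in> I \<Longrightarrow> sqi L (f i)" "sqi L g"
  shows "(\<integral>x. (\<Sum>i\<in>I. f i x) \<bullet> g x \<partial>L) = (\<Sum>i\<in>I. \<integral>x. f i x \<bullet> g x \<partial>L)"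
  unfolding inner_sum_left by (rule Bochner_Integration.integral_sum) (rule sqi_inner[OF assms])

context brownian_motion
begin

text \<open>By the isometry the mean square at time 0 is an integral over a null set of
  times.\<close>

lemma ito_zero:
  fixes H :: "real \<Rightarrow> 'w \<Rightarrow> 'a::euclidean_space"
  assumes I: "ito j H I" and H: "L2 H"
  shows "AE \<omega> in M. I 0 \<omega> = 0"
proof -
  have t: "0 \<in> {0..T}" using T by simp
  have [measurable]: "I 0 \<in> borel_measurable M" "(\<lambda>z. H (fst z) (snd z)) \<in> borel_measurable N"
    using ito_measurable[OF I t] sqi_measurable[OF L2_sqi[OF H]] by auto
  have [measurable]: "fst \<in> borel_measurable N" using measurable_fst_N_borel[of "\<lambda>x. x"] by simp
  have "AE s in lborel. s \<noteq> (0::real)" by (rule AE_lborel_singleton)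
  then have ae: "AE s in lam. 0 < s" unfolding lam_def by (subst AE_restrict_space_iff) auto
  have "(\<integral>\<^sup>+\<omega>. ennreal ((norm (I 0 \<omega>))\<^sup>2) \<partial>M) = (\<integral>\<^sup>+z. (if fst z \<le> 0 then ennreal ((norm (H (fst z) (snd z)))\<^sup>2) else 0) \<partial>N)"
    by (rule ito_isometry[OF I H t])
  also have "\<dots> = (\<integral>\<^sup>+s. \<integral>\<^sup>+\<omega>. (if s \<le> 0 then ennreal ((norm (H s \<omega>))\<^sup>2) else 0) \<partial>M \<partial>lam)"
    by (subst nn_integral_N) (auto cong: if_cong)
  also have "\<dots> = (\<integral>\<^sup>+s. 0 \<partial>lam)"
    by (rule nn_integral_cong_AE) (use ae in \<open>auto elim!: eventually_mono\<close>)
  finally have "AE \<omega> in M. ennreal ((norm (I 0 \<omega>))\<^sup>2) = 0"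
    by (subst nn_integral_0_iff_AE[symmetric]) auto
  then show ?thesis by eventually_elim simp
qed

lemma running_integral_zero: "running_integral f 0 \<omega> = 0"
proof -
  have "AE s in lborel. s \<noteq> (0::real)" by (rule AE_lborel_singleton)
  then have "AE s in lam. 0 < s" unfolding lam_def by (subst AE_restrict_space_iff) auto
  then show ?thesis unfolding running_integral_def by (intro integral_eq_zero_AE) (auto elim!: eventually_mono)
qed

text \<open>The product formula for E(p(T) . Y(T)) is obtained without Ito's formula: only the isometry, the
  martingale property and Fubini's theorem are needed, because the two iterated drift integrals cancel.\<close>

lemma duality:
  fixes p f a Y :: "real \<Rightarrow> 'w \<Rightarrow> 'a::euclidean_space"
  assumes L: "L2 p" "L2 f" "\<And>j. L2 (k j)" "L2 a" "\<And>j. L2 (b j)" "L2 Y" and \<zeta>: "sqi M \<zeta>"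
    and I: "\<And>j. ito j (k j) (I j)"
    and p: "\<And>t. t \<in> {0..T} \<Longrightarrow> AE \<omega> in M. p t \<omega> = \<zeta> \<omega> + (running_integral f T \<omega> - running_integral f t \<omega>) - (\<Sum>j\<in>UNIV. I j T \<omega> - I j t \<omega>)"
    and Y: "ito_process 0 a b Y"
  shows "(\<integral>\<omega>. \<zeta> \<omega> \<bullet> Y T \<omega> \<partial>M) = (\<integral>z. p (fst z) (snd z) \<bullet> a (fst z) (snd z) \<partial>N)
     - (\<integral>z. f (fst z) (snd z) \<bullet> Y (fst z) (snd z) \<partial>N) + (\<Sum>j\<in>UNIV. \<integral>z. k j (fst z) (snd z) \<bullet> b j (fst z) (snd z) \<partial>N)"
proof -
  obtain J where J: "\<And>j. ito j (b j) (J j)" "\<And>t. t \<in> {0..T} \<Longrightarrow> AE \<omega> in M. Y t \<omega> = 0 + running_integral a t \<omega> + (\<Sum>j\<in>UNIV. J j t \<omega>)"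
    using Y unfolding ito_process_def by blast
  have T0: "0 \<in> {0..T}" "T \<in> {0..T}" using T by auto
  define S where "S t \<omega> = (\<Sum>j\<in>UNIV. I j t \<omega>)" for t \<omega>
  define R where "R t \<omega> = (\<Sum>j\<in>UNIV. J j t \<omega>)" for t \<omega>
  have sI: "sqi M (I j t)" and sJ: "sqi M (J j t)" if "t \<in> {0..T}" for j t
    using ito_sqi[OF I L2_sqi[OF L(3)] that] ito_sqi[OF J(1) L2_sqi[OF L(5)] that] by auto
  have sS: "sqi M (S t)" and sR: "sqi M (R t)" if "t \<in> {0..T}" for t
    unfolding S_def[abs_def] R_def[abs_def] by (intro sqi_sum sI sJ that)+
  have martS: "(\<integral>\<omega>. S T \<omega> \<bullet> \<eta> \<omega> \<partial>M) = (\<integral>\<omega>. S s \<omega> \<bullet> \<eta> \<omega> \<partial>M)" if s: "s \<in> {0..T}" "\<eta> \<in> borel_measurable (Fs s)" "sqi M \<eta>" for s \<eta>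
    unfolding S_def using s T0(2) ito_martingale[OF I L2_sqi[OF L(3)] _ _ _ s(2,3), of T]
    by (simp add: sqi_inner_sum sI)
  have martR: "(\<integral>\<omega>. R T \<omega> \<bullet> \<eta> \<omega> \<partial>M) = (\<integral>\<omega>. R s \<omega> \<bullet> \<eta> \<omega> \<partial>M)" if s: "s \<in> {0..T}" "\<eta> \<in> borel_measurable (Fs s)" "sqi M \<eta>" for s \<eta>
    unfolding R_def using s T0(2) ito_martingale[OF J(1) L2_sqi[OF L(5)] _ _ _ s(2,3), of T]
    by (simp add: sqi_inner_sum sJ)
  have S0: "AE \<omega> in M. S 0 \<omega> = 0" and R0: "AE \<omega> in M. R 0 \<omega> = 0"
  proof -
    have "AE \<omega> in M. \<forall>j\<in>UNIV. I j 0 \<omega> = 0" by (subst AE_finite_all) (auto intro: ito_zero[OF I L(3)])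
    then show "AE \<omega> in M. S 0 \<omega> = 0" by eventually_elim (simp add: S_def)
    have "AE \<omega> in M. \<forall>j\<in>UNIV. J j 0 \<omega> = 0" by (subst AE_finite_all) (auto intro: ito_zero[OF J(1) L(5)])
    then show "AE \<omega> in M. R 0 \<omega> = 0" by eventually_elim (simp add: R_def)
  qed
  have pS: "AE \<omega> in M. p t \<omega> = \<zeta> \<omega> + (running_integral f T \<omega> - running_integral f t \<omega>) - (S T \<omega> - S t \<omega>)" if "t \<in> {0..T}" for t
    using p[OF that] by eventually_elim (simp add: S_def sum_subtractf)
  have YR: "AE \<omega> in M. Y t \<omega> = running_integral a t \<omega> + R t \<omega>" if "t \<in> {0..T}" for t
    using J(2)[OF that] by eventually_elim (simp add: R_def)
  let ?p = "\<lambda>z. p (fst z) (snd z)" and ?f = "\<lambda>z. f (fst z) (snd z)" and ?a = "\<lambda>z. a (fst z) (snd z)" and ?Y = "\<lambda>z. Y (fst z) (snd z)"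
  let ?F = "\<lambda>z. running_integral f T (snd z) - running_integral f (fst z) (snd z)" and ?A = "\<lambda>z. running_integral a (fst z) (snd z)"
  note sp = L2_sqi[OF L(1)] and sf = L2_sqi[OF L(2)] and sa = L2_sqi[OF L(4)] and sY = L2_sqi[OF L(6)]
  note sFT = sqi_running_integral_T[OF L(2)] and sAT = sqi_running_integral_T[OF L(4)]
  have sF: "sqi N ?F" by (rule sqi_diff[OF sqi_snd[OF sFT] L2_sqi[OF L2_running_integral[OF L(2)]]])
  note sA = L2_sqi[OF L2_running_integral[OF L(4)]]
  note sz = sqi_snd[OF \<zeta>] and sST = sqi_snd[OF sS[OF T0(2)]]
  \<comment> \<open>Solving the backward equation for \<open>S s\<close> gives an expression that is
    jointly measurable, unlike \<open>S\<close>, and can be integrated over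
    \<open>N\<close>.\<close>
  have sV: "sqi N (\<lambda>z. S T (snd z) - \<zeta> (snd z) + ?p z - ?F z)" 
    by (rule sqi_diff[OF sqi_add[OF sqi_diff[OF sST sz] sp] sF])
  have "(\<integral>z. S T (snd z) \<bullet> ?a z \<partial>N) = (\<integral>z. (S T (snd z) - \<zeta> (snd z) + ?p z - ?F z) \<bullet> ?a z \<partial>N)"
  proof (rule martingale_integral[where V = "\<lambda>s \<omega>. S T \<omega> - \<zeta> \<omega> + p s \<omega> - (running_integral f T \<omega> - running_integral f s \<omega>)" and S = S and a = a])
    show "AE \<omega> in M. S T \<omega> - \<zeta> \<omega> + p s \<omega> - (running_integral f T \<omega> - running_integral f s \<omega>) = S s \<omega>" if "s \<in> {0..T}" for s
      using pS[OF that] by eventually_elim simp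
  qed (rule L(4) sV sS[OF T0(2)] martS sqi_measurable[OF sS]; assumption)+
  also have "\<dots> = (\<integral>z. S T (snd z) \<bullet> ?a z - \<zeta> (snd z) \<bullet> ?a z + ?p z \<bullet> ?a z - ?F z \<bullet> ?a z \<partial>N)"
    by (intro Bochner_Integration.integral_cong refl) (simp only: inner_add_left inner_diff_left)
  also have "\<dots> = (\<integral>z. S T (snd z) \<bullet> ?a z \<partial>N) - (\<integral>z. \<zeta> (snd z) \<bullet> ?a z \<partial>N) + (\<integral>z. ?p z \<bullet> ?a z \<partial>N) - (\<integral>z. ?F z \<bullet> ?a z \<partial>N)"
    using sqi_inner[OF sST sa] sqi_inner[OF sz sa] sqi_inner[OF sp sa] sqi_inner[OF sF sa]
    by (simp add: Bochner_Integration.integral_add Bochner_Integration.integral_diff del: inner_diff_left)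
  finally have e1: "(\<integral>z. \<zeta> (snd z) \<bullet> ?a z \<partial>N) = (\<integral>z. ?p z \<bullet> ?a z \<partial>N) - (\<integral>z. ?F z \<bullet> ?a z \<partial>N)" by linarith
  have "(\<integral>z. R T (snd z) \<bullet> ?f z \<partial>N) = (\<integral>z. (?Y z - ?A z) \<bullet> ?f z \<partial>N)"
  proof (rule martingale_integral[where V = "\<lambda>s \<omega>. Y s \<omega> - running_integral a s \<omega>" and S = R and a = f])
    show "AE \<omega> in M. Y s \<omega> - running_integral a s \<omega> = R s \<omega>" if "s \<in> {0..T}" for s
      using YR[OF that] by eventually_elim simp
  qed (rule L(2) sqi_diff[OF sY sA] sR[OF T0(2)] martR sqi_measurable[OF sR]; assumption)+
  also have "\<dots> = (\<integral>z. ?Y z \<bullet> ?f z \<partial>N) - (\<integral>z. ?A z \<bullet> ?f z \<partial>N)"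
    unfolding inner_diff_left by (rule Bochner_Integration.integral_diff[OF sqi_inner[OF sY sf] sqi_inner[OF sA sf]])
  also have "(\<integral>z. ?A z \<bullet> ?f z \<partial>N) = (\<integral>z. ?F z \<bullet> ?a z \<partial>N)" by (rule integration_by_parts[OF L(4) L(2)])
  finally have e2: "(\<integral>\<omega>. R T \<omega> \<bullet> running_integral f T \<omega> \<partial>M) = (\<integral>z. ?Y z \<bullet> ?f z \<partial>N) - (\<integral>z. ?F z \<bullet> ?a z \<partial>N)"
    unfolding integral_running_integral[OF L(2) sR[OF T0(2)]] .
  \<comment> \<open>\<open>p 0\<close> is known at time 0, so its pairing with \<open>R T\<close>
    equals the pairing with \<open>R 0\<close>, which vanishes.\<close>
  have p0m: "p 0 \<in> borel_measurable (Fs 0)" by (rule prog_measurable_Fs[OF L2_prog[OF L(1)] T0(1)])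
  have sp0: "sqi M (p 0)"
  proof (rule sqi_cong_AE)
    show "sqi M (\<lambda>\<omega>. \<zeta> \<omega> + (running_integral f T \<omega> - running_integral f 0 \<omega>) - (S T \<omega> - S 0 \<omega>))"
      by (intro sqi_add sqi_diff \<zeta> sFT running_integral_sq_le(1)[OF L(2) T0(1)] sS T0)
    show "AE \<omega> in M. \<zeta> \<omega> + (running_integral f T \<omega> - running_integral f 0 \<omega>) - (S T \<omega> - S 0 \<omega>) = p 0 \<omega>"
      using pS[OF T0(1)] by eventually_elim simp
  qed (rule measurable_Fs_M[OF p0m])
  have "(\<integral>\<omega>. R T \<omega> \<bullet> p 0 \<omega> \<partial>M) = (\<integral>\<omega>. R 0 \<omega> \<bullet> p 0 \<omega> \<partial>M)" by (rule martR[OF T0(1) p0m sp0])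
  also have "\<dots> = 0" by (rule integral_eq_zero_AE) (use R0 in \<open>auto elim!: eventually_mono\<close>)
  finally have e3: "(\<integral>\<omega>. p 0 \<omega> \<bullet> R T \<omega> \<partial>M) = 0" by (simp add: inner_commute)
  have e4: "(\<integral>\<omega>. S T \<omega> \<bullet> R T \<omega> \<partial>M) = (\<Sum>j\<in>UNIV. \<integral>z. k j (fst z) (snd z) \<bullet> b j (fst z) (snd z) \<partial>N)"
  proof -
    have pair: "(\<integral>\<omega>. I i T \<omega> \<bullet> J j T \<omega> \<partial>M) = (if i = j then (\<integral>z. k j (fst z) (snd z) \<bullet> b j (fst z) (snd z) \<partial>N) else 0)" for i j
    proof (cases "i = j")
      case True
      have "(\<integral>z. (indicator {..min T T} (fst z) *\<^sub>R k i (fst z) (snd z)) \<bullet> b j (fst z) (snd z) \<partial>N) = (\<integral>z. k i (fst z) (snd z) \<bullet> b j (fst z) (snd z) \<partial>N)"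
        by (intro Bochner_Integration.integral_cong) (auto simp: N_def space_pair_measure)
      then show ?thesis
        using ito_pairing[OF I L2_sqi[OF L(3)] J(1) L2_sqi[OF L(5)] T0(2) T0(2), of i j] True by simp
    next
      case False
      then show ?thesis using ito_pairing[OF I L2_sqi[OF L(3)] J(1) L2_sqi[OF L(5)] T0(2) T0(2), of i j] by simp
    qed
    have "(\<integral>\<omega>. S T \<omega> \<bullet> R T \<omega> \<partial>M) = (\<Sum>i\<in>UNIV. \<integral>\<omega>. I i T \<omega> \<bullet> R T \<omega> \<partial>M)"
      unfolding S_def by (rule sqi_inner_sum[OF sI[OF T0(2)] sR[OF T0(2)]])
    also have "\<dots> = (\<Sum>i\<in>UNIV. \<Sum>j\<in>UNIV. \<integral>\<omega>. I i T \<omega> \<bullet> J j T \<omega> \<partial>M)"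
    proof (rule sum.cong[OF refl])
      fix i
      show "(\<integral>\<omega>. I i T \<omega> \<bullet> R T \<omega> \<partial>M) = (\<Sum>j\<in>UNIV. \<integral>\<omega>. I i T \<omega> \<bullet> J j T \<omega> \<partial>M)"
        unfolding R_def inner_sum_right by (rule Bochner_Integration.integral_sum) (rule sqi_inner[OF sI[OF T0(2)] sJ[OF T0(2)]])
    qed
    finally show ?thesis unfolding pair by simp
  qed
  \<comment> \<open>The backward equation at time 0 expresses \<open>\<zeta>\<close> by
    \<open>p 0\<close>, the total drift and \<open>S T\<close>; the first of these is orthogonal to
    \<open>R T\<close>.\<close>
  have e5: "(\<integral>\<omega>. \<zeta> \<omega> \<bullet> R T \<omega> \<partial>M) = - (\<integral>\<omega>. R T \<omega> \<bullet> running_integral f T \<omega> \<partial>M) + (\<integral>\<omega>. S T \<omega> \<bullet> R T \<omega> \<partial>M)"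
  proof -
    have "(\<integral>\<omega>. \<zeta> \<omega> \<bullet> R T \<omega> \<partial>M) = (\<integral>\<omega>. p 0 \<omega> \<bullet> R T \<omega> - running_integral f T \<omega> \<bullet> R T \<omega> + S T \<omega> \<bullet> R T \<omega> \<partial>M)"
    proof (rule integral_cong_AE)
      show "(\<lambda>\<omega>. \<zeta> \<omega> \<bullet> R T \<omega>) \<in> borel_measurable M" using sqi_inner[OF \<zeta> sR[OF T0(2)]] by simp
      show "(\<lambda>\<omega>. p 0 \<omega> \<bullet> R T \<omega> - running_integral f T \<omega> \<bullet> R T \<omega> + S T \<omega> \<bullet> R T \<omega>) \<in> borel_measurable M"
        using sqi_inner[OF sp0 sR[OF T0(2)]] sqi_inner[OF sFT sR[OF T0(2)]] sqi_inner[OF sS[OF T0(2)] sR[OF T0(2)]] by simp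
      show "AE \<omega> in M. \<zeta> \<omega> \<bullet> R T \<omega> = p 0 \<omega> \<bullet> R T \<omega> - running_integral f T \<omega> \<bullet> R T \<omega> + S T \<omega> \<bullet> R T \<omega>"
        using pS[OF T0(1)] S0
      proof eventually_elim
        case (elim \<omega>)
        then have "\<zeta> \<omega> = p 0 \<omega> - running_integral f T \<omega> + S T \<omega>" by (simp add: running_integral_zero)
        then show ?case by (simp add: inner_add_left inner_diff_left)
      qed
    qed
    also have "\<dots> = (\<integral>\<omega>. p 0 \<omega> \<bullet> R T \<omega> \<partial>M) - (\<integral>\<omega>. running_integral f T \<omega> \<bullet> R T \<omega> \<partial>M) + (\<integral>\<omega>. S T \<omega> \<bullet> R T \<omega> \<partial>M)"
      using sqi_inner[OF sp0 sR[OF T0(2)]] sqi_inner[OF sFT sR[OF T0(2)]] sqi_inner[OF sS[OF T0(2)] sR[OF T0(2)]] by simp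
    finally show ?thesis using e3 by (simp add: inner_commute)
  qed
  have "(\<integral>\<omega>. \<zeta> \<omega> \<bullet> Y T \<omega> \<partial>M) = (\<integral>\<omega>. \<zeta> \<omega> \<bullet> running_integral a T \<omega> + \<zeta> \<omega> \<bullet> R T \<omega> \<partial>M)"
  proof (rule integral_cong_AE)
    have "Y T \<in> borel_measurable M" by (rule prog_measurable_M[OF L2_prog[OF L(6)] T0(2)])
    then show "(\<lambda>\<omega>. \<zeta> \<omega> \<bullet> Y T \<omega>) \<in> borel_measurable M" using sqi_measurable[OF \<zeta>] by measurable
    show "(\<lambda>\<omega>. \<zeta> \<omega> \<bullet> running_integral a T \<omega> + \<zeta> \<omega> \<bullet> R T \<omega>) \<in> borel_measurable M"
      using sqi_inner[OF \<zeta> sAT] sqi_inner[OF \<zeta> sR[OF T0(2)]] by simp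
    show "AE \<omega> in M. \<zeta> \<omega> \<bullet> Y T \<omega> = \<zeta> \<omega> \<bullet> running_integral a T \<omega> + \<zeta> \<omega> \<bullet> R T \<omega>"
      using YR[OF T0(2)] by eventually_elim (simp add: inner_add_right)
  qed
  also have "\<dots> = (\<integral>\<omega>. \<zeta> \<omega> \<bullet> running_integral a T \<omega> \<partial>M) + (\<integral>\<omega>. \<zeta> \<omega> \<bullet> R T \<omega> \<partial>M)"
    by (rule Bochner_Integration.integral_add[OF sqi_inner[OF \<zeta> sAT] sqi_inner[OF \<zeta> sR[OF T0(2)]]])
  also have "(\<integral>\<omega>. \<zeta> \<omega> \<bullet> running_integral a T \<omega> \<partial>M) = (\<integral>z. ?p z \<bullet> ?a z \<partial>N) - (\<integral>z. ?F z \<bullet> ?a z \<partial>N)"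
    unfolding integral_running_integral[OF L(4) \<zeta>] e1 ..
  finally have "(\<integral>\<omega>. \<zeta> \<omega> \<bullet> Y T \<omega> \<partial>M) = (\<integral>z. ?p z \<bullet> ?a z \<partial>N) - (\<integral>z. ?Y z \<bullet> ?f z \<partial>N) + (\<integral>\<omega>. S T \<omega> \<bullet> R T \<omega> \<partial>M)"
    using e2 e5 by linarith
  moreover have "(\<integral>z. ?Y z \<bullet> ?f z \<partial>N) = (\<integral>z. ?f z \<bullet> ?Y z \<partial>N)"
    unfolding inner_commute[of "Y _ _"] ..
  ultimately show ?thesis using e4 by linarith
qed

end

definition ess_bounded_measurable :: "(real \<Rightarrow> real^'b::finite^'a::finite) \<Rightarrow> bool" where
  "ess_bounded_measurable E \<longleftrightarrow> E \<in> borel_measurable borel \<and> (\<exists>c. AE t in lborel. norm (E t) \<le> c)"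

lemma linear_transpose: "linear (transpose :: real^'b::finite^'a::finite \<Rightarrow> real^'a^'b)"
  by (rule linearI) (simp_all add: transpose_def vec_eq_iff)

lemma bounded_measurable_transpose:
  fixes E :: "real \<Rightarrow> real^'b::finite^'a::finite"
  assumes "bounded_measurable E"
  shows "bounded_measurable (\<lambda>s. transpose (E s))"
proof -
  have bl: "bounded_linear (transpose :: real^'b^'a \<Rightarrow> real^'a^'b)"
    using linear_transpose by (simp add: linear_conv_bounded_linear)
  then have "transpose \<in> borel_measurable (borel :: (real^'b^'a) measure)"
    by (intro borel_measurable_continuous_onI linear_continuous_on)
  then have "(\<lambda>s. transpose (E s)) \<in> borel_measurable borel"
    using assms unfolding bounded_measurable_def by (intro measurable_compose[of E _ borel transpose]) auto
  moreover have "bounded (range (\<lambda>s. transpose (E s)))"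
    using bounded_linear_image[OF _ bl, of "range E"] assms by (simp add: bounded_measurable_def image_image)
  ultimately show ?thesis by (simp add: bounded_measurable_def)
qed

lemma inner_matrix_transpose: "x \<bullet> (E *v y) = (transpose E *v x) \<bullet> (y :: real^'b::finite)"
  using dot_lmul_matrix[of x E y] vector_transpose_matrix[of x "transpose E"] by simp

context brownian_motion
begin

section \<open>Transfer between the time interval and the whole line\<close>

lemma AE_lam_iff: "(AE s in lborel. s \<in> {0..T} \<longrightarrow> P s) \<longleftrightarrow> (AE s in lam. P s)"
  unfolding lam_def by (subst AE_restrict_space_iff) auto

text \<open>The coefficient is bounded only at almost every time, so the bound is first lifted to
  almost every point of \<open>N\<close>.\<close>

lemma L2_mv_ess:
  fixes E :: "real \<Rightarrow> real^'b::finite^'a::finite"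
  assumes E: "ess_bounded_measurable E" and X: "L2 X"
  shows "L2 (\<lambda>s \<omega>. E s *v X s \<omega>)"
proof -
  obtain c where c: "AE t in lborel. norm (E t) \<le> c" and Em: "E \<in> borel_measurable borel" using E by (auto simp: ess_bounded_measurable_def)
  have p: "prog (\<lambda>s \<omega>. E s *v X s \<omega>)" by (intro prog_mv Em L2_prog[OF X])
  have "AE s in lam. norm (E s) \<le> c" using c unfolding AE_lam_iff[symmetric] by eventually_elim simp
  then have "AE s in lam. AE \<omega> in M. norm (E (fst (s, \<omega>))) \<le> c" by simp
  moreover have "{z\<in>space (lam \<Otimes>\<^sub>M M). norm (E (fst z)) \<le> c} \<in> sets (lam \<Otimes>\<^sub>M M)"
  proof -
    have [measurable]: "(\<lambda>z. E (fst z)) \<in> borel_measurable N" by (rule measurable_fst_N_borel[OF Em])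
    have "{z\<in>space N. norm (E (fst z)) \<le> c} \<in> sets N" by measurable
    then show ?thesis by (simp add: N_def)
  qed
  ultimately have "AE z in N. norm (E (fst z)) \<le> c" unfolding N_def by (rule lamM.AE_pair_measure[rotated])
  then have "AE z in N. norm (E (fst z) *v X (fst z) (snd z)) \<le> (real CARD('a) * c) * norm (X (fst z) (snd z))"
  proof eventually_elim
    case (elim z)
    have "norm (E (fst z) *v X (fst z) (snd z)) \<le> real CARD('a) * norm (E (fst z)) * norm (X (fst z) (snd z))"
      by (rule norm_matrix_vector_le)
    also have "\<dots> \<le> (real CARD('a) * c) * norm (X (fst z) (snd z))"
      by (intro mult_right_mono mult_left_mono elim) auto
    finally show ?case .
  qed
  then have "sqi N (\<lambda>z. E (fst z) *v X (fst z) (snd z))"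
    by (rule sqi_bound[OF L2_sqi[OF X] prog_measurable_N[OF p]])
  with p show ?thesis by (simp add: L2F_iff)
qed

lemma L2_det:
  assumes "L2det T u"
  shows "L2 (\<lambda>s \<omega>. u s :: 'a::euclidean_space)"
proof -
  have um: "u \<in> borel_measurable borel" using assms by (simp add: L2det_def)
  have p: "prog (\<lambda>s \<omega>. u s)" by (rule prog_det[OF um])
  note m = prog_measurable_N[OF p]
  have "(\<integral>\<^sup>+z. ennreal ((norm (u (fst z)))\<^sup>2) \<partial>N) = (\<integral>\<^sup>+s. indicator {0..T} s * ennreal ((norm (u s))\<^sup>2) \<partial>lborel)"
    using m by (subst nn_integral_N) (auto simp: emeasure_space_1 nn_integral_lam)
  then have "sqi N (\<lambda>z. u (fst z))" using assms m by (simp add: sqi_iff_nn_integral L2det_def)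
  with p show ?thesis by (simp add: L2F_iff)
qed

text \<open>Deterministic functions are treated as processes that are constant in chance; total mass
  1 turns the result back into one about functions of time.\<close>

lemma L2det_lincomb:
  fixes u w :: "real \<Rightarrow> 'a::euclidean_space"
  assumes u: "L2det T u" and w: "L2det T w"
  shows "L2det T (\<lambda>s. u s + c *\<^sub>R w s)"
proof -
  have [measurable]: "u \<in> borel_measurable borel" "w \<in> borel_measurable borel" using u w by (auto simp: L2det_def)
  have "(\<integral>\<^sup>+\<omega>. (\<integral>\<^sup>+s. indicator {0..T} s * ennreal ((norm (u s + c *\<^sub>R w s))\<^sup>2) \<partial>lborel) \<partial>M) < \<infinity>"
    using L2_lincomb[OF L2_det[OF u] L2_det[OF w], of c] unfolding L2F_def by blast
  then show ?thesis by (simp add: L2det_def emeasure_space_1)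
qed

text \<open>A function on the time interval is extended by 0, because \<open>L2det\<close> demands
  measurability on the whole line.\<close>

lemma L2det_of_sqi_lam:
  fixes u :: "real \<Rightarrow> 'a::euclidean_space"
  assumes "sqi lam u"
  shows "L2det T (\<lambda>s. indicator {0..T} s *\<^sub>R u s)"
proof -
  have um: "u \<in> borel_measurable lam" using assms by (rule sqi_measurable)
  have "(\<lambda>s. indicator {0..T} s *\<^sub>R u s) \<in> borel_measurable lborel"
    using um unfolding lam_def by (subst (asm) borel_measurable_restrict_space_iff) auto
  moreover have "(\<integral>\<^sup>+s. indicator {0..T} s * ennreal ((norm (indicator {0..T} s *\<^sub>R u s))\<^sup>2) \<partial>lborel) = (\<integral>\<^sup>+s. ennreal ((norm (u s))\<^sup>2) \<partial>lam)"
    unfolding nn_integral_lam by (intro nn_integral_cong) (auto simp: indicator_def)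
  ultimately show ?thesis using assms sqi_iff_nn_integral[OF um] by (simp add: L2det_def)
qed

text \<open>\<open>h\<close> is measurable for \<open>N\<close> only. Clamping time into
  \<open>{0..T}\<close> and multiplying by the indicator gives a measurable function on the larger
  product, hence measurable sets on which almost-everywhere statements can be passed to sections and
  back.\<close>

lemma AE_N_iff:
  fixes h :: "real \<times> 'w \<Rightarrow> 'a::euclidean_space"
  assumes h: "h \<in> borel_measurable N"
  shows "(AE z in lborel \<Otimes>\<^sub>M M. fst z \<in> {0..T} \<longrightarrow> h z = 0) \<longleftrightarrow> (AE z in N. h z = 0)"
proof -
  interpret LM: pair_sigma_finite lborel M ..
  have cl: "(\<lambda>s. max 0 (min T s)) \<in> measurable borel lam"
  proof -
    have "(\<lambda>s. max 0 (min T s)) \<in> measurable borel (restrict_space borel {0..T})"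
      by (rule measurable_restrict_space2) (use T in auto)
    then show ?thesis by (simp add: measurable_cong_sets[OF refl sets_lam])
  qed
  define h' where "h' z = indicator {0..T} (fst z) *\<^sub>R h (max 0 (min T (fst z)), snd z)" for z
  have "(\<lambda>z. (max 0 (min T (fst z)), snd z)) \<in> measurable (lborel \<Otimes>\<^sub>M M) N"
    unfolding N_def by (intro measurable_Pair measurable_compose[OF measurable_fst] measurable_snd) (use cl in simp)
  from measurable_compose[OF this h]
  have "h' \<in> borel_measurable (lborel \<Otimes>\<^sub>M M)"
    unfolding h'_def by (intro borel_measurable_scaleR) auto
  from measurable_sets[OF this, of "{0}"]
  have "{z\<in>space (lborel \<Otimes>\<^sub>M M). h' z = 0} \<in> sets (lborel \<Otimes>\<^sub>M M)"
    by (simp add: vimage_def Int_def conj_commute)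
  moreover have "h' z = 0 \<longleftrightarrow> (fst z \<in> {0..T} \<longrightarrow> h z = 0)" for z by (cases z) (auto simp: h'_def indicator_def)
  ultimately have m1: "{z\<in>space (lborel \<Otimes>\<^sub>M M). fst z \<in> {0..T} \<longrightarrow> h z = 0} \<in> sets (lborel \<Otimes>\<^sub>M M)" by simp
  from measurable_sets[OF h, of "{0}"]
  have m2: "{z\<in>space (lam \<Otimes>\<^sub>M M). h z = 0} \<in> sets (lam \<Otimes>\<^sub>M M)"
    by (simp add: N_def vimage_def Int_def conj_commute)
  have "(AE z in lborel \<Otimes>\<^sub>M M. fst z \<in> {0..T} \<longrightarrow> h z = 0) \<longleftrightarrow> (AE s in lborel. AE \<omega> in M. s \<in> {0..T} \<longrightarrow> h (s, \<omega>) = 0)"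
    using LM.AE_pair_measure[OF m1] LM.AE_pair[of "\<lambda>z. fst z \<in> {0..T} \<longrightarrow> h z = 0"] by auto
  also have "\<dots> \<longleftrightarrow> (AE s in lborel. s \<in> {0..T} \<longrightarrow> (AE \<omega> in M. h (s, \<omega>) = 0))"
  proof -
    have "(AE \<omega> in M. s \<in> {0..T} \<longrightarrow> h (s, \<omega>) = 0) \<longleftrightarrow> (s \<in> {0..T} \<longrightarrow> (AE \<omega> in M. h (s, \<omega>) = 0))" for s
      by (cases "s \<in> {0..T}") auto
    then show ?thesis by simp
  qed
  also have "\<dots> \<longleftrightarrow> (AE s in lam. AE \<omega> in M. h (s, \<omega>) = 0)" by (rule AE_lam_iff)
  also have "\<dots> \<longleftrightarrow> (AE z in N. h z = 0)"
    unfolding N_def using lamM.AE_pair_measure[OF m2] lamM.AE_pair[of "\<lambda>z. h z = 0"] by auto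
  finally show ?thesis .
qed

lemma tail_integral:
  fixes f :: "real \<Rightarrow> 'w \<Rightarrow> 'a::euclidean_space"
  assumes f: "integrable lam (\<lambda>r. f r \<omega>)" and t: "t \<in> {0..T}"
  shows "set_lebesgue_integral lborel {t..T} (\<lambda>r. f r \<omega>) = running_integral f T \<omega> - running_integral f t \<omega>"
proof -
  have [measurable]: "(\<lambda>r. f r \<omega>) \<in> borel_measurable lam" using f by simp
  have i: "integrable lam (\<lambda>r. if r \<le> t then f r \<omega> else 0)"
    by (rule Bochner_Integration.integrable_bound[OF f]) auto
  have "running_integral f T \<omega> - running_integral f t \<omega> = (\<integral>r. f r \<omega> - (if r \<le> t then f r \<omega> else 0) \<partial>lam)"
  proof -
    have "running_integral f T \<omega> = (\<integral>r. f r \<omega> \<partial>lam)" unfolding running_integral_def by (intro Bochner_Integration.integral_cong) auto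
    then show ?thesis unfolding running_integral_def using Bochner_Integration.integral_diff[OF f i] by simp
  qed
  also have "\<dots> = (\<integral>r. indicator {t..T} r *\<^sub>R f r \<omega> \<partial>lam)"
  proof (rule integral_cong_AE)
    have "AE s in lborel. s \<noteq> t" by (rule AE_lborel_singleton)
    then have "AE s in lam. s \<noteq> t" unfolding AE_lam_iff[symmetric] by eventually_elim simp
    then show "AE r in lam. f r \<omega> - (if r \<le> t then f r \<omega> else 0) = indicator {t..T} r *\<^sub>R f r \<omega>"
      using AE_space by eventually_elim (auto simp: indicator_def)
    have [measurable]: "(indicator {t..T} :: real \<Rightarrow> real) \<in> borel_measurable lam" by (rule measurable_lam) simp
    show "(\<lambda>r. indicator {t..T} r *\<^sub>R f r \<omega>) \<in> borel_measurable lam" by measurable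
  qed measurable
  also have "\<dots> = set_lebesgue_integral lborel {t..T} (\<lambda>r. f r \<omega>)"
    using t by (intro set_integral_lam[symmetric]) auto
  finally show ?thesis by simp
qed

lemma integral_N_iterated:
  fixes f :: "real \<Rightarrow> 'w \<Rightarrow> real"
  assumes "integrable N (\<lambda>z. f (fst z) (snd z))"
  shows "(\<integral>\<omega>. set_lebesgue_integral lborel {0..T} (\<lambda>s. f s \<omega>) \<partial>M) = (\<integral>z. f (fst z) (snd z) \<partial>N)"
proof -
  have "(\<integral>z. f (fst z) (snd z) \<partial>N) = (\<integral>\<omega>. \<integral>s. f s \<omega> \<partial>lam \<partial>M)"
    using lamM.integral_snd[of f] assms by (simp add: N_def case_prod_beta')
  moreover have "set_lebesgue_integral lborel {0..T} (\<lambda>s. f s \<omega>) = (\<integral>s. f s \<omega> \<partial>lam)" for \<omega>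
    unfolding integral_lam set_lebesgue_integral_def ..
  ultimately show ?thesis by simp
qed

text \<open>Jensen's inequality at each time. It makes the mean of the first optimality expression
  an admissible deterministic direction.\<close>

lemma mean_sqi_lam:
  fixes h :: "real \<Rightarrow> 'w \<Rightarrow> 'a::euclidean_space"
  assumes h: "L2 h"
  shows "sqi lam (\<lambda>s. \<integral>\<omega>. h s \<omega> \<partial>M)"
proof -
  note sh = L2_sqi[OF h]
  have [measurable]: "(\<lambda>z. h (fst z) (snd z)) \<in> borel_measurable N" by (rule sqi_measurable[OF sh])
  have "integrable (lam \<Otimes>\<^sub>M M) (\<lambda>z. h (fst z) (snd z))"
    using sqi_integrable[OF N_finite sh] by (simp add: N_def)
  from lamM.integrable_fst'[OF this] have m: "(\<lambda>s. \<integral>\<omega>. h s \<omega> \<partial>M) \<in> borel_measurable lam" by simp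
  have "(\<integral>\<^sup>+s. ennreal ((norm (\<integral>\<omega>. h s \<omega> \<partial>M))\<^sup>2) \<partial>lam) \<le> (\<integral>\<^sup>+s. \<integral>\<^sup>+\<omega>. ennreal ((norm (h s \<omega>))\<^sup>2) \<partial>M \<partial>lam)"
  proof (rule nn_integral_mono)
    fix s assume "s \<in> space lam"
    then have "h s \<in> borel_measurable M" using prog_measurable_M[OF L2_prog[OF h]] by simp
    from norm_integral_power2_le[OF this, of "\<lambda>_. True"]
    show "ennreal ((norm (\<integral>\<omega>. h s \<omega> \<partial>M))\<^sup>2) \<le> (\<integral>\<^sup>+\<omega>. ennreal ((norm (h s \<omega>))\<^sup>2) \<partial>M)"
      by (simp add: emeasure_space_1)
  qed
  also have "\<dots> = (\<integral>\<^sup>+z. ennreal ((norm (h (fst z) (snd z)))\<^sup>2) \<partial>N)"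
    by (subst nn_integral_N) auto
  also have "\<dots> < \<infinity>" using sh sqi_iff_nn_integral[OF sqi_measurable[OF sh]] by simp
  finally show ?thesis using m by (simp add: sqi_iff_nn_integral)
qed

end

section \<open>The linear-quadratic problem\<close>

lemma integral_quadratic:
  fixes f g h :: "'a \<Rightarrow> real"
  assumes "integrable L f" "integrable L g" "integrable L h"
  shows "(\<integral>x. f x + a * g x + b * h x \<partial>L) = (\<integral>x. f x \<partial>L) + a * (\<integral>x. g x \<partial>L) + b * (\<integral>x. h x \<partial>L)"
  using assms by simp

locale lq_control = brownian_motion M W T
  for M :: "'w measure" and W :: "'d::finite \<Rightarrow> real \<Rightarrow> 'w \<Rightarrow> real" and T :: real +
  fixes A :: "real \<Rightarrow> real^'n::finite^'n"
    and B1 :: "real \<Rightarrow> real^'l1::finite^'n" and B2 :: "real \<Rightarrow> real^'l2::finite^'n"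
    and C :: "'d \<Rightarrow> real \<Rightarrow> real^'n^'n"
    and D1 :: "'d \<Rightarrow> real \<Rightarrow> real^'l1^'n" and D2 :: "'d \<Rightarrow> real \<Rightarrow> real^'l2^'n"
    and Q :: "real \<Rightarrow> real^'n^'n"
    and R1 :: "real \<Rightarrow> real^'l1^'l1" and R2 :: "real \<Rightarrow> real^'l2^'l2"
    and G :: "real^'n^'n"
  assumes A: "bounded_measurable A" and B1: "bounded_measurable B1" and B2: "bounded_measurable B2" and C: "\<And>j. bounded_measurable (C j)"
    and D1: "\<And>j. bounded_measurable (D1 j)" and D2: "\<And>j. bounded_measurable (D2 j)"
    and Q: "ess_bounded_measurable Q" and R1: "ess_bounded_measurable R1" and R2: "ess_bounded_measurable R2"
    and sym: "\<And>t. transpose (Q t) = Q t" "\<And>t. transpose (R1 t) = R1 t" "\<And>t. transpose (R2 t) = R2 t" "transpose G = G"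
    and psd: "\<And>t x. x \<bullet> (Q t *v x) \<ge> 0" "\<And>t x. x \<bullet> (R1 t *v x) \<ge> 0" "\<And>t x. x \<bullet> (R2 t *v x) \<ge> 0" "\<And>x. x \<bullet> (G *v x) \<ge> 0"
begin

abbreviation state where "state \<equiv> is_state M W T A B1 B2 C D1 D2"

abbreviation J where "J \<equiv> cost M T Q R1 R2 G"

abbreviation drift where "drift u1 u2 X \<equiv> \<lambda>s \<omega>. A s *v X s \<omega> + B1 s *v u1 s + B2 s *v u2 s \<omega>"

abbreviation diffusion where "diffusion u1 u2 X \<equiv> \<lambda>j s \<omega>. C j s *v X s \<omega> + D1 j s *v u1 s + D2 j s *v u2 s \<omega>"

lemma L2_drift: "L2 (drift u1 u2 X)" and L2_diffusion: "L2 (diffusion u1 u2 X j)"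
  if "L2det T u1" "L2 u2" "L2 X"
  by (intro L2_add L2_mv[OF A] L2_mv[OF B1] L2_mv[OF B2] L2_mv[OF C] L2_mv[OF D1] L2_mv[OF D2] L2_det that)+

lemma state_iff: "state x0 u1 u2 X \<longleftrightarrow> L2 X \<and> ito_process x0 (drift u1 u2 X) (diffusion u1 u2 X) X"
proof -
  have eq: "set_lebesgue_integral lborel {0..t} (\<lambda>s. drift u1 u2 X s \<omega>) = running_integral (drift u1 u2 X) t \<omega>" if "t \<in> {0..T}" for t \<omega>
    by (rule running_integral_eq) (use that in simp)
  show ?thesis unfolding is_state_def ito_process_def by (simp only: eq cong: ball_cong)
qed

lemma state_lincomb:
  assumes X: "state x0 u1 u2 X" "L2det T u1" "L2 u2" and Y: "state y0 w1 w2 Y" "L2det T w1" "L2 w2"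
  shows "state (x0 + c *\<^sub>R y0) (\<lambda>s. u1 s + c *\<^sub>R w1 s) (\<lambda>s \<omega>. u2 s \<omega> + c *\<^sub>R w2 s \<omega>) (\<lambda>s \<omega>. X s \<omega> + c *\<^sub>R Y s \<omega>)"
proof -
  have L: "L2 X" "L2 Y" and I: "ito_process x0 (drift u1 u2 X) (diffusion u1 u2 X) X" "ito_process y0 (drift w1 w2 Y) (diffusion w1 w2 Y) Y"
    using X Y by (auto simp: state_iff)
  have "ito_process (x0 + c *\<^sub>R y0) (\<lambda>s \<omega>. drift u1 u2 X s \<omega> + c *\<^sub>R drift w1 w2 Y s \<omega>) (\<lambda>j s \<omega>. diffusion u1 u2 X j s \<omega> + c *\<^sub>R diffusion w1 w2 Y j s \<omega>)
     (\<lambda>s \<omega>. X s \<omega> + c *\<^sub>R Y s \<omega>)"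
    by (rule ito_process_lincomb[OF I]) (intro L2_drift L2_diffusion X Y L)+
  moreover have "(\<lambda>s \<omega>. drift u1 u2 X s \<omega> + c *\<^sub>R drift w1 w2 Y s \<omega>)
      = drift (\<lambda>s. u1 s + c *\<^sub>R w1 s) (\<lambda>s \<omega>. u2 s \<omega> + c *\<^sub>R w2 s \<omega>) (\<lambda>s \<omega>. X s \<omega> + c *\<^sub>R Y s \<omega>)"
    by (simp add: matrix_vector_right_distrib matrix_vector_mult_scaleR scaleR_add_right add_ac)
  moreover have "(\<lambda>j s \<omega>. diffusion u1 u2 X j s \<omega> + c *\<^sub>R diffusion w1 w2 Y j s \<omega>)
      = diffusion (\<lambda>s. u1 s + c *\<^sub>R w1 s) (\<lambda>s \<omega>. u2 s \<omega> + c *\<^sub>R w2 s \<omega>) (\<lambda>s \<omega>. X s \<omega> + c *\<^sub>R Y s \<omega>)"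
    by (simp add: matrix_vector_right_distrib matrix_vector_mult_scaleR scaleR_add_right add_ac)
  ultimately show ?thesis using L2_lincomb[OF L, of c] by (simp add: state_iff)
qed

lemma state_exists:
  assumes "L2det T u1" "L2 u2"
  shows "\<exists>X. state x0 u1 u2 X"
proof -
  have b: "L2 (\<lambda>s \<omega>. B1 s *v u1 s + B2 s *v u2 s \<omega>)"
    by (intro L2_add L2_mv[OF B1] L2_mv[OF B2] L2_det assms)
  have d: "L2 ((\<lambda>j s \<omega>. D1 j s *v u1 s + D2 j s *v u2 s \<omega>) j)" for j
    by (intro L2_add L2_mv[OF D1] L2_mv[OF D2] L2_det assms)
  obtain X where "L2 X" "ito_process x0 (\<lambda>s \<omega>. A s *v X s \<omega> + (B1 s *v u1 s + B2 s *v u2 s \<omega>))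
     (\<lambda>j s \<omega>. C j s *v X s \<omega> + (D1 j s *v u1 s + D2 j s *v u2 s \<omega>)) X"
    using sde_exists[where C = C and d = "\<lambda>j s \<omega>. D1 j s *v u1 s + D2 j s *v u2 s \<omega>" and ?x0.0 = x0, OF A C b d] by blast
  then show ?thesis by (auto simp: state_iff add.assoc)
qed

text \<open>Membership in \<open>L2\<close> does not see the single time \<open>T\<close>; the bound
  uniform in time does, and it makes the terminal cost finite.\<close>

lemma state_sqi_T:
  assumes "state x0 u1 u2 X" "L2det T u1" "L2 u2"
  shows "sqi M (X T)"
proof -
  have L: "L2 X" and I: "ito_process x0 (drift u1 u2 X) (diffusion u1 u2 X) X" using assms by (auto simp: state_iff)
  have T': "T \<in> {0..T}" using T by simp
  have "\<exists>c. (\<integral>\<^sup>+\<omega>. ennreal ((norm (X T \<omega>))\<^sup>2) \<partial>M) \<le> ennreal c"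
    by (rule ito_process_L2[OF I L2_prog[OF L] L2_drift[OF assms(2,3) L] L2_diffusion[OF assms(2,3) L]]) (use T' in blast)
  then have "(\<integral>\<^sup>+\<omega>. ennreal ((norm (X T \<omega>))\<^sup>2) \<partial>M) < \<infinity>" by (auto intro: le_less_trans)
  then show ?thesis using prog_measurable_M[OF L2_prog[OF L] T'] by (simp add: sqi_iff_nn_integral)
qed

lemma sqi_G: "sqi M \<xi> \<Longrightarrow> sqi M (\<lambda>\<omega>. G *v \<xi> \<omega>)"
  by (rule sqi_bound[of _ \<xi> _ "real CARD('n) * norm G"])
     (auto simp: sqi_def intro!: borel_measurable_matrix_vector norm_matrix_vector_le)

text \<open>The bilinear form whose diagonal is twice the cost. Off the diagonal, by symmetry of the
  weights, it is the derivative of the cost in the direction of the second triple.\<close>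

definition quad where
  "quad u1 u2 X w1 w2 Y = (\<integral>z. X (fst z) (snd z) \<bullet> (Q (fst z) *v Y (fst z) (snd z)) + u1 (fst z) \<bullet> (R1 (fst z) *v w1 (fst z))
       + u2 (fst z) (snd z) \<bullet> (R2 (fst z) *v w2 (fst z) (snd z)) \<partial>N) + (\<integral>\<omega>. X T \<omega> \<bullet> (G *v Y T \<omega>) \<partial>M)"

lemma quad_integrable:
  assumes "L2det T u1" "L2 u2" "L2 X" "L2det T w1" "L2 w2" "L2 Y"
  shows "integrable N (\<lambda>z. X (fst z) (snd z) \<bullet> (Q (fst z) *v Y (fst z) (snd z)))"
    and "integrable N (\<lambda>z. u1 (fst z) \<bullet> (R1 (fst z) *v w1 (fst z)))"
    and "integrable N (\<lambda>z. u2 (fst z) (snd z) \<bullet> (R2 (fst z) *v w2 (fst z) (snd z)))"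
  using sqi_inner[OF L2_sqi[OF assms(3)] L2_sqi[OF L2_mv_ess[OF Q assms(6)]]]
    sqi_inner[OF L2_sqi[OF L2_det[OF assms(1)]] L2_sqi[OF L2_mv_ess[OF R1 L2_det[OF assms(4)]]]]
    sqi_inner[OF L2_sqi[OF assms(2)] L2_sqi[OF L2_mv_ess[OF R2 assms(5)]]] by simp_all

lemma cost_eq_quad:
  assumes "L2det T u1" "L2 u2" "L2 X"
  shows "J u1 u2 X = quad u1 u2 X u1 u2 X / 2"
proof -
  note i = quad_integrable[OF assms assms]
  have "(\<integral>\<omega>. set_lebesgue_integral lborel {0..T} (\<lambda>s. X s \<omega> \<bullet> (Q s *v X s \<omega>) + u1 s \<bullet> (R1 s *v u1 s) + u2 s \<omega> \<bullet> (R2 s *v u2 s \<omega>)) \<partial>M)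
    = (\<integral>z. X (fst z) (snd z) \<bullet> (Q (fst z) *v X (fst z) (snd z)) + u1 (fst z) \<bullet> (R1 (fst z) *v u1 (fst z))
       + u2 (fst z) (snd z) \<bullet> (R2 (fst z) *v u2 (fst z) (snd z)) \<partial>N)"
    by (rule integral_N_iterated) (use i in simp)
  then show ?thesis unfolding cost_def quad_def by simp
qed

lemma cost_nonneg:
  assumes "L2det T u1" "L2 u2" "L2 X"
  shows "0 \<le> J u1 u2 X"
proof -
  have "0 \<le> quad u1 u2 X u1 u2 X"
    unfolding quad_def using psd by (intro add_nonneg_nonneg Bochner_Integration.integral_nonneg) auto
  then show ?thesis by (simp add: cost_eq_quad[OF assms])
qed

lemma sym_inner: "x \<bullet> (E *v y) = y \<bullet> (E *v x)" if "transpose E = E" for E :: "real^'b::finite^'b"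
  using inner_matrix_transpose[of x E y] that by (simp add: inner_commute)

text \<open>Symmetry merges the two mixed terms, and the factor 2 cancels against the one half in
  the cost. The second-order term is the cost of the direction itself and hence nonnegative.\<close>

lemma cost_expand:
  assumes X: "state x0 u1 u2 X" "L2det T u1" "L2 u2" and Y: "state y0 w1 w2 Y" "L2det T w1" "L2 w2"
  shows "J (\<lambda>s. u1 s + c *\<^sub>R w1 s) (\<lambda>s \<omega>. u2 s \<omega> + c *\<^sub>R w2 s \<omega>) (\<lambda>s \<omega>. X s \<omega> + c *\<^sub>R Y s \<omega>)
     = J u1 u2 X + c * quad u1 u2 X w1 w2 Y + c\<^sup>2 * J w1 w2 Y"
proof -
  have L: "L2 X" "L2 Y" using X Y by (auto simp: state_iff)
  have L': "L2 (\<lambda>s \<omega>. X s \<omega> + c *\<^sub>R Y s \<omega>)" by (rule L2_lincomb[OF L])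
  have d: "L2det T (\<lambda>s. u1 s + c *\<^sub>R w1 s)" by (rule L2det_lincomb[OF X(2) Y(2)])
  have q2: "L2 (\<lambda>s \<omega>. u2 s \<omega> + c *\<^sub>R w2 s \<omega>)" by (rule L2_lincomb[OF X(3) Y(3)])
  note i1 = quad_integrable[OF X(2,3) L(1) X(2,3) L(1)] and i2 = quad_integrable[OF X(2,3) L(1) Y(2,3) L(2)] and i3 = quad_integrable[OF Y(2,3) L(2) Y(2,3) L(2)]
  have exp: "(x + c *\<^sub>R y) \<bullet> (E *v (x + c *\<^sub>R y)) = x \<bullet> (E *v x) + 2 * c * (x \<bullet> (E *v y)) + c\<^sup>2 * (y \<bullet> (E *v y))"
    if E: "transpose E = E" for E :: "real^'b::finite^'b" and x y
    using sym_inner[OF E, of y x]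
    by (simp add: matrix_vector_right_distrib matrix_vector_mult_scaleR inner_add_left inner_add_right power2_eq_square algebra_simps)
  let ?qX = "\<lambda>z. X (fst z) (snd z) \<bullet> (Q (fst z) *v X (fst z) (snd z)) + u1 (fst z) \<bullet> (R1 (fst z) *v u1 (fst z)) + u2 (fst z) (snd z) \<bullet> (R2 (fst z) *v u2 (fst z) (snd z))"
  let ?qXY = "\<lambda>z. X (fst z) (snd z) \<bullet> (Q (fst z) *v Y (fst z) (snd z)) + u1 (fst z) \<bullet> (R1 (fst z) *v w1 (fst z)) + u2 (fst z) (snd z) \<bullet> (R2 (fst z) *v w2 (fst z) (snd z))"
  let ?qY = "\<lambda>z. Y (fst z) (snd z) \<bullet> (Q (fst z) *v Y (fst z) (snd z)) + w1 (fst z) \<bullet> (R1 (fst z) *v w1 (fst z)) + w2 (fst z) (snd z) \<bullet> (R2 (fst z) *v w2 (fst z) (snd z))"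
  let ?u = "\<lambda>s. u1 s + c *\<^sub>R w1 s" and ?v = "\<lambda>s \<omega>. u2 s \<omega> + c *\<^sub>R w2 s \<omega>" and ?Z = "\<lambda>s \<omega>. X s \<omega> + c *\<^sub>R Y s \<omega>"
  have I: "integrable N ?qX" "integrable N ?qXY" "integrable N ?qY" using i1 i2 i3 by simp_all
  have "(\<integral>z. ?Z (fst z) (snd z) \<bullet> (Q (fst z) *v ?Z (fst z) (snd z)) + ?u (fst z) \<bullet> (R1 (fst z) *v ?u (fst z))
       + ?v (fst z) (snd z) \<bullet> (R2 (fst z) *v ?v (fst z) (snd z)) \<partial>N) = (\<integral>z. ?qX z + 2 * c * ?qXY z + c\<^sup>2 * ?qY z \<partial>N)"
    unfolding exp[OF sym(1)] exp[OF sym(2)] exp[OF sym(3)]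
  proof (intro Bochner_Integration.integral_cong refl)
    have "a1 + r * b1 + e * c1 + (a2 + r * b2 + e * c2) + (a3 + r * b3 + e * c3)
       = a1 + a2 + a3 + r * (b1 + b2 + b3) + e * (c1 + c2 + c3)" for a1 a2 a3 b1 b2 b3 c1 c2 c3 r e :: real
      by (simp add: algebra_simps)
    then show "X (fst z) (snd z) \<bullet> (Q (fst z) *v X (fst z) (snd z)) + 2 * c * (X (fst z) (snd z) \<bullet> (Q (fst z) *v Y (fst z) (snd z)))
          + c\<^sup>2 * (Y (fst z) (snd z) \<bullet> (Q (fst z) *v Y (fst z) (snd z)))
        + (u1 (fst z) \<bullet> (R1 (fst z) *v u1 (fst z)) + 2 * c * (u1 (fst z) \<bullet> (R1 (fst z) *v w1 (fst z))) + c\<^sup>2 * (w1 (fst z) \<bullet> (R1 (fst z) *v w1 (fst z))))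
        + (u2 (fst z) (snd z) \<bullet> (R2 (fst z) *v u2 (fst z) (snd z)) + 2 * c * (u2 (fst z) (snd z) \<bullet> (R2 (fst z) *v w2 (fst z) (snd z)))
          + c\<^sup>2 * (w2 (fst z) (snd z) \<bullet> (R2 (fst z) *v w2 (fst z) (snd z))))
        = ?qX z + 2 * c * ?qXY z + c\<^sup>2 * ?qY z" for z .
  qed
  also have "\<dots> = (\<integral>z. ?qX z \<partial>N) + 2 * c * (\<integral>z. ?qXY z \<partial>N) + c\<^sup>2 * (\<integral>z. ?qY z \<partial>N)"
    by (rule integral_quadratic[OF I])
  finally have a: "(\<integral>z. ?Z (fst z) (snd z) \<bullet> (Q (fst z) *v ?Z (fst z) (snd z)) + ?u (fst z) \<bullet> (R1 (fst z) *v ?u (fst z))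
       + ?v (fst z) (snd z) \<bullet> (R2 (fst z) *v ?v (fst z) (snd z)) \<partial>N) = (\<integral>z. ?qX z \<partial>N) + 2 * c * (\<integral>z. ?qXY z \<partial>N) + c\<^sup>2 * (\<integral>z. ?qY z \<partial>N)" .
  note sX = state_sqi_T[OF X] and sY = state_sqi_T[OF Y]
  have b: "(\<integral>\<omega>. ?Z T \<omega> \<bullet> (G *v ?Z T \<omega>) \<partial>M) = (\<integral>\<omega>. X T \<omega> \<bullet> (G *v X T \<omega>) \<partial>M) + 2 * c * (\<integral>\<omega>. X T \<omega> \<bullet> (G *v Y T \<omega>) \<partial>M) + c\<^sup>2 * (\<integral>\<omega>. Y T \<omega> \<bullet> (G *v Y T \<omega>) \<partial>M)"
    unfolding exp[OF sym(4)] using sqi_inner[OF sX sqi_G[OF sX]] sqi_inner[OF sX sqi_G[OF sY]] sqi_inner[OF sY sqi_G[OF sY]]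
    by (rule integral_quadratic)
  have final: "(a1 + 2 * c * b1 + c\<^sup>2 * d1 + (a2 + 2 * c * b2 + c\<^sup>2 * d2)) / 2 = (a1 + a2) / 2 + c * (b1 + b2) + c\<^sup>2 * ((d1 + d2) / 2)"
    for a1 a2 b1 b2 d1 d2 :: real by (simp add: field_simps)
  show ?thesis
    unfolding cost_eq_quad[OF d q2 L'] cost_eq_quad[OF X(2,3) L(1)] cost_eq_quad[OF Y(2,3) L(2)] quad_def a b
    by (rule final)
qed

text \<open>The gradient with respect to the first control of the Hamiltonian, in which
  \<open>p\<close> is paired with the drift and \<open>k j\<close> with the diffusions.\<close>

abbreviation \<Gamma>1 where "\<Gamma>1 u1 p k \<equiv> \<lambda>s \<omega>. transpose (B1 s) *v p s \<omega> + (\<Sum>j\<in>UNIV. transpose (D1 j s) *v k j s \<omega>) + R1 s *v u1 s"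

abbreviation \<Gamma>2 where "\<Gamma>2 u2 p k \<equiv> \<lambda>s \<omega>. transpose (B2 s) *v p s \<omega> + (\<Sum>j\<in>UNIV. transpose (D2 j s) *v k j s \<omega>) + R2 s *v u2 s \<omega>"

lemma L2_\<Gamma>:
  assumes "L2det T u1" "L2 u2" "L2 p" "\<And>j. L2 (k j)"
  shows "L2 (\<Gamma>1 u1 p k)" "L2 (\<Gamma>2 u2 p k)"
  by (intro L2_add L2_sum L2_mv[OF bounded_measurable_transpose[OF B1]] L2_mv[OF bounded_measurable_transpose[OF D1]] L2_mv_ess[OF R1]
      L2_mv[OF bounded_measurable_transpose[OF B2]] L2_mv[OF bounded_measurable_transpose[OF D2]] L2_mv_ess[OF R2] L2_det assms)+

text \<open>The terminal term of \<open>quad\<close> is the left side of \<open>duality\<close> with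
  \<open>\<zeta>\<close> equal to \<open>G *v X T \<omega>\<close>. The adjoint drift
  \<open>f\<close> is designed so that everything containing \<open>Y\<close> then cancels.\<close>

lemma variation_formula:
  assumes X: "state x0 u1 u2 X" "L2det T u1" "L2 u2" and Y: "state 0 w1 w2 Y" "L2det T w1" "L2 w2"
    and adj: "is_adjoint M W T A C Q G X p k"
  shows "quad u1 u2 X w1 w2 Y = (\<integral>z. \<Gamma>1 u1 p k (fst z) (snd z) \<bullet> w1 (fst z) \<partial>N) + (\<integral>z. \<Gamma>2 u2 p k (fst z) (snd z) \<bullet> w2 (fst z) (snd z) \<partial>N)"
proof -
  have LX: "L2 X" and LY: "L2 Y" and IY: "ito_process 0 (drift w1 w2 Y) (diffusion w1 w2 Y) Y" using X Y by (auto simp: state_iff)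
  define f where "f s \<omega> = transpose (A s) *v p s \<omega> + (\<Sum>j\<in>UNIV. transpose (C j s) *v k j s \<omega>) + Q s *v X s \<omega>" for s \<omega>
  have Lp: "L2 p" and Lk: "\<And>j. L2 (k j)" using adj by (auto simp: is_adjoint_def)
  obtain I where I: "\<And>j. ito j (k j) (I j)" and peq: "\<And>t. t \<in> {0..T} \<Longrightarrow> AE \<omega> in M. p t \<omega> = G *v X T \<omega>
      + set_lebesgue_integral lborel {t..T} (\<lambda>s. f s \<omega>) - (\<Sum>j\<in>UNIV. I j T \<omega> - I j t \<omega>)"
    using adj unfolding is_adjoint_def f_def by blast
  have Lf: "L2 f" unfolding f_def[abs_def]
    by (intro L2_add L2_sum L2_mv[OF bounded_measurable_transpose[OF A]] L2_mv[OF bounded_measurable_transpose[OF C]] L2_mv_ess[OF Q] Lp Lk LX)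
  note sX = state_sqi_T[OF X] and sY = state_sqi_T[OF Y]
  note La = L2_drift[OF Y(2,3) LY] and Lb = L2_diffusion[OF Y(2,3) LY]
  let ?p = "\<lambda>z. p (fst z) (snd z)" and ?f = "\<lambda>z. f (fst z) (snd z)" and ?Y = "\<lambda>z. Y (fst z) (snd z)"
    and ?a = "\<lambda>z. drift w1 w2 Y (fst z) (snd z)"
  have dual: "(\<integral>\<omega>. (G *v X T \<omega>) \<bullet> Y T \<omega> \<partial>M) = (\<integral>z. ?p z \<bullet> ?a z \<partial>N) - (\<integral>z. ?f z \<bullet> ?Y z \<partial>N)
     + (\<Sum>j\<in>UNIV. \<integral>z. k j (fst z) (snd z) \<bullet> diffusion w1 w2 Y j (fst z) (snd z) \<partial>N)"
  proof (rule duality[OF Lp Lf Lk La Lb LY sqi_G[OF sX] I _ IY])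
    fix t assume t: "t \<in> {0..T}"
    show "AE \<omega> in M. p t \<omega> = G *v X T \<omega> + (running_integral f T \<omega> - running_integral f t \<omega>) - (\<Sum>j\<in>UNIV. I j T \<omega> - I j t \<omega>)"
      using peq[OF t] AE_section_integrable[OF Lf]
    proof eventually_elim
      case (elim \<omega>)
      then show ?case using tail_integral[where f = f and \<omega> = \<omega>, OF elim(2) t] by simp
    qed
  qed
  note sp = L2_sqi[OF Lp] and sf = L2_sqi[OF Lf] and sYN = L2_sqi[OF LY]
  note ipa = sqi_inner[OF sp L2_sqi[OF La]] and ifY = sqi_inner[OF sf sYN] and ikb = sqi_inner[OF L2_sqi[OF Lk] L2_sqi[OF Lb]]
  let ?q = "\<lambda>z. X (fst z) (snd z) \<bullet> (Q (fst z) *v ?Y z) + u1 (fst z) \<bullet> (R1 (fst z) *v w1 (fst z)) + u2 (fst z) (snd z) \<bullet> (R2 (fst z) *v w2 (fst z) (snd z))"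
  have iq: "integrable N ?q" using quad_integrable[OF X(2,3) LX Y(2,3) LY] by simp
  let ?kb = "\<lambda>z. \<Sum>j\<in>UNIV. k j (fst z) (snd z) \<bullet> diffusion w1 w2 Y j (fst z) (snd z)"
  have ikb': "integrable N ?kb" by (rule Bochner_Integration.integrable_sum[OF ikb])
  have kb: "(\<Sum>j\<in>UNIV. \<integral>z. k j (fst z) (snd z) \<bullet> diffusion w1 w2 Y j (fst z) (snd z) \<partial>N) = (\<integral>z. ?kb z \<partial>N)"
    by (rule Bochner_Integration.integral_sum[OF ikb, symmetric])
  have "(\<integral>\<omega>. X T \<omega> \<bullet> (G *v Y T \<omega>) \<partial>M) = (\<integral>\<omega>. (G *v X T \<omega>) \<bullet> Y T \<omega> \<partial>M)"
    by (intro Bochner_Integration.integral_cong refl) (simp add: inner_matrix_transpose sym(4))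
  then have "quad u1 u2 X w1 w2 Y = (\<integral>z. ?q z \<partial>N) + ((\<integral>z. ?p z \<bullet> ?a z \<partial>N) - (\<integral>z. ?f z \<bullet> ?Y z \<partial>N) + (\<integral>z. ?kb z \<partial>N))"
    unfolding quad_def dual kb by simp
  also have "\<dots> = (\<integral>z. ?q z + ((?p z \<bullet> ?a z - ?f z \<bullet> ?Y z) + ?kb z) \<partial>N)"
    by (subst Bochner_Integration.integral_add[OF iq Bochner_Integration.integrable_add[OF Bochner_Integration.integrable_diff[OF ipa ifY] ikb']],
        subst Bochner_Integration.integral_add[OF Bochner_Integration.integrable_diff[OF ipa ifY] ikb'],
        subst Bochner_Integration.integral_diff[OF ipa ifY]) simp
  also have "\<dots> = (\<integral>z. \<Gamma>1 u1 p k (fst z) (snd z) \<bullet> w1 (fst z) + \<Gamma>2 u2 p k (fst z) (snd z) \<bullet> w2 (fst z) (snd z) \<partial>N)"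
  proof (intro Bochner_Integration.integral_cong refl)
    fix z
    have r: "u1 s \<bullet> (R1 s *v w) = (R1 s *v u1 s) \<bullet> w" "u2 s \<omega> \<bullet> (R2 s *v w') = (R2 s *v u2 s \<omega>) \<bullet> w'"
      "X s \<omega> \<bullet> (Q s *v y) = (Q s *v X s \<omega>) \<bullet> y" for s \<omega> w w' y
      by (simp_all add: inner_matrix_transpose sym)
    \<comment> \<open>After transposition the terms with \<open>A\<close> and \<open>C j\<close>
      cancel between \<open>f\<close> and the coefficients of \<open>Y\<close>, the term with
      \<open>Q\<close> cancels the running cost, and only the control terms remain.\<close>
    show "?q z + ((?p z \<bullet> ?a z - ?f z \<bullet> ?Y z) + ?kb z) = \<Gamma>1 u1 p k (fst z) (snd z) \<bullet> w1 (fst z) + \<Gamma>2 u2 p k (fst z) (snd z) \<bullet> w2 (fst z) (snd z)"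
      unfolding f_def r by (simp add: inner_add_left inner_add_right inner_sum_left inner_matrix_transpose[of "p _ _"] inner_matrix_transpose[of "k _ _ _"] sum.distrib)
  qed
  also have "\<dots> = (\<integral>z. \<Gamma>1 u1 p k (fst z) (snd z) \<bullet> w1 (fst z) \<partial>N) + (\<integral>z. \<Gamma>2 u2 p k (fst z) (snd z) \<bullet> w2 (fst z) (snd z) \<partial>N)"
    by (rule Bochner_Integration.integral_add[OF sqi_inner[OF L2_sqi[OF L2_\<Gamma>(1)[OF X(2,3) Lp Lk]] L2_sqi[OF L2_det[OF Y(2)]]]
        sqi_inner[OF L2_sqi[OF L2_\<Gamma>(2)[OF X(2,3) Lp Lk]] L2_sqi[OF Y(3)]]])
  finally show ?thesis .
qed

text \<open>A deterministic factor comes out of the expectation at almost every time, so a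
  deterministic direction tests only the mean.\<close>

lemma mean_inner_det:
  fixes h :: "real \<Rightarrow> 'w \<Rightarrow> 'a::euclidean_space"
  assumes h: "L2 h" and w: "L2det T w"
  shows "(\<integral>z. h (fst z) (snd z) \<bullet> w (fst z) \<partial>N) = (\<integral>s. (\<integral>\<omega>. h s \<omega> \<partial>M) \<bullet> w s \<partial>lam)"
proof -
  have i: "integrable N (\<lambda>z. h (fst z) (snd z) \<bullet> w (fst z))" by (rule sqi_inner[OF L2_sqi[OF h] L2_sqi[OF L2_det[OF w]]])
  have "(\<integral>z. h (fst z) (snd z) \<bullet> w (fst z) \<partial>N) = (\<integral>s. \<integral>\<omega>. h s \<omega> \<bullet> w s \<partial>M \<partial>lam)"
    by (subst integral_N[OF i]) simp
  also have "\<dots> = (\<integral>s. (\<integral>\<omega>. h s \<omega> \<partial>M) \<bullet> w s \<partial>lam)"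
  proof (rule integral_cong_AE)
    show "(\<lambda>s. \<integral>\<omega>. h s \<omega> \<bullet> w s \<partial>M) \<in> borel_measurable lam"
      using lamM.integrable_fst'[of "\<lambda>z. h (fst z) (snd z) \<bullet> w (fst z)"] i by (simp add: N_def borel_measurable_integrable)
    have "w \<in> borel_measurable lam" using w by (intro measurable_lam) (simp add: L2det_def)
    then show "(\<lambda>s. (\<integral>\<omega>. h s \<omega> \<partial>M) \<bullet> w s) \<in> borel_measurable lam"
      using sqi_measurable[OF mean_sqi_lam[OF h]] by measurable
    show "AE s in lam. (\<integral>\<omega>. h s \<omega> \<bullet> w s \<partial>M) = (\<integral>\<omega>. h s \<omega> \<partial>M) \<bullet> w s"
      using AE_sqi_at[OF h]
    proof eventually_elim
      case (elim s)
      then have "integrable M (h s)" using sqi_integrable[OF finite_measure_axioms] by blast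
      then show ?case by (rule integral_inner_left)
    qed
  qed
  finally show ?thesis .
qed

theorem optimality:
  assumes X: "state x0 u1 u2 X" "L2det T u1" "L2 u2" and adj: "is_adjoint M W T A C Q G X p k"
  shows "optimal M W T A B1 B2 C D1 D2 Q R1 R2 G x0 u1 u2 X \<longleftrightarrow>
    (AE s in lam. (\<integral>\<omega>. \<Gamma>1 u1 p k s \<omega> \<partial>M) = 0) \<and> (AE z in N. \<Gamma>2 u2 p k (fst z) (snd z) = 0)"
proof -
  have LX: "L2 X" using X by (simp add: state_iff)
  have Lp: "L2 p" and Lk: "\<And>j. L2 (k j)" using adj by (auto simp: is_adjoint_def)
  note L\<Gamma> = L2_\<Gamma>[OF X(2,3) Lp Lk]
  show ?thesis
  proof
    assume opt: "optimal M W T A B1 B2 C D1 D2 Q R1 R2 G x0 u1 u2 X"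
    have zero: "(\<integral>z. \<Gamma>1 u1 p k (fst z) (snd z) \<bullet> w1 (fst z) \<partial>N) + (\<integral>z. \<Gamma>2 u2 p k (fst z) (snd z) \<bullet> w2 (fst z) (snd z) \<partial>N) = 0"
      if w: "L2det T w1" "L2 w2" for w1 w2
    proof -
      obtain Y where Y: "state 0 w1 w2 Y" using state_exists[OF w] by blast
      define l c where "l = quad u1 u2 X w1 w2 Y" and "c = J w1 w2 Y"
      have LY: "L2 Y" using Y by (simp add: state_iff)
      \<comment> \<open>The perturbed control is admissible with the perturbed state, so optimality
        bounds the increment of the cost from below.\<close>
      have ge: "0 \<le> e * l + e\<^sup>2 * c" for e
      proof -
        have d: "L2det T (\<lambda>s. u1 s + e *\<^sub>R w1 s)" by (rule L2det_lincomb[OF X(2) w(1)])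
        have "state x0 (\<lambda>s. u1 s + e *\<^sub>R w1 s) (\<lambda>s \<omega>. u2 s \<omega> + e *\<^sub>R w2 s \<omega>) (\<lambda>s \<omega>. X s \<omega> + e *\<^sub>R Y s \<omega>)"
          using state_lincomb[OF X Y w, of e] by simp
        then have "J u1 u2 X \<le> J (\<lambda>s. u1 s + e *\<^sub>R w1 s) (\<lambda>s \<omega>. u2 s \<omega> + e *\<^sub>R w2 s \<omega>) (\<lambda>s \<omega>. X s \<omega> + e *\<^sub>R Y s \<omega>)"
          using opt d L2_lincomb[OF X(3) w(2), of e] unfolding optimal_def by blast
        then show ?thesis unfolding cost_expand[OF X Y w] l_def c_def by simp
      qed
      have c0: "c \<ge> 0" unfolding c_def by (rule cost_nonneg[OF w LY])
      have "l = 0"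
      proof (rule ccontr)
        assume l: "l \<noteq> 0"
        \<comment> \<open>A step against the sign of \<open>l\<close>; the 1 in the denominator
          covers \<open>c = 0\<close>. Multiplied by \<open>(c + 1)\<^sup>2\<close> the increment
          becomes \<open>- l\<^sup>2\<close>, which is negative.\<close>
        define e where "e = - l / (c + 1)"
        have e: "e * (c + 1) = - l" using c0 by (simp add: e_def)
        have "(c + 1)\<^sup>2 * (e * l + e\<^sup>2 * c) = (c + 1) * (e * (c + 1)) * l + (e * (c + 1))\<^sup>2 * c"
          by (simp add: power2_eq_square algebra_simps)
        also have "\<dots> = - l\<^sup>2" unfolding e by (simp add: power2_eq_square algebra_simps)
        finally have "(c + 1)\<^sup>2 * (e * l + e\<^sup>2 * c) = - l\<^sup>2" .
        moreover have "0 \<le> (c + 1)\<^sup>2 * (e * l + e\<^sup>2 * c)" by (rule mult_nonneg_nonneg[OF zero_le_power2 ge])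
        ultimately show False using l by simp
      qed
      then show ?thesis unfolding l_def variation_formula[OF X Y w adj] .
    qed
    have ae2: "AE z in N. \<Gamma>2 u2 p k (fst z) (snd z) = 0"
    proof (rule sqi_AE_zero[OF L2_sqi[OF L\<Gamma>(2)]])
      have "L2det T (\<lambda>_. 0 :: real^'l1)" by (simp add: L2det_def)
      from zero[OF this L\<Gamma>(2)] show "(\<integral>z. (norm (\<Gamma>2 u2 p k (fst z) (snd z)))\<^sup>2 \<partial>N) = 0"
        unfolding power2_norm_eq_inner by simp
    qed
    \<comment> \<open>The mean itself is the test direction, extended by 0 so that it is measurable
      on the whole line; its pairing with the mean is the squared L2 norm.\<close>
    define w where "w s = indicator {0..T} s *\<^sub>R (\<integral>\<omega>. \<Gamma>1 u1 p k s \<omega> \<partial>M)" for s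
    have m: "sqi lam (\<lambda>s. \<integral>\<omega>. \<Gamma>1 u1 p k s \<omega> \<partial>M)" by (rule mean_sqi_lam[OF L\<Gamma>(1)])
    have Lw: "L2det T w" unfolding w_def[abs_def] by (rule L2det_of_sqi_lam[OF m])
    have "(\<integral>s. (norm (\<integral>\<omega>. \<Gamma>1 u1 p k s \<omega> \<partial>M))\<^sup>2 \<partial>lam) = (\<integral>s. (\<integral>\<omega>. \<Gamma>1 u1 p k s \<omega> \<partial>M) \<bullet> w s \<partial>lam)"
      by (intro Bochner_Integration.integral_cong) (auto simp: w_def power2_norm_eq_inner)
    also have "\<dots> = (\<integral>z. \<Gamma>1 u1 p k (fst z) (snd z) \<bullet> w (fst z) \<partial>N)" by (rule mean_inner_det[OF L\<Gamma>(1) Lw, symmetric])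
    also have "\<dots> = 0" using zero[OF Lw L2_zero] by simp
    finally have "AE s in lam. (\<integral>\<omega>. \<Gamma>1 u1 p k s \<omega> \<partial>M) = 0" by (rule sqi_AE_zero[OF m])
    with ae2 show "(AE s in lam. (\<integral>\<omega>. \<Gamma>1 u1 p k s \<omega> \<partial>M) = 0) \<and> (AE z in N. \<Gamma>2 u2 p k (fst z) (snd z) = 0)" by blast
  next
    assume cond: "(AE s in lam. (\<integral>\<omega>. \<Gamma>1 u1 p k s \<omega> \<partial>M) = 0) \<and> (AE z in N. \<Gamma>2 u2 p k (fst z) (snd z) = 0)"
    show "optimal M W T A B1 B2 C D1 D2 Q R1 R2 G x0 u1 u2 X"
      unfolding optimal_def
    proof (intro allI impI)
      fix v1 v2 Z assume v: "L2det T v1 \<and> L2 v2 \<and> state x0 v1 v2 Z"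
      define w1 where "w1 s = v1 s + (-1) *\<^sub>R u1 s" for s
      define w2 where "w2 s \<omega> = v2 s \<omega> + (-1) *\<^sub>R u2 s \<omega>" for s \<omega>
      define Y where "Y s \<omega> = Z s \<omega> + (-1) *\<^sub>R X s \<omega>" for s \<omega>
      \<comment> \<open>The initial values cancel in the difference of two states, so it solves the
        linearised equation started at 0.\<close>
      have Y: "state 0 w1 w2 Y"
        using state_lincomb[where c = "-1", OF _ _ _ X, of x0 v1 v2 Z] v unfolding w1_def[abs_def] w2_def[abs_def] Y_def[abs_def] by simp
      have d: "L2det T w1" unfolding w1_def[abs_def] using v by (intro L2det_lincomb X) auto
      have q: "L2 w2" unfolding w2_def[abs_def] using v by (intro L2_lincomb X) auto
      have LY: "L2 Y" using Y by (simp add: state_iff)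
      have "(\<integral>z. \<Gamma>1 u1 p k (fst z) (snd z) \<bullet> w1 (fst z) \<partial>N) = (\<integral>s. (\<integral>\<omega>. \<Gamma>1 u1 p k s \<omega> \<partial>M) \<bullet> w1 s \<partial>lam)"
        by (rule mean_inner_det[OF L\<Gamma>(1) d])
      also have "\<dots> = 0"
      proof (rule integral_eq_zero_AE)
        from cond have "AE s in lam. (\<integral>\<omega>. \<Gamma>1 u1 p k s \<omega> \<partial>M) = 0" by blast
        then show "AE s in lam. (\<integral>\<omega>. \<Gamma>1 u1 p k s \<omega> \<partial>M) \<bullet> w1 s = 0" by eventually_elim simp
      qed
      finally have 1: "(\<integral>z. \<Gamma>1 u1 p k (fst z) (snd z) \<bullet> w1 (fst z) \<partial>N) = 0" .
      have 2: "(\<integral>z. \<Gamma>2 u2 p k (fst z) (snd z) \<bullet> w2 (fst z) (snd z) \<partial>N) = 0"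
      proof (rule integral_eq_zero_AE)
        from cond have "AE z in N. \<Gamma>2 u2 p k (fst z) (snd z) = 0" by blast
        then show "AE z in N. \<Gamma>2 u2 p k (fst z) (snd z) \<bullet> w2 (fst z) (snd z) = 0" by eventually_elim simp
      qed
      have "quad u1 u2 X w1 w2 Y = 0" unfolding variation_formula[OF X Y d q adj] 1 2 by simp
      \<comment> \<open>The full step \<open>c = 1\<close> leads from the given control to the
        competitor. As the first variation vanishes, the cost changes exactly by the cost of the
        difference, which is nonnegative.\<close>
      then have "J (\<lambda>s. u1 s + 1 *\<^sub>R w1 s) (\<lambda>s \<omega>. u2 s \<omega> + 1 *\<^sub>R w2 s \<omega>) (\<lambda>s \<omega>. X s \<omega> + 1 *\<^sub>R Y s \<omega>) = J u1 u2 X + J w1 w2 Y"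
        unfolding cost_expand[OF X Y d q] by simp
      moreover have "(\<lambda>s. u1 s + 1 *\<^sub>R w1 s) = v1" "(\<lambda>s \<omega>. u2 s \<omega> + 1 *\<^sub>R w2 s \<omega>) = v2" "(\<lambda>s \<omega>. X s \<omega> + 1 *\<^sub>R Y s \<omega>) = Z"
        by (simp_all add: w1_def w2_def Y_def fun_eq_iff)
      ultimately show "J u1 u2 X \<le> J v1 v2 Z" using cost_nonneg[OF d q LY] by simp
    qed
  qed
qed

end

theorem theorem2p1:
  fixes M :: "'w measure" and T :: real
    and W :: "'d::finite \<Rightarrow> real \<Rightarrow> 'w \<Rightarrow> real"
    and A :: "real \<Rightarrow> real^'n::finite^'n"
    and B1 :: "real \<Rightarrow> real^'l1::finite^'n" and B2 :: "real \<Rightarrow> real^'l2::finite^'n"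
    and C :: "'d \<Rightarrow> real \<Rightarrow> real^'n^'n"
    and D1 :: "'d \<Rightarrow> real \<Rightarrow> real^'l1^'n" and D2 :: "'d \<Rightarrow> real \<Rightarrow> real^'l2^'n"
    and Q :: "real \<Rightarrow> real^'n^'n"
    and R1 :: "real \<Rightarrow> real^'l1^'l1" and R2 :: "real \<Rightarrow> real^'l2^'l2"
    and G :: "real^'n^'n" and x0 :: "real^'n"
    and u1 :: "real \<Rightarrow> real^'l1" and u2 :: "real \<Rightarrow> 'w \<Rightarrow> real^'l2"
    and X :: "real \<Rightarrow> 'w \<Rightarrow> real^'n"
    and p :: "real \<Rightarrow> 'w \<Rightarrow> real^'n" and k :: "'d \<Rightarrow> real \<Rightarrow> 'w \<Rightarrow> real^'n"
  assumes "prob_space M" and "T > 0" and "brownian M W"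
    and "A \<in> borel_measurable borel" and "bounded (range A)"
    and "B1 \<in> borel_measurable borel" and "bounded (range B1)"
    and "B2 \<in> borel_measurable borel" and "bounded (range B2)"
    and "\<And>j. C j \<in> borel_measurable borel" and "\<And>j. bounded (range (C j))"
    and "\<And>j. D1 j \<in> borel_measurable borel" and "\<And>j. bounded (range (D1 j))"
    and "\<And>j. D2 j \<in> borel_measurable borel" and "\<And>j. bounded (range (D2 j))"
    and "Q \<in> borel_measurable borel" and "\<exists>c. AE t in lborel. norm (Q t) \<le> c"
    and "R1 \<in> borel_measurable borel" and "\<exists>c. AE t in lborel. norm (R1 t) \<le> c"
    and "R2 \<in> borel_measurable borel" and "\<exists>c. AE t in lborel. norm (R2 t) \<le> c"
    and "\<And>t. transpose (Q t) = Q t" and "\<And>t x. x \<bullet> (Q t *v x) \<ge> 0"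
    and "\<And>t. transpose (R1 t) = R1 t" and "\<And>t x. x \<noteq> 0 \<Longrightarrow> x \<bullet> (R1 t *v x) > 0"
    and "\<And>t. transpose (R2 t) = R2 t" and "\<And>t x. x \<noteq> 0 \<Longrightarrow> x \<bullet> (R2 t *v x) > 0"
    and "transpose G = G" and "\<And>x. x \<bullet> (G *v x) \<ge> 0"
    and "L2det T u1" and "L2F M (aug_filtration M W) T u2"
    and "is_state M W T A B1 B2 C D1 D2 x0 u1 u2 X"
    and "is_adjoint M W T A C Q G X p k"
  shows "optimal M W T A B1 B2 C D1 D2 Q R1 R2 G x0 u1 u2 X \<longleftrightarrow>
     ((AE s in lborel. s \<in> {0..T} \<longrightarrow>
         integral\<^sup>L M (\<lambda>\<omega>. transpose (B1 s) *v p s \<omega>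
             + (\<Sum>j\<in>UNIV. transpose (D1 j s) *v k j s \<omega>) + R1 s *v u1 s) = 0) \<and>
      (AE z in lborel \<Otimes>\<^sub>M M. fst z \<in> {0..T} \<longrightarrow>
         transpose (B2 (fst z)) *v p (fst z) (snd z)
             + (\<Sum>j\<in>UNIV. transpose (D2 j (fst z)) *v k j (fst z) (snd z))
             + R2 (fst z) *v u2 (fst z) (snd z) = 0))"
proof -
  have R1_psd: "x \<bullet> (R1 t *v x) \<ge> 0" for t x using assms(25)[of x t] by (cases "x = 0") auto
  have R2_psd: "x \<bullet> (R2 t *v x) \<ge> 0" for t x using assms(27)[of x t] by (cases "x = 0") auto
  interpret prob_space M by (rule assms(1))
  interpret lq_control M W T A B1 B2 C D1 D2 Q R1 R2 G
    by unfold_locales (use assms R1_psd R2_psd in \<open>auto simp: bounded_measurable_def ess_bounded_measurable_def\<close>)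
  have "L2 p" and "\<And>j. L2 (k j)" using assms(33) by (auto simp: is_adjoint_def)
  then have "L2 (\<Gamma>2 u2 p k)" by (rule L2_\<Gamma>(2)[OF assms(30,31)])
  \<comment> \<open>\<open>optimality\<close> states its conditions over the time interval and over
    \<open>N\<close>; these equivalences restate them over the whole line with the condition that
    the time lies in \<open>{0..T}\<close>.\<close>
  from AE_N_iff[OF sqi_measurable[OF L2_sqi[OF this]]] optimality[OF assms(32,30,31,33)]
  show ?thesis unfolding AE_lam_iff by simp
qed

end
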